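(* Let $G$ be a locally compact abelian group and let $\nu\in M(G)$ be a symmetric probability measure. Assume that $\nu$ is a square, that is, $\nu=\eta*\eta$ for some symmetric probability measure $\eta\in M(G)$. Let $X$ be a $K$-convex Banach space. (1) For any $1<p<\infty$, the convolution operator $C_{\nu,p}^X\colon L^p(G;X)\to L^p(G;X)$, $f\mapsto \nu*f$, is a Ritt operator. (2) For any bounded strongly continuous representation $\pi\colon G\to B(X)$, the operator $S(\pi,\nu)=\int_G\pi(t)\,d\nu(t)\in B(X)$ is a Ritt operator.
   Context: All Banach spaces are complex. $G$ is equipped with a fixed Haar measure $dt$; $L^p(G;X)$ is the Bochner space. $M(G)$ is the Banach algebra of bounded regular Borel measures on $G$ (product = convolution). A probability measure $\nu\in M(G)$ is symmetric if $\nu(-V)=\nu(V)$ for every measurable $V\subset G$. The convolution is $\nu*f=\int_G f(\cdot-t)\,d\nu(t)$. Representation: a map $\pi\colon G\to B(X)$ with $\pi(t+s)=\pi(t)\pi(s)$ for all $t,s\in G$ and $\pi(e)=I_X$ ($e$ the unit of $G$); it is bounded if $\sup_{t\in G}\|\pi(t)\|<\infty$, and strongly continuous if $t\mapsto\pi(t)x$ is continuous from $G$ to $X$ for every $x\in X$. The integral $S(\pi,\nu)$ is defined in the strong sense: $S(\pi,\nu)x=\int_G\pi(t)x\,d\nu(t)$. Ritt operator: a bounded operator $T$ on a Banach space is a Ritt operator if $\sup_{n\ge0}\|T^n\|<\infty$ and $\sup_{n\ge1}n\|T^n-T^{n-1}\|<\infty$. $K$-convexity: let $\Omega_0=\{-1,1\}^{\mathbb{N}}$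 with its normalized Haar measure, let $\varepsilon_n(\Theta)=\theta_n$ for $\Theta=(\theta_i)_{i\ge1}\in\Omega_0$ (Rademacher functions), let $\mathrm{Rad}_2\subset L^2(\Omega_0)$ be the closed linear span of the $\varepsilon_n$, $n\geq 1$, and let $Q\colon L^2(\Omega_0)\to L^2(\Omega_0)$ be the orthogonal projection onto $\mathrm{Rad}_2$. $X$ is $K$-convex if $Q\otimes I_X$ extends to a bounded operator on $L^2(\Omega_0;X)$. *)

theory Defs
  imports "HOL-Probability.Probability"
begin

section \<open>Complex Banach spaces\<close>

class complex_banach = banach +
  fixes scaleC :: "complex \<Rightarrow> 'a \<Rightarrow> 'a"
  assumes scaleC_add_right: "scaleC c (x + y) = scaleC c x + scaleC c y"
    and scaleC_add_left: "scaleC (c + d) x = scaleC c x + scaleC d x"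
    and scaleC_scaleC: "scaleC c (scaleC d x) = scaleC (c * d) x"
    and scaleC_of_real: "scaleC (complex_of_real r) x = scaleR r x"
    and norm_scaleC: "norm (scaleC c x) = cmod c * norm x"

instantiation complex :: complex_banach
begin

definition scaleC_complex :: "complex \<Rightarrow> complex \<Rightarrow> complex"
  where "scaleC_complex c x = c * x"

instance
  by standard (simp_all add: scaleC_complex_def algebra_simps norm_mult scaleR_conv_of_real)

end

text \<open>
  The exponent \<open>p\<close> of an \<open>L\<^sup>p\<close> space is a value, so such spaces cannot be types. Operators are
  therefore considered on normed spaces given by an explicit carrier; a Banach space that is a type
  is embedded by \<open>type_space\<close>.
\<close>

record 'v cnormed =
  ncarrier :: "'v set"
  nadd :: "'v \<Rightarrow> 'v \<Rightarrow> 'v"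
  nscale :: "complex \<Rightarrow> 'v \<Rightarrow> 'v"
  nnorm :: "'v \<Rightarrow> real"

definition ndiff :: "'v cnormed \<Rightarrow> 'v \<Rightarrow> 'v \<Rightarrow> 'v"
  where "ndiff E x y = nadd E x (nscale E (- 1) y)"

definition type_space :: "('x :: complex_banach) cnormed"
  where "type_space = \<lparr>ncarrier = UNIV, nadd = (+), nscale = scaleC, nnorm = norm\<rparr>"

definition bounded_operator :: "'v cnormed \<Rightarrow> ('v \<Rightarrow> 'v) \<Rightarrow> bool"
  where "bounded_operator E T \<longleftrightarrow>
    T \<in> ncarrier E \<rightarrow> ncarrier E \<and>
    (\<forall>x\<in>ncarrier E. \<forall>y\<in>ncarrier E. T (nadd E x y) = nadd E (T x) (T y)) \<and>
    (\<forall>c. \<forall>x\<in>ncarrier E. T (nscale E c x) = nscale E c (T x)) \<and>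
    (\<exists>C. \<forall>x\<in>ncarrier E. nnorm E (T x) \<le> C * nnorm E x)"

definition op_norm :: "'v cnormed \<Rightarrow> ('v \<Rightarrow> 'v) \<Rightarrow> real"
  where "op_norm E T = Inf {C. 0 \<le> C \<and> (\<forall>x\<in>ncarrier E. nnorm E (T x) \<le> C * nnorm E x)}"

definition ritt_operator :: "'v cnormed \<Rightarrow> ('v \<Rightarrow> 'v) \<Rightarrow> bool"
  where "ritt_operator E T \<longleftrightarrow>
    bounded_operator E T \<and>
    bdd_above (range (\<lambda>n. op_norm E (T ^^ n))) \<and>
    bdd_above ((\<lambda>n. real n * op_norm E (\<lambda>x. ndiff E ((T ^^ n) x) ((T ^^ (n - 1)) x))) ` {1..})"

section \<open>Bochner integral and Bochner spaces without separability\<close>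

text \<open>
  The library's Bochner integral requires a second countable codomain. Here Borel measurability is
  replaced by being an almost everywhere limit of simple functions.
\<close>

definition ae_strongly_measurable :: "'a measure \<Rightarrow> ('a \<Rightarrow> 'x::real_normed_vector) \<Rightarrow> bool"
  where "ae_strongly_measurable M f \<longleftrightarrow>
    (\<exists>s. (\<forall>i::nat. simple_function M (s i)) \<and> (AE x in M. (\<lambda>i. s i x) \<longlonglongrightarrow> f x))"

definition has_strong_integral :: "'a measure \<Rightarrow> ('a \<Rightarrow> 'x::real_normed_vector) \<Rightarrow> 'x \<Rightarrow> bool"
  where "has_strong_integral M f y \<longleftrightarrow>
    ae_strongly_measurable M f \<and>
    (\<exists>s. (\<forall>i::nat. Bochner_Integration.simple_bochner_integrable M (s i)) \<and>
      (\<lambda>i. \<integral>\<^sup>+x. ennreal (norm (f x - s i x)) \<partial>M) \<longlonglongrightarrow> 0 \<and>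
      (\<lambda>i. Bochner_Integration.simple_bochner_integral M (s i)) \<longlonglongrightarrow> y)"

definition strong_integral :: "'a measure \<Rightarrow> ('a \<Rightarrow> 'x::real_normed_vector) \<Rightarrow> 'x"
  where "strong_integral M f =
    (if \<exists>y. has_strong_integral M f y then THE y. has_strong_integral M f y else 0)"

lemma has_strong_integral_iff_has_bochner_integral:
  fixes f :: "'a \<Rightarrow> 'x::{real_normed_vector, second_countable_topology}"
  assumes f: "f \<in> borel_measurable M"
  shows "has_strong_integral M f y \<longleftrightarrow> has_bochner_integral M f y"
proof -
  obtain F where "\<And>i. simple_function M (F i)" "\<And>x. x \<in> space M \<Longrightarrow> (\<lambda>i. F i x) \<longlonglongrightarrow> f x"
    using borel_measurable_implies_sequence_metric[OF f, of 0] by blast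
  then have "ae_strongly_measurable M f"
    unfolding ae_strongly_measurable_def by (intro exI[of _ F]) auto
  then show ?thesis
    using f unfolding has_strong_integral_def has_bochner_integral.simps by blast
qed

definition Lp_fun :: "'a measure \<Rightarrow> real \<Rightarrow> ('a \<Rightarrow> 'x::real_normed_vector) set"
  where "Lp_fun M p = {f. ae_strongly_measurable M f \<and> (\<integral>\<^sup>+x. ennreal (norm (f x) powr p) \<partial>M) < \<infinity>}"

definition Lp_class :: "'a measure \<Rightarrow> real \<Rightarrow> ('a \<Rightarrow> 'x::real_normed_vector) \<Rightarrow> ('a \<Rightarrow> 'x) set"
  where "Lp_class M p f = {g \<in> Lp_fun M p. AE x in M. g x = f x}"

definition repr :: "('a \<Rightarrow> 'x) set \<Rightarrow> 'a \<Rightarrow> 'x"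
  where "repr F = (SOME f. f \<in> F)"

definition Lp_space :: "'a measure \<Rightarrow> real \<Rightarrow> ('a \<Rightarrow> 'x::complex_banach) set cnormed"
  where "Lp_space M p =
    \<lparr>ncarrier = Lp_class M p ` Lp_fun M p,
     nadd = (\<lambda>F G. Lp_class M p (\<lambda>x. repr F x + repr G x)),
     nscale = (\<lambda>c F. Lp_class M p (\<lambda>x. scaleC c (repr F x))),
     nnorm = (\<lambda>F. enn2real (\<integral>\<^sup>+x. ennreal (norm (repr F x) powr p) \<partial>M) powr (1 / p))\<rparr>"

section \<open>K-convexity\<close>

text \<open>
  The normalized Haar measure of \<open>{-1, 1}\<^sup>\<nat>\<close> is the product of the uniform measures. Coordinates
  are numbered from \<open>0\<close>.
\<close>

definition Omega0 :: "(nat \<Rightarrow> real) measure"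
  where "Omega0 = (\<Pi>\<^sub>M i\<in>UNIV. uniform_count_measure {- 1, 1})"

abbreviation L2_Omega0 :: "((nat \<Rightarrow> real) \<Rightarrow> 'x::complex_banach) set cnormed"
  where "L2_Omega0 \<equiv> Lp_space Omega0 2"

definition rademacher :: "nat \<Rightarrow> ((nat \<Rightarrow> real) \<Rightarrow> complex) set"
  where "rademacher n = Lp_class Omega0 2 (\<lambda>\<theta>. complex_of_real (\<theta> n))"

definition linear_subspace :: "'v cnormed \<Rightarrow> 'v set \<Rightarrow> bool"
  where "linear_subspace E V \<longleftrightarrow> V \<subseteq> ncarrier E \<and> V \<noteq> {} \<and>
    (\<forall>x\<in>V. \<forall>y\<in>V. nadd E x y \<in> V) \<and> (\<forall>c. \<forall>x\<in>V. nscale E c x \<in> V)"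

definition linear_span :: "'v cnormed \<Rightarrow> 'v set \<Rightarrow> 'v set"
  where "linear_span E S = \<Inter> {V. linear_subspace E V \<and> S \<subseteq> V}"

definition closed_span :: "'v cnormed \<Rightarrow> 'v set \<Rightarrow> 'v set"
  where "closed_span E S =
    {x \<in> ncarrier E. \<forall>e>0. \<exists>y\<in>linear_span E S. nnorm E (ndiff E x y) < e}"

definition Rad2 :: "((nat \<Rightarrow> real) \<Rightarrow> complex) set set"
  where "Rad2 = closed_span L2_Omega0 (range rademacher)"

definition L2_inner :: "'a measure \<Rightarrow> ('a \<Rightarrow> complex) set \<Rightarrow> ('a \<Rightarrow> complex) set \<Rightarrow> complex"
  where "L2_inner M F G = strong_integral M (\<lambda>x. repr F x * cnj (repr G x))"

definition rad_projection ::
    "((nat \<Rightarrow> real) \<Rightarrow> complex) set \<Rightarrow> ((nat \<Rightarrow> real) \<Rightarrow> complex) set"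
  where "rad_projection F =
    (THE G. G \<in> Rad2 \<and> (\<forall>H\<in>Rad2. L2_inner Omega0 (ndiff L2_Omega0 F G) H = 0))"

definition L2_tensor ::
    "((nat \<Rightarrow> real) \<Rightarrow> complex) set \<Rightarrow> 'x::complex_banach \<Rightarrow> ((nat \<Rightarrow> real) \<Rightarrow> 'x) set"
  where "L2_tensor F x = Lp_class Omega0 2 (\<lambda>\<theta>. scaleC (repr F \<theta>) x)"

text \<open>
  A linear operator extends \<open>Q \<otimes> I\<close> from the algebraic tensor product iff it does so on elementary
  tensors.
\<close>

definition K_convex :: "'x::complex_banach itself \<Rightarrow> bool"
  where "K_convex _ \<longleftrightarrow>
    (\<exists>R :: ((nat \<Rightarrow> real) \<Rightarrow> 'x) set \<Rightarrow> ((nat \<Rightarrow> real) \<Rightarrow> 'x) set.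
      bounded_operator L2_Omega0 R \<and>
      (\<forall>F\<in>ncarrier L2_Omega0. \<forall>x. R (L2_tensor F x) = L2_tensor (rad_projection F) x))"

section \<open>Measures on locally compact abelian groups\<close>

definition haar_measure :: "('g::{topological_ab_group_add, t2_space}) measure \<Rightarrow> bool"
  where "haar_measure \<mu> \<longleftrightarrow>
    sets \<mu> = sets borel \<and>
    emeasure \<mu> UNIV \<noteq> 0 \<and>
    (\<forall>V\<in>sets borel. \<forall>t. emeasure \<mu> ((\<lambda>s. t + s) ` V) = emeasure \<mu> V) \<and>
    (\<forall>K. compact K \<longrightarrow> emeasure \<mu> K < \<infinity>) \<and>
    (\<forall>V\<in>sets borel. emeasure \<mu> V = (INF U\<in>{U. open U \<and> V \<subseteq> U}. emeasure \<mu> U)) \<and>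
    (\<forall>U. open U \<longrightarrow> emeasure \<mu> U = (SUP K\<in>{K. compact K \<and> K \<subseteq> U}. emeasure \<mu> K))"

definition regular_prob_measure :: "('g::t2_space) measure \<Rightarrow> bool"
  where "regular_prob_measure \<nu> \<longleftrightarrow>
    prob_space \<nu> \<and> sets \<nu> = sets borel \<and>
    (\<forall>V\<in>sets borel. emeasure \<nu> V = (INF U\<in>{U. open U \<and> V \<subseteq> U}. emeasure \<nu> U)) \<and>
    (\<forall>V\<in>sets borel. emeasure \<nu> V = (SUP K\<in>{K. compact K \<and> K \<subseteq> V}. emeasure \<nu> K))"

definition symmetric_measure :: "('g::{topological_ab_group_add, t2_space}) measure \<Rightarrow> bool"
  where "symmetric_measure \<nu> \<longleftrightarrow> (\<forall>V\<in>sets borel. emeasure \<nu> (uminus ` V) = emeasure \<nu> V)"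

text \<open>
  Convolution is not the image of the product measure \<open>\<nu> \<Otimes>\<^sub>M \<eta>\<close> under addition: addition need not be
  measurable for the product \<open>\<sigma>\<close>-algebra if the group is not second countable. For regular Borel
  measures the inner integrand below is Borel measurable in \<open>t\<close>.
\<close>

definition conv_measure ::
    "('g::{topological_ab_group_add, t2_space}) measure \<Rightarrow> 'g measure \<Rightarrow> 'g measure"
  where "conv_measure \<nu> \<eta> =
    measure_of UNIV (sets borel) (\<lambda>V. \<integral>\<^sup>+t. emeasure \<nu> {s. s + t \<in> V} \<partial>\<eta>)"

definition conv_fun ::
    "('g::{topological_ab_group_add, t2_space}) measure \<Rightarrow> ('g \<Rightarrow> 'x::complex_banach) \<Rightarrow> 'g \<Rightarrow> 'x"
  where "conv_fun \<nu> f = (\<lambda>s. strong_integral \<nu> (\<lambda>t. f (s - t)))"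

definition conv_operator ::
    "('g::{topological_ab_group_add, t2_space}) measure \<Rightarrow> real \<Rightarrow> 'g measure \<Rightarrow>
      ('g \<Rightarrow> 'x::complex_banach) set \<Rightarrow> ('g \<Rightarrow> 'x) set"
  where "conv_operator \<mu> p \<nu> F = Lp_class \<mu> p (conv_fun \<nu> (repr F))"

section \<open>Representations\<close>

definition group_representation ::
    "('g::{topological_ab_group_add, t2_space} \<Rightarrow> 'x::complex_banach \<Rightarrow> 'x) \<Rightarrow> bool"
  where "group_representation \<pi> \<longleftrightarrow>
    (\<forall>t. bounded_operator type_space (\<pi> t)) \<and>
    (\<forall>t s. \<pi> (t + s) = \<pi> t \<circ> \<pi> s) \<and> \<pi> 0 = id"

definition bounded_representation :: "('g \<Rightarrow> 'x::complex_banach \<Rightarrow> 'x) \<Rightarrow> bool"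
  where "bounded_representation \<pi> \<longleftrightarrow> bdd_above (range (\<lambda>t. op_norm type_space (\<pi> t)))"

definition strongly_continuous ::
    "('g::topological_space \<Rightarrow> 'x::complex_banach \<Rightarrow> 'x) \<Rightarrow> bool"
  where "strongly_continuous \<pi> \<longleftrightarrow> (\<forall>x. continuous_on UNIV (\<lambda>t. \<pi> t x))"

definition S_operator :: "('g \<Rightarrow> 'x::complex_banach \<Rightarrow> 'x) \<Rightarrow> 'g measure \<Rightarrow> 'x \<Rightarrow> 'x"
  where "S_operator \<pi> \<nu> x = strong_integral \<nu> (\<lambda>t. \<pi> t x)"

end

theory Submission
  imports Defs "HOL-Library.Poly_Mapping" "HOL-Library.Function_Algebras"
begin

text \<open>
  The operator attached to \<open>\<nu> = \<eta> * \<eta>\<close> is a limit of operators that a polynomial identity controls. If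
  \<open>\<eta>\<close> is replaced by a finite convex combination of point masses at \<open>t j\<close>, with weights \<open>w j\<close>, then by
  symmetry the square of its operator is close to \<open>\<tau> = b * b'\<close>, where \<open>b\<close> is the mean of the group elements
  \<open>t j\<close> and \<open>b'\<close> the mean of their inverses. All estimates below for such products \<open>\<tau>\<close> have constants
  that depend only on the bound of the representation and on \<open>X\<close>, so they pass to the limit.
  
  Geometry of \<open>X\<close>. A K-convex space does not contain the spaces \<open>\<ell>\<^sub>1\<^sup>k\<close> uniformly (\<open>K_convex_imp_B_convex\<close>): on
  vectors that behave like the basis of \<open>\<ell>\<^sub>1\<close> over the points of the cube \<open>{-1, 1}\<^sup>m\<close>, the Rademacher
  projection has norm at least the mean of \<open>\<bar>\<theta>\<^sub>1 + \<dots> + \<theta>\<^sub>m\<bar>\<close>, which is of order \<open>\<surd>m\<close>. Hence in the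
  inequality \<open>E \<parallel>\<Sum> \<plusminus> x j\<parallel>\<^sup>p \<le> \<alpha> k\<^sup>p\<^sup>-\<^sup>1 \<Sum> \<parallel>x j\<parallel>\<^sup>p\<close>, which holds with \<open>\<alpha> = 1\<close> in every space, some \<open>k\<close> allows
  \<open>\<alpha> < 1\<close>. This constant is multiplicative under blocking, so it becomes as small as desired
  (\<open>K_convex_imp_signed_type\<close>), and it is inherited by \<open>L\<^sup>p\<close> of \<open>X\<close> by integration.
  
  From signs to differences. Multiply \<open>k\<close> independent random group elements \<open>u\<^sub>1, \<dots>, u\<^sub>k\<close> distributed as in \<open>b\<close>, and
  leave one of them out: the vectors \<open>h j = b (\<Prod>i\<noteq>j. u\<^sub>i) x\<close> are bounded. A signed sum of the \<open>h j\<close> is small on average by the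
  inequality above; multiplying it by the inverses of the \<open>u\<^sub>i\<close> with \<open>i\<close> outside the set of positive signs
  and averaging turns \<open>h j\<close> into \<open>\<tau>\<^sup>k x\<close> if its sign is positive and into \<open>\<tau>\<^sup>k\<^sup>+\<^sup>1 x\<close> if it is negative.
  So \<open>\<parallel>\<tau>\<^sup>k (1 - \<tau>)\<parallel>\<close> is small (\<open>product_square_difference\<close>). Every power \<open>\<tau>\<^sup>q\<close> is a product of the same
  kind, so \<open>\<parallel>(\<tau>\<^sup>q)\<^sup>k (1 - \<tau>\<^sup>q)\<parallel> \<le> 1/2\<close> for all \<open>q\<close> with one \<open>k\<close>.
  
  The Ritt estimate. This smallness for \<open>S = \<tau>\<^sup>q\<close> keeps \<open>S\<close> away from multiplication by a unimodular number far from 1,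
  so \<open>1 - z S\<close> is bounded below for such \<open>z\<close>. Choosing \<open>q\<close> according to \<open>\<phi>\<close> yields
  \<open>\<parallel>\<Sum>j<m. (e\<^sup>i\<^sup>\<phi> \<tau>)\<^sup>j\<parallel> \<le> C / \<bar>\<phi>\<bar>\<close>, and a discrete Fourier inversion gives \<open>n \<parallel>\<tau>\<^sup>n (1 - \<tau>)\<parallel> \<le> C'\<close>
  (\<open>ritt_estimate_of_small_differences\<close>). The estimates are for one orbit at a time.
  
  Approximation. The convolution by \<open>\<eta>\<close> on \<open>L\<^sup>p\<close> and the integral of an orbit are limits, on finitely many vectors
  at once, of means of translates or of orbit points over a finite Borel partition of \<open>G\<close>
  (\<open>conv_fun_discretization\<close>, \<open>simultaneous_integral_discretization\<close>). Since \<open>G\<close> need not be second countable,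
  subtraction need not be measurable for the product \<open>\<sigma>\<close>-algebra; Fubini's theorem is replaced by direct
  estimates of \<open>s \<mapsto> \<nu> {t. s - t \<in> V}\<close> that rest on regularity.
\<close>

section \<open>Convexity of powers\<close>

lemma powr_above_tangent:
  fixes a m p :: real
  assumes "0 \<le> a" "0 < m" "1 \<le> p"
  shows "m powr p + p * m powr (p - 1) * (a - m) \<le> a powr p"
proof (cases "a = 0")
  case True
  have "m powr (p - 1) * m = m powr p"
    using \<open>0 < m\<close> by (simp add: powr_mult_base mult.commute)
  then show ?thesis
    using True assms by (simp add: mult.assoc)
next
  case False
  then have a: "0 < a" using assms by simp
  have der: "((\<lambda>x. x powr p) has_real_derivative p * m powr (p - 1)) (at m within {0<..})"
    using \<open>0 < m\<close> by (auto intro!: derivative_eq_intros)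
  have "m \<in> interior {0<..}" using \<open>0 < m\<close> by (simp add: interior_open)
  from convex_on_imp_above_tangent[OF powr_convex[OF \<open>1 \<le> p\<close>] _ this _ der, of a] a
  show ?thesis by (auto simp: algebra_simps)
qed

lemma jensen_powr_sum:
  fixes w a :: "'i \<Rightarrow> real" and p :: real
  assumes "finite I" "\<And>i. i \<in> I \<Longrightarrow> 0 \<le> w i" "(\<Sum>i\<in>I. w i) = 1" "\<And>i. i \<in> I \<Longrightarrow> 0 \<le> a i" "1 \<le> p"
  shows "(\<Sum>i\<in>I. w i * a i) powr p \<le> (\<Sum>i\<in>I. w i * a i powr p)"
proof -
  define m where "m = (\<Sum>i\<in>I. w i * a i)"
  have m0: "0 \<le> m" unfolding m_def using assms by (intro sum_nonneg) auto
  show ?thesis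
  proof (cases "m = 0")
    case True
    then show ?thesis using assms by (auto simp: m_def[symmetric] intro!: sum_nonneg)
  next
    case False
    with m0 have m: "0 < m" by simp
    have "m powr p = (\<Sum>i\<in>I. w i * (m powr p + p * m powr (p - 1) * (a i - m)))"
    proof -
      have "(\<Sum>i\<in>I. w i * (m powr p + p * m powr (p - 1) * (a i - m)))
          = m powr p * (\<Sum>i\<in>I. w i) + p * m powr (p - 1) * ((\<Sum>i\<in>I. w i * a i) - m * (\<Sum>i\<in>I. w i))"
        by (simp add: sum_distrib_left sum_distrib_right sum_subtractf sum.distrib algebra_simps)
      then show ?thesis
        using assms(3) by (simp add: m_def[symmetric])
    qed
    also have "\<dots> \<le> (\<Sum>i\<in>I. w i * a i powr p)"
      using assms m by (intro sum_mono mult_left_mono powr_above_tangent) auto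
    finally show ?thesis by (simp add: m_def)
  qed
qed

section \<open>Averages in a commutative ring with a seminorm\<close>

text \<open>
  The ring will be the group algebra of \<open>G\<close> and \<open>N\<close> the norm of an orbit, \<open>N a = \<parallel>a x\<parallel>\<close>. Such an \<open>N\<close> is
  not submultiplicative, so contractivity is a property of ring elements (\<open>contractive\<close>) and all
  estimates are read off at a single vector.
\<close>

locale scalar_ring =
  fixes sc :: "complex \<Rightarrow> 'r::comm_ring_1" and N :: "'r \<Rightarrow> real"
  assumes sc_add: "sc (c + d) = sc c + sc d"
    and sc_mult: "sc (c * d) = sc c * sc d"
    and sc_1: "sc 1 = 1"
    and N_triangle: "N (x + y) \<le> N x + N y"
    and N_sc: "N (sc c * x) = cmod c * N x"
begin

lemma sc_0: "sc 0 = 0"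
  using sc_add[of 0 0] by simp

lemma sc_uminus: "sc (- c) = - sc c"
  using sc_add[of c "- c"] by (simp add: sc_0 add_eq_0_iff)

lemma sc_diff: "sc (c - d) = sc c - sc d"
  using sc_add[of c "- d"] by (simp add: sc_uminus)

lemma sc_sum: "sc (sum f A) = (\<Sum>i\<in>A. sc (f i))"
  by (induction A rule: infinite_finite_induct) (auto simp: sc_0 sc_add)

lemma sc_prod: "sc (prod f A) = (\<Prod>i\<in>A. sc (f i))"
  by (induction A rule: infinite_finite_induct) (auto simp: sc_1 sc_mult)

lemma sc_power: "sc (c ^ n) = sc c ^ n"
  by (induction n) (auto simp: sc_1 sc_mult)

lemma sc_of_nat: "sc (of_nat n) = of_nat n"
  by (induction n) (auto simp: sc_0 sc_1 sc_add)

lemma N_0: "N 0 = 0"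
  using N_sc[of 0 0] by simp

lemma N_uminus: "N (- x) = N x"
  using N_sc[of "- 1" x] by (simp add: sc_uminus sc_1)

lemma N_nonneg: "0 \<le> N x"
  using N_triangle[of x "- x"] by (simp add: N_0 N_uminus)

lemma N_diff: "N (x - y) \<le> N x + N y"
  using N_triangle[of x "- y"] by (simp add: N_uminus)

lemma N_sum: "N (sum f A) \<le> (\<Sum>i\<in>A. N (f i))"
  by (induction A rule: infinite_finite_induct) (auto simp: N_0 intro: order_trans[OF N_triangle])

lemma N_scaled_sum:
  assumes "\<And>i. i \<in> A \<Longrightarrow> 0 \<le> w i"
  shows "N (\<Sum>i\<in>A. sc (of_real (w i)) * f i) \<le> (\<Sum>i\<in>A. w i * N (f i))"
  by (rule order_trans[OF N_sum]) (use assms in \<open>auto intro!: sum_mono simp: N_sc\<close>)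

end

lemma sum_card_mult_Pow:
  assumes "finite K"
  shows "(\<Sum>B\<in>Pow K. real (card B)) = 2 ^ card K * (real (card K) / 2)"
    and "(\<Sum>B\<in>Pow K. real (card K) - real (card B)) = 2 ^ card K * (real (card K) / 2)"
proof -
  have 1: "(\<Sum>B\<in>Pow K. real (card B)) = (\<Sum>B\<in>Pow K. real (card (K - B)))"
    by (rule sum.reindex_bij_witness[of _ "\<lambda>B. K - B" "\<lambda>B. K - B"]) (auto simp: double_diff)
  have 2: "(\<Sum>B\<in>Pow K. real (card (K - B))) = (\<Sum>B\<in>Pow K. real (card K) - real (card B))"
    using assms by (intro sum.cong refl) (auto simp: card_Diff_subset finite_subset card_mono of_nat_diff)
  have "(\<Sum>B\<in>Pow K. real (card B)) + (\<Sum>B\<in>Pow K. real (card K) - real (card B)) = 2 ^ card K * real (card K)"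
    using assms by (simp add: sum.distrib[symmetric] card_Pow)
  with 1 2 show "(\<Sum>B\<in>Pow K. real (card B)) = 2 ^ card K * (real (card K) / 2)"
    and "(\<Sum>B\<in>Pow K. real (card K) - real (card B)) = 2 ^ card K * (real (card K) / 2)"
    by simp_all
qed

text \<open>
  A choice of signs \<open>\<plusminus>\<close> is the set \<open>B\<close> of indices with sign \<open>+\<close>.
\<close>

definition signed :: "'i set \<Rightarrow> 'i \<Rightarrow> 'a::ab_group_add \<Rightarrow> 'a"
  where "signed B j x = (if j \<in> B then x else - x)"

text \<open>
  For \<open>\<alpha> = 1\<close> this holds for every norm, by the triangle inequality and Jensen's inequality. A constant
  \<open>\<alpha> < 1\<close> expresses that the sums \<open>\<Sum> \<plusminus> x j\<close> cannot all be as long as in \<open>\<ell>\<^sub>1\<close>.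
\<close>

definition signed_type :: "nat \<Rightarrow> real \<Rightarrow> real \<Rightarrow> ('a::ab_group_add \<Rightarrow> real) \<Rightarrow> bool"
  where "signed_type k \<alpha> p N \<longleftrightarrow> (\<forall>x. (\<Sum>B\<in>Pow {..<k}. N (\<Sum>j<k. signed B j (x j)) powr p)
     \<le> 2 ^ k * \<alpha> * real k powr (p - 1) * (\<Sum>j<k. N (x j) powr p))"

locale averaging = scalar_ring sc N for sc :: "complex \<Rightarrow> 'r::comm_ring_1" and N +
  fixes \<Gamma> :: "'r set" and M :: real
  assumes one_in: "1 \<in> \<Gamma>" and mult_in: "\<lbrakk>g \<in> \<Gamma>; h \<in> \<Gamma>\<rbrakk> \<Longrightarrow> g * h \<in> \<Gamma>"
    and bound: "g \<in> \<Gamma> \<Longrightarrow> N (g * x) \<le> M * N x"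
    and M_ge_1: "1 \<le> M"
begin

definition contractive :: "'r set"
  where "contractive = {a. \<forall>x C. (\<forall>g\<in>\<Gamma>. N (g * x) \<le> C) \<longrightarrow> (\<forall>g\<in>\<Gamma>. N (g * (a * x)) \<le> C)}"

lemma \<Gamma>_subset_contractive: "\<Gamma> \<subseteq> contractive"
  unfolding contractive_def using mult_in by (auto simp: mult.assoc[symmetric])

lemma contractive_one: "1 \<in> contractive"
  using one_in \<Gamma>_subset_contractive by auto

lemma contractive_mult: "\<lbrakk>a \<in> contractive; b \<in> contractive\<rbrakk> \<Longrightarrow> a * b \<in> contractive"
  unfolding contractive_def by (auto simp: mult.assoc)

lemma contractive_power: "a \<in> contractive \<Longrightarrow> a ^ n \<in> contractive"
  by (induction n) (auto intro: contractive_one contractive_mult)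

lemma contractive_prod: "(\<And>i. i \<in> A \<Longrightarrow> f i \<in> contractive) \<Longrightarrow> prod f A \<in> contractive"
  by (induction A rule: infinite_finite_induct) (auto intro: contractive_one contractive_mult)

lemma contractive_average:
  assumes "finite I" "\<And>i. i \<in> I \<Longrightarrow> 0 \<le> w i" "(\<Sum>i\<in>I. w i) = 1"
    and "\<And>i. i \<in> I \<Longrightarrow> f i \<in> contractive"
  shows "(\<Sum>i\<in>I. sc (of_real (w i)) * f i) \<in> contractive"
  unfolding contractive_def
proof (safe)
  fix x C g assume C: "\<forall>g\<in>\<Gamma>. N (g * x) \<le> C" and g: "g \<in> \<Gamma>"
  have "N (g * ((\<Sum>i\<in>I. sc (of_real (w i)) * f i) * x)) = N (\<Sum>i\<in>I. sc (of_real (w i)) * (g * (f i * x)))"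
    by (simp add: sum_distrib_left sum_distrib_right mult_ac)
  also have "\<dots> \<le> (\<Sum>i\<in>I. w i * N (g * (f i * x)))"
    using assms(2) by (rule N_scaled_sum)
  also have "\<dots> \<le> (\<Sum>i\<in>I. w i * C)"
    using assms C g by (intro sum_mono mult_left_mono) (auto simp: contractive_def)
  finally show "N (g * ((\<Sum>i\<in>I. sc (of_real (w i)) * f i) * x)) \<le> C"
    using assms(3) by (simp flip: sum_distrib_right)
qed

lemma contractive_bound:
  assumes "a \<in> contractive" shows "N (a * x) \<le> M * N x"
proof -
  have "\<forall>g\<in>\<Gamma>. N (g * x) \<le> M * N x" using bound by auto
  with assms one_in have "N (1 * (a * x)) \<le> M * N x"
    unfolding contractive_def by blast
  then show ?thesis by simp
qed

text \<open>
  With \<open>b = \<Sum> w u\<close>, \<open>b' = \<Sum> w v\<close> and independent random indices \<open>\<omega> 0, \<dots>, \<omega> (k - 1)\<close>, the product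
  \<open>h j = b (\<Prod>i\<noteq>j. u (\<omega> i)) x\<close> omits the factor number \<open>j\<close>. If \<open>\<Sum> \<plusminus> h j\<close> is multiplied by
  \<open>v (\<omega> i)\<close> for all \<open>i\<close> outside \<open>B\<close>, these cancel \<open>u (\<omega> i)\<close>, except that for \<open>j\<close> outside \<open>B\<close> the factor
  \<open>v (\<omega> j)\<close> stays and has mean \<open>b'\<close>. After completing the powers of \<open>b'\<close>, the mean of the
  \<open>j\<close>-th term is \<open>S ^ k x\<close> or \<open>S ^ (k + 1) x\<close> according to \<open>j \<in> B\<close>. Averaging over \<open>B\<close> leaves
  \<open>k / 2\<close> times \<open>S ^ k (1 - S) x\<close>, while the left-hand side is small by the type inequality.
\<close>

lemma product_square_difference:
  fixes w :: "'i \<Rightarrow> real" and u v :: "'i \<Rightarrow> 'r"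
  assumes I: "finite I" and w: "\<And>i. i \<in> I \<Longrightarrow> 0 \<le> w i" "(\<Sum>i\<in>I. w i) = 1"
    and u: "\<And>i. i \<in> I \<Longrightarrow> u i \<in> \<Gamma>" and v: "\<And>i. i \<in> I \<Longrightarrow> v i \<in> \<Gamma>"
    and uv: "\<And>i. i \<in> I \<Longrightarrow> u i * v i = 1"
    and type: "signed_type k (c powr p) p N" and "0 \<le> c" "1 \<le> p" "0 < k"
  defines "S \<equiv> (\<Sum>i\<in>I. sc (of_real (w i)) * u i) * (\<Sum>i\<in>I. sc (of_real (w i)) * v i)"
  shows "N (S ^ k * (1 - S) * x) \<le> 2 * c * M\<^sup>2 * N x"
proof -
  define b where "b = (\<Sum>i\<in>I. sc (of_real (w i)) * u i)"
  define b' where "b' = (\<Sum>i\<in>I. sc (of_real (w i)) * v i)"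
  have S: "S = b * b'" by (simp add: S_def b_def b'_def)
  have b_in: "b \<in> contractive" and b'_in: "b' \<in> contractive"
    unfolding b_def b'_def using assms \<Gamma>_subset_contractive by (auto intro!: contractive_average)
  then have S_in: "S \<in> contractive" unfolding S by (rule contractive_mult)
  define Om where "Om = PiE {..<k} (\<lambda>_. I)"
  define W where "W \<omega> = (\<Prod>i<k. w (\<omega> i))" for \<omega>
  have fin: "finite Om" unfolding Om_def using I by (intro finite_PiE) auto
  have W0: "0 \<le> W \<omega>" if "\<omega> \<in> Om" for \<omega>
    using that w unfolding W_def Om_def by (intro prod_nonneg) (auto simp: PiE_iff)
  have int: "(\<Sum>\<omega>\<in>Om. W \<omega> * (\<Prod>i<k. f i (\<omega> i))) = (\<Prod>i<k. \<Sum>a\<in>I. w a * f i a)" for f :: "nat \<Rightarrow> 'i \<Rightarrow> real"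
    unfolding Om_def W_def using I by (simp add: prod_sum_PiE prod.distrib)
  have W1: "(\<Sum>\<omega>\<in>Om. W \<omega>) = 1"
    using int[of "\<lambda>_ _. 1"] w by simp
  have int_sc: "(\<Sum>\<omega>\<in>Om. sc (of_real (W \<omega>)) * (\<Prod>i<k. f i (\<omega> i))) = (\<Prod>i<k. \<Sum>a\<in>I. sc (of_real (w a)) * f i a)"
    for f :: "nat \<Rightarrow> 'i \<Rightarrow> 'r"
    unfolding Om_def W_def using I by (simp add: prod_sum_PiE prod.distrib of_real_prod sc_prod)
  define h where "h \<omega> j = b * (\<Prod>i\<in>{..<k} - {j}. u (\<omega> i)) * x" for \<omega> j
  have N_h: "N (h \<omega> j) \<le> M * N x" if "\<omega> \<in> Om" for \<omega> j
    unfolding h_def using that u \<Gamma>_subset_contractive b_in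
    by (intro contractive_bound contractive_mult contractive_prod) (auto simp: Om_def PiE_iff)
  \<comment> \<open>The mean \<open>E\<close> below is over signs and indices; the type inequality is used for each \<open>\<omega>\<close>.\<close>
  define g where "g B \<omega> = (\<Sum>j<k. signed B j (h \<omega> j))" for B \<omega>
  define K where "K = {..<k}"
  have K: "finite K" "card K = k" by (simp_all add: K_def)
  define E where "E = (\<Sum>(B, \<omega>)\<in>Pow K \<times> Om. W \<omega> / 2 ^ k * N (g B \<omega>))"
  have E0: "0 \<le> E" unfolding E_def using W0 N_nonneg by (intro sum_nonneg) auto
  have "E powr p \<le> (\<Sum>(B, \<omega>)\<in>Pow K \<times> Om. W \<omega> / 2 ^ k * N (g B \<omega>) powr p)"
    unfolding E_def
    using jensen_powr_sum[of "Pow K \<times> Om" "\<lambda>(B,\<omega>). W \<omega> / 2 ^ k" "\<lambda>(B,\<omega>). N (g B \<omega>)" p]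
      fin W0 N_nonneg K W1 \<open>1 \<le> p\<close>
    by (auto simp: case_prod_unfold sum.cartesian_product' sum_divide_distrib[symmetric] card_Pow)
  also have "\<dots> = (\<Sum>\<omega>\<in>Om. W \<omega> / 2 ^ k * (\<Sum>B\<in>Pow K. N (g B \<omega>) powr p))"
    by (subst sum.cartesian_product[symmetric], subst sum.swap) (simp add: sum_distrib_left)
  also have "\<dots> \<le> (\<Sum>\<omega>\<in>Om. W \<omega> / 2 ^ k * (2 ^ k * (c powr p) * real k powr (p - 1) * (\<Sum>j<k. (M * N x) powr p)))"
  proof (intro sum_mono mult_left_mono)
    fix \<omega> assume om: "\<omega> \<in> Om"
    have "(\<Sum>B\<in>Pow K. N (g B \<omega>) powr p) \<le> 2 ^ k * (c powr p) * real k powr (p - 1) * (\<Sum>j<k. N (h \<omega> j) powr p)"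
      using type unfolding signed_type_def K_def g_def by auto
    also have "\<dots> \<le> 2 ^ k * (c powr p) * real k powr (p - 1) * (\<Sum>j<k. (M * N x) powr p)"
      using N_h[OF om] N_nonneg \<open>1 \<le> p\<close> by (intro mult_left_mono sum_mono powr_mono2) auto
    finally show "(\<Sum>B\<in>Pow K. N (g B \<omega>) powr p) \<le> 2 ^ k * (c powr p) * real k powr (p - 1) * (\<Sum>j<k. (M * N x) powr p)" .
  qed (use W0 in auto)
  also have "\<dots> = (\<Sum>\<omega>\<in>Om. W \<omega>) * ((c powr p) * (real k powr (p - 1) * k) * (M * N x) powr p)"
    by (simp add: sum_distrib_right sum_distrib_left mult_ac)
  also have "\<dots> = (c * k * (M * N x)) powr p"
  proof -
    have "real k powr (p - 1) * k = k powr p" using \<open>0 < k\<close> by (simp add: powr_mult_base mult.commute)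
    then show ?thesis
      using W1 \<open>0 \<le> c\<close> M_ge_1 N_nonneg[of x] by (simp add: powr_mult mult_ac)
  qed
  finally have Ep: "E powr p \<le> (c * k * (M * N x)) powr p" .
  have E: "E \<le> c * k * (M * N x)"
  proof (rule ccontr)
    assume "\<not> E \<le> c * k * (M * N x)"
    moreover have "0 \<le> c * k * (M * N x)"
      using \<open>0 \<le> c\<close> M_ge_1 N_nonneg[of x] by (intro mult_nonneg_nonneg) auto
    ultimately have "(c * k * (M * N x)) powr p < E powr p"
      using \<open>1 \<le> p\<close> by (intro powr_less_mono2) auto
    with Ep show False by simp
  qed
  define R where "R B \<omega> = b' ^ card B * S ^ (k - card B) * (\<Prod>i\<in>K - B. v (\<omega> i)) * g B \<omega>" for B \<omega>
  have N_R: "N (R B \<omega>) \<le> M * N (g B \<omega>)" if "\<omega> \<in> Om" for B \<omega>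
    unfolding R_def using that v \<Gamma>_subset_contractive b'_in S_in
    by (intro contractive_bound contractive_mult contractive_prod contractive_power) (auto simp: Om_def PiE_iff K_def)
  have term_sum: "(\<Sum>\<omega>\<in>Om. sc (of_real (W \<omega>)) * (b' ^ card B * S ^ (k - card B) * (\<Prod>i\<in>K - B. v (\<omega> i)) * h \<omega> j))
      = (if j \<in> B then S ^ k else S ^ Suc k) * x" if B: "B \<subseteq> K" and j: "j < k" for B j
  proof -
    define f where "f i a = (if i \<in> B then 1 else v a) * (if i = j then 1 else u a)" for i a
    have fp: "(\<Prod>i\<in>K - B. v (\<omega> i)) * (\<Prod>i\<in>{..<k} - {j}. u (\<omega> i)) = (\<Prod>i<k. f i (\<omega> i))" for \<omega>
      unfolding f_def prod.distrib K_def
      by (intro arg_cong2[where f="(*)"] prod.mono_neutral_cong_left) auto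
    have "(\<Sum>\<omega>\<in>Om. sc (of_real (W \<omega>)) * (b' ^ card B * S ^ (k - card B) * (\<Prod>i\<in>K - B. v (\<omega> i)) * h \<omega> j))
        = (\<Sum>\<omega>\<in>Om. sc (of_real (W \<omega>)) * (\<Prod>i<k. f i (\<omega> i))) * (b' ^ card B * S ^ (k - card B) * b * x)"
      unfolding h_def sum_distrib_right fp[symmetric] by (intro sum.cong refl) (simp add: mult_ac)
    also have "(\<Sum>\<omega>\<in>Om. sc (of_real (W \<omega>)) * (\<Prod>i<k. f i (\<omega> i))) = (\<Prod>i<k. \<Sum>a\<in>I. sc (of_real (w a)) * f i a)"
      by (rule int_sc)
    also have "\<dots> = (\<Prod>i<k. if i \<in> B then (if i = j then 1 else b) else (if i = j then b' else 1))"
    proof (intro prod.cong refl)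
      have one: "(\<Sum>a\<in>I. sc (of_real (w a))) = 1"
        unfolding sc_sum[symmetric] using w by (simp add: sc_1 flip: of_real_sum)
      show "(\<Sum>a\<in>I. sc (of_real (w a)) * f i a) = (if i \<in> B then (if i = j then 1 else b) else (if i = j then b' else 1))" for i
      proof -
        have "(\<Sum>a\<in>I. sc (of_real (w a)) * (v a * u a)) = (\<Sum>a\<in>I. sc (of_real (w a)))"
          using uv by (intro sum.cong) (auto simp: mult.commute)
        then show ?thesis using one by (auto simp: f_def b_def b'_def)
      qed
    qed
    also have "\<dots> = (if j \<in> B then b ^ (card B - 1) else b ^ card B * b')"
    proof -
      have "(\<Prod>i<k. if i \<in> B then (if i = j then 1 else b) else (if i = j then b' else 1))
         = (\<Prod>i<k. (if i \<in> B - {j} then b else 1) * (if i = j then (if j \<in> B then 1 else b') else 1))"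
        by (intro prod.cong) auto
      also have "\<dots> = (\<Prod>i<k. if i \<in> B - {j} then b else 1) * (if j \<in> B then 1 else b')"
        unfolding prod.distrib using j by simp
      also have "(\<Prod>i<k. if i \<in> B - {j} then b else 1) = b ^ card (B - {j})"
      proof -
        have "{..<k} \<inter> {i. i \<in> B - {j}} = B - {j}" using B by (auto simp: K_def)
        then show ?thesis by (simp add: prod.If_cases)
      qed
      finally show ?thesis using B K by (auto simp: card_Diff_singleton_if)
    qed
    finally have eq: "(\<Sum>\<omega>\<in>Om. sc (of_real (W \<omega>)) * (b' ^ card B * S ^ (k - card B) * (\<Prod>i\<in>K - B. v (\<omega> i)) * h \<omega> j))
      = (if j \<in> B then b ^ (card B - 1) else b ^ card B * b') * (b' ^ card B * S ^ (k - card B) * b * x)" .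
    have cB: "card B \<le> k" using B K by (metis card_mono)
    have pow: "b ^ card B * b' ^ card B * S ^ (k - card B) = S ^ k"
      using cB by (simp add: S power_mult_distrib[symmetric] flip: power_add)
    show ?thesis
    proof (cases "j \<in> B")
      case True
      then have "0 < card B" using B K by (metis card_gt_0_iff empty_iff finite_subset)
      then have "b ^ (card B - 1) * b = b ^ card B" by (metis power_minus_mult)
      then have pb: "b ^ (card B - 1) * b = b ^ card B" .
      have "b ^ (card B - 1) * (b' ^ card B * S ^ (k - card B) * b * x) = S ^ k * x"
        unfolding pow[symmetric] pb[symmetric] by (simp only: mult_ac)
      with True eq show ?thesis by simp
    next
      case False
      have "b ^ card B * b' * (b' ^ card B * S ^ (k - card B) * b * x) = (b * b') * (b ^ card B * b' ^ card B * S ^ (k - card B)) * x"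
        by (simp add: mult_ac)
      with False eq pow show ?thesis by (simp add: S)
    qed
  qed
  have R_sum: "(\<Sum>\<omega>\<in>Om. sc (of_real (W \<omega>)) * R B \<omega>)
      = sc (of_real (real (card B))) * (S ^ k * x) - sc (of_real (real k - real (card B))) * (S ^ Suc k * x)"
    if B: "B \<subseteq> K" for B
  proof -
    have cB: "card B \<le> k" using B K by (metis card_mono)
    have "(\<Sum>\<omega>\<in>Om. sc (of_real (W \<omega>)) * R B \<omega>) = (\<Sum>j<k. signed B j (\<Sum>\<omega>\<in>Om. sc (of_real (W \<omega>)) * (b' ^ card B * S ^ (k - card B) * (\<Prod>i\<in>K - B. v (\<omega> i)) * h \<omega> j)))"
    proof -
      have "(\<Sum>\<omega>\<in>Om. sc (of_real (W \<omega>)) * R B \<omega>) = (\<Sum>\<omega>\<in>Om. \<Sum>j<k. signed B j (sc (of_real (W \<omega>)) * (b' ^ card B * S ^ (k - card B) * (\<Prod>i\<in>K - B. v (\<omega> i)) * h \<omega> j)))"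
        unfolding R_def g_def sum_distrib_left by (intro sum.cong refl) (auto simp: signed_def)
      also have "\<dots> = (\<Sum>j<k. \<Sum>\<omega>\<in>Om. signed B j (sc (of_real (W \<omega>)) * (b' ^ card B * S ^ (k - card B) * (\<Prod>i\<in>K - B. v (\<omega> i)) * h \<omega> j)))"
        by (rule sum.swap)
      finally show ?thesis by (auto simp: signed_def sum_negf intro!: sum.cong)
    qed
    also have "\<dots> = (\<Sum>j<k. if j \<in> B then S ^ k * x else - (S ^ Suc k * x))"
      using term_sum[OF B] by (intro sum.cong refl) (auto simp: signed_def)
    also have "\<dots> = of_nat (card B) * (S ^ k * x) - of_nat (k - card B) * (S ^ Suc k * x)"
    proof -
      have "{..<k} \<inter> {j. j \<in> B} = B" "{..<k} \<inter> - {j. j \<in> B} = K - B" using B by (auto simp: K_def)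
      moreover have "card (K - B) = k - card B" using B K by (metis card_Diff_subset finite_subset)
      ultimately show ?thesis by (simp add: sum.If_cases)
    qed
    also have "of_nat (k - card B) = sc (of_real (real k - real (card B)))"
      using cB sc_of_nat[of "k - card B"] by (simp add: of_nat_diff)
    finally show ?thesis using sc_of_nat[of "card B"] by simp
  qed
  have half: "(\<Sum>B\<in>Pow K. real (card B)) = 2 ^ k * (real k / 2)"
    "(\<Sum>B\<in>Pow K. real k - real (card B)) = 2 ^ k * (real k / 2)"
    using sum_card_mult_Pow[OF K(1)] K(2) by simp_all
  have "(\<Sum>(B, \<omega>)\<in>Pow K \<times> Om. sc (of_real (W \<omega> / 2 ^ k)) * R B \<omega>)
      = (\<Sum>B\<in>Pow K. sc (of_real (1 / 2 ^ k)) * (\<Sum>\<omega>\<in>Om. sc (of_real (W \<omega>)) * R B \<omega>))"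
    by (subst sum.cartesian_product[symmetric]) (simp add: sum_distrib_left mult.assoc[symmetric] flip: sc_mult)
  also have "\<dots> = sc (of_real (1 / 2 ^ k)) * (\<Sum>B\<in>Pow K. sc (of_real (real (card B))) * (S ^ k * x) - sc (of_real (real k - real (card B))) * (S ^ Suc k * x))"
    using R_sum by (simp add: sum_distrib_left)
  also have "\<dots> = sc (of_real (1 / 2 ^ k)) * (sc (of_real (\<Sum>B\<in>Pow K. real (card B))) * (S ^ k * x)
      - sc (of_real (\<Sum>B\<in>Pow K. real k - real (card B))) * (S ^ Suc k * x))"
    by (simp only: of_real_sum sc_sum sum_distrib_right) (simp only: sum_subtractf)
  also have "\<dots> = sc (of_real (1 / 2 ^ k)) * sc (of_real (2 ^ k * (real k / 2))) * (S ^ k * x - S ^ Suc k * x)"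
    unfolding half by (simp add: algebra_simps)
  also have "\<dots> = sc (of_real (real k / 2)) * (S ^ k * (1 - S) * x)"
    unfolding sc_mult[symmetric] of_real_mult[symmetric] by (simp add: algebra_simps)
  finally have total: "(\<Sum>(B, \<omega>)\<in>Pow K \<times> Om. sc (of_real (W \<omega> / 2 ^ k)) * R B \<omega>) = sc (of_real (real k / 2)) * (S ^ k * (1 - S) * x)" .
  have "real k / 2 * N (S ^ k * (1 - S) * x) = N (\<Sum>(B, \<omega>)\<in>Pow K \<times> Om. sc (of_real (W \<omega> / 2 ^ k)) * R B \<omega>)"
    unfolding total by (subst N_sc) simp
  also have "\<dots> \<le> (\<Sum>(B, \<omega>)\<in>Pow K \<times> Om. W \<omega> / 2 ^ k * N (R B \<omega>))"
    using N_scaled_sum[of "Pow K \<times> Om" "\<lambda>(B, \<omega>). W \<omega> / 2 ^ k" "\<lambda>(B, \<omega>). R B \<omega>"] W0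
    by (auto simp: case_prod_unfold)
  also have "\<dots> \<le> (\<Sum>(B, \<omega>)\<in>Pow K \<times> Om. W \<omega> / 2 ^ k * (M * N (g B \<omega>)))"
    using W0 N_R by (intro sum_mono) (auto intro!: mult_left_mono divide_right_mono)
  also have "\<dots> = M * E"
    unfolding E_def by (simp add: sum_distrib_left case_prod_unfold mult_ac)
  also have "\<dots> \<le> M * (c * k * (M * N x))"
    using E M_ge_1 by (intro mult_left_mono) auto
  finally show ?thesis
    using \<open>0 < k\<close> by (simp add: field_simps power2_eq_square)
qed

end

section \<open>The Ritt estimate from small differences\<close>

text \<open>
  Some multiple of the angle lands in the part of the circle at distance at least 1 from the point 1. It
  fixes the power \<open>T ^ q\<close> to which the hypothesis of the Ritt estimate is applied at the frequency \<open>\<phi>\<close>.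
\<close>

lemma small_angle_multiple:
  fixes \<phi> :: real
  assumes "\<phi> \<noteq> 0" "\<bar>\<phi>\<bar> \<le> pi"
  obtains q :: nat where "1 \<le> q" "real q \<le> 5 / \<bar>\<phi>\<bar>" "1 \<le> cmod (1 - cis (real q * \<phi>))"
proof
  define t where "t = pi / (3 * \<bar>\<phi>\<bar>)"
  define q where "q = nat \<lceil>t\<rceil>"
  have t: "0 < t" using assms by (simp add: t_def)
  show "1 \<le> q" using t unfolding q_def by linarith
  have q: "t \<le> q" "q \<le> t + 1" using t unfolding q_def by linarith+
  have "t * \<bar>\<phi>\<bar> = pi / 3" using assms by (simp add: t_def)
  have lo: "pi / 3 \<le> real q * \<bar>\<phi>\<bar>"
    using mult_right_mono[OF q(1), of "\<bar>\<phi>\<bar>"] \<open>t * \<bar>\<phi>\<bar> = pi / 3\<close> by simp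
  have hi: "real q * \<bar>\<phi>\<bar> \<le> pi / 3 + \<bar>\<phi>\<bar>"
    using mult_right_mono[OF q(2), of "\<bar>\<phi>\<bar>"] \<open>t * \<bar>\<phi>\<bar> = pi / 3\<close> by (simp add: algebra_simps)
  have "real q * \<bar>\<phi>\<bar> \<le> 5"
    using hi assms(2) pi_less_4 pi_approx by (simp add: pi_approx)
  then show "real q \<le> 5 / \<bar>\<phi>\<bar>" using assms by (simp add: field_simps)
  have hi2: "real q * \<bar>\<phi>\<bar> \<le> 4 * pi / 3" using hi assms(2) by simp
  have "cos (real q * \<phi>) \<le> 1 / 2"
  proof -
    have "cos (real q * \<phi>) = cos (real q * \<bar>\<phi>\<bar>)"
      by (cases "\<phi> \<ge> 0") auto
    also have "\<dots> \<le> cos (pi / 3)"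
    proof (cases "real q * \<bar>\<phi>\<bar> \<le> pi")
      case True
      then show ?thesis using lo by (intro cos_monotone_0_pi_le) auto
    next
      case False
      have "cos (real q * \<bar>\<phi>\<bar>) = cos (2 * pi - real q * \<bar>\<phi>\<bar>)" by (simp add: cos_diff)
      also have "\<dots> \<le> cos (pi / 3)"
        using False hi2 by (intro cos_monotone_0_pi_le) auto
      finally show ?thesis .
    qed
    finally show ?thesis by (simp add: cos_60)
  qed
  moreover have "(cmod (1 - cis (real q * \<phi>)))\<^sup>2 = 2 - 2 * cos (real q * \<phi>)"
  proof -
    have "(cmod (1 - cis x))\<^sup>2 = (1 - cos x)\<^sup>2 + (sin x)\<^sup>2" for x
      by (simp add: cmod_power2)
    also have "(1 - cos x)\<^sup>2 + (sin x)\<^sup>2 = 2 - 2 * cos x" for x :: real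
      using sin_cos_squared_add[of x] by (simp add: power2_eq_square algebra_simps)
    finally show ?thesis .
  qed
  ultimately have "1 \<le> (cmod (1 - cis (real q * \<phi>)))\<^sup>2" by simp
  then show "1 \<le> cmod (1 - cis (real q * \<phi>))"
    using power2_le_imp_le[of 1 "cmod (1 - cis (real q * \<phi>))"] by simp
qed

lemma norm_1_minus_cis_le: "cmod (1 - cis \<phi>) \<le> \<bar>\<phi>\<bar>"
proof -
  have 1: "(cmod (1 - cis \<phi>))\<^sup>2 = (2 * sin (\<phi> / 2))\<^sup>2"
  proof -
    have "cos \<phi> = 1 - 2 * (sin (\<phi> / 2))\<^sup>2" using cos_double_sin[of "\<phi> / 2"] by simp
    moreover have "(cmod (1 - cis \<phi>))\<^sup>2 = (1 - cos \<phi>)\<^sup>2 + (sin \<phi>)\<^sup>2"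
      by (simp add: cmod_power2)
    moreover have "(1 - cos \<phi>)\<^sup>2 + (sin \<phi>)\<^sup>2 = 2 - 2 * cos \<phi>"
      using sin_cos_squared_add[of \<phi>] by (simp add: power2_eq_square algebra_simps)
    ultimately show ?thesis by (simp add: power2_eq_square)
  qed
  then have "cmod (1 - cis \<phi>) = \<bar>2 * sin (\<phi> / 2)\<bar>"
    by (metis abs_norm_cancel power2_eq_iff_nonneg abs_ge_zero power2_abs norm_ge_zero)
  also have "\<dots> \<le> \<bar>\<phi>\<bar>" using abs_sin_x_le_abs_x[of "\<phi> / 2"] by (simp add: abs_mult)
  finally show ?thesis .
qed

lemma sum_cis_roots:
  fixes m :: int and h :: nat
  defines "L \<equiv> 2 * real h + 1"
  assumes "\<bar>m\<bar> < 2 * int h + 1"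
  shows "(\<Sum>j\<in>{- int h..int h}. cis (2 * pi * of_int j * of_int m / L)) = (if m = 0 then of_real L else 0)"
proof (cases "m = 0")
  case True
  then show ?thesis by (simp add: L_def)
next
  case False
  define z where "z = cis (2 * pi * of_int m / L)"
  have L: "L > 0" by (simp add: L_def)
  have zL: "z ^ (2 * h + 1) = 1"
  proof -
    have "real (2 * h + 1) * (2 * pi * of_int m / L) = 2 * pi * of_int m"
      using L by (simp add: L_def field_simps)
    then have "z ^ (2 * h + 1) = cis (2 * pi * of_int m)"
      by (simp only: z_def Complex.DeMoivre)
    then show ?thesis by (simp add: cis_multiple_2pi)
  qed
  have z1: "z \<noteq> 1"
  proof
    assume "z = 1"
    then have "cos (2 * pi * of_int m / L) = 1" by (simp add: z_def complex_eq_iff)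
    then obtain n :: int where "2 * pi * of_int m / L = of_int n * 2 * pi"
      using cos_one_2pi_int by blast
    then have "of_int m = of_int n * L" using L by (simp add: field_simps)
    then have "real_of_int m = real_of_int (n * (2 * int h + 1))" by (simp add: L_def)
    then have m: "m = n * (2 * int h + 1)" by (simp only: of_int_eq_iff)
    then have "n \<noteq> 0" using False by auto
    then have "1 \<le> \<bar>n\<bar>" by simp
    then have "1 * \<bar>2 * int h + 1\<bar> \<le> \<bar>n\<bar> * \<bar>2 * int h + 1\<bar>" by (intro mult_right_mono) auto
    then have "\<bar>m\<bar> \<ge> 2 * int h + 1" using m by (simp add: abs_mult)
    with assms(2) show False by simp
  qed
  have "(\<Sum>j\<in>{- int h..int h}. cis (2 * pi * of_int j * of_int m / L))
      = (\<Sum>i<2 * h + 1. cis (2 * pi * of_int (int i - int h) * of_int m / L))"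
    by (rule sum.reindex_bij_witness[of _ "\<lambda>i. int i - int h" "\<lambda>j. nat (j + int h)"]) auto
  also have "\<dots> = (\<Sum>i<2 * h + 1. cis (- (2 * pi * of_int m * h / L)) * z ^ i)"
    unfolding z_def Complex.DeMoivre by (intro sum.cong refl) (simp add: cis_mult field_simps add_divide_distrib diff_divide_distrib)
  also have "\<dots> = 0"
    using geometric_sum[OF z1, of "2 * h + 1"] zL by (simp add: sum_distrib_left[symmetric] del: power_Suc)
  finally show ?thesis using False by simp
qed

lemma sum_inverse_squares_le: "(\<Sum>j=1..h. 1 / (real j)\<^sup>2) \<le> 2"
proof -
  have "(\<Sum>j=1..h. 1 / (real j)\<^sup>2) \<le> 2 - 1 / real h" if "1 \<le> h" for h
    using that
  proof (induction h rule: dec_induct)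
    case (step h)
    have "1 / (real (Suc h))\<^sup>2 \<le> 1 / real h - 1 / real (Suc h)"
    proof -
      have "1 / (real (Suc h))\<^sup>2 \<le> 1 / (real h * real (Suc h))"
        using step by (intro divide_left_mono) (auto simp: power2_eq_square)
      also have "\<dots> = 1 / real h - 1 / real (Suc h)" using step by (simp add: field_simps)
      finally show ?thesis .
    qed
    with step show ?case by simp
  qed auto
  from this[of h] show ?thesis by (cases "h = 0") (auto intro: order_trans)
qed

lemma geometric_sum_mult:
  fixes a :: "'r::comm_ring_1"
  shows "(1 - a) * (\<Sum>j<n. a ^ j) = 1 - a ^ n"
  by (rule one_diff_power_eq[symmetric])

context scalar_ring
begin

text \<open>
  If \<open>(1 - z S) y\<close> were small, \<open>S\<close> would act on \<open>y\<close> almost as the scalar \<open>cnj z\<close>, and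
  \<open>S ^ k (1 - S) y\<close> would have size about \<open>\<bar>1 - z\<bar>\<close> times that of \<open>y\<close>; the hypothesis allows only half of \<open>N y\<close>.
\<close>

lemma multiple_minus_unimodular_bounded_below:
  assumes pb: "\<And>n x. N (S ^ n * x) \<le> M * N x" and M: "1 \<le> M"
    and small: "\<And>x. N (S ^ k * (1 - S) * x) \<le> N x / 2"
    and z: "cmod z = 1" "1 \<le> cmod (1 - z)"
  shows "N y \<le> 2 * (2 * real k + 1) * M * N ((1 - sc z * S) * y)"
proof -
  define c where "c = N ((1 - sc z * S) * y)"
  have zz: "cnj z * z = 1" using z(1) by (simp add: complex_norm_square[symmetric] mult.commute)
  have approx: "N ((S ^ j - sc (cnj z ^ j)) * y) \<le> real j * M * c" for j
  proof -
    have "sc (cnj z ^ j) * (sc z * S) ^ j = sc ((cnj z * z) ^ j) * S ^ j"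
      by (simp only: power_mult_distrib sc_mult sc_power mult_ac)
    then have S: "S ^ j = sc (cnj z ^ j) * (sc z * S) ^ j" by (simp add: zz sc_1)
    have "(S ^ j - sc (cnj z ^ j)) * y = - (sc (cnj z ^ j) * (1 - (sc z * S) ^ j) * y)"
      by (subst S) (simp add: algebra_simps)
    also have "\<dots> = - (sc (cnj z ^ j) * (\<Sum>i<j. sc (z ^ i) * (S ^ i * ((1 - sc z * S) * y))))"
      unfolding geometric_sum_mult[symmetric]
      by (simp add: sum_distrib_left sum_distrib_right power_mult_distrib sc_power mult_ac)
    finally have "N ((S ^ j - sc (cnj z ^ j)) * y) = N (\<Sum>i<j. sc (z ^ i) * (S ^ i * ((1 - sc z * S) * y)))"
      using z by (simp add: N_uminus N_sc norm_power)
    also have "\<dots> \<le> (\<Sum>i<j. N (sc (z ^ i) * (S ^ i * ((1 - sc z * S) * y))))" by (rule N_sum)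
    also have "\<dots> \<le> (\<Sum>i<j. M * c)"
      using z pb by (intro sum_mono) (auto simp: N_sc norm_power c_def)
    finally show ?thesis by simp
  qed
  have "1 * N y \<le> cmod (1 - z) * N y" using z N_nonneg by (intro mult_right_mono) auto
  also have "\<dots> = N (sc (cnj z ^ k * (1 - cnj z)) * y)"
  proof -
    have "cmod (1 - cnj z) = cmod (1 - z)" by (metis complex_cnj_diff complex_cnj_one complex_mod_cnj)
    then show ?thesis using z by (subst N_sc) (simp add: norm_mult norm_power)
  qed
  also have "sc (cnj z ^ k * (1 - cnj z)) * y
      = S ^ k * (1 - S) * y - (S ^ k - sc (cnj z ^ k)) * y + (S ^ Suc k - sc (cnj z ^ Suc k)) * y"
    by (simp add: algebra_simps sc_mult sc_diff sc_1)
  also have "N \<dots> \<le> N y / 2 + real k * M * c + real (Suc k) * M * c"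
    using small[of y] approx[of k] approx[of "Suc k"]
    by (intro order_trans[OF N_triangle] add_mono order_trans[OF N_diff]) auto
  finally show ?thesis unfolding c_def by (simp add: algebra_simps)
qed

end

definition ritt_constant :: "real \<Rightarrow> nat \<Rightarrow> real" where
  "ritt_constant M k = (let C = 10 * (2 * real k + 1) * M\<^sup>2 * (1 + M)
     in 2 * (5 * (C + 1 + M) * C\<^sup>2 + (1 + M) * M\<^sup>2))"

context scalar_ring
begin

text \<open>
  The Dirichlet sums \<open>D z m = \<Sum>j<m. (z T)\<^sup>j\<close> are of order \<open>1 / \<bar>\<phi>\<bar>\<close> at \<open>z = e\<^sup>i\<^sup>\<phi>\<close>: the lower bound for
  \<open>1 - (z T) ^ q\<close> inverts the factor in \<open>(1 - (z T) ^ q) D z m = (1 - (z T) ^ m) D z q\<close>, where \<open>q\<close> is of order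
  \<open>1 / \<bar>\<phi>\<bar>\<close>. In \<open>(D z m) ^ 3\<close> the coefficient of \<open>T ^ n\<close> with \<open>n = m - 1\<close> is of order \<open>m\<^sup>2\<close>, and it is extracted by averaging over the
  \<open>L\<close>-th roots of unity, with \<open>L\<close> larger than the degree. The factor \<open>1 - T\<close> gains one power of
  \<open>\<bar>\<phi>\<bar>\<close>, so the sum over frequencies is dominated by the convergent sum of \<open>1 / \<phi>\<^sup>2\<close>.
\<close>

lemma ritt_estimate_of_small_differences:
  assumes pb: "\<And>n x. N (T ^ n * x) \<le> M * N x" and M: "1 \<le> M"
    and small: "\<And>q x. 1 \<le> q \<Longrightarrow> N ((T ^ q) ^ k * (1 - T ^ q) * x) \<le> N x / 2"
  shows "real (Suc n) * N (T ^ n * (1 - T) * x) \<le> ritt_constant M k * N x"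
proof -
  define C where "C = 10 * (2 * real k + 1) * M\<^sup>2 * (1 + M)"
  have C0: "0 \<le> C" using M by (simp add: C_def)
  have MN: "0 \<le> M * N x" for x using M N_nonneg[of x] by simp
  define D where "D z m = (\<Sum>j<m. (sc z * T) ^ j)" for z m
  have N_power: "N ((sc z * T) ^ j * y) \<le> M * N y" if "cmod z = 1" for z j y
    using pb[of j y] that by (simp add: power_mult_distrib N_sc norm_power mult.assoc flip: sc_power)
  have N_1_power: "N ((1 - (sc z * T) ^ j) * y) \<le> (1 + M) * N y" if "cmod z = 1" for z j y
  proof -
    have "N ((1 - (sc z * T) ^ j) * y) = N (y - (sc z * T) ^ j * y)" by (simp add: algebra_simps)
    also have "\<dots> \<le> N y + M * N y" using N_diff N_power[OF that] by (meson add_left_mono order_trans)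
    finally show ?thesis by (simp add: algebra_simps)
  qed
  have N_D_trivial: "N (D z m * y) \<le> real m * M * N y" if "cmod z = 1" for z m y
  proof -
    have "N (D z m * y) \<le> (\<Sum>j<m. M * N y)"
      unfolding D_def sum_distrib_right
      by (rule order_trans[OF N_sum]) (intro sum_mono N_power that)
    then show ?thesis by simp
  qed
  have N_D: "N (D (cis \<phi>) m * y) \<le> C / \<bar>\<phi>\<bar> * N y" if phi: "\<phi> \<noteq> 0" "\<bar>\<phi>\<bar> \<le> pi" for \<phi> m y
  proof -
    obtain q :: nat where q: "1 \<le> q" "real q \<le> 5 / \<bar>\<phi>\<bar>" "1 \<le> cmod (1 - cis (real q * \<phi>))"
      using small_angle_multiple[OF phi] .
    define a where "a = sc (cis \<phi>) * T"
    have aq: "a ^ q = sc (cis (real q * \<phi>)) * T ^ q"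
      by (simp only: a_def power_mult_distrib sc_power[symmetric] Complex.DeMoivre)
    have pbq: "N ((T ^ q) ^ n * x) \<le> M * N x" for n x using pb by (simp flip: power_mult)
    have "N (D (cis \<phi>) m * y) \<le> 2 * (2 * real k + 1) * M * N ((1 - a ^ q) * (D (cis \<phi>) m * y))"
      unfolding aq using multiple_minus_unimodular_bounded_below[OF pbq M small[OF q(1)] _ q(3)] by simp
    also have "(1 - a ^ q) * (D (cis \<phi>) m * y) = (1 - a ^ m) * (D (cis \<phi>) q * y)"
      unfolding geometric_sum_mult[symmetric] D_def a_def by (simp add: mult_ac)
    also have "N \<dots> \<le> (1 + M) * (real q * M * N y)"
      using M unfolding a_def by (intro order_trans[OF N_1_power] mult_left_mono N_D_trivial) auto
    also have "\<dots> \<le> (1 + M) * (5 / \<bar>\<phi>\<bar> * M * N y)"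
      using M q(2) N_nonneg[of y] by (intro mult_left_mono mult_right_mono) auto
    finally have "N (D (cis \<phi>) m * y) \<le> 2 * (2 * real k + 1) * M * ((1 + M) * (5 / \<bar>\<phi>\<bar> * M * N y))"
      using M by (simp add: mult_left_mono)
    then show ?thesis by (simp add: C_def power2_eq_square field_simps)
  qed
  define m where "m = Suc n"
  define h where "h = 2 * m"
  define L where "L = 2 * real h + 1"
  have L: "L > 0" "L = 4 * real m + 1" "L \<le> 5 * real m" by (simp_all add: L_def h_def m_def)
  define ph where "ph j = 2 * pi * real_of_int j / L" for j
  \<comment> \<open>The third power of the Dirichlet sum makes the terms summable over the frequencies.\<close>
  define F where "F j = sc (cis (- (ph j * real n))) * ((1 - T) * D (cis (ph j)) m ^ 3 * x)" for j
  have F_nonzero: "N (F j) \<le> (C + 1 + M) * C\<^sup>2 / (ph j)\<^sup>2 * N x" if j: "j \<in> {- int h..int h}" "j \<noteq> 0" for j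
  proof -
    have phi: "ph j \<noteq> 0" using j L by (simp add: ph_def)
    have "\<bar>j\<bar> \<le> int h" using j by auto
    then have "real_of_int \<bar>j\<bar> \<le> real_of_int (int h)" by (simp only: of_int_le_iff)
    then have "2 * \<bar>real_of_int j\<bar> \<le> L" by (simp add: L_def)
    then have "pi * (2 * \<bar>real_of_int j\<bar>) \<le> pi * L" by (intro mult_left_mono) auto
    then have phi': "\<bar>ph j\<bar> \<le> pi" using L by (simp add: ph_def abs_mult field_simps)
    define z where "z = cis (ph j)"
    have "sc (cnj z) * sc z = 1" by (simp add: z_def cis_cnj cis_mult sc_1 flip: sc_mult)
    have id: "(1 - T) * D z m = sc (cnj z) * (sc (z - 1) * D z m + (1 - (sc z * T) ^ m))"
    proof -
      have "sc (cnj z) * (sc (z - 1) * D z m + (1 - (sc z * T) ^ m)) = sc (cnj z) * (sc (z - 1) + (1 - sc z * T)) * D z m"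
        unfolding geometric_sum_mult[symmetric] D_def[symmetric] by (simp add: algebra_simps)
      also have "sc (cnj z) * (sc (z - 1) + (1 - sc z * T)) = (sc (cnj z) * sc z) * (1 - T)"
        by (simp add: sc_diff sc_1 algebra_simps)
      finally show ?thesis using \<open>sc (cnj z) * sc z = 1\<close> by simp
    qed
    have first: "N ((1 - T) * D z m * y) \<le> (C + 1 + M) * N y" for y
    proof -
      have "N ((1 - T) * D z m * y) = N (sc (z - 1) * (D z m * y) + (1 - (sc z * T) ^ m) * y)"
        unfolding id mult.assoc[of "sc (cnj z)"] N_sc
        by (simp add: z_def distrib_right mult.assoc)
      also have "\<dots> \<le> cmod (z - 1) * N (D z m * y) + (1 + M) * N y"
        using N_1_power[of z m y] N_sc by (intro order_trans[OF N_triangle] add_mono) (auto simp: z_def)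
      also have "cmod (z - 1) * N (D z m * y) \<le> \<bar>ph j\<bar> * (C / \<bar>ph j\<bar> * N y)"
        using norm_1_minus_cis_le[of "ph j"] N_D[OF phi phi'] N_nonneg
        by (intro mult_mono) (auto simp: z_def norm_minus_commute)
      finally show ?thesis using phi by (simp add: algebra_simps)
    qed
    have "N (F j) = N ((1 - T) * D z m * (D z m * (D z m * x)))"
      unfolding F_def N_sc z_def by (simp add: power3_eq_cube mult_ac)
    also have "\<dots> \<le> (C + 1 + M) * (C / \<bar>ph j\<bar> * (C / \<bar>ph j\<bar> * N x))"
      using C0 M N_nonneg unfolding z_def
      by (intro order_trans[OF first[unfolded z_def]] mult_left_mono order_trans[OF N_D[OF phi phi']]) auto
    also have "\<dots> = (C + 1 + M) * C\<^sup>2 / (ph j)\<^sup>2 * N x"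
      using phi by (simp add: power2_eq_square field_simps)
    finally show ?thesis .
  qed
  have F_zero: "N (F 0) \<le> (1 + M) * M\<^sup>2 * (real m)\<^sup>2 * N x"
  proof -
    have "(1 - T) * D 1 m = 1 - T ^ m"
      using geometric_sum_mult[of T m] by (simp add: D_def sc_1)
    then have "F 0 = (1 - T ^ m) * (D 1 m * (D 1 m * x))"
      by (simp add: F_def ph_def sc_1 power3_eq_cube mult.assoc[symmetric])
    also have "N \<dots> \<le> (1 + M) * (real m * M * (real m * M * N x))"
      using M N_1_power[of 1 m] N_nonneg
      by (intro order_trans[OF _ mult_left_mono[OF order_trans[OF N_D_trivial mult_left_mono[OF N_D_trivial]]]])
        (auto simp: sc_1)
    finally show ?thesis by (simp add: power2_eq_square mult_ac)
  qed
  define A where "A = (C + 1 + M) * C\<^sup>2 * (L / (2 * pi))\<^sup>2 * N x"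
  have A0: "0 \<le> A" using C0 M N_nonneg[of x] unfolding A_def by (intro mult_nonneg_nonneg) auto
  have N_F_sum: "(\<Sum>j\<in>{- int h..int h}. N (F j)) \<le> N (F 0) + 4 * A"
  proof -
    have split: "{- int h..int h} = insert 0 ((\<lambda>j. int j) ` {1..h} \<union> (\<lambda>j. - int j) ` {1..h})"
    proof -
      have "j \<in> (\<lambda>j. int j) ` {1..h} \<union> (\<lambda>j. - int j) ` {1..h}" if "j \<noteq> 0" "- int h \<le> j" "j \<le> int h" for j
      proof (cases "j > 0")
        case True
        then show ?thesis using that by (intro UnI1 image_eqI[of _ _ "nat j"]) auto
      next
        case False
        then show ?thesis using that by (intro UnI2 image_eqI[of _ _ "nat (- j)"]) auto
      qed
      then have "{- int h..int h} \<subseteq> insert 0 ((\<lambda>j. int j) ` {1..h} \<union> (\<lambda>j. - int j) ` {1..h})"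
        by (metis atLeastAtMost_iff insertCI subsetI)
      then show ?thesis by (intro equalityI) auto
    qed
    have bnd: "N (F (s * int j)) \<le> A * (1 / (real j)\<^sup>2)" if "j \<in> {1..h}" "s = 1 \<or> s = - 1" for s j
    proof -
      have "N (F (s * int j)) \<le> (C + 1 + M) * C\<^sup>2 / (ph (s * int j))\<^sup>2 * N x"
        using that by (intro F_nonzero) auto
      also have "(ph (s * int j))\<^sup>2 = (2 * pi / L)\<^sup>2 * (real j)\<^sup>2"
        using that by (auto simp: ph_def power_mult_distrib power_divide)
      finally show ?thesis using L by (simp add: A_def power_divide field_simps)
    qed
    have half: "(\<Sum>j=1..h. N (F (s * int j))) \<le> A * 2" if "s = 1 \<or> s = - 1" for s
    proof -
      have "(\<Sum>j=1..h. N (F (s * int j))) \<le> (\<Sum>j=1..h. A * (1 / (real j)\<^sup>2))"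
        using bnd that by (intro sum_mono) auto
      also have "\<dots> \<le> A * 2"
        unfolding sum_distrib_left[symmetric] using A0 by (intro mult_left_mono sum_inverse_squares_le)
      finally show ?thesis .
    qed
    have "(\<Sum>j\<in>{- int h..int h}. N (F j)) = N (F 0) + ((\<Sum>j=1..h. N (F (1 * int j))) + (\<Sum>j=1..h. N (F (- 1 * int j))))"
      unfolding split
      by (subst sum.insert, simp, force, subst sum.union_disjoint) (auto simp: sum.reindex inj_on_def)
    also have "\<dots> \<le> N (F 0) + (A * 2 + A * 2)" by (intro add_left_mono add_mono half) auto
    finally show ?thesis by simp
  qed
  have F_expand: "(\<Sum>j\<in>{- int h..int h}. F j) = sc (of_real (L * (real m * (real m + 1) / 2))) * (T ^ n * (1 - T) * x)"
  proof -
    have cube: "D z m ^ 3 = (\<Sum>a<m. \<Sum>b<m. \<Sum>c<m. sc (z ^ (a + b + c)) * T ^ (a + b + c))" for z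
      unfolding D_def power3_eq_cube sum_product
      by (simp add: sum_distrib_left sum_distrib_right power_mult_distrib sc_power sc_mult power_add mult_ac)
    have "(\<Sum>j\<in>{- int h..int h}. sc (cis (- (ph j * real n))) * D (cis (ph j)) m ^ 3)
       = (\<Sum>j\<in>{- int h..int h}. \<Sum>a<m. \<Sum>b<m. \<Sum>c<m. sc (cis (2 * pi * of_int j * of_int (int (a + b + c) - int n) / L)) * T ^ (a + b + c))"
    proof (intro sum.cong refl)
      fix j
      have "cis (- (ph j * real n)) * cis (ph j) ^ s = cis (2 * pi * of_int j * of_int (int s - int n) / L)" for s
        unfolding Complex.DeMoivre cis_mult by (intro arg_cong[where f=cis]) (simp add: ph_def algebra_simps diff_divide_distrib)
      then show "sc (cis (- (ph j * real n))) * D (cis (ph j)) m ^ 3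
        = (\<Sum>a<m. \<Sum>b<m. \<Sum>c<m. sc (cis (2 * pi * of_int j * of_int (int (a + b + c) - int n) / L)) * T ^ (a + b + c))"
        unfolding cube by (simp add: sum_distrib_left mult.assoc[symmetric] flip: sc_mult)
    qed
    also have "\<dots> = (\<Sum>a<m. \<Sum>b<m. \<Sum>c<m. sc (\<Sum>j\<in>{- int h..int h}. cis (2 * pi * of_int j * of_int (int (a + b + c) - int n) / L)) * T ^ (a + b + c))"
      unfolding sc_sum sum_distrib_right
      by (subst sum.swap, intro sum.cong refl, subst sum.swap, intro sum.cong refl, rule sum.swap)
    also have "\<dots> = (\<Sum>a<m. \<Sum>b<m. \<Sum>c<m. if c = n - a - b \<and> a + b \<le> n then sc (of_real L) * T ^ n else 0)"
    proof (intro sum.cong refl)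
      fix a b c assume abc: "a \<in> {..<m}" "b \<in> {..<m}" "c \<in> {..<m}"
      have "\<bar>int (a + b + c) - int n\<bar> < 2 * int h + 1" using abc by (auto simp: h_def m_def)
      note roots = sum_cis_roots[OF this, folded L_def]
      show "sc (\<Sum>j\<in>{- int h..int h}. cis (2 * pi * of_int j * of_int (int (a + b + c) - int n) / L)) * T ^ (a + b + c)
        = (if c = n - a - b \<and> a + b \<le> n then sc (of_real L) * T ^ n else 0)"
        unfolding roots using sc_0 by auto
    qed
    also have "\<dots> = (\<Sum>a<m. \<Sum>b<m. if a + b \<le> n then sc (of_real L) * T ^ n else 0)"
    proof (intro sum.cong refl)
      fix a b
      have "(\<Sum>c<m. if c = n - a - b \<and> a + b \<le> n then sc (of_real L) * T ^ n else 0)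
          = (\<Sum>c<m. if c = n - a - b then (if a + b \<le> n then sc (of_real L) * T ^ n else 0) else 0)"
        by (intro sum.cong) auto
      also have "\<dots> = (if a + b \<le> n then sc (of_real L) * T ^ n else 0)"
        by (subst sum.delta) (auto simp: m_def)
      finally show "(\<Sum>c<m. if c = n - a - b \<and> a + b \<le> n then sc (of_real L) * T ^ n else 0)
          = (if a + b \<le> n then sc (of_real L) * T ^ n else 0)" .
    qed
    also have "\<dots> = (\<Sum>a<m. of_nat (m - a) * (sc (of_real L) * T ^ n))"
    proof (intro sum.cong refl)
      fix a assume a: "a \<in> {..<m}"
      have "{..<m} \<inter> {b. a + b \<le> n} = {..<m - a}" using a by (auto simp: m_def)
      then show "(\<Sum>b<m. if a + b \<le> n then sc (of_real L) * T ^ n else 0) = of_nat (m - a) * (sc (of_real L) * T ^ n)"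
        by (simp add: sum.If_cases)
    qed
    also have "\<dots> = sc (of_real (\<Sum>a<m. real (m - a))) * (sc (of_real L) * T ^ n)"
      by (simp only: of_real_sum sc_sum sum_distrib_right of_real_of_nat_eq sc_of_nat)
    also have "(\<Sum>a<m. real (m - a)) = real m * (real m + 1) / 2"
    proof (induction m)
      case (Suc m)
      have "(\<Sum>a<Suc m. real (Suc m - a)) = real (Suc m) + (\<Sum>a<m. real (m - a))"
        by (subst sum.lessThan_Suc_shift) simp
      with Suc show ?case by (simp add: field_simps)
    qed simp
    finally have "(\<Sum>j\<in>{- int h..int h}. sc (cis (- (ph j * real n))) * D (cis (ph j)) m ^ 3)
        = sc (of_real (L * (real m * (real m + 1) / 2))) * T ^ n"
      by (simp only: of_real_mult sc_mult mult_ac)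
    then have "(\<Sum>j\<in>{- int h..int h}. sc (cis (- (ph j * real n))) * D (cis (ph j)) m ^ 3) * ((1 - T) * x)
        = sc (of_real (L * (real m * (real m + 1) / 2))) * T ^ n * ((1 - T) * x)" by simp
    then show ?thesis unfolding F_def by (simp add: sum_distrib_right sum_distrib_left mult_ac)
  qed
  have "L * (real m * (real m + 1) / 2) * N (T ^ n * (1 - T) * x) = N (\<Sum>j\<in>{- int h..int h}. F j)"
    unfolding F_expand N_sc norm_of_real using L by (simp add: m_def)
  also have "\<dots> \<le> (\<Sum>j\<in>{- int h..int h}. N (F j))" by (rule N_sum)
  also have "\<dots> \<le> (1 + M) * M\<^sup>2 * (real m)\<^sup>2 * N x + 4 * A" using N_F_sum F_zero by simp
  also have "4 * A \<le> 5 * ((C + 1 + M) * C\<^sup>2) * N x * L * real m"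
  proof -
    have "3 \<le> pi" using pi_gt3 by simp
    then have "3\<^sup>2 \<le> pi\<^sup>2" by (intro power_mono) auto
    have "4 * (L / (2 * pi))\<^sup>2 = L\<^sup>2 / pi\<^sup>2" by (simp add: power_divide)
    also have "\<dots> \<le> L\<^sup>2 / 1" using \<open>3\<^sup>2 \<le> pi\<^sup>2\<close> by (intro divide_left_mono) auto
    also have "\<dots> \<le> L * (5 * real m)" using L by (auto simp: power2_eq_square)
    finally have "((C + 1 + M) * C\<^sup>2 * N x) * (4 * (L / (2 * pi))\<^sup>2) \<le> ((C + 1 + M) * C\<^sup>2 * N x) * (L * (5 * real m))"
      using C0 M N_nonneg[of x] by (intro mult_left_mono) auto
    then show ?thesis by (simp add: A_def mult_ac)
  qed
  also have "(1 + M) * M\<^sup>2 * (real m)\<^sup>2 * N x \<le> (1 + M) * M\<^sup>2 * N x * L * real m"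
  proof -
    have "(real m)\<^sup>2 \<le> L * real m" using L by (simp add: power2_eq_square)
    then have "((1 + M) * M\<^sup>2 * N x) * (real m)\<^sup>2 \<le> ((1 + M) * M\<^sup>2 * N x) * (L * real m)"
      using M N_nonneg[of x] by (intro mult_left_mono) auto
    then show ?thesis by (simp add: mult_ac)
  qed
  finally have "(L * real m) * ((real m + 1) / 2 * N (T ^ n * (1 - T) * x))
      \<le> (L * real m) * ((5 * ((C + 1 + M) * C\<^sup>2) + (1 + M) * M\<^sup>2) * N x)"
    by (simp add: algebra_simps)
  then have "(real m + 1) / 2 * N (T ^ n * (1 - T) * x) \<le> (5 * ((C + 1 + M) * C\<^sup>2) + (1 + M) * M\<^sup>2) * N x"
    using L by (subst (asm) mult_le_cancel_left_pos) (auto simp: m_def)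
  then have "(real m + 1) * N (T ^ n * (1 - T) * x) \<le> ritt_constant M k * N x"
    unfolding ritt_constant_def Let_def C_def[symmetric] by (simp add: algebra_simps)
  moreover have "real m * N (T ^ n * (1 - T) * x) \<le> (real m + 1) * N (T ^ n * (1 - T) * x)"
    using N_nonneg by (intro mult_right_mono) auto
  ultimately show ?thesis by (simp add: m_def)
qed

end

section \<open>Strongly measurable functions\<close>

definition strongly_measurable :: "'a measure \<Rightarrow> ('a \<Rightarrow> 'x::real_normed_vector) \<Rightarrow> bool"
  where "strongly_measurable M g \<longleftrightarrow>
    (\<exists>s. (\<forall>i::nat. simple_function M (s i)) \<and> (\<forall>x\<in>space M. (\<lambda>i. s i x) \<longlonglongrightarrow> g x))"

lemma strongly_measurable_borel: "strongly_measurable M g \<Longrightarrow> g \<in> borel_measurable M"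
  unfolding strongly_measurable_def
  by (elim exE conjE, rule_tac f=s in borel_measurable_LIMSEQ_metric) (auto intro: borel_measurable_simple_function)

lemma strongly_measurable_simple: "simple_function M s \<Longrightarrow> strongly_measurable M s"
  unfolding strongly_measurable_def by (intro exI[of _ "\<lambda>_. s"]) auto

lemma strongly_measurable_separable:
  assumes "strongly_measurable M g"
  obtains D where "countable D" "g ` space M \<subseteq> closure D"
proof -
  obtain s where s: "\<And>i::nat. simple_function M (s i)" "\<And>x. x \<in> space M \<Longrightarrow> (\<lambda>i. s i x) \<longlonglongrightarrow> g x"
    using assms unfolding strongly_measurable_def by auto
  show ?thesis
  proof
    show "countable (\<Union>i. s i ` space M)"
      using s(1) by (auto simp: simple_function_def intro: countable_finite)
    show "g ` space M \<subseteq> closure (\<Union>i. s i ` space M)"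
    proof safe
      fix x assume "x \<in> space M"
      then show "g x \<in> closure (\<Union>i. s i ` space M)"
        using s(2)[of x] unfolding closure_sequential by (intro exI[of _ "\<lambda>i. s i x"]) auto
    qed
  qed
qed

text \<open>
  The nearest point among the first \<open>n\<close> members of a countable dense set is a simple function of the value.
  This criterion makes sums, limits and restrictions accessible without second countability of the codomain.
\<close>

lemma strongly_measurable_Pettis:
  fixes g :: "'a \<Rightarrow> 'x::real_normed_vector"
  assumes g: "g \<in> borel_measurable M" and D: "countable D" "g ` space M \<subseteq> closure D"
  shows "strongly_measurable M g"
proof (cases "space M = {}")
  case True
  then show ?thesis unfolding strongly_measurable_def
    by (intro exI[of _ "\<lambda>_ _. 0"]) auto
next
  case False
  with D(2) have "D \<noteq> {}" by force
  define d where "d = from_nat_into D"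
  have d: "range d = D" using D(1) \<open>D \<noteq> {}\<close> unfolding d_def by (rule range_from_nat_into[rotated])
  define best where "best n x = (LEAST i. i \<le> n \<and> (\<forall>j\<le>n. dist (g x) (d i) \<le> dist (g x) (d j)))" for n x
  have ex: "\<exists>i. i \<le> n \<and> (\<forall>j\<le>n. dist (g x) (d i) \<le> dist (g x) (d j))" for n x
  proof -
    obtain i where "i \<in> {..n}" "dist (g x) (d i) = Min ((\<lambda>j. dist (g x) (d j)) ` {..n})"
      using Min_in[of "(\<lambda>j. dist (g x) (d j)) ` {..n}"] by fastforce
    then show ?thesis by (intro exI[of _ i]) auto
  qed
  have best: "best n x \<le> n" "j \<le> n \<Longrightarrow> dist (g x) (d (best n x)) \<le> dist (g x) (d j)" for n x j
    using LeastI_ex[OF ex[of n x]] unfolding best_def by auto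
  have [measurable]: "(\<lambda>x. dist (g x) z) \<in> borel_measurable M" for z
    using g by (intro borel_measurable_continuous_on[of "\<lambda>y. dist y z", OF _ g]) (auto intro!: continuous_intros)
  have [measurable]: "best n \<in> measurable M (count_space UNIV)" for n
    unfolding best_def by measurable
  have simple: "simple_function M (\<lambda>x. d (best n x))" for n
  proof -
    have "simple_function M (best n)"
      unfolding simple_function_def
    proof
      show "finite (best n ` space M)"
        by (rule finite_subset[of _ "{..n}"]) (use best(1)[of n] in auto)
      show "\<forall>x\<in>best n ` space M. best n -` {x} \<inter> space M \<in> sets M" by simp
    qed
    from simple_function_compose1[OF this, of d] show ?thesis .
  qed
  show ?thesis unfolding strongly_measurable_def
  proof (intro exI[of _ "\<lambda>n x. d (best n x)"] conjI allI simple ballI)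
    fix x assume x: "x \<in> space M"
    show "(\<lambda>n. d (best n x)) \<longlonglongrightarrow> g x"
    proof (rule metric_LIMSEQ_I)
      fix e :: real assume "0 < e"
      have "g x \<in> closure D" using D(2) x by auto
      then obtain y where "y \<in> D" "dist y (g x) < e" using \<open>0 < e\<close> closure_approachable by blast
      then obtain j where "dist (g x) (d j) < e" using d by (metis dist_commute rangeE)
      then show "\<exists>no. \<forall>n\<ge>no. dist (d (best n x)) (g x) < e"
        using best(2)[of j _ x] by (intro exI[of _ j]) (auto simp: dist_commute intro: le_less_trans)
    qed
  qed
qed

lemma strongly_measurable_LIMSEQ:
  assumes "\<And>i::nat. strongly_measurable M (f i)" "\<And>x. x \<in> space M \<Longrightarrow> (\<lambda>i. f i x) \<longlonglongrightarrow> g x"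
  shows "strongly_measurable M g"
proof -
  have "\<exists>D. countable D \<and> f i ` space M \<subseteq> closure D" for i
    by (rule strongly_measurable_separable[OF assms(1)[of i]]) blast
  note ex = this
  define D where "D i = (SOME D. countable D \<and> f i ` space M \<subseteq> closure D)" for i
  have D: "countable (D i)" "f i ` space M \<subseteq> closure (D i)" for i
    using someI_ex[OF ex[of i]] unfolding D_def by auto
  show ?thesis
  proof (rule strongly_measurable_Pettis)
    show "g \<in> borel_measurable M"
      by (rule borel_measurable_LIMSEQ_metric[of f]) (use assms strongly_measurable_borel in auto)
    show "countable (\<Union>i. D i)" using D by auto
    show "g ` space M \<subseteq> closure (\<Union>i. D i)"
    proof safe
      fix x assume x: "x \<in> space M"
      have "f i x \<in> closure (\<Union>i. D i)" for i
        using D(2)[of i] x closure_mono[of "D i" "\<Union>i. D i"] by auto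
      then show "g x \<in> closure (\<Union>i. D i)"
        by (rule closed_sequentially[OF closed_closure _ assms(2)[OF x]])
    qed
  qed
qed

lemma strongly_measurable_compose2:
  assumes "strongly_measurable M f" "strongly_measurable M g"
    and "\<And>a b. isCont (\<lambda>(a, b). p a b) (a, b)"
  shows "strongly_measurable M (\<lambda>x. p (f x) (g x))"
proof -
  obtain s where s: "\<And>i::nat. simple_function M (s i)" "\<And>x. x \<in> space M \<Longrightarrow> (\<lambda>i. s i x) \<longlonglongrightarrow> f x"
    using assms(1) unfolding strongly_measurable_def by blast
  obtain t where t: "\<And>i::nat. simple_function M (t i)" "\<And>x. x \<in> space M \<Longrightarrow> (\<lambda>i. t i x) \<longlonglongrightarrow> g x"
    using assms(2) unfolding strongly_measurable_def by blast
  show ?thesis unfolding strongly_measurable_def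
  proof (intro exI[of _ "\<lambda>i x. p (s i x) (t i x)"] conjI allI ballI)
    show "simple_function M (\<lambda>x. p (s i x) (t i x))" for i by (rule simple_function_compose2[OF s(1) t(1)])
    show "(\<lambda>i. p (s i x) (t i x)) \<longlonglongrightarrow> p (f x) (g x)" if "x \<in> space M" for x
      using isCont_tendsto_compose[OF assms(3) tendsto_Pair[OF s(2)[OF that] t(2)[OF that]]] by simp
  qed
qed

lemma strongly_measurable_add:
  "strongly_measurable M f \<Longrightarrow> strongly_measurable M g \<Longrightarrow> strongly_measurable M (\<lambda>x. f x + g x)"
  by (rule strongly_measurable_compose2[where p="(+)"]) (simp_all add: case_prod_unfold)

lemma bounded_linear_scaleC: "bounded_linear (scaleC c :: 'x::complex_banach \<Rightarrow> 'x)"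
proof
  show "scaleC c (b + b') = scaleC c b + scaleC c b'" for b b' :: 'x by (rule scaleC_add_right)
  show "scaleC c (r *\<^sub>R b) = r *\<^sub>R scaleC c b" for r and b :: 'x
    by (simp add: scaleC_of_real[symmetric] scaleC_scaleC mult.commute)
  show "\<exists>K. \<forall>x::'x. norm (scaleC c x) \<le> norm x * K"
    by (intro exI[of _ "cmod c"]) (simp add: norm_scaleC)
qed

lemma strongly_measurable_linear:
  assumes "strongly_measurable M f" "bounded_linear h"
  shows "strongly_measurable M (\<lambda>x. h (f x))"
proof -
  obtain s where s: "\<And>i::nat. simple_function M (s i)" "\<And>x. x \<in> space M \<Longrightarrow> (\<lambda>i. s i x) \<longlonglongrightarrow> f x"
    using assms(1) unfolding strongly_measurable_def by blast
  have "simple_function M (\<lambda>x. h (s i x))" for i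
    by (rule simple_function_compose1[OF s(1)])
  moreover have "(\<lambda>i. h (s i x)) \<longlonglongrightarrow> h (f x)" if "x \<in> space M" for x
    by (rule bounded_linear.tendsto[OF assms(2) s(2)[OF that]])
  ultimately show ?thesis
    unfolding strongly_measurable_def by (intro exI[of _ "\<lambda>i x. h (s i x)"]) blast
qed

lemma strongly_measurable_compose:
  assumes "strongly_measurable M g" "\<phi> \<in> measurable M' M"
  shows "strongly_measurable M' (\<lambda>x. g (\<phi> x))"
proof -
  obtain s where s: "\<And>i::nat. simple_function M (s i)" "\<And>x. x \<in> space M \<Longrightarrow> (\<lambda>i. s i x) \<longlonglongrightarrow> g x"
    using assms unfolding strongly_measurable_def by auto
  show ?thesis unfolding strongly_measurable_def
    using s(2) measurable_space[OF assms(2)] simple_function_comp[OF assms(2) s(1)]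
    by (intro exI[of _ "\<lambda>i x. s i (\<phi> x)"]) simp
qed

lemma strongly_measurable_If:
  assumes "strongly_measurable M f" "strongly_measurable M g" "A \<in> sets M"
  shows "strongly_measurable M (\<lambda>x. if x \<in> A then f x else g x)"
proof -
  obtain s where s: "\<And>i::nat. simple_function M (s i)" "\<And>x. x \<in> space M \<Longrightarrow> (\<lambda>i. s i x) \<longlonglongrightarrow> f x"
    using assms(1) unfolding strongly_measurable_def by blast
  obtain t where t: "\<And>i::nat. simple_function M (t i)" "\<And>x. x \<in> space M \<Longrightarrow> (\<lambda>i. t i x) \<longlonglongrightarrow> g x"
    using assms(2) unfolding strongly_measurable_def by blast
  show ?thesis unfolding strongly_measurable_def
  proof (intro exI[of _ "\<lambda>i x. if x \<in> A then s i x else t i x"] conjI allI ballI)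
    show "simple_function M (\<lambda>x. if x \<in> A then s i x else t i x)" for i
      using assms(3) by (intro simple_function_If_set s t) auto
    show "(\<lambda>i. if x \<in> A then s i x else t i x) \<longlonglongrightarrow> (if x \<in> A then f x else g x)" if "x \<in> space M" for x
      using s(2)[OF that] t(2)[OF that] by simp
  qed
qed

lemma strongly_measurable_dominated_approx:
  assumes g: "strongly_measurable M g"
  obtains s where "\<And>i::nat. simple_function M (s i)" "\<And>x. x \<in> space M \<Longrightarrow> (\<lambda>i. s i x) \<longlonglongrightarrow> g x"
    "\<And>i x. x \<in> space M \<Longrightarrow> norm (s i x) \<le> 2 * norm (g x)"
proof -
  obtain s where s: "\<And>i::nat. simple_function M (s i)" "\<And>x. x \<in> space M \<Longrightarrow> (\<lambda>i. s i x) \<longlonglongrightarrow> g x"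
    using g unfolding strongly_measurable_def by auto
  have [measurable]: "s i \<in> borel_measurable M" "g \<in> borel_measurable M" for i
    using s g by (auto intro: borel_measurable_simple_function strongly_measurable_borel)
  define A where "A i = {x \<in> space M. norm (s i x) \<le> 2 * norm (g x)}" for i
  have A: "A i \<in> sets M" for i unfolding A_def by measurable
  show ?thesis
  proof
    show "simple_function M (\<lambda>x. if x \<in> A i then s i x else 0)" for i
      using s A by (intro simple_function_If_set) auto
    show "norm (if x \<in> A i then s i x else 0) \<le> 2 * norm (g x)" if "x \<in> space M" for i x
      by (auto simp: A_def)
    fix x assume x: "x \<in> space M"
    show "(\<lambda>i. if x \<in> A i then s i x else 0) \<longlonglongrightarrow> g x"
    proof (cases "g x = 0")
      case True
      then have "(if x \<in> A i then s i x else 0) = 0" for i by (auto simp: A_def)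
      then show ?thesis using True by simp
    next
      case False
      have "(\<lambda>i. norm (s i x)) \<longlonglongrightarrow> norm (g x)" using s(2)[OF x] by (rule tendsto_norm)
      then have "\<forall>\<^sub>F i in sequentially. norm (s i x) < 2 * norm (g x)"
        using False by (intro order_tendstoD) auto
      then have "\<forall>\<^sub>F i in sequentially. s i x = (if x \<in> A i then s i x else 0)"
        by eventually_elim (use x in \<open>auto simp: A_def\<close>)
      with s(2)[OF x] show ?thesis by (rule Lim_transform_eventually)
    qed
  qed
qed

text \<open>
  The exceptional null set can be moved into the representative, which reduces all closure properties to
  limits that exist everywhere.
\<close>

lemma ae_strongly_measurable_iff:
  "ae_strongly_measurable M f \<longleftrightarrow> (\<exists>g. strongly_measurable M g \<and> (AE x in M. f x = g x))"
proof
  assume "ae_strongly_measurable M f"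
  then obtain s where s: "\<And>i::nat. simple_function M (s i)" "AE x in M. (\<lambda>i. s i x) \<longlonglongrightarrow> f x"
    unfolding ae_strongly_measurable_def by auto
  obtain N where N: "{x \<in> space M. \<not> (\<lambda>i. s i x) \<longlonglongrightarrow> f x} \<subseteq> N" "emeasure M N = 0" "N \<in> sets M"
    using AE_E[OF s(2)] .
  define g where "g x = (if x \<in> N then 0 else f x)" for x
  have "strongly_measurable M g"
    unfolding strongly_measurable_def
    by (intro exI[of _ "\<lambda>i x. if x \<in> N then 0 else s i x"])
      (use s N in \<open>auto simp: g_def intro!: simple_function_If_set\<close>)
  moreover have "AE x in M. f x = g x"
    using N(2,3) by (intro AE_I'[of N]) (auto simp: g_def null_sets_def)
  ultimately show "\<exists>g. strongly_measurable M g \<and> (AE x in M. f x = g x)" by blast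
next
  assume "\<exists>g. strongly_measurable M g \<and> (AE x in M. f x = g x)"
  then obtain g s where s: "\<And>i::nat. simple_function M (s i)" "\<And>x. x \<in> space M \<Longrightarrow> (\<lambda>i. s i x) \<longlonglongrightarrow> g x"
    and fg: "AE x in M. f x = g x"
    unfolding strongly_measurable_def by blast
  have "AE x in M. (\<lambda>i. s i x) \<longlonglongrightarrow> f x"
    using fg AE_space by eventually_elim (use s(2) in auto)
  with s(1) show "ae_strongly_measurable M f" unfolding ae_strongly_measurable_def by blast
qed

lemma ae_strongly_measurableE:
  assumes "ae_strongly_measurable M f"
  obtains g where "strongly_measurable M g" "AE x in M. f x = g x"
  using assms unfolding ae_strongly_measurable_iff by blast

lemma strongly_measurable_imp_ae: "strongly_measurable M f \<Longrightarrow> ae_strongly_measurable M f"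
  unfolding ae_strongly_measurable_iff by (intro exI[of _ f]) simp

lemma ae_strongly_measurable_cong_AE:
  assumes "AE x in M. f x = g x" "ae_strongly_measurable M f"
  shows "ae_strongly_measurable M g"
proof -
  obtain h where h: "strongly_measurable M h" "AE x in M. f x = h x"
    using assms(2) by (rule ae_strongly_measurableE)
  have "AE x in M. g x = h x" using assms(1) h(2) by eventually_elim simp
  with h(1) show ?thesis unfolding ae_strongly_measurable_iff by blast
qed

lemma ae_strongly_measurable_add:
  assumes "ae_strongly_measurable M f" "ae_strongly_measurable M g"
  shows "ae_strongly_measurable M (\<lambda>x. f x + g x)"
proof -
  obtain f' where f': "strongly_measurable M f'" "AE x in M. f x = f' x"
    using assms(1) by (rule ae_strongly_measurableE)
  obtain g' where g': "strongly_measurable M g'" "AE x in M. g x = g' x"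
    using assms(2) by (rule ae_strongly_measurableE)
  have "AE x in M. f x + g x = f' x + g' x" using f'(2) g'(2) by eventually_elim simp
  with f'(1) g'(1) show ?thesis
    unfolding ae_strongly_measurable_iff
    by (intro exI[of _ "\<lambda>x. f' x + g' x"]) (auto intro: strongly_measurable_add)
qed

lemma ae_strongly_measurable_linear:
  assumes "ae_strongly_measurable M f" "bounded_linear h"
  shows "ae_strongly_measurable M (\<lambda>x. h (f x))"
proof -
  obtain f' where f': "strongly_measurable M f'" "AE x in M. f x = f' x"
    using assms(1) by (rule ae_strongly_measurableE)
  have "AE x in M. h (f x) = h (f' x)" using f'(2) by eventually_elim simp
  with f'(1) show ?thesis
    unfolding ae_strongly_measurable_iff
    by (intro exI[of _ "\<lambda>x. h (f' x)"]) (auto intro: strongly_measurable_linear assms)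
qed

lemma ae_strongly_measurable_scaleC:
  "ae_strongly_measurable M f \<Longrightarrow> ae_strongly_measurable M (\<lambda>x. scaleC c (f x))"
  by (rule ae_strongly_measurable_linear[OF _ bounded_linear_scaleC])

lemma ae_strongly_measurable_uminus:
  "ae_strongly_measurable M f \<Longrightarrow> ae_strongly_measurable M (\<lambda>x. - f x)"
  by (erule ae_strongly_measurable_linear) (rule bounded_linear_minus[OF bounded_linear_ident])

lemma ae_strongly_measurable_diff:
  "ae_strongly_measurable M f \<Longrightarrow> ae_strongly_measurable M g \<Longrightarrow> ae_strongly_measurable M (\<lambda>x. f x - g x)"
  using ae_strongly_measurable_add[OF _ ae_strongly_measurable_uminus, of M f g] by simp

lemma ae_strongly_measurable_zero: "ae_strongly_measurable M (\<lambda>_. 0)"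
  by (intro strongly_measurable_imp_ae strongly_measurable_simple) simp

lemma ae_strongly_measurable_sum:
  "(\<And>i. i \<in> I \<Longrightarrow> ae_strongly_measurable M (f i)) \<Longrightarrow> ae_strongly_measurable M (\<lambda>x. \<Sum>i\<in>I. f i x)"
  by (induction I rule: infinite_finite_induct) (auto intro: ae_strongly_measurable_zero ae_strongly_measurable_add)

lemma ae_strongly_measurable_LIMSEQ:
  assumes "\<And>i::nat. ae_strongly_measurable M (f i)" "AE x in M. (\<lambda>i. f i x) \<longlonglongrightarrow> g x"
  shows "ae_strongly_measurable M g"
proof -
  define f' where "f' i = (SOME f'. strongly_measurable M f' \<and> (AE x in M. f i x = f' x))" for i
  have f': "strongly_measurable M (f' i)" "AE x in M. f i x = f' i x" for i
    using someI_ex[OF assms(1)[of i, unfolded ae_strongly_measurable_iff]] unfolding f'_def by auto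
  have "AE x in M. \<forall>i. f i x = f' i x" using f'(2) by (simp add: AE_all_countable)
  then have "AE x in M. (\<lambda>i. f' i x) \<longlonglongrightarrow> g x" using assms(2) by eventually_elim simp
  then obtain N where N: "{x \<in> space M. \<not> (\<lambda>i. f' i x) \<longlonglongrightarrow> g x} \<subseteq> N" "emeasure M N = 0" "N \<in> sets M"
    by (rule AE_E)
  have "strongly_measurable M (\<lambda>x. if x \<in> N then 0 else g x)"
  proof (rule strongly_measurable_LIMSEQ)
    show "strongly_measurable M (\<lambda>x. if x \<in> N then 0 else f' i x)" for i
      using f'(1)[of i] N(3) strongly_measurable_simple[of M "\<lambda>_. 0"] by (intro strongly_measurable_If) auto
  qed (use N in auto)
  moreover have "AE x in M. g x = (if x \<in> N then 0 else g x)"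
    using N(2,3) by (intro AE_I'[of N]) (auto simp: null_sets_def)
  ultimately show ?thesis unfolding ae_strongly_measurable_iff by blast
qed

section \<open>Lp seminorms\<close>

lemma powr_convex_combination_le:
  fixes a b l p :: real
  assumes "0 \<le> a" "0 \<le> b" "0 < l" "l < 1" "1 \<le> p"
  shows "(a + b) powr p \<le> l powr (1 - p) * a powr p + (1 - l) powr (1 - p) * b powr p"
proof -
  have 1: "t * (c / t) powr p = t powr (1 - p) * c powr p" if "0 < t" "0 \<le> c" for t c :: real
    using that by (simp add: powr_divide powr_diff field_simps)
  have "(\<Sum>i\<in>{True, False}. (if i then l else 1 - l) * (if i then a / l else b / (1 - l))) powr p
     \<le> (\<Sum>i\<in>{True, False}. (if i then l else 1 - l) * (if i then a / l else b / (1 - l)) powr p)"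
    using assms by (intro jensen_powr_sum) auto
  then show ?thesis using assms 1[of l a] 1[of "1 - l" b] by simp
qed

text \<open>
  Minkowski's inequality is the optimization over \<open>l\<close> of the pointwise convexity inequality
  \<open>(a + b)\<^sup>p \<le> l\<^sup>1\<^sup>-\<^sup>p a\<^sup>p + (1 - l)\<^sup>1\<^sup>-\<^sup>p b\<^sup>p\<close>; the best \<open>l\<close> is the ratio of the norm of the first function to the sum of both.
\<close>

lemma minkowski_from_convexity:
  fixes F G H p :: real
  assumes "0 \<le> F" "0 \<le> G" "0 \<le> H" "1 \<le> p"
    and le: "\<And>l. 0 < l \<Longrightarrow> l < 1 \<Longrightarrow> H \<le> l powr (1 - p) * F + (1 - l) powr (1 - p) * G"
  shows "H powr (1 / p) \<le> F powr (1 / p) + G powr (1 / p)"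
proof (rule field_le_epsilon)
  fix e :: real assume "0 < e"
  define a b where "a = F powr (1 / p) + e / 2" and "b = G powr (1 / p) + e / 2"
  have ab: "0 < a" "0 < b" using \<open>0 < e\<close> by (auto simp: a_def b_def add_nonneg_pos)
  have F: "F \<le> a powr p" and G: "G \<le> b powr p"
  proof -
    have "(F powr (1 / p)) powr p \<le> a powr p" "(G powr (1 / p)) powr p \<le> b powr p"
      using \<open>0 < e\<close> assms by (auto simp: a_def b_def intro!: powr_mono2)
    then show "F \<le> a powr p" "G \<le> b powr p" using assms by (simp_all add: powr_powr)
  qed
  define l where "l = a / (a + b)"
  have l: "0 < l" "l < 1" "1 - l = b / (a + b)" using ab by (auto simp: l_def field_simps)
  have aux: "(c / (a + b)) powr (1 - p) * c powr p = (a + b) powr (p - 1) * c" if "0 < c" for c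
  proof -
    have "c powr (1 - p) * c powr p = c" using that by (simp flip: powr_add)
    moreover have "(a + b) powr (p - 1) = inverse ((a + b) powr (1 - p))"
      by (simp flip: powr_minus)
    moreover have "(c / (a + b)) powr (1 - p) = c powr (1 - p) * inverse ((a + b) powr (1 - p))"
      using that ab by (subst powr_divide) (auto simp: divide_inverse)
    ultimately show ?thesis by (simp add: mult_ac)
  qed
  have "H \<le> l powr (1 - p) * a powr p + (1 - l) powr (1 - p) * b powr p"
    using le[OF l(1,2)] F G by (smt (verit) mult_left_mono powr_ge_zero)
  also have "\<dots> = (a + b) powr (p - 1) * (a + b)"
    unfolding l(3) unfolding l_def using aux[of a] aux[of b] ab by (simp add: distrib_left)
  also have "\<dots> = (a + b) powr p" using ab by (simp add: powr_mult_base mult.commute)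
  finally have "H powr (1 / p) \<le> ((a + b) powr p) powr (1 / p)"
    using assms by (intro powr_mono2) auto
  also have "\<dots> = a + b" using ab assms by (simp add: powr_powr)
  finally show "H powr (1 / p) \<le> F powr (1 / p) + G powr (1 / p) + e" by (simp add: a_def b_def)
qed

abbreviation Lp_int :: "'a measure \<Rightarrow> real \<Rightarrow> ('a \<Rightarrow> 'x::real_normed_vector) \<Rightarrow> ennreal"
  where "Lp_int M p f \<equiv> \<integral>\<^sup>+x. ennreal (norm (f x) powr p) \<partial>M"

definition Lp_norm :: "'a measure \<Rightarrow> real \<Rightarrow> ('a \<Rightarrow> 'x::real_normed_vector) \<Rightarrow> real"
  where "Lp_norm M p f = enn2real (Lp_int M p f) powr (1 / p)"

lemma Lp_int_cong_AE: "AE x in M. f x = g x \<Longrightarrow> Lp_int M p f = Lp_int M p g"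
  by (rule nn_integral_cong_AE) (auto elim: eventually_mono)

lemma Lp_norm_cong_AE: "AE x in M. f x = g x \<Longrightarrow> Lp_norm M p f = Lp_norm M p g"
  unfolding Lp_norm_def by (simp add: Lp_int_cong_AE)

lemma Lp_fun_cong_AE: "AE x in M. f x = g x \<Longrightarrow> f \<in> Lp_fun M p \<Longrightarrow> g \<in> Lp_fun M p"
  unfolding Lp_fun_def using Lp_int_cong_AE[of f g M p] ae_strongly_measurable_cong_AE[of f g M] by auto

lemma Lp_norm_nonneg: "0 \<le> Lp_norm M p f" by (simp add: Lp_norm_def)

lemma Lp_norm_powr:
  assumes "f \<in> Lp_fun M p" "0 < p"
  shows "ennreal (Lp_norm M p f powr p) = Lp_int M p f"
  using assms by (simp add: Lp_norm_def powr_powr Lp_fun_def)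

lemma Lp_norm_le_iff:
  assumes "f \<in> Lp_fun M p" "0 < p" "0 \<le> C"
  shows "Lp_norm M p f \<le> C \<longleftrightarrow> Lp_int M p f \<le> ennreal (C powr p)"
proof -
  have "Lp_norm M p f \<le> C \<longleftrightarrow> Lp_norm M p f powr p \<le> C powr p"
    using assms Lp_norm_nonneg by (metis powr_less_mono2 powr_mono2 not_le order_less_imp_le)
  then show ?thesis unfolding Lp_norm_powr[OF assms(1,2), symmetric] by simp
qed

lemma measurable_norm_powr [measurable]:
  "g \<in> borel_measurable M \<Longrightarrow> (\<lambda>x. ennreal (norm (g x) powr p)) \<in> borel_measurable M"
  by measurable

lemma Lp_int_add_le:
  assumes "ae_strongly_measurable M f" "ae_strongly_measurable M g" "0 < l" "l < 1" "1 \<le> p"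
  shows "Lp_int M p (\<lambda>x. f x + g x) \<le> ennreal (l powr (1 - p)) * Lp_int M p f + ennreal ((1 - l) powr (1 - p)) * Lp_int M p g"
proof -
  obtain f' where f': "strongly_measurable M f'" "AE x in M. f x = f' x"
    using assms(1) by (rule ae_strongly_measurableE)
  obtain g' where g': "strongly_measurable M g'" "AE x in M. g x = g' x"
    using assms(2) by (rule ae_strongly_measurableE)
  note fg = f' g'
  have [measurable]: "f' \<in> borel_measurable M" "g' \<in> borel_measurable M"
    using fg by (auto intro: strongly_measurable_borel)
  have "Lp_int M p (\<lambda>x. f x + g x) = Lp_int M p (\<lambda>x. f' x + g' x)"
    by (rule Lp_int_cong_AE) (use fg(2,4) in eventually_elim, simp)
  also have "\<dots> \<le> (\<integral>\<^sup>+x. ennreal (l powr (1 - p)) * ennreal (norm (f' x) powr p) + ennreal ((1 - l) powr (1 - p)) * ennreal (norm (g' x) powr p) \<partial>M)"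
  proof (rule nn_integral_mono)
    fix x
    have "norm (f' x + g' x) powr p \<le> (norm (f' x) + norm (g' x)) powr p"
      using assms by (intro powr_mono2) (auto intro: norm_triangle_ineq)
    also have "\<dots> \<le> l powr (1 - p) * norm (f' x) powr p + (1 - l) powr (1 - p) * norm (g' x) powr p"
      using assms by (intro powr_convex_combination_le) auto
    finally show "ennreal (norm (f' x + g' x) powr p) \<le> ennreal (l powr (1 - p)) * ennreal (norm (f' x) powr p) + ennreal ((1 - l) powr (1 - p)) * ennreal (norm (g' x) powr p)"
      by (simp flip: ennreal_mult ennreal_plus)
  qed
  also have "\<dots> = ennreal (l powr (1 - p)) * Lp_int M p f' + ennreal ((1 - l) powr (1 - p)) * Lp_int M p g'"
    by (subst nn_integral_add) (auto simp: nn_integral_cmult)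
  also have "Lp_int M p f' = Lp_int M p f" by (rule Lp_int_cong_AE[symmetric, OF fg(2)])
  also have "Lp_int M p g' = Lp_int M p g" by (rule Lp_int_cong_AE[symmetric, OF fg(4)])
  finally show ?thesis .
qed

lemma Lp_fun_add:
  assumes "f \<in> Lp_fun M p" "g \<in> Lp_fun M p" "1 \<le> p"
  shows "(\<lambda>x. f x + g x) \<in> Lp_fun M p"
proof -
  have "Lp_int M p (\<lambda>x. f x + g x) \<le> ennreal ((1/2) powr (1 - p)) * Lp_int M p f + ennreal ((1 - 1/2) powr (1 - p)) * Lp_int M p g"
    using assms by (intro Lp_int_add_le) (auto simp: Lp_fun_def)
  also have "\<dots> < \<infinity>" using assms by (auto simp: Lp_fun_def ennreal_mult_less_top)
  finally show ?thesis using assms by (auto simp: Lp_fun_def intro: ae_strongly_measurable_add)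
qed

lemma Lp_norm_triangle:
  assumes "f \<in> Lp_fun M p" "g \<in> Lp_fun M p" "1 \<le> p"
  shows "Lp_norm M p (\<lambda>x. f x + g x) \<le> Lp_norm M p f + Lp_norm M p g"
  unfolding Lp_norm_def
proof (rule minkowski_from_convexity)
  fix l :: real assume l: "0 < l" "l < 1"
  have fin: "Lp_int M p f < \<infinity>" "Lp_int M p g < \<infinity>" using assms by (auto simp: Lp_fun_def)
  define F G where "F = enn2real (Lp_int M p f)" and "G = enn2real (Lp_int M p g)"
  have FG: "Lp_int M p f = ennreal F" "Lp_int M p g = ennreal G" "0 \<le> F" "0 \<le> G"
    using fin by (auto simp: F_def G_def)
  have "Lp_int M p (\<lambda>x. f x + g x) \<le> ennreal (l powr (1 - p)) * Lp_int M p f + ennreal ((1 - l) powr (1 - p)) * Lp_int M p g"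
    using assms l by (intro Lp_int_add_le) (auto simp: Lp_fun_def)
  also have "\<dots> = ennreal (l powr (1 - p) * F + (1 - l) powr (1 - p) * G)"
    unfolding FG using FG(3,4) by (simp flip: ennreal_mult ennreal_plus)
  finally show "enn2real (Lp_int M p (\<lambda>x. f x + g x)) \<le> l powr (1 - p) * enn2real (Lp_int M p f) + (1 - l) powr (1 - p) * enn2real (Lp_int M p g)"
    unfolding F_def[symmetric] G_def[symmetric] using FG(3,4) by (intro enn2real_leI) auto
qed (use assms in auto)

lemma Lp_int_scaleC:
  assumes "0 < p" "ae_strongly_measurable M f"
  shows "Lp_int M p (\<lambda>x. scaleC c (f x)) = ennreal (cmod c powr p) * Lp_int M p f"
proof -
  obtain f' where f': "strongly_measurable M f'" "AE x in M. f x = f' x"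
    using assms(2) by (rule ae_strongly_measurableE)
  have [measurable]: "f' \<in> borel_measurable M" using f' by (auto intro: strongly_measurable_borel)
  have "Lp_int M p (\<lambda>x. scaleC c (f x)) = Lp_int M p (\<lambda>x. scaleC c (f' x))"
    by (rule Lp_int_cong_AE) (use f'(2) in eventually_elim, simp)
  also have "\<dots> = ennreal (cmod c powr p) * Lp_int M p f'"
    by (simp add: norm_scaleC powr_mult ennreal_mult nn_integral_cmult)
  also have "Lp_int M p f' = Lp_int M p f" by (rule Lp_int_cong_AE[symmetric, OF f'(2)])
  finally show ?thesis .
qed

lemma Lp_fun_scaleC:
  assumes "f \<in> Lp_fun M p" "0 < p" shows "(\<lambda>x. scaleC c (f x)) \<in> Lp_fun M p"
  using assms by (auto simp: Lp_fun_def Lp_int_scaleC ae_strongly_measurable_scaleC ennreal_mult_less_top)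

lemma Lp_norm_scaleC:
  assumes "f \<in> Lp_fun M p" "0 < p" shows "Lp_norm M p (\<lambda>x. scaleC c (f x)) = cmod c * Lp_norm M p f"
  using assms
  by (simp add: Lp_norm_def Lp_fun_def Lp_int_scaleC enn2real_mult powr_mult powr_powr)

lemma Lp_fun_zero: "0 < p \<Longrightarrow> (\<lambda>_. 0) \<in> Lp_fun M p"
  by (simp add: Lp_fun_def ae_strongly_measurable_zero)

lemma Lp_norm_zero: "Lp_norm M p (\<lambda>_. 0) = 0"
  by (simp add: Lp_norm_def)

lemma scaleC_minus1: "scaleC (- 1) x = - x"
  using scaleC_of_real[of "- 1" x] by simp

lemma scaleC_one: "scaleC 1 x = x"
  using scaleC_of_real[of 1 x] by simp

lemma scaleC_zero_left: "scaleC 0 x = 0"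
  using scaleC_of_real[of 0 x] by simp

lemma Lp_fun_uminus:
  fixes f :: "'a \<Rightarrow> 'x::complex_banach"
  assumes "f \<in> Lp_fun M p" shows "(\<lambda>x. - f x) \<in> Lp_fun M p"
  using assms ae_strongly_measurable_uminus by (auto simp: Lp_fun_def)

lemma Lp_fun_diff:
  fixes f g :: "'a \<Rightarrow> 'x::complex_banach"
  assumes "f \<in> Lp_fun M p" "g \<in> Lp_fun M p" "1 \<le> p"
  shows "(\<lambda>x. f x - g x) \<in> Lp_fun M p"
  using Lp_fun_add[OF assms(1) Lp_fun_uminus[OF assms(2)] assms(3)] by simp

lemma Lp_fun_sum:
  assumes "\<And>i. i \<in> I \<Longrightarrow> f i \<in> Lp_fun M p" "1 \<le> p"
  shows "(\<lambda>x. \<Sum>i\<in>I. f i x) \<in> Lp_fun M p"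
  using assms by (induction I rule: infinite_finite_induct) (auto intro: Lp_fun_zero Lp_fun_add)

lemma Lp_norm_sum_le:
  assumes "\<And>i. i \<in> I \<Longrightarrow> f i \<in> Lp_fun M p" "1 \<le> p"
  shows "Lp_norm M p (\<lambda>x. \<Sum>i\<in>I. f i x) \<le> (\<Sum>i\<in>I. Lp_norm M p (f i))"
  using assms
proof (induction I rule: infinite_finite_induct)
  case (insert i I)
  have "Lp_norm M p (\<lambda>x. f i x + (\<Sum>i\<in>I. f i x)) \<le> Lp_norm M p (f i) + Lp_norm M p (\<lambda>x. \<Sum>i\<in>I. f i x)"
    using insert by (intro Lp_norm_triangle Lp_fun_sum) auto
  with insert show ?case by force
qed (auto simp: Lp_norm_zero)

lemma Lp_fun_approx_simple:
  fixes f :: "'a \<Rightarrow> 'x::real_normed_vector"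
  assumes f: "f \<in> Lp_fun M p" and p: "0 < p"
  obtains s where "\<And>i::nat. simple_function M (s i)" "\<And>i. Lp_int M p (s i) < \<infinity>"
    "(\<lambda>i. Lp_int M p (\<lambda>x. f x - s i x)) \<longlonglongrightarrow> 0"
proof -
  obtain g where g: "strongly_measurable M g" "AE x in M. f x = g x"
    using f by (auto simp: Lp_fun_def elim: ae_strongly_measurableE)
  obtain s where s: "\<And>i::nat. simple_function M (s i)" "\<And>x. x \<in> space M \<Longrightarrow> (\<lambda>i. s i x) \<longlonglongrightarrow> g x"
    "\<And>i x. x \<in> space M \<Longrightarrow> norm (s i x) \<le> 2 * norm (g x)"
    by (rule strongly_measurable_dominated_approx[OF g(1)]) (rule that)
  have sm: "strongly_measurable M (\<lambda>x. g x - s i x)" for i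
    using g(1) s(1) strongly_measurable_add[of M g "\<lambda>x. - s i x"]
    by (auto intro: strongly_measurable_simple simple_function_compose1)
  have [measurable]: "g \<in> borel_measurable M" "s i \<in> borel_measurable M" "(\<lambda>x. g x - s i x) \<in> borel_measurable M" for i
    using g s sm by (auto intro: strongly_measurable_borel borel_measurable_simple_function)
  have fin: "Lp_int M p g < \<infinity>" using f Lp_int_cong_AE[OF g(2)] by (auto simp: Lp_fun_def)
  have fin_c: "(\<integral>\<^sup>+x. ennreal ((c * norm (g x)) powr p) \<partial>M) < \<infinity>" if "0 \<le> c" for c
    using that fin by (simp add: powr_mult ennreal_mult nn_integral_cmult ennreal_mult_less_top)
  have "(\<lambda>i. Lp_int M p (\<lambda>x. g x - s i x)) \<longlonglongrightarrow> (\<integral>\<^sup>+x. 0 \<partial>M)"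
  proof (rule nn_integral_dominated_convergence[where w="\<lambda>x. ennreal ((3 * norm (g x)) powr p)"])
    show "AE x in M. ennreal (norm (g x - s i x) powr p) \<le> ennreal ((3 * norm (g x)) powr p)" for i
    proof (rule AE_I2)
      fix x assume "x \<in> space M"
      then have "norm (g x - s i x) \<le> 3 * norm (g x)"
        using s(3)[of x i] norm_triangle_ineq4[of "g x" "s i x"] by simp
      then show "ennreal (norm (g x - s i x) powr p) \<le> ennreal ((3 * norm (g x)) powr p)"
        using p by (intro ennreal_leI powr_mono2) auto
    qed
    show "AE x in M. (\<lambda>i. ennreal (norm (g x - s i x) powr p)) \<longlonglongrightarrow> 0"
    proof (rule AE_I2)
      fix x assume x: "x \<in> space M"
      have "(\<lambda>i. norm (g x - s i x) powr p) \<longlonglongrightarrow> norm (g x - g x) powr p"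
        using s(2)[OF x] p by (intro tendsto_powr' tendsto_intros) auto
      then have "(\<lambda>i. ennreal (norm (g x - s i x) powr p)) \<longlonglongrightarrow> ennreal 0" using p by (intro tendsto_ennrealI) simp
      then show "(\<lambda>i. ennreal (norm (g x - s i x) powr p)) \<longlonglongrightarrow> 0" by simp
    qed
  qed (use fin_c[of 3] in auto)
  then have lim: "(\<lambda>i. Lp_int M p (\<lambda>x. f x - s i x)) \<longlonglongrightarrow> 0"
  proof -
    have "Lp_int M p (\<lambda>x. f x - s i x) = Lp_int M p (\<lambda>x. g x - s i x)" for i
      by (rule Lp_int_cong_AE) (use g(2) in eventually_elim, simp)
    then show "(\<lambda>i. Lp_int M p (\<lambda>x. g x - s i x)) \<longlonglongrightarrow> (\<integral>\<^sup>+x. 0 \<partial>M) \<Longrightarrow> ?thesis" by simp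
  qed
  have "Lp_int M p (s i) < \<infinity>" for i
  proof -
    have "Lp_int M p (s i) \<le> (\<integral>\<^sup>+x. ennreal ((2 * norm (g x)) powr p) \<partial>M)"
      using s(3) p by (intro nn_integral_mono ennreal_leI powr_mono2) auto
    with fin_c[of 2] show ?thesis by simp
  qed
  with that s(1) lim show ?thesis by blast
qed

section \<open>The strong integral\<close>

lemma nn_integral_norm_add_le:
  assumes "ae_strongly_measurable M f" "ae_strongly_measurable M g"
  shows "(\<integral>\<^sup>+x. ennreal (norm (f x + g x)) \<partial>M) \<le> (\<integral>\<^sup>+x. ennreal (norm (f x)) \<partial>M) + (\<integral>\<^sup>+x. ennreal (norm (g x)) \<partial>M)"
  using Lp_int_add_le[OF assms, of "1/2" 1] by simp

lemma simple_bochner_integrable_imp_ae: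
  "Bochner_Integration.simple_bochner_integrable M s \<Longrightarrow> ae_strongly_measurable M s"
  by (auto elim!: Bochner_Integration.simple_bochner_integrable.cases intro: strongly_measurable_imp_ae strongly_measurable_simple)

lemma simple_bochner_integrable_linear:
  assumes "linear h" "Bochner_Integration.simple_bochner_integrable M s"
  shows "Bochner_Integration.simple_bochner_integrable M (\<lambda>x. h (s x))"
  by (rule Bochner_Integration.simple_bochner_integrable_compose2[where p="\<lambda>a b. h a", OF _ assms(2) assms(2)])
    (simp add: linear_0[OF assms(1)])

lemma simple_bochner_integrable_add:
  "Bochner_Integration.simple_bochner_integrable M s \<Longrightarrow> Bochner_Integration.simple_bochner_integrable M t
    \<Longrightarrow> Bochner_Integration.simple_bochner_integrable M (\<lambda>x. s x + t x)"
  by (rule Bochner_Integration.simple_bochner_integrable_compose2[where p="(+)"]) auto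

lemma simple_bochner_integrable_diff:
  "Bochner_Integration.simple_bochner_integrable M s \<Longrightarrow> Bochner_Integration.simple_bochner_integrable M t
    \<Longrightarrow> Bochner_Integration.simple_bochner_integrable M (\<lambda>x. s x - t x)"
  by (rule Bochner_Integration.simple_bochner_integrable_compose2[where p="(-)"]) auto

lemma norm_simple_bochner_integral_le:
  assumes "Bochner_Integration.simple_bochner_integrable M s"
  shows "ennreal (norm (Bochner_Integration.simple_bochner_integral M s)) \<le> (\<integral>\<^sup>+x. ennreal (norm (s x)) \<partial>M)"
proof -
  have "Bochner_Integration.simple_bochner_integrable M (\<lambda>x. norm (s x))"
    by (rule Bochner_Integration.simple_bochner_integrable_compose2[where p="\<lambda>a b. norm a", OF _ assms assms]) simp
  then have "ennreal (Bochner_Integration.simple_bochner_integral M (\<lambda>x. norm (s x))) = (\<integral>\<^sup>+x. ennreal (norm (s x)) \<partial>M)"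
    by (rule Bochner_Integration.simple_bochner_integral_eq_nn_integral) simp
  moreover have "norm (Bochner_Integration.simple_bochner_integral M s) \<le> Bochner_Integration.simple_bochner_integral M (\<lambda>x. norm (s x))"
    by (rule Bochner_Integration.simple_bochner_integral_norm_bound[OF assms])
  ultimately show ?thesis by (metis ennreal_leI)
qed

lemma has_strong_integral_norm_le:
  fixes f :: "'a \<Rightarrow> 'x::real_normed_vector"
  assumes "has_strong_integral M f y"
  shows "ennreal (norm y) \<le> (\<integral>\<^sup>+x. ennreal (norm (f x)) \<partial>M)"
proof -
  obtain s where s: "\<And>i::nat. Bochner_Integration.simple_bochner_integrable M (s i)"
    "(\<lambda>i. \<integral>\<^sup>+x. ennreal (norm (f x - s i x)) \<partial>M) \<longlonglongrightarrow> 0"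
    "(\<lambda>i. Bochner_Integration.simple_bochner_integral M (s i)) \<longlonglongrightarrow> y" and f: "ae_strongly_measurable M f"
    using assms unfolding has_strong_integral_def by auto
  have 1: "(\<lambda>i. ennreal (norm (Bochner_Integration.simple_bochner_integral M (s i)))) \<longlonglongrightarrow> ennreal (norm y)"
    by (intro tendsto_ennrealI tendsto_norm s(3))
  have 2: "(\<lambda>i. (\<integral>\<^sup>+x. ennreal (norm (f x)) \<partial>M) + (\<integral>\<^sup>+x. ennreal (norm (f x - s i x)) \<partial>M)) \<longlonglongrightarrow> (\<integral>\<^sup>+x. ennreal (norm (f x)) \<partial>M) + 0"
    by (intro tendsto_add s(2) tendsto_const)
  have "ennreal (norm (Bochner_Integration.simple_bochner_integral M (s i))) \<le> (\<integral>\<^sup>+x. ennreal (norm (f x)) \<partial>M) + (\<integral>\<^sup>+x. ennreal (norm (f x - s i x)) \<partial>M)" for i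
  proof -
    have "ae_strongly_measurable M (\<lambda>x. - (f x - s i x))"
      using f simple_bochner_integrable_imp_ae[OF s(1)] by (intro ae_strongly_measurable_uminus ae_strongly_measurable_diff)
    from nn_integral_norm_add_le[OF f this]
    have "(\<integral>\<^sup>+x. ennreal (norm (s i x)) \<partial>M) \<le> (\<integral>\<^sup>+x. ennreal (norm (f x)) \<partial>M) + (\<integral>\<^sup>+x. ennreal (norm (f x - s i x)) \<partial>M)"
      by (simp add: norm_minus_commute)
    with norm_simple_bochner_integral_le[OF s(1)] show ?thesis by (rule order_trans)
  qed
  then show ?thesis using LIMSEQ_le[OF 1 2] by auto
qed

lemma has_strong_integral_linear:
  assumes "has_strong_integral M f y" "bounded_linear h"
  shows "has_strong_integral M (\<lambda>x. h (f x)) (h y)"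
proof -
  obtain s where s: "\<And>i::nat. Bochner_Integration.simple_bochner_integrable M (s i)"
    "(\<lambda>i. \<integral>\<^sup>+x. ennreal (norm (f x - s i x)) \<partial>M) \<longlonglongrightarrow> 0"
    "(\<lambda>i. Bochner_Integration.simple_bochner_integral M (s i)) \<longlonglongrightarrow> y" and f: "ae_strongly_measurable M f"
    using assms unfolding has_strong_integral_def by auto
  have h: "linear h" using assms(2) by (rule bounded_linear.linear)
  obtain K where K: "0 \<le> K" "\<And>x. norm (h x) \<le> norm x * K"
    using bounded_linear.nonneg_bounded[OF assms(2)] by auto
  show ?thesis unfolding has_strong_integral_def
  proof (intro conjI exI[of _ "\<lambda>i x. h (s i x)"] allI)
    show "ae_strongly_measurable M (\<lambda>x. h (f x))" by (rule ae_strongly_measurable_linear[OF f assms(2)])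
    show "Bochner_Integration.simple_bochner_integrable M (\<lambda>x. h (s i x))" for i
      by (rule simple_bochner_integrable_linear[OF h s(1)])
    show "(\<lambda>i. Bochner_Integration.simple_bochner_integral M (\<lambda>x. h (s i x))) \<longlonglongrightarrow> h y"
      using bounded_linear.tendsto[OF assms(2) s(3)] Bochner_Integration.simple_bochner_integral_linear[OF h s(1)] by simp
    have le: "(\<integral>\<^sup>+x. ennreal (norm (h (f x) - h (s i x))) \<partial>M) \<le> ennreal K * (\<integral>\<^sup>+x. ennreal (norm (f x - s i x)) \<partial>M)" for i
    proof -
      have d: "ae_strongly_measurable M (\<lambda>x. f x - s i x)"
        using f simple_bochner_integrable_imp_ae[OF s(1)] by (rule ae_strongly_measurable_diff)
      obtain g where g: "strongly_measurable M g" "AE x in M. f x - s i x = g x"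
        using d by (rule ae_strongly_measurableE)
      have [measurable]: "g \<in> borel_measurable M" using g by (intro strongly_measurable_borel)
      have "(\<integral>\<^sup>+x. ennreal (norm (h (f x) - h (s i x))) \<partial>M) \<le> (\<integral>\<^sup>+x. ennreal K * ennreal (norm (g x)) \<partial>M)"
      proof (rule nn_integral_mono_AE)
        show "AE x in M. ennreal (norm (h (f x) - h (s i x))) \<le> ennreal K * ennreal (norm (g x))"
          using g(2)
        proof eventually_elim
          case (elim x)
          then have "norm (h (f x) - h (s i x)) \<le> K * norm (g x)"
            using K(2)[of "g x"] by (metis linear_diff[OF h] mult.commute)
          then show ?case using K(1) by (simp add: ennreal_leI flip: ennreal_mult)
        qed
      qed
      also have "\<dots> = ennreal K * (\<integral>\<^sup>+x. ennreal (norm (g x)) \<partial>M)" by (simp add: nn_integral_cmult)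
      also have "(\<integral>\<^sup>+x. ennreal (norm (g x)) \<partial>M) = (\<integral>\<^sup>+x. ennreal (norm (f x - s i x)) \<partial>M)"
        by (rule nn_integral_cong_AE) (use g(2) in eventually_elim, simp)
      finally show ?thesis .
    qed
    have "(\<lambda>i. ennreal K * (\<integral>\<^sup>+x. ennreal (norm (f x - s i x)) \<partial>M)) \<longlonglongrightarrow> ennreal K * 0"
      by (intro ennreal_tendsto_cmult s(2)) simp
    then have "(\<lambda>i. ennreal K * (\<integral>\<^sup>+x. ennreal (norm (f x - s i x)) \<partial>M)) \<longlonglongrightarrow> 0" by simp
    note lim = this
    show "(\<lambda>i. \<integral>\<^sup>+x. ennreal (norm (h (f x) - h (s i x))) \<partial>M) \<longlonglongrightarrow> 0"
      by (rule tendsto_sandwich[OF _ _ tendsto_const lim]) (auto intro!: always_eventually le)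
  qed
qed

lemma has_strong_integral_add:
  assumes "has_strong_integral M f y" "has_strong_integral M g z"
  shows "has_strong_integral M (\<lambda>x. f x + g x) (y + z)"
proof -
  obtain s where s: "\<And>i::nat. Bochner_Integration.simple_bochner_integrable M (s i)"
    "(\<lambda>i. \<integral>\<^sup>+x. ennreal (norm (f x - s i x)) \<partial>M) \<longlonglongrightarrow> 0"
    "(\<lambda>i. Bochner_Integration.simple_bochner_integral M (s i)) \<longlonglongrightarrow> y" and f: "ae_strongly_measurable M f"
    using assms(1) unfolding has_strong_integral_def by auto
  obtain t where t: "\<And>i::nat. Bochner_Integration.simple_bochner_integrable M (t i)"
    "(\<lambda>i. \<integral>\<^sup>+x. ennreal (norm (g x - t i x)) \<partial>M) \<longlonglongrightarrow> 0"
    "(\<lambda>i. Bochner_Integration.simple_bochner_integral M (t i)) \<longlonglongrightarrow> z" and g: "ae_strongly_measurable M g"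
    using assms(2) unfolding has_strong_integral_def by auto
  show ?thesis unfolding has_strong_integral_def
  proof (intro conjI exI[of _ "\<lambda>i x. s i x + t i x"] allI)
    show "ae_strongly_measurable M (\<lambda>x. f x + g x)" by (rule ae_strongly_measurable_add[OF f g])
    show "Bochner_Integration.simple_bochner_integrable M (\<lambda>x. s i x + t i x)" for i
      by (rule simple_bochner_integrable_add[OF s(1) t(1)])
    show "(\<lambda>i. Bochner_Integration.simple_bochner_integral M (\<lambda>x. s i x + t i x)) \<longlonglongrightarrow> y + z"
      using tendsto_add[OF s(3) t(3)] Bochner_Integration.simple_bochner_integral_add[OF s(1) t(1)] by simp
    have le: "(\<integral>\<^sup>+x. ennreal (norm (f x + g x - (s i x + t i x))) \<partial>M)
        \<le> (\<integral>\<^sup>+x. ennreal (norm (f x - s i x)) \<partial>M) + (\<integral>\<^sup>+x. ennreal (norm (g x - t i x)) \<partial>M)" for i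
      using nn_integral_norm_add_le[OF ae_strongly_measurable_diff[OF f simple_bochner_integrable_imp_ae[OF s(1)]]
          ae_strongly_measurable_diff[OF g simple_bochner_integrable_imp_ae[OF t(1)]], of i i]
      by (simp add: algebra_simps)
    have "(\<lambda>i. (\<integral>\<^sup>+x. ennreal (norm (f x - s i x)) \<partial>M) + (\<integral>\<^sup>+x. ennreal (norm (g x - t i x)) \<partial>M)) \<longlonglongrightarrow> 0 + 0"
      by (intro tendsto_add s(2) t(2))
    then have "(\<lambda>i. (\<integral>\<^sup>+x. ennreal (norm (f x - s i x)) \<partial>M) + (\<integral>\<^sup>+x. ennreal (norm (g x - t i x)) \<partial>M)) \<longlonglongrightarrow> 0" by simp
    note lim = this
    show "(\<lambda>i. \<integral>\<^sup>+x. ennreal (norm (f x + g x - (s i x + t i x))) \<partial>M) \<longlonglongrightarrow> 0"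
      by (rule tendsto_sandwich[OF _ _ tendsto_const lim]) (auto intro!: always_eventually le)
  qed
qed

lemma has_strong_integral_unique:
  assumes "has_strong_integral M f y" "has_strong_integral M f z"
  shows "y = z"
proof -
  have "has_strong_integral M (\<lambda>x. f x + - f x) (y + - z)"
    using assms has_strong_integral_linear[OF assms(2) bounded_linear_minus[OF bounded_linear_ident]]
    by (intro has_strong_integral_add) auto
  from has_strong_integral_norm_le[OF this] show ?thesis by simp
qed

lemma strong_integral_eq: "has_strong_integral M f y \<Longrightarrow> strong_integral M f = y"
  unfolding strong_integral_def using has_strong_integral_unique[of M f] by (auto intro!: the_equality)

lemma has_strong_integral_cong_AE:
  assumes "AE x in M. f x = g x" "has_strong_integral M f y"
  shows "has_strong_integral M g y"
proof -
  have "(\<integral>\<^sup>+x. ennreal (norm (f x - s x)) \<partial>M) = (\<integral>\<^sup>+x. ennreal (norm (g x - s x)) \<partial>M)" for s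
    by (rule nn_integral_cong_AE) (use assms(1) in eventually_elim, simp)
  then show ?thesis
    using assms(2) ae_strongly_measurable_cong_AE[OF assms(1)] unfolding has_strong_integral_def by simp
qed

lemma strong_integral_cong_AE:
  assumes "AE x in M. f x = g x"
  shows "strong_integral M f = strong_integral M g"
proof -
  have "AE x in M. g x = f x" using assms by eventually_elim simp
  then have "has_strong_integral M f = has_strong_integral M g"
    using has_strong_integral_cong_AE assms by blast
  then show ?thesis unfolding strong_integral_def by auto
qed

definition strongly_integrable :: "'a measure \<Rightarrow> ('a \<Rightarrow> 'x::real_normed_vector) \<Rightarrow> bool"
  where "strongly_integrable M f \<longleftrightarrow> ae_strongly_measurable M f \<and> (\<integral>\<^sup>+x. ennreal (norm (f x)) \<partial>M) < \<infinity>"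

lemma strongly_integrable_iff_Lp_fun: "strongly_integrable M f \<longleftrightarrow> f \<in> Lp_fun M 1"
  by (simp add: strongly_integrable_def Lp_fun_def)

text \<open>
  Completeness enters here: the integrals of approximating simple functions form a Cauchy sequence.
\<close>

lemma has_strong_integral_strong_integral:
  fixes f :: "'a \<Rightarrow> 'x::banach"
  assumes "strongly_integrable M f"
  shows "has_strong_integral M f (strong_integral M f)"
proof -
  have fLp: "f \<in> Lp_fun M 1" and f: "ae_strongly_measurable M f"
    using assms by (auto simp: strongly_integrable_def Lp_fun_def)
  obtain s where s: "\<And>i::nat. simple_function M (s i)" "\<And>i. Lp_int M 1 (s i) < \<infinity>"
    "(\<lambda>i. Lp_int M 1 (\<lambda>x. f x - s i x)) \<longlonglongrightarrow> 0"
    by (rule Lp_fun_approx_simple[OF fLp zero_less_one]) (rule that)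
  have sbi: "Bochner_Integration.simple_bochner_integrable M (s i)" for i
    using s(1,2)[of i] by (intro Bochner_Integration.simple_bochner_integrableI_bounded) auto
  define I where "I i = Bochner_Integration.simple_bochner_integral M (s i)" for i
  have diff: "ennreal (norm (I i - I j)) \<le> Lp_int M 1 (\<lambda>x. f x - s i x) + Lp_int M 1 (\<lambda>x. f x - s j x)" for i j
  proof -
    have "ennreal (norm (I i - I j)) \<le> (\<integral>\<^sup>+x. ennreal (norm (s i x - s j x)) \<partial>M)"
      unfolding I_def Bochner_Integration.simple_bochner_integral_diff[OF sbi sbi, symmetric]
      by (rule norm_simple_bochner_integral_le[OF simple_bochner_integrable_diff[OF sbi sbi]])
    also have "\<dots> = (\<integral>\<^sup>+x. ennreal (norm (- (f x - s i x) + (f x - s j x))) \<partial>M)" by simp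
    also have "\<dots> \<le> (\<integral>\<^sup>+x. ennreal (norm (- (f x - s i x))) \<partial>M) + (\<integral>\<^sup>+x. ennreal (norm (f x - s j x)) \<partial>M)"
      using f simple_bochner_integrable_imp_ae[OF sbi]
      by (intro nn_integral_norm_add_le ae_strongly_measurable_uminus ae_strongly_measurable_diff)
    finally show ?thesis by (simp add: norm_minus_commute)
  qed
  have "Cauchy I"
  proof (rule metric_CauchyI)
    fix e :: real assume "0 < e"
    then have "\<forall>\<^sub>F i in sequentially. Lp_int M 1 (\<lambda>x. f x - s i x) < ennreal (e / 2)"
      using s(3) by (intro order_tendstoD(2)) auto
    then obtain n where n: "\<And>i. i \<ge> n \<Longrightarrow> Lp_int M 1 (\<lambda>x. f x - s i x) < ennreal (e / 2)"
      unfolding eventually_sequentially by auto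
    have "dist (I i) (I j) < e" if "i \<ge> n" "j \<ge> n" for i j
    proof -
      have "ennreal (norm (I i - I j)) < ennreal (e / 2) + ennreal (e / 2)"
        using diff[of i j] add_strict_mono[OF n[OF that(1)] n[OF that(2)]] by (rule le_less_trans)
      also have "\<dots> = ennreal e" using \<open>0 < e\<close> by (simp flip: ennreal_plus)
      finally show ?thesis using \<open>0 < e\<close> by (simp add: dist_norm ennreal_less_iff)
    qed
    then show "\<exists>n. \<forall>i\<ge>n. \<forall>j\<ge>n. dist (I i) (I j) < e" by blast
  qed
  then obtain y where "I \<longlonglongrightarrow> y" using Cauchy_convergent convergent_def by blast
  then have "has_strong_integral M f y"
    using f sbi s(3) unfolding has_strong_integral_def I_def by (intro conjI exI[of _ s]) auto
  with strong_integral_eq[OF this] show ?thesis by simp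
qed

lemma strong_integral_add:
  fixes f g :: "'a \<Rightarrow> 'x::banach"
  assumes "strongly_integrable M f" "strongly_integrable M g"
  shows "strong_integral M (\<lambda>x. f x + g x) = strong_integral M f + strong_integral M g"
  by (intro strong_integral_eq has_strong_integral_add has_strong_integral_strong_integral assms)

lemma strong_integral_linear:
  fixes f :: "'a \<Rightarrow> 'x::banach"
  assumes "strongly_integrable M f" "bounded_linear h"
  shows "strong_integral M (\<lambda>x. h (f x)) = h (strong_integral M f)"
  by (rule strong_integral_eq[OF has_strong_integral_linear[OF has_strong_integral_strong_integral[OF assms(1)] assms(2)]])

lemma strong_integral_diff:
  fixes f g :: "'a \<Rightarrow> 'x::banach"
  assumes "strongly_integrable M f" "strongly_integrable M g"
  shows "strong_integral M (\<lambda>x. f x - g x) = strong_integral M f - strong_integral M g"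
proof -
  have "has_strong_integral M (\<lambda>x. f x + - g x) (strong_integral M f + - strong_integral M g)"
    using has_strong_integral_linear[OF has_strong_integral_strong_integral[OF assms(2)] bounded_linear_minus[OF bounded_linear_ident]]
    by (intro has_strong_integral_add has_strong_integral_strong_integral assms) auto
  then show ?thesis using strong_integral_eq by fastforce
qed

lemma strongly_integrable_sum:
  "(\<And>i. i \<in> I \<Longrightarrow> strongly_integrable M (f i)) \<Longrightarrow> strongly_integrable M (\<lambda>x. \<Sum>i\<in>I. f i x)"
  by (simp add: strongly_integrable_iff_Lp_fun Lp_fun_sum)

lemma strong_integral_zero: "strong_integral M (\<lambda>_. 0 :: 'x::banach) = 0"
  using strong_integral_add[of M "\<lambda>_. 0 :: 'x" "\<lambda>_. 0"]
  by (simp add: strongly_integrable_def ae_strongly_measurable_zero)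

lemma strong_integral_sum:
  fixes f :: "'i \<Rightarrow> 'a \<Rightarrow> 'x::banach"
  assumes "\<And>i. i \<in> I \<Longrightarrow> strongly_integrable M (f i)"
  shows "strong_integral M (\<lambda>x. \<Sum>i\<in>I. f i x) = (\<Sum>i\<in>I. strong_integral M (f i))"
  using assms
  by (induction I rule: infinite_finite_induct)
    (auto simp: strong_integral_zero strong_integral_add strongly_integrable_sum)

lemma norm_strong_integral_le:
  fixes f :: "'a \<Rightarrow> 'x::banach"
  shows "ennreal (norm (strong_integral M f)) \<le> (\<integral>\<^sup>+x. ennreal (norm (f x)) \<partial>M)"
proof (cases "\<exists>y. has_strong_integral M f y")
  case True
  then obtain y where "has_strong_integral M f y" by auto
  then show ?thesis using strong_integral_eq has_strong_integral_norm_le by metis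
qed (simp add: strong_integral_def)

lemma strongly_integrable_bounded_linear:
  assumes "strongly_integrable M f" "bounded_linear h"
  shows "strongly_integrable M (\<lambda>x. h (f x))"
proof -
  obtain g where g: "strongly_measurable M g" "AE x in M. f x = g x"
    using assms(1) by (auto simp: strongly_integrable_def elim: ae_strongly_measurableE)
  have [measurable]: "g \<in> borel_measurable M" using g by (intro strongly_measurable_borel)
  obtain K where K: "0 \<le> K" "\<And>x. norm (h x) \<le> norm x * K"
    using bounded_linear.nonneg_bounded[OF assms(2)] by auto
  have "(\<integral>\<^sup>+x. ennreal (norm (h (f x))) \<partial>M) \<le> (\<integral>\<^sup>+x. ennreal K * ennreal (norm (g x)) \<partial>M)"
    by (rule nn_integral_mono_AE)
      (use g(2) in \<open>eventually_elim, use K in \<open>auto simp: ennreal_leI mult.commute simp flip: ennreal_mult\<close>\<close>)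
  also have "\<dots> = ennreal K * (\<integral>\<^sup>+x. ennreal (norm (g x)) \<partial>M)" by (simp add: nn_integral_cmult)
  also have "(\<integral>\<^sup>+x. ennreal (norm (g x)) \<partial>M) = (\<integral>\<^sup>+x. ennreal (norm (f x)) \<partial>M)"
    by (rule nn_integral_cong_AE) (use g(2) in eventually_elim, simp)
  finally show ?thesis using assms ae_strongly_measurable_linear[OF _ assms(2)]
    by (auto simp: strongly_integrable_def ennreal_mult_less_top intro: le_less_trans)
qed

lemma strong_integral_indicator:
  fixes x :: "'x::banach"
  assumes A: "A \<in> sets M" "emeasure M A < \<infinity>"
  shows "strongly_integrable M (\<lambda>t. indicator A t *\<^sub>R x)"
    and "strong_integral M (\<lambda>t. indicator A t *\<^sub>R x) = measure M A *\<^sub>R x"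
proof -
  have h: "has_strong_integral M (indicator A :: _ \<Rightarrow> real) (measure M A)"
    using has_bochner_integral_real_indicator[OF A] A
    by (subst has_strong_integral_iff_has_bochner_integral) auto
  have bl: "bounded_linear (\<lambda>r. r *\<^sub>R x)" by (rule bounded_linear_scaleR_left)
  show "strong_integral M (\<lambda>t. indicator A t *\<^sub>R x) = measure M A *\<^sub>R x"
    using strong_integral_eq[OF has_strong_integral_linear[OF h bl]] .
  have "strongly_integrable M (indicator A :: _ \<Rightarrow> real)"
    using h A unfolding strongly_integrable_def has_strong_integral_def by (simp add: ennreal_indicator)
  from strongly_integrable_bounded_linear[OF this bl] show "strongly_integrable M (\<lambda>t. indicator A t *\<^sub>R x)" .
qed

lemma simple_function_eq_sum:
  fixes s :: "'a \<Rightarrow> 'x::real_vector"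
  assumes "x \<in> space M" "simple_function M s"
  shows "s x = (\<Sum>y\<in>s ` space M - {0}. indicator (s -` {y} \<inter> space M) x *\<^sub>R y)"
proof -
  have fin: "finite (s ` space M)" using assms(2) by (rule simple_functionD)
  have "(\<Sum>y\<in>s ` space M - {0}. indicator (s -` {y} \<inter> space M) x *\<^sub>R y) = (\<Sum>y\<in>s ` space M. indicator (s -` {y} \<inter> space M) x *\<^sub>R y)"
    using fin by (intro sum.mono_neutral_left) auto
  also have "\<dots> = (\<Sum>y\<in>{s x}. indicator (s -` {y} \<inter> space M) x *\<^sub>R y)"
    using fin assms(1) by (intro sum.mono_neutral_right) auto
  finally show ?thesis using assms(1) by simp
qed

section \<open>The Bochner space of classes\<close>

lemma repr_Lp_class:
  assumes "f \<in> Lp_fun M p"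
  shows "repr (Lp_class M p f) \<in> Lp_fun M p" "AE x in M. repr (Lp_class M p f) x = f x"
proof -
  have "f \<in> Lp_class M p f" using assms by (simp add: Lp_class_def)
  then have "repr (Lp_class M p f) \<in> Lp_class M p f" unfolding repr_def by (rule someI[of "\<lambda>h. h \<in> Lp_class M p f"])
  then show "repr (Lp_class M p f) \<in> Lp_fun M p" "AE x in M. repr (Lp_class M p f) x = f x"
    by (auto simp: Lp_class_def)
qed

lemma Lp_class_cong:
  assumes "AE x in M. f x = g x"
  shows "Lp_class M p f = Lp_class M p g"
proof -
  have "(AE x in M. h x = f x) \<longleftrightarrow> (AE x in M. h x = g x)" for h
  proof
    assume "AE x in M. h x = f x"
    then show "AE x in M. h x = g x" using assms by eventually_elim simp
  next
    assume "AE x in M. h x = g x"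
    then show "AE x in M. h x = f x" using assms by eventually_elim simp
  qed
  then show ?thesis by (simp add: Lp_class_def)
qed

lemma ncarrier_Lp_space [simp]: "ncarrier (Lp_space M p) = Lp_class M p ` Lp_fun M p"
  by (simp add: Lp_space_def)

lemma nadd_Lp_space:
  assumes "f \<in> Lp_fun M p" "g \<in> Lp_fun M p"
  shows "nadd (Lp_space M p) (Lp_class M p f) (Lp_class M p g) = Lp_class M p (\<lambda>x. f x + g x)"
proof -
  have "AE x in M. repr (Lp_class M p f) x + repr (Lp_class M p g) x = f x + g x"
    using repr_Lp_class(2)[OF assms(1)] repr_Lp_class(2)[OF assms(2)] by eventually_elim simp
  then show ?thesis by (simp add: Lp_space_def Lp_class_cong)
qed

lemma nscale_Lp_space:
  assumes "f \<in> Lp_fun M p"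
  shows "nscale (Lp_space M p) c (Lp_class M p f) = Lp_class M p (\<lambda>x. scaleC c (f x))"
proof -
  have "AE x in M. scaleC c (repr (Lp_class M p f) x) = scaleC c (f x)"
    using repr_Lp_class(2)[OF assms(1)] by eventually_elim simp
  then show ?thesis by (simp add: Lp_space_def Lp_class_cong)
qed

lemma nnorm_Lp_space:
  assumes "f \<in> Lp_fun M p"
  shows "nnorm (Lp_space M p) (Lp_class M p f) = Lp_norm M p f"
proof -
  have "nnorm (Lp_space M p) (Lp_class M p f) = Lp_norm M p (repr (Lp_class M p f))"
    by (simp add: Lp_space_def Lp_norm_def)
  also have "\<dots> = Lp_norm M p f" by (rule Lp_norm_cong_AE[OF repr_Lp_class(2)[OF assms]])
  finally show ?thesis .
qed

lemma ndiff_Lp_space: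
  assumes "f \<in> Lp_fun M p" "g \<in> Lp_fun M p" "0 < p"
  shows "ndiff (Lp_space M p) (Lp_class M p f) (Lp_class M p g) = Lp_class M p (\<lambda>x. f x - g x)"
proof -
  have "ndiff (Lp_space M p) (Lp_class M p f) (Lp_class M p g) = Lp_class M p (\<lambda>x. f x + scaleC (- 1) (g x))"
    unfolding ndiff_def using assms by (simp add: nscale_Lp_space nadd_Lp_space Lp_fun_scaleC)
  then show ?thesis by (simp add: scaleC_minus1)
qed

text \<open>
  The constant in the definition of boundedness may be negative; it can be replaced by its absolute value where norms are nonnegative.
\<close>

lemma bounded_operator_bound:
  assumes "bounded_operator E T"
  obtains C where "0 \<le> C" "\<And>x. x \<in> ncarrier E \<Longrightarrow> 0 \<le> nnorm E x \<Longrightarrow> nnorm E (T x) \<le> C * nnorm E x"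
proof -
  obtain C where C: "\<And>x. x \<in> ncarrier E \<Longrightarrow> nnorm E (T x) \<le> C * nnorm E x"
    using assms unfolding bounded_operator_def by blast
  show ?thesis
  proof
    fix x assume "x \<in> ncarrier E" "0 \<le> nnorm E x"
    then show "nnorm E (T x) \<le> max C 0 * nnorm E x"
      using C[of x] mult_right_mono[of C "max C 0" "nnorm E x"] by simp
  qed simp
qed

section \<open>The Hilbert space of square integrable functions\<close>

lemma strongly_measurable_times_cnj:
  fixes f g :: "'a \<Rightarrow> complex"
  assumes "strongly_measurable M f" "strongly_measurable M g"
  shows "strongly_measurable M (\<lambda>x. f x * cnj (g x))"
  by (rule strongly_measurable_compose2[where p="\<lambda>a b. a * cnj b", OF assms])
    (simp add: case_prod_unfold)

lemma nn_integral_times_cnj_le: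
  fixes f g :: "'a \<Rightarrow> complex"
  assumes "f \<in> Lp_fun M 2" "g \<in> Lp_fun M 2"
  shows "ae_strongly_measurable M (\<lambda>x. f x * cnj (g x))"
    "(\<integral>\<^sup>+x. ennreal (norm (f x * cnj (g x))) \<partial>M) \<le> ennreal (Lp_norm M 2 f * Lp_norm M 2 g)"
proof -
  obtain f' where f': "strongly_measurable M f'" "AE x in M. f x = f' x"
    using assms(1) by (auto simp: Lp_fun_def elim: ae_strongly_measurableE)
  obtain g' where g': "strongly_measurable M g'" "AE x in M. g x = g' x"
    using assms(2) by (auto simp: Lp_fun_def elim: ae_strongly_measurableE)
  have eq: "AE x in M. f x * cnj (g x) = f' x * cnj (g' x)"
    using f'(2) g'(2) by eventually_elim simp
  show "ae_strongly_measurable M (\<lambda>x. f x * cnj (g x))"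
    unfolding ae_strongly_measurable_iff
    using strongly_measurable_times_cnj[OF f'(1) g'(1)] eq by blast
  have [measurable]: "f' \<in> borel_measurable M" "g' \<in> borel_measurable M"
    using f' g' by (auto intro: strongly_measurable_borel)
  have sq: "(\<integral>\<^sup>+x. (ennreal (norm (h' x)))\<^sup>2 \<partial>M) = ennreal ((Lp_norm M 2 h)\<^sup>2)"
    if "h \<in> Lp_fun M 2" "AE x in M. h x = h' x" for h h' :: "'a \<Rightarrow> complex"
  proof -
    have "(\<integral>\<^sup>+x. (ennreal (norm (h' x)))\<^sup>2 \<partial>M) = Lp_int M 2 h'"
      by (intro nn_integral_cong) (simp add: ennreal_power powr_numeral)
    also have "\<dots> = Lp_int M 2 h" by (rule Lp_int_cong_AE[symmetric, OF that(2)])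
    also have "\<dots> = ennreal (Lp_norm M 2 h powr 2)" using Lp_norm_powr[OF that(1)] by simp
    finally show ?thesis using Lp_norm_nonneg[of M 2 h] by (simp add: powr_numeral)
  qed
  have "(\<integral>\<^sup>+x. ennreal (norm (f x * cnj (g x))) \<partial>M) = (\<integral>\<^sup>+x. ennreal (norm (f' x)) * ennreal (norm (g' x)) \<partial>M)"
    by (rule nn_integral_cong_AE) (use eq in eventually_elim, simp add: norm_mult ennreal_mult)
  moreover have "(\<integral>\<^sup>+x. ennreal (norm (f' x)) * ennreal (norm (g' x)) \<partial>M)\<^sup>2
      \<le> (\<integral>\<^sup>+x. (ennreal (norm (f' x)))\<^sup>2 \<partial>M) * (\<integral>\<^sup>+x. (ennreal (norm (g' x)))\<^sup>2 \<partial>M)"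
    by (rule Cauchy_Schwarz_nn_integral) measurable
  ultimately have le: "(\<integral>\<^sup>+x. ennreal (norm (f x * cnj (g x))) \<partial>M)\<^sup>2 \<le> ennreal ((Lp_norm M 2 f * Lp_norm M 2 g)\<^sup>2)"
    using sq[OF assms(1) f'(2)] sq[OF assms(2) g'(2)] by (simp add: power_mult_distrib ennreal_mult)
  define I where "I = (\<integral>\<^sup>+x. ennreal (norm (f x * cnj (g x))) \<partial>M)"
  have "I \<noteq> \<infinity>"
    using le unfolding I_def[symmetric] by (auto simp: top_unique)
  then obtain r where r: "I = ennreal r" "0 \<le> r" by (cases I) auto
  have "r\<^sup>2 \<le> (Lp_norm M 2 f * Lp_norm M 2 g)\<^sup>2"
    using le r unfolding I_def[symmetric] by (simp add: ennreal_power)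
  then have "r \<le> Lp_norm M 2 f * Lp_norm M 2 g"
    by (rule power2_le_imp_le) (simp add: Lp_norm_nonneg)
  then show "(\<integral>\<^sup>+x. ennreal (norm (f x * cnj (g x))) \<partial>M) \<le> ennreal (Lp_norm M 2 f * Lp_norm M 2 g)"
    unfolding I_def[symmetric] r(1) by (rule ennreal_leI)
qed

lemma strongly_integrable_times_cnj:
  fixes f g :: "'a \<Rightarrow> complex"
  assumes "f \<in> Lp_fun M 2" "g \<in> Lp_fun M 2"
  shows "strongly_integrable M (\<lambda>x. f x * cnj (g x))"
  unfolding strongly_integrable_def
  using nn_integral_times_cnj_le[OF assms] by (auto intro: le_less_trans)

lemma L2_inner_Lp_class:
  assumes "f \<in> Lp_fun M 2" "g \<in> Lp_fun M 2"
  shows "L2_inner M (Lp_class M 2 f) (Lp_class M 2 g) = strong_integral M (\<lambda>x. f x * cnj (g x))"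
  unfolding L2_inner_def
proof (rule strong_integral_cong_AE)
  show "AE x in M. repr (Lp_class M 2 f) x * cnj (repr (Lp_class M 2 g) x) = f x * cnj (g x)"
    using repr_Lp_class(2)[OF assms(1)] repr_Lp_class(2)[OF assms(2)] by eventually_elim simp
qed

lemma norm_L2_inner_le:
  fixes f g :: "'a \<Rightarrow> complex"
  assumes "f \<in> Lp_fun M 2" "g \<in> Lp_fun M 2"
  shows "cmod (strong_integral M (\<lambda>x. f x * cnj (g x))) \<le> Lp_norm M 2 f * Lp_norm M 2 g"
proof -
  have "ennreal (norm (strong_integral M (\<lambda>x. f x * cnj (g x)))) \<le> ennreal (Lp_norm M 2 f * Lp_norm M 2 g)"
    using norm_strong_integral_le nn_integral_times_cnj_le(2)[OF assms] by (rule order_trans)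
  then show ?thesis by (subst (asm) ennreal_le_iff) (intro mult_nonneg_nonneg Lp_norm_nonneg)
qed

lemma strongly_measurable_borel_second_countable:
  fixes f :: "'a \<Rightarrow> 'x::{real_normed_vector, second_countable_topology}"
  assumes "f \<in> borel_measurable M"
  shows "strongly_measurable M f"
  using borel_measurable_implies_sequence_metric[OF assms, of 0] unfolding strongly_measurable_def by blast

lemma Lp_fun_bounded:
  assumes M: "prob_space M" and f: "ae_strongly_measurable M f" and B: "\<And>x. x \<in> space M \<Longrightarrow> norm (f x) \<le> B" and p: "0 < p"
  shows "f \<in> Lp_fun M p"
proof -
  have "Lp_int M p f \<le> (\<integral>\<^sup>+x. ennreal (B powr p) \<partial>M)"
    using B p by (intro nn_integral_mono ennreal_leI powr_mono2) auto
  also have "\<dots> < \<infinity>" using prob_space.emeasure_space_1[OF M] by simp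
  finally show ?thesis using f by (simp add: Lp_fun_def)
qed

section \<open>The Rademacher projection\<close>

definition sign_point :: "nat set \<Rightarrow> nat \<Rightarrow> real"
  where "sign_point \<theta> j = (if j \<in> \<theta> then 1 else - 1)"

text \<open>
  Points of the finite cube \<open>{-1, 1}\<^sup>J\<close> are represented by the set of their positive coordinates.
\<close>

definition cylinder :: "nat set \<Rightarrow> nat set \<Rightarrow> (nat \<Rightarrow> real) set"
  where "cylinder J \<theta> = {\<omega> \<in> space Omega0. \<forall>j\<in>J. \<omega> j = sign_point \<theta> j}"

interpretation Omega0: product_prob_space "\<lambda>_::nat. uniform_count_measure {- 1, 1 :: real}" UNIV
  by (rule product_prob_spaceI, rule prob_space_uniform_count_measure) simp_all

lemma prob_space_Omega0: "prob_space Omega0"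
  unfolding Omega0_def by (rule Omega0.prob_space_axioms)

lemma space_Omega0: "space Omega0 = {\<omega>. \<forall>j. \<omega> j \<in> {- 1, 1}}"
  by (auto simp: Omega0_def space_PiM PiE_def Pi_def space_uniform_count_measure)

lemma cylinder_sets:
  assumes "finite J"
  shows "cylinder J \<theta> \<in> sets Omega0" "emeasure Omega0 (cylinder J \<theta>) = ennreal ((1 / 2) ^ card J)"
proof -
  have eq: "cylinder J \<theta> = prod_emb UNIV (\<lambda>_::nat. uniform_count_measure {- 1, 1 :: real}) J (PiE J (\<lambda>j. {sign_point \<theta> j}))"
    by (auto simp: cylinder_def prod_emb_def Omega0_def space_PiM PiE_iff)
  show "cylinder J \<theta> \<in> sets Omega0"
    unfolding eq Omega0_def using assms
    by (intro sets_PiM_I) (auto simp: sets_uniform_count_measure sign_point_def)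
  have "emeasure Omega0 (cylinder J \<theta>) = (\<Prod>j\<in>J. emeasure (uniform_count_measure {- 1, 1 :: real}) {sign_point \<theta> j})"
    unfolding eq Omega0_def using assms
    by (intro Omega0.emeasure_PiM_emb) (auto simp: sets_uniform_count_measure sign_point_def)
  also have "\<dots> = (\<Prod>j\<in>J. ennreal (1 / 2))"
    by (intro prod.cong refl) (auto simp: emeasure_uniform_count_measure sign_point_def)
  also have "\<dots> = ennreal (1 / 2) ^ card J" by (rule prod_constant)
  also have "\<dots> = ennreal ((1 / 2) ^ card J)" by (rule ennreal_power) simp
  finally show "emeasure Omega0 (cylinder J \<theta>) = ennreal ((1 / 2) ^ card J)" .
qed

lemma mem_cylinder_iff:
  assumes om: "\<omega> \<in> space Omega0" and th: "\<theta> \<subseteq> J"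
  shows "(\<forall>j\<in>J. \<omega> j = sign_point \<theta> j) \<longleftrightarrow> \<theta> = {j\<in>J. \<omega> j = 1}"
proof
  assume A: "\<forall>j\<in>J. \<omega> j = sign_point \<theta> j"
  show "\<theta> = {j\<in>J. \<omega> j = 1}"
  proof (intro set_eqI iffI)
    fix j assume "j \<in> \<theta>"
    then show "j \<in> {j\<in>J. \<omega> j = 1}" using A th by (auto simp: sign_point_def)
  next
    fix j assume "j \<in> {j\<in>J. \<omega> j = 1}"
    then have "sign_point \<theta> j = 1" using A by (metis (mono_tags, lifting) mem_Collect_eq)
    then show "j \<in> \<theta>" by (simp add: sign_point_def split: if_splits)
  qed
next
  assume th: "\<theta> = {j\<in>J. \<omega> j = 1}"
  show "\<forall>j\<in>J. \<omega> j = sign_point \<theta> j"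
  proof
    fix j assume "j \<in> J"
    have "\<omega> j = - 1 \<or> \<omega> j = 1" using om by (auto simp: space_Omega0)
    then show "\<omega> j = sign_point \<theta> j" using \<open>j \<in> J\<close> by (auto simp: th sign_point_def)
  qed
qed

lemma finite_coordinates_sum:
  fixes F :: "(nat \<Rightarrow> real) \<Rightarrow> 'x::real_vector"
  assumes "finite J" and F: "\<And>\<omega>. \<omega> \<in> space Omega0 \<Longrightarrow> F \<omega> = F (sign_point {j\<in>J. \<omega> j = 1})"
    and om: "\<omega> \<in> space Omega0"
  shows "F \<omega> = (\<Sum>\<theta>\<in>Pow J. indicator (cylinder J \<theta>) \<omega> *\<^sub>R F (sign_point \<theta>))"
proof -
  let ?t = "{j\<in>J. \<omega> j = 1}"
  have *: "\<omega> \<in> cylinder J \<theta> \<longleftrightarrow> \<theta> = ?t" if "\<theta> \<subseteq> J" for \<theta>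
    using om mem_cylinder_iff[OF om that] by (simp add: cylinder_def)
  have "(\<Sum>\<theta>\<in>Pow J. indicator (cylinder J \<theta>) \<omega> *\<^sub>R F (sign_point \<theta>)) = (\<Sum>\<theta>\<in>Pow J. if \<theta> = ?t then F (sign_point \<theta>) else 0)"
    using * by (intro sum.cong) (auto simp: indicator_def)
  also have "\<dots> = F (sign_point ?t)" using assms(1) by (subst sum.delta) auto
  finally show ?thesis using F[OF om] by simp
qed

lemma finite_coordinates_measurable:
  fixes F :: "(nat \<Rightarrow> real) \<Rightarrow> 'x::complex_banach"
  assumes J: "finite J" and F: "\<And>\<omega>. \<omega> \<in> space Omega0 \<Longrightarrow> F \<omega> = F (sign_point {j\<in>J. \<omega> j = 1})"
  shows "simple_function Omega0 F" "F \<in> Lp_fun Omega0 2"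
    "strong_integral Omega0 F = (1 / 2) ^ card J *\<^sub>R (\<Sum>\<theta>\<in>Pow J. F (sign_point \<theta>))"
proof -
  have "simple_function Omega0 (\<lambda>\<omega>. {j\<in>J. \<omega> j = 1})"
    unfolding simple_function_def
  proof
    have "(\<lambda>\<omega>. {j \<in> J. \<omega> j = 1}) ` space Omega0 \<subseteq> Pow J" by auto
    then show "finite ((\<lambda>\<omega>. {j \<in> J. \<omega> j = 1}) ` space Omega0)" using J by (auto intro: finite_subset)
    have "(\<lambda>\<omega>. {j \<in> J. \<omega> j = 1}) -` {\<theta>} \<inter> space Omega0 = cylinder J \<theta>" if "\<theta> \<subseteq> J" for \<theta>
      using mem_cylinder_iff[OF _ that] by (auto simp: cylinder_def)
    then show "\<forall>\<theta>\<in>(\<lambda>\<omega>. {j \<in> J. \<omega> j = 1}) ` space Omega0. (\<lambda>\<omega>. {j \<in> J. \<omega> j = 1}) -` {\<theta>} \<inter> space Omega0 \<in> sets Omega0"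
      using cylinder_sets(1)[OF J] by auto
  qed
  then have "simple_function Omega0 (\<lambda>\<omega>. F (sign_point {j\<in>J. \<omega> j = 1}))"
    by (rule simple_function_compose1[where g="\<lambda>\<theta>. F (sign_point \<theta>)"])
  then show simple: "simple_function Omega0 F"
    using simple_function_cong[of Omega0 F "\<lambda>\<omega>. F (sign_point {j\<in>J. \<omega> j = 1})", OF F] by simp
  have fin: "finite (F ` space Omega0)" using simple by (rule simple_functionD)
  show "F \<in> Lp_fun Omega0 2"
  proof (rule Lp_fun_bounded[OF prob_space_Omega0])
    show "ae_strongly_measurable Omega0 F" using simple by (intro strongly_measurable_imp_ae strongly_measurable_simple)
    show "norm (F \<omega>) \<le> Max (norm ` F ` space Omega0)" if "\<omega> \<in> space Omega0" for \<omega>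
      using fin that by (intro Max_ge) auto
  qed simp
  have fin: "emeasure Omega0 (cylinder J \<theta>) < \<infinity>" for \<theta> using cylinder_sets(2)[OF J] by simp
  have "strong_integral Omega0 F = strong_integral Omega0 (\<lambda>\<omega>. \<Sum>\<theta>\<in>Pow J. indicator (cylinder J \<theta>) \<omega> *\<^sub>R F (sign_point \<theta>))"
    by (rule strong_integral_cong_AE, rule AE_I2) (rule finite_coordinates_sum[where F=F and J=J, OF J F])
  also have "\<dots> = (\<Sum>\<theta>\<in>Pow J. measure Omega0 (cylinder J \<theta>) *\<^sub>R F (sign_point \<theta>))"
  proof -
    have "strongly_integrable Omega0 (\<lambda>\<omega>. indicator (cylinder J \<theta>) \<omega> *\<^sub>R F (sign_point \<theta>))"
      "strong_integral Omega0 (\<lambda>\<omega>. indicator (cylinder J \<theta>) \<omega> *\<^sub>R F (sign_point \<theta>)) = measure Omega0 (cylinder J \<theta>) *\<^sub>R F (sign_point \<theta>)" for \<theta>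
      by (rule strong_integral_indicator[OF cylinder_sets(1)[OF J] fin])+
    then show ?thesis by (subst strong_integral_sum) auto
  qed
  also have "\<dots> = (\<Sum>\<theta>\<in>Pow J. (1 / 2) ^ card J *\<^sub>R F (sign_point \<theta>))"
    using cylinder_sets(2)[OF J] by (simp add: measure_def)
  finally show "strong_integral Omega0 F = (1 / 2) ^ card J *\<^sub>R (\<Sum>\<theta>\<in>Pow J. F (sign_point \<theta>))"
    by (simp add: scaleR_sum_right)
qed

text \<open>
  Reverses the signs at the indices in \<open>E\<close>.
\<close>

definition flip :: "'i set \<Rightarrow> 'i set \<Rightarrow> 'i set"
  where "flip E B = (B - E) \<union> (E - B)"

lemma mem_flip: "j \<in> flip E B \<longleftrightarrow> (if j \<in> E then j \<notin> B else j \<in> B)"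
  by (auto simp: flip_def)

lemma sum_flip:
  assumes "E \<subseteq> K" shows "(\<Sum>B\<in>Pow K. F (flip E B)) = (\<Sum>B\<in>Pow K. F B)"
  using assms by (intro sum.reindex_bij_witness[of _ "flip E" "flip E"]) (auto simp: flip_def)

lemma sum_flip_odd:
  fixes F :: "'i set \<Rightarrow> 'a::real_vector"
  assumes "n \<in> K" "\<And>B. F (flip {n} B) = - F B"
  shows "(\<Sum>B\<in>Pow K. F B) = 0"
proof -
  have "(\<Sum>B\<in>Pow K. F B) = - (\<Sum>B\<in>Pow K. F B)"
    using sum_flip[of "{n}" K F] assms by (simp add: sum_negf)
  then have "2 *\<^sub>R (\<Sum>B\<in>Pow K. F B) = 0" by (simp only: scaleR_2 eq_neg_iff_add_eq_0)
  then show ?thesis by simp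
qed

lemma sign_point_flip: "sign_point (flip {n} B) j = (if j = n then - sign_point B j else sign_point B j)"
  by (auto simp: sign_point_def flip_def)

lemma rademacher_Lp: "(\<lambda>\<omega>. complex_of_real (\<omega> n)) \<in> Lp_fun Omega0 2"
  by (rule finite_coordinates_measurable(2)[of "{n}"]) (auto simp: space_Omega0 sign_point_def)

lemma inner_self:
  assumes "f \<in> Lp_fun M 2" "strong_integral M (\<lambda>x. f x * cnj (f x)) = 0"
  shows "AE x in M. f x = 0"
proof -
  obtain f' where f': "strongly_measurable M f'" "AE x in M. f x = f' x"
    using assms(1) by (auto simp: Lp_fun_def elim: ae_strongly_measurableE)
  have [measurable]: "f' \<in> borel_measurable M" using f' by (auto intro: strongly_measurable_borel)
  have f'Lp: "f' \<in> Lp_fun M 2" using Lp_fun_cong_AE[OF f'(2) assms(1)] .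
  have int: "strongly_integrable M (\<lambda>x. f' x * cnj (f' x))"
    by (rule strongly_integrable_times_cnj[OF f'Lp f'Lp])
  have ReSq: "Re (z * cnj z) = (cmod z)\<^sup>2" for z :: complex
    unfolding complex_norm_square[symmetric] by simp
  have "0 = Re (strong_integral M (\<lambda>x. f' x * cnj (f' x)))"
    using assms(2) strong_integral_cong_AE[of "\<lambda>x. f x * cnj (f x)" "\<lambda>x. f' x * cnj (f' x)" M] eventually_mono[OF f'(2)]
    by simp
  also have "\<dots> = strong_integral M (\<lambda>x. Re (f' x * cnj (f' x)))"
    by (rule strong_integral_linear[OF int bounded_linear_Re, symmetric])
  also have "\<dots> = strong_integral M (\<lambda>x. (cmod (f' x))\<^sup>2)"
    by (simp only: ReSq)
  finally have zero: "strong_integral M (\<lambda>x. (cmod (f' x))\<^sup>2) = 0" by simp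
  have "strongly_integrable M (\<lambda>x. Re (f' x * cnj (f' x)))"
    by (rule strongly_integrable_bounded_linear[OF int bounded_linear_Re])
  then have "strongly_integrable M (\<lambda>x. (cmod (f' x))\<^sup>2)"
    by (simp only: ReSq)
  from has_strong_integral_strong_integral[OF this]
  have "has_bochner_integral M (\<lambda>x. (cmod (f' x))\<^sup>2) 0"
    unfolding zero by (subst (asm) has_strong_integral_iff_has_bochner_integral) measurable
  then have "(\<integral>\<^sup>+x. ennreal ((cmod (f' x))\<^sup>2) \<partial>M) = 0"
    by (subst nn_integral_eq_integral) (auto simp: has_bochner_integral_iff)
  then have "AE x in M. ennreal ((cmod (f' x))\<^sup>2) = 0"
    by (subst (asm) nn_integral_0_iff_AE) measurable
  with f'(2) show ?thesis by eventually_elim simp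
qed

text \<open>
  The vectors orthogonal to \<open>f\<close> form a linear subspace and the inner product is continuous, so orthogonality is only
  needed on the spanning set.
\<close>

lemma inner_zero_closed_span:
  assumes S: "S \<subseteq> Lp_class M 2 ` Lp_fun M 2" and f: "f \<in> Lp_fun M 2"
    and orth: "\<And>s. s \<in> S \<Longrightarrow> L2_inner M (Lp_class M 2 f) s = 0"
    and H: "H \<in> closed_span (Lp_space M 2) S"
  shows "L2_inner M (Lp_class M 2 f) H = 0"
proof -
  define V where "V = {G \<in> ncarrier (Lp_space M 2 :: _ cnormed). L2_inner M (Lp_class M 2 f) G = 0}"
  have V: "Lp_class M 2 g \<in> V \<longleftrightarrow> strong_integral M (\<lambda>x. f x * cnj (g x)) = 0" if "g \<in> Lp_fun M 2" for g
    unfolding V_def using that f by (simp add: L2_inner_Lp_class)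
  have "linear_subspace (Lp_space M 2) V"
    unfolding linear_subspace_def
  proof (intro conjI ballI allI)
    show "V \<subseteq> ncarrier (Lp_space M 2)" by (auto simp: V_def)
    have "Lp_class M 2 (\<lambda>_. 0) \<in> V" by (subst V) (simp_all add: Lp_fun_zero strong_integral_zero)
    then show "V \<noteq> {}" by auto
  next
    fix G G' assume GG: "G \<in> V" "G' \<in> V"
    then obtain g g' where g: "g \<in> Lp_fun M 2" "g' \<in> Lp_fun M 2" "G = Lp_class M 2 g" "G' = Lp_class M 2 g'"
      by (auto simp: V_def)
    have "strong_integral M (\<lambda>x. f x * cnj (g x + g' x)) = strong_integral M (\<lambda>x. f x * cnj (g x)) + strong_integral M (\<lambda>x. f x * cnj (g' x))"
      using strong_integral_add[OF strongly_integrable_times_cnj[OF f g(1)] strongly_integrable_times_cnj[OF f g(2)]]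
      by (simp add: distrib_left)
    then show "nadd (Lp_space M 2) G G' \<in> V"
      using GG g by (simp add: nadd_Lp_space V Lp_fun_add)
  next
    fix c G assume G: "G \<in> V"
    then obtain g where g: "g \<in> Lp_fun M 2" "G = Lp_class M 2 g" by (auto simp: V_def)
    have "strong_integral M (\<lambda>x. f x * cnj (scaleC c (g x))) = cnj c * strong_integral M (\<lambda>x. f x * cnj (g x))"
      using strong_integral_linear[OF strongly_integrable_times_cnj[OF f g(1)] bounded_linear_mult_right[of "cnj c"]]
      by (simp add: scaleC_complex_def mult_ac)
    then show "nscale (Lp_space M 2) c G \<in> V"
      using G g by (simp add: nscale_Lp_space V Lp_fun_scaleC)
  qed
  moreover have "S \<subseteq> V" using S orth by (auto simp: V_def)
  ultimately have span: "linear_span (Lp_space M 2) S \<subseteq> V" unfolding linear_span_def by auto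
  obtain h where h: "h \<in> Lp_fun M 2" "H = Lp_class M 2 h" using H by (auto simp: closed_span_def)
  have "cmod (strong_integral M (\<lambda>x. f x * cnj (h x))) \<le> 0 + e" if "0 < e" for e
  proof -
    define d where "d = e / (Lp_norm M 2 f + 1)"
    have pos: "0 < Lp_norm M 2 f + 1" using Lp_norm_nonneg[of M 2 f] by simp
    then have "0 < d" using \<open>0 < e\<close> by (simp add: d_def)
    then obtain G where G: "G \<in> linear_span (Lp_space M 2) S" "nnorm (Lp_space M 2) (ndiff (Lp_space M 2) H G) < d"
      using H unfolding closed_span_def by blast
    then have "G \<in> V" using span by auto
    then obtain g where g: "g \<in> Lp_fun M 2" "G = Lp_class M 2 g" by (auto simp: V_def)
    have diff: "(\<lambda>x. h x - g x) \<in> Lp_fun M 2" using h g by (intro Lp_fun_diff) auto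
    have "Lp_norm M 2 (\<lambda>x. h x - g x) < d"
      using G(2) h g diff by (simp add: ndiff_Lp_space nnorm_Lp_space)
    moreover have "strong_integral M (\<lambda>x. f x * cnj (g x)) = 0" using \<open>G \<in> V\<close> g V by simp
    then have "strong_integral M (\<lambda>x. f x * cnj (h x)) = strong_integral M (\<lambda>x. f x * cnj (h x - g x))"
      using strong_integral_diff[OF strongly_integrable_times_cnj[OF f h(1)] strongly_integrable_times_cnj[OF f g(1)]]
      by (simp add: right_diff_distrib)
    ultimately have "cmod (strong_integral M (\<lambda>x. f x * cnj (h x))) \<le> Lp_norm M 2 f * d"
      using norm_L2_inner_le[OF f diff] Lp_norm_nonneg[of M 2 f] mult_left_mono[of "Lp_norm M 2 (\<lambda>x. h x - g x)" d "Lp_norm M 2 f"]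
      by simp
    also have "\<dots> \<le> (Lp_norm M 2 f + 1) * d" using \<open>0 < d\<close> by simp
    also have "\<dots> = e" using pos by (simp add: d_def)
    finally show ?thesis by simp
  qed
  then have "cmod (strong_integral M (\<lambda>x. f x * cnj (h x))) \<le> 0" by (rule field_le_epsilon)
  then show ?thesis using h f by (simp add: L2_inner_Lp_class)
qed

lemma linear_span_superset: "S \<subseteq> linear_span E S"
  unfolding linear_span_def by auto

lemma linear_span_add: "x \<in> linear_span E S \<Longrightarrow> y \<in> linear_span E S \<Longrightarrow> nadd E x y \<in> linear_span E S"
  unfolding linear_span_def linear_subspace_def by blast

lemma linear_span_scale: "x \<in> linear_span E S \<Longrightarrow> nscale E c x \<in> linear_span E S"
  unfolding linear_span_def linear_subspace_def by blast

lemma rademacher_sum_in_span: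
  "Lp_class Omega0 2 (\<lambda>\<omega>. \<Sum>j<m. a j * complex_of_real (\<omega> j)) \<in> linear_span L2_Omega0 (range rademacher)"
proof (induction m)
  case 0
  have "nscale L2_Omega0 0 (rademacher 0) \<in> linear_span L2_Omega0 (range rademacher)"
    by (intro linear_span_scale subsetD[OF linear_span_superset]) auto
  then show ?case
    by (simp add: rademacher_def nscale_Lp_space[OF rademacher_Lp] scaleC_zero_left)
next
  case (Suc m)
  have sum: "(\<lambda>\<omega>. \<Sum>j<m. a j * complex_of_real (\<omega> j)) \<in> Lp_fun Omega0 2"
    using Lp_fun_sum[of "{..<m}" "\<lambda>j \<omega>. scaleC (a j) (complex_of_real (\<omega> j))", OF Lp_fun_scaleC[OF rademacher_Lp]]
    by (simp add: scaleC_complex_def)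
  have "nscale L2_Omega0 (a m) (rademacher m) \<in> linear_span L2_Omega0 (range rademacher)"
    by (intro linear_span_scale subsetD[OF linear_span_superset]) auto
  from linear_span_add[OF Suc this] show ?case
    using nadd_Lp_space[OF sum Lp_fun_scaleC[OF rademacher_Lp]]
    by (simp add: rademacher_def nscale_Lp_space[OF rademacher_Lp] scaleC_complex_def)
qed

definition cylinder_function :: "nat \<Rightarrow> nat set \<Rightarrow> (nat \<Rightarrow> real) \<Rightarrow> complex"
  where "cylinder_function m \<theta> \<omega> = (if \<forall>j<m. \<omega> j = sign_point \<theta> j then 1 else 0)"

definition cylinder_projection :: "nat \<Rightarrow> nat set \<Rightarrow> (nat \<Rightarrow> real) \<Rightarrow> complex"
  where "cylinder_projection m \<theta> \<omega> = (\<Sum>j<m. of_real (sign_point \<theta> j / 2 ^ m) * of_real (\<omega> j))"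

lemma sign_point_restrict:
  assumes "\<omega> \<in> space Omega0" "P j"
  shows "sign_point {j. P j \<and> \<omega> j = 1} j = \<omega> j"
proof -
  have "\<omega> j = - 1 \<or> \<omega> j = 1" using assms(1) by (simp add: space_Omega0)
  then show ?thesis using assms(2) by (auto simp: sign_point_def)
qed

lemma cylinder_function_Lp: "cylinder_function m \<theta> \<in> Lp_fun Omega0 2"
  by (rule finite_coordinates_measurable(2)[of "{..<m}"]) (auto simp: cylinder_function_def sign_point_restrict)

lemma cylinder_projection_Lp: "cylinder_projection m \<theta> \<in> Lp_fun Omega0 2"
  by (rule finite_coordinates_measurable(2)[of "{..<m}"]) (auto simp: cylinder_projection_def sign_point_restrict)

lemma cylinder_inner_rademacher:
  assumes "\<theta> \<subseteq> {..<m}"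
  shows "strong_integral Omega0 (\<lambda>\<omega>. cylinder_function m \<theta> \<omega> * complex_of_real (\<omega> n)) = of_real (if n < m then sign_point \<theta> n / 2 ^ m else 0)"
proof (cases "n < m")
  case True
  have "strong_integral Omega0 (\<lambda>\<omega>. cylinder_function m \<theta> \<omega> * complex_of_real (\<omega> n))
      = (1 / 2) ^ card {..<m} *\<^sub>R (\<Sum>B\<in>Pow {..<m}. cylinder_function m \<theta> (sign_point B) * complex_of_real (sign_point B n))"
    using True by (intro finite_coordinates_measurable(3)) (auto simp: cylinder_function_def sign_point_restrict)
  also have "(\<Sum>B\<in>Pow {..<m}. cylinder_function m \<theta> (sign_point B) * complex_of_real (sign_point B n))
      = (\<Sum>B\<in>Pow {..<m}. if B = \<theta> then complex_of_real (sign_point \<theta> n) else 0)"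
  proof (intro sum.cong refl)
    fix B assume "B \<in> Pow {..<m}"
    then have "(\<forall>j<m. sign_point B j = sign_point \<theta> j) \<longleftrightarrow> B = \<theta>"
      using assms by (auto simp: sign_point_def split: if_splits)
    then show "cylinder_function m \<theta> (sign_point B) * complex_of_real (sign_point B n) = (if B = \<theta> then complex_of_real (sign_point \<theta> n) else 0)"
      by (auto simp: cylinder_function_def)
  qed
  also have "\<dots> = complex_of_real (sign_point \<theta> n)" using assms by (subst sum.delta) auto
  finally show ?thesis using True by (simp add: scaleR_conv_of_real power_divide)
next
  case False
  have "strong_integral Omega0 (\<lambda>\<omega>. cylinder_function m \<theta> \<omega> * complex_of_real (\<omega> n))
      = (1 / 2) ^ card {..n} *\<^sub>R (\<Sum>B\<in>Pow {..n}. cylinder_function m \<theta> (sign_point B) * complex_of_real (sign_point B n))"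
    using False by (intro finite_coordinates_measurable(3)) (auto simp: cylinder_function_def sign_point_restrict)
  also have "(\<Sum>B\<in>Pow {..n}. cylinder_function m \<theta> (sign_point B) * complex_of_real (sign_point B n)) = 0"
    using False by (intro sum_flip_odd[of n]) (auto simp: cylinder_function_def sign_point_flip)
  finally show ?thesis using False by simp
qed

lemma rademacher_inner_rademacher:
  "strong_integral Omega0 (\<lambda>\<omega>. complex_of_real (\<omega> j) * complex_of_real (\<omega> n)) = (if j = n then 1 else 0)"
proof -
  have "strong_integral Omega0 (\<lambda>\<omega>. complex_of_real (\<omega> j) * complex_of_real (\<omega> n))
      = (1 / 2) ^ card {j, n} *\<^sub>R (\<Sum>B\<in>Pow {j, n}. complex_of_real (sign_point B j) * complex_of_real (sign_point B n))"
    by (intro finite_coordinates_measurable(3)) (auto simp: sign_point_restrict)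
  also have "\<dots> = (if j = n then 1 else 0)"
  proof (cases "j = n")
    case True
    have "complex_of_real (sign_point B n) * complex_of_real (sign_point B n) = 1" for B by (simp add: sign_point_def)
    then show ?thesis using True by (simp add: card_Pow scaleR_conv_of_real)
  next
    case False
    then have "(\<Sum>B\<in>Pow {j, n}. complex_of_real (sign_point B j) * complex_of_real (sign_point B n)) = 0"
      by (intro sum_flip_odd[of n]) (auto simp: sign_point_flip)
    with False show ?thesis by simp
  qed
  finally show ?thesis .
qed

text \<open>
  The orthogonal projection of a cylinder indicator is the finite sum of its Rademacher coefficients:
  the difference is orthogonal to every Rademacher function, and two such elements of \<open>Rad2\<close> agree since
  their difference is orthogonal to itself.
\<close>

lemma rad_projection_cylinder:
  assumes th: "\<theta> \<subseteq> {..<m}"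
  shows "rad_projection (Lp_class Omega0 2 (cylinder_function m \<theta>)) = Lp_class Omega0 2 (cylinder_projection m \<theta>)"
proof -
  let ?f = "cylinder_function m \<theta>" and ?g = "cylinder_projection m \<theta>"
  note Lp = cylinder_function_Lp[of m \<theta>] cylinder_projection_Lp[of m \<theta>]
  have diffLp: "(\<lambda>x. ?f x - ?g x) \<in> Lp_fun Omega0 2" by (intro Lp_fun_diff Lp) simp
  have orth: "L2_inner Omega0 (Lp_class Omega0 2 (\<lambda>x. ?f x - ?g x)) H = 0" if "H \<in> Rad2" for H
  proof (rule inner_zero_closed_span[OF _ diffLp _ that[unfolded Rad2_def]])
    show "range rademacher \<subseteq> Lp_class Omega0 2 ` Lp_fun Omega0 2"
      by (auto simp: rademacher_def rademacher_Lp)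
    fix s assume "s \<in> range rademacher"
    then obtain n where s: "s = Lp_class Omega0 2 (\<lambda>\<omega>. complex_of_real (\<omega> n))" by (auto simp: rademacher_def)
    have int: "strongly_integrable Omega0 (\<lambda>\<omega>. h \<omega> * complex_of_real (\<omega> n))" if "h \<in> Lp_fun Omega0 2" for h
      using strongly_integrable_times_cnj[OF that rademacher_Lp] by simp
    have "strong_integral Omega0 (\<lambda>\<omega>. (?f \<omega> - ?g \<omega>) * cnj (complex_of_real (\<omega> n)))
        = strong_integral Omega0 (\<lambda>\<omega>. ?f \<omega> * complex_of_real (\<omega> n)) - strong_integral Omega0 (\<lambda>\<omega>. ?g \<omega> * complex_of_real (\<omega> n))"
      using strong_integral_diff[OF int[OF Lp(1)] int[OF Lp(2)]] by (simp add: left_diff_distrib)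
    also have "strong_integral Omega0 (\<lambda>\<omega>. ?g \<omega> * complex_of_real (\<omega> n))
        = (\<Sum>j<m. of_real (sign_point \<theta> j / 2 ^ m) * strong_integral Omega0 (\<lambda>\<omega>. of_real (\<omega> j) * complex_of_real (\<omega> n)))"
    proof -
      define a where "a j = complex_of_real (sign_point \<theta> j / 2 ^ m)" for j
      have a: "strongly_integrable Omega0 (\<lambda>\<omega>. a j * (of_real (\<omega> j) * complex_of_real (\<omega> n)))"
        "strong_integral Omega0 (\<lambda>\<omega>. a j * (of_real (\<omega> j) * complex_of_real (\<omega> n)))
          = a j * strong_integral Omega0 (\<lambda>\<omega>. of_real (\<omega> j) * complex_of_real (\<omega> n))" for j
        by (rule strongly_integrable_bounded_linear[OF int[OF rademacher_Lp] bounded_linear_mult_right])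
          (rule strong_integral_linear[OF int[OF rademacher_Lp] bounded_linear_mult_right])
      have "strong_integral Omega0 (\<lambda>\<omega>. \<Sum>j<m. a j * (of_real (\<omega> j) * complex_of_real (\<omega> n)))
        = (\<Sum>j<m. a j * strong_integral Omega0 (\<lambda>\<omega>. of_real (\<omega> j) * complex_of_real (\<omega> n)))"
        by (subst strong_integral_sum[OF a(1)]) (simp only: a(2))
      then show ?thesis
        by (simp only: a_def[symmetric] cylinder_projection_def sum_distrib_right mult.assoc)
    qed
    also have "\<dots> = (\<Sum>j<m. if j = n then complex_of_real (sign_point \<theta> j / 2 ^ m) else 0)"
      unfolding rademacher_inner_rademacher by (intro sum.cong) auto
    also have "\<dots> = of_real (if n < m then sign_point \<theta> n / 2 ^ m else 0)" by simp
    finally have "strong_integral Omega0 (\<lambda>\<omega>. (?f \<omega> - ?g \<omega>) * cnj (complex_of_real (\<omega> n))) = 0"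
      unfolding cylinder_inner_rademacher[OF th] by simp
    then show "L2_inner Omega0 (Lp_class Omega0 2 (\<lambda>x. ?f x - ?g x)) s = 0"
      unfolding s L2_inner_Lp_class[OF diffLp rademacher_Lp] .
  qed
  have in_span: "Lp_class Omega0 2 ?g \<in> linear_span L2_Omega0 (range rademacher)"
    unfolding cylinder_projection_def by (rule rademacher_sum_in_span)
  have "ndiff L2_Omega0 (Lp_class Omega0 2 ?g) (Lp_class Omega0 2 ?g) = Lp_class Omega0 2 (\<lambda>_. 0)"
    using Lp by (simp add: ndiff_Lp_space)
  then have "nnorm L2_Omega0 (ndiff L2_Omega0 (Lp_class Omega0 2 ?g) (Lp_class Omega0 2 ?g)) = 0"
    by (simp add: nnorm_Lp_space Lp_fun_zero Lp_norm_zero)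
  then have in_Rad: "Lp_class Omega0 2 ?g \<in> Rad2"
    unfolding Rad2_def closed_span_def using in_span Lp by (auto intro!: bexI[OF _ in_span])
  have ndiff: "ndiff L2_Omega0 (Lp_class Omega0 2 ?f) (Lp_class Omega0 2 h) = Lp_class Omega0 2 (\<lambda>x. ?f x - h x)"
    if "h \<in> Lp_fun Omega0 2" for h
    using that Lp by (intro ndiff_Lp_space) auto
  show ?thesis unfolding rad_projection_def
  proof (rule the_equality, intro conjI ballI)
    show "Lp_class Omega0 2 ?g \<in> Rad2" by (rule in_Rad)
    show "L2_inner Omega0 (ndiff L2_Omega0 (Lp_class Omega0 2 ?f) (Lp_class Omega0 2 ?g)) H = 0" if "H \<in> Rad2" for H
      unfolding ndiff[OF Lp(2)] by (rule orth[OF that])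
  next
    fix G assume "G \<in> Rad2 \<and> (\<forall>H\<in>Rad2. L2_inner Omega0 (ndiff L2_Omega0 (Lp_class Omega0 2 ?f) G) H = 0)"
    then have G: "G \<in> Rad2" and G_orth: "\<forall>H\<in>Rad2. L2_inner Omega0 (ndiff L2_Omega0 (Lp_class Omega0 2 ?f) G) H = 0"
      by auto
    then obtain g where g: "g \<in> Lp_fun Omega0 2" "G = Lp_class Omega0 2 g"
      by (auto simp: Rad2_def closed_span_def)
    have fg: "(\<lambda>x. ?f x - g x) \<in> Lp_fun Omega0 2" by (intro Lp_fun_diff Lp g) simp
    have gg: "(\<lambda>x. ?g x - g x) \<in> Lp_fun Omega0 2" by (intro Lp_fun_diff Lp g) simp
    have zero: "strong_integral Omega0 (\<lambda>x. (?g x - g x) * cnj (h x)) = 0"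
      if "h \<in> Lp_fun Omega0 2" "Lp_class Omega0 2 h \<in> Rad2" for h
    proof -
      have "strong_integral Omega0 (\<lambda>x. (?f x - g x) * cnj (h x)) = 0"
        using G_orth that L2_inner_Lp_class[OF fg that(1)] ndiff[OF g(1)] by (auto simp: g(2))
      moreover have "strong_integral Omega0 (\<lambda>x. (?f x - ?g x) * cnj (h x)) = 0"
        using orth[OF that(2)] L2_inner_Lp_class[OF diffLp that(1)] by simp
      ultimately show ?thesis
        using strong_integral_diff[OF strongly_integrable_times_cnj[OF fg that(1)] strongly_integrable_times_cnj[OF diffLp that(1)]]
        by (simp add: left_diff_distrib algebra_simps)
    qed
    have "strong_integral Omega0 (\<lambda>x. (?g x - g x) * cnj (?g x - g x)) = 0"
      using strong_integral_diff[OF strongly_integrable_times_cnj[OF gg Lp(2)] strongly_integrable_times_cnj[OF gg g(1)]]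
        zero[OF Lp(2) in_Rad] zero[OF g(1) G[unfolded g(2)]]
      by (simp add: right_diff_distrib)
    from inner_self[OF gg this] have "AE x in Omega0. g x = ?g x" by (rule eventually_mono) simp
    then show "G = Lp_class Omega0 2 ?g" unfolding g(2) by (rule Lp_class_cong)
  qed
qed

text \<open>
  K-convexity applied to the step function with value \<open>x \<theta>\<close> on the cylinder of \<open>\<theta>\<close>. Its image has the
  displayed values, so a lower bound \<open>c\<close> for their norms is one for the norm of the image.
\<close>

lemma K_convex_cylinder_bound:
  assumes "K_convex TYPE('x::complex_banach)"
  obtains C where "0 \<le> C"
    "\<And>m (x :: nat set \<Rightarrow> 'x) c. (\<And>\<theta>. \<theta> \<subseteq> {..<m} \<Longrightarrow> norm (x \<theta>) \<le> 1) \<Longrightarrow> 0 \<le> c \<Longrightarrow>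
      (\<And>B. B \<subseteq> {..<m} \<Longrightarrow> c \<le> norm (\<Sum>\<theta>\<in>Pow {..<m}. ((\<Sum>j<m. sign_point \<theta> j * sign_point B j) / 2 ^ m) *\<^sub>R x \<theta>)) \<Longrightarrow> c \<le> C"
proof -
  obtain R :: "((nat \<Rightarrow> real) \<Rightarrow> 'x) set \<Rightarrow> ((nat \<Rightarrow> real) \<Rightarrow> 'x) set" where
    R: "bounded_operator L2_Omega0 R"
    and R_tensor: "\<And>F x. F \<in> ncarrier L2_Omega0 \<Longrightarrow> R (L2_tensor F x) = L2_tensor (rad_projection F) x"
    using assms unfolding K_convex_def by blast
  obtain C where C: "0 \<le> C"
    "\<And>X. X \<in> ncarrier L2_Omega0 \<Longrightarrow> 0 \<le> nnorm L2_Omega0 X \<Longrightarrow> nnorm L2_Omega0 (R X) \<le> C * nnorm L2_Omega0 X"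
    by (rule bounded_operator_bound[OF R]) blast
  have R_add: "R (Lp_class Omega0 2 (\<lambda>\<omega>. f \<omega> + g \<omega>)) = nadd L2_Omega0 (R (Lp_class Omega0 2 f)) (R (Lp_class Omega0 2 g))"
    if "f \<in> Lp_fun Omega0 2" "g \<in> Lp_fun Omega0 2" for f g
  proof -
    have "Lp_class Omega0 2 f \<in> ncarrier L2_Omega0" "Lp_class Omega0 2 g \<in> ncarrier L2_Omega0"
      using that by simp_all
    then have "R (nadd L2_Omega0 (Lp_class Omega0 2 f) (Lp_class Omega0 2 g)) = nadd L2_Omega0 (R (Lp_class Omega0 2 f)) (R (Lp_class Omega0 2 g))"
      using R unfolding bounded_operator_def by blast
    then show ?thesis using that by (simp add: nadd_Lp_space)
  qed
  have R_zero: "R (Lp_class Omega0 2 (\<lambda>_. 0 :: 'x)) = Lp_class Omega0 2 (\<lambda>_. 0)"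
  proof -
    have z: "(\<lambda>_. 0 :: 'x) \<in> Lp_fun Omega0 2" by (simp add: Lp_fun_zero)
    then have "R (Lp_class Omega0 2 (\<lambda>_. 0 :: 'x)) \<in> Lp_class Omega0 2 ` Lp_fun Omega0 2"
      using R unfolding bounded_operator_def by auto
    then obtain g where g: "g \<in> Lp_fun Omega0 2" "R (Lp_class Omega0 2 (\<lambda>_. 0 :: 'x)) = Lp_class Omega0 2 g" by auto
    have "R (nscale L2_Omega0 0 (Lp_class Omega0 2 (\<lambda>_. 0))) = nscale L2_Omega0 0 (R (Lp_class Omega0 2 (\<lambda>_. 0 :: 'x)))"
    proof -
      have "Lp_class Omega0 2 (\<lambda>_. 0) \<in> ncarrier (L2_Omega0 :: ((nat \<Rightarrow> real) \<Rightarrow> 'x) set cnormed)"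
        using z by simp
      then show ?thesis using R unfolding bounded_operator_def by blast
    qed
    then show ?thesis using g z by (simp add: nscale_Lp_space scaleC_zero_left)
  qed
  have tensor: "L2_tensor (Lp_class Omega0 2 f) x = Lp_class Omega0 2 (\<lambda>\<omega>. scaleC (f \<omega>) x)"
    if "f \<in> Lp_fun Omega0 2" for f and x :: 'x
    unfolding L2_tensor_def
    by (rule Lp_class_cong) (use repr_Lp_class(2)[OF that] in eventually_elim, simp)
  show ?thesis
  proof (rule that[OF C(1)])
    fix m c and x :: "nat set \<Rightarrow> 'x"
    assume x: "\<And>\<theta>. \<theta> \<subseteq> {..<m} \<Longrightarrow> norm (x \<theta>) \<le> 1" and "0 \<le> c"
      and c: "\<And>B. B \<subseteq> {..<m} \<Longrightarrow> c \<le> norm (\<Sum>\<theta>\<in>Pow {..<m}. ((\<Sum>j<m. sign_point \<theta> j * sign_point B j) / 2 ^ m) *\<^sub>R x \<theta>)"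
    have fLp: "(\<lambda>\<omega>. scaleC (cylinder_function m \<theta> \<omega>) (y::'x)) \<in> Lp_fun Omega0 2" for \<theta> y
      by (rule finite_coordinates_measurable(2)[of "{..<m}"]) (auto simp: cylinder_function_def sign_point_restrict)
    have gLp: "(\<lambda>\<omega>. scaleC (cylinder_projection m \<theta> \<omega>) (y::'x)) \<in> Lp_fun Omega0 2" for \<theta> y
      by (rule finite_coordinates_measurable(2)[of "{..<m}"]) (auto simp: cylinder_projection_def sign_point_restrict)
    have R_sum: "R (Lp_class Omega0 2 (\<lambda>\<omega>. \<Sum>\<theta>\<in>A. scaleC (cylinder_function m \<theta> \<omega>) (x \<theta>)))
        = Lp_class Omega0 2 (\<lambda>\<omega>. \<Sum>\<theta>\<in>A. scaleC (cylinder_projection m \<theta> \<omega>) (x \<theta>))"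
      if "finite A" "A \<subseteq> Pow {..<m}" for A
      using that
    proof (induction A rule: finite_induct)
      case empty
      then show ?case using R_zero by simp
    next
      case (insert \<theta> A)
      have "R (Lp_class Omega0 2 (\<lambda>\<omega>. scaleC (cylinder_function m \<theta> \<omega>) (x \<theta>))) = Lp_class Omega0 2 (\<lambda>\<omega>. scaleC (cylinder_projection m \<theta> \<omega>) (x \<theta>))"
        using R_tensor[of "Lp_class Omega0 2 (cylinder_function m \<theta>)" "x \<theta>"] insert.prems
        by (simp add: tensor cylinder_function_Lp cylinder_projection_Lp rad_projection_cylinder)
      then show ?case using insert
        by (simp add: R_add fLp gLp Lp_fun_sum nadd_Lp_space)
    qed
    define f where "f \<omega> = (\<Sum>\<theta>\<in>Pow {..<m}. scaleC (cylinder_function m \<theta> \<omega>) (x \<theta>))" for \<omega>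
    define g where "g \<omega> = (\<Sum>\<theta>\<in>Pow {..<m}. scaleC (cylinder_projection m \<theta> \<omega>) (x \<theta>))" for \<omega>
    have fgLp: "f \<in> Lp_fun Omega0 2" "g \<in> Lp_fun Omega0 2"
      unfolding f_def g_def by (auto intro!: Lp_fun_sum fLp gLp)
    have "norm (f \<omega>) \<le> 1" if om: "\<omega> \<in> space Omega0" for \<omega>
    proof -
      let ?t = "{j\<in>{..<m}. \<omega> j = 1}"
      have "(\<forall>j<m. \<omega> j = sign_point \<theta> j) \<longleftrightarrow> \<theta> = ?t" if "\<theta> \<subseteq> {..<m}" for \<theta>
        using mem_cylinder_iff[OF om that] by (simp add: Ball_def)
      then have "f \<omega> = (\<Sum>\<theta>\<in>Pow {..<m}. if \<theta> = ?t then x \<theta> else 0)"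
        unfolding f_def by (intro sum.cong refl) (simp add: cylinder_function_def scaleC_one scaleC_zero_left)
      also have "\<dots> = x ?t" by (subst sum.delta) auto
      finally show ?thesis using x[of ?t] by auto
    qed
    then have "Lp_int Omega0 2 f \<le> (\<integral>\<^sup>+\<omega>. 1 \<partial>Omega0)"
      by (intro nn_integral_mono) (simp add: powr_numeral power_le_one)
    also have "\<dots> = 1" using prob_space.emeasure_space_1[OF prob_space_Omega0] by simp
    finally have f1: "Lp_norm Omega0 2 f \<le> 1" using fgLp by (subst Lp_norm_le_iff) auto
    have g_ge: "c \<le> norm (g \<omega>)" if om: "\<omega> \<in> space Omega0" for \<omega>
    proof -
      let ?t = "{j\<in>{..<m}. \<omega> j = 1}"
      have "scaleC (cylinder_projection m \<theta> \<omega>) (x \<theta>) = ((\<Sum>j<m. sign_point \<theta> j * sign_point ?t j) / 2 ^ m) *\<^sub>R x \<theta>" for \<theta>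
      proof -
        have "cylinder_projection m \<theta> \<omega> = of_real ((\<Sum>j<m. sign_point \<theta> j * sign_point ?t j) / 2 ^ m)"
          unfolding cylinder_projection_def using om by (simp add: sign_point_restrict sum_divide_distrib)
        then show ?thesis by (simp only: scaleC_of_real)
      qed
      moreover have "?t \<subseteq> {..<m}" by auto
      ultimately show ?thesis using c[of ?t] by (simp add: g_def)
    qed
    have "ennreal (c powr 2) = (\<integral>\<^sup>+\<omega>. ennreal (c powr 2) \<partial>Omega0)"
      using prob_space.emeasure_space_1[OF prob_space_Omega0] by simp
    also have "\<dots> \<le> Lp_int Omega0 2 g"
      using g_ge \<open>0 \<le> c\<close> by (intro nn_integral_mono ennreal_leI powr_mono2) auto
    also have "\<dots> = ennreal (Lp_norm Omega0 2 g powr 2)" using Lp_norm_powr[OF fgLp(2)] by simp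
    finally have "c powr 2 \<le> Lp_norm Omega0 2 g powr 2" by simp
    then have "c\<^sup>2 \<le> (Lp_norm Omega0 2 g)\<^sup>2"
      using \<open>0 \<le> c\<close> Lp_norm_nonneg[of Omega0 2 g] by simp
    then have "c \<le> Lp_norm Omega0 2 g"
      by (rule power2_le_imp_le) (rule Lp_norm_nonneg)
    also have "Lp_norm Omega0 2 g = nnorm L2_Omega0 (R (Lp_class Omega0 2 f))"
      using R_sum[of "Pow {..<m}"] fgLp unfolding f_def[symmetric] g_def[symmetric] by (simp add: nnorm_Lp_space)
    also have "\<dots> \<le> C * Lp_norm Omega0 2 f"
      using C(2)[of "Lp_class Omega0 2 f"] fgLp Lp_norm_nonneg[of Omega0 2 f] by (simp add: nnorm_Lp_space)
    also have "\<dots> \<le> C" using C(1) f1 mult_left_mono[OF f1 C(1)] by simp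
    finally show "c \<le> C" .
  qed
qed

section \<open>B-convexity\<close>

lemma sum_Pow_insert:
  assumes "finite K" "n \<notin> K"
  shows "(\<Sum>B\<in>Pow (insert n K). F B) = (\<Sum>B\<in>Pow K. F B + F (insert n B))"
proof -
  have "(\<Sum>B\<in>Pow (insert n K). F B) = (\<Sum>B\<in>Pow K. F B) + (\<Sum>B\<in>insert n ` Pow K. F B)"
    unfolding Pow_insert using assms by (intro sum.union_disjoint) auto
  also have "(\<Sum>B\<in>insert n ` Pow K. F B) = (\<Sum>B\<in>Pow K. F (insert n B))"
    using assms by (subst sum.reindex) (auto simp: inj_on_def)
  finally show ?thesis by (simp add: sum.distrib)
qed

lemma sign_sum_moments:
  shows "(\<Sum>B\<in>Pow {..<m}. (\<Sum>j<m. sign_point B j)\<^sup>2) = 2 ^ m * real m"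
    and "(\<Sum>B\<in>Pow {..<m}. (\<Sum>j<m. sign_point B j) ^ 4) = 2 ^ m * (3 * (real m)\<^sup>2 - 2 * real m)"
proof -
  have "(\<Sum>B\<in>Pow {..<m}. (\<Sum>j<m. sign_point B j)\<^sup>2) = 2 ^ m * real m \<and>
    (\<Sum>B\<in>Pow {..<m}. (\<Sum>j<m. sign_point B j) ^ 4) = 2 ^ m * (3 * (real m)\<^sup>2 - 2 * real m)"
  proof (induction m)
    case (Suc m)
    define S where "S B = (\<Sum>j<m. sign_point B j)" for B
    have step: "(\<Sum>B\<in>Pow {..<Suc m}. (\<Sum>j<Suc m. sign_point B j) ^ r) = (\<Sum>B\<in>Pow {..<m}. (S B - 1) ^ r + (S B + 1) ^ r)" for r
    proof -
      have "(\<Sum>j<Suc m. sign_point B j) = S B - 1" "(\<Sum>j<Suc m. sign_point (insert m B) j) = S B + 1"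
        if "B \<subseteq> {..<m}" for B
        using that by (auto simp: S_def sign_point_def intro!: sum.cong)
      then show ?thesis
        unfolding lessThan_Suc by (subst sum_Pow_insert) (auto simp flip: lessThan_Suc)
    qed
    have IH: "(\<Sum>B\<in>Pow {..<m}. (S B)\<^sup>2) = 2 ^ m * real m"
      "(\<Sum>B\<in>Pow {..<m}. (S B) ^ 4) = 2 ^ m * (3 * (real m)\<^sup>2 - 2 * real m)"
      using Suc unfolding S_def by auto
    have one: "(\<Sum>B\<in>Pow {..<m}. 1 :: real) = 2 ^ m" by (simp add: card_Pow)
    have "(\<Sum>B\<in>Pow {..<m}. (S B - 1) ^ 2 + (S B + 1) ^ 2) = (\<Sum>B\<in>Pow {..<m}. 2 * (S B)\<^sup>2 + 2 * 1)"
      by (intro sum.cong refl) (simp add: power2_eq_square algebra_simps)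
    also have "\<dots> = 2 * (2 ^ m * real m) + 2 * 2 ^ m"
      unfolding sum.distrib sum_distrib_left[symmetric] IH one ..
    finally have 2: "(\<Sum>B\<in>Pow {..<m}. (S B - 1) ^ 2 + (S B + 1) ^ 2) = 2 * (2 ^ m * real m) + 2 * 2 ^ m" .
    have "(\<Sum>B\<in>Pow {..<m}. (S B - 1) ^ 4 + (S B + 1) ^ 4) = (\<Sum>B\<in>Pow {..<m}. 2 * S B ^ 4 + 12 * (S B)\<^sup>2 + 2 * 1)"
      by (intro sum.cong refl) (simp add: power2_eq_square power4_eq_xxxx algebra_simps)
    also have "\<dots> = 2 * (2 ^ m * (3 * (real m)\<^sup>2 - 2 * real m)) + 12 * (2 ^ m * real m) + 2 * 2 ^ m"
      unfolding sum.distrib sum_distrib_left[symmetric] IH one ..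
    finally have 4: "(\<Sum>B\<in>Pow {..<m}. (S B - 1) ^ 4 + (S B + 1) ^ 4) = 2 * (2 ^ m * (3 * (real m)\<^sup>2 - 2 * real m)) + 12 * (2 ^ m * real m) + 2 * 2 ^ m" .
    show ?case unfolding step 2 4 by (simp add: power2_eq_square algebra_simps)
  qed simp
  then show "(\<Sum>B\<in>Pow {..<m}. (\<Sum>j<m. sign_point B j)\<^sup>2) = 2 ^ m * real m"
    and "(\<Sum>B\<in>Pow {..<m}. (\<Sum>j<m. sign_point B j) ^ 4) = 2 ^ m * (3 * (real m)\<^sup>2 - 2 * real m)" by auto
qed

text \<open>
  A weak form of Khinchin's inequality: the second moment is \<open>m\<close> and the fourth at most \<open>3 m\<^sup>2\<close>, so the mean of
  the absolute value is of order \<open>\<surd>m\<close>.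
\<close>

lemma sign_sum_unbounded:
  obtains m where "0 < m" "2 ^ m * A \<le> (\<Sum>B\<in>Pow {..<m}. \<bar>\<Sum>j<m. sign_point B j\<bar>)"
proof -
  define n where "n = nat \<lceil>\<bar>A\<bar>\<rceil> + 1"
  have n: "0 < n" "A \<le> real n" unfolding n_def by linarith+
  define m where "m = 2 * (2 * n)\<^sup>2"
  define c where "c = real (4 * n)"
  have c: "0 < c" "c\<^sup>2 = 2 * real m" using n by (auto simp: c_def m_def power2_eq_square)
  \<comment> \<open>The even quartic that touches the absolute value at \<open>\<plusminus>c\<close>; only two moments are then needed.\<close>
  have pt: "3 / (2 * c) * s\<^sup>2 - 1 / (2 * c ^ 3) * s ^ 4 \<le> \<bar>s\<bar>" for s :: real
  proof -
    define t where "t = \<bar>s\<bar> / c"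
    have t: "0 \<le> t" "\<bar>s\<bar> = c * t" using c by (auto simp: t_def)
    have "0 \<le> c * (t * (1 / 2 * ((t - 1)\<^sup>2 * (t + 2))))" using t c by (intro mult_nonneg_nonneg) auto
    also have "\<dots> = c * t - (3 / 2 * c * t\<^sup>2 - 1 / 2 * c * t ^ 4)" by (simp add: power2_eq_square power4_eq_xxxx algebra_simps)
    also have "3 / 2 * c * t\<^sup>2 = 3 / (2 * c) * s\<^sup>2"
      using c(1) by (simp add: t_def power2_eq_square field_simps)
    also have "1 / 2 * c * t ^ 4 = 1 / (2 * c ^ 3) * s ^ 4"
      using c(1) by (simp add: t_def power_divide power4_eq_xxxx power3_eq_cube field_simps)
    finally show ?thesis using t by simp
  qed
  have "(\<Sum>B\<in>Pow {..<m}. 3 / (2 * c) * (\<Sum>j<m. sign_point B j)\<^sup>2 - 1 / (2 * c ^ 3) * (\<Sum>j<m. sign_point B j) ^ 4)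
      \<le> (\<Sum>B\<in>Pow {..<m}. \<bar>\<Sum>j<m. sign_point B j\<bar>)"
    by (intro sum_mono pt)
  moreover have "(\<Sum>B\<in>Pow {..<m}. 3 / (2 * c) * (\<Sum>j<m. sign_point B j)\<^sup>2 - 1 / (2 * c ^ 3) * (\<Sum>j<m. sign_point B j) ^ 4)
     = 2 ^ m * (3 / (2 * c) * real m - 1 / (2 * c ^ 3) * (3 * (real m)\<^sup>2 - 2 * real m))"
    unfolding sum_subtractf sum_distrib_left[symmetric] sign_sum_moments by (simp add: algebra_simps)
  moreover have "A \<le> 3 / (2 * c) * real m - 1 / (2 * c ^ 3) * (3 * (real m)\<^sup>2 - 2 * real m)"
  proof -
    have m: "real m = c\<^sup>2 / 2" using c by simp
    have "1 / (2 * c ^ 3) * (3 * (real m)\<^sup>2 - 2 * real m) \<le> 1 / (2 * c ^ 3) * (3 * (real m)\<^sup>2)"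
      using c by (intro mult_left_mono) auto
    also have "\<dots> = 3 / 8 * c" using c(1) unfolding m by (simp add: power2_eq_square power3_eq_cube field_simps)
    finally have "3 / 4 * c - 3 / 8 * c \<le> 3 / (2 * c) * real m - 1 / (2 * c ^ 3) * (3 * (real m)\<^sup>2 - 2 * real m)"
      using c(1) unfolding m by (simp add: power2_eq_square field_simps)
    then have "3 / 8 * c \<le> 3 / (2 * c) * real m - 1 / (2 * c ^ 3) * (3 * (real m)\<^sup>2 - 2 * real m)"
      by linarith
    moreover have "A \<le> 3 / 8 * c" using n by (simp add: c_def)
    ultimately show ?thesis by (rule order_trans[rotated])
  qed
  ultimately have "2 ^ m * A \<le> (\<Sum>B\<in>Pow {..<m}. \<bar>\<Sum>j<m. sign_point B j\<bar>)"
    by (smt (verit) mult_left_mono zero_le_power)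
  moreover have "0 < m" using n by (simp add: m_def)
  ultimately show ?thesis using that by blast
qed

lemma norm_signed [simp]: "norm (signed B j (x::'a::real_normed_vector)) = norm x"
  by (simp add: signed_def)

text \<open>
  Suppose that for \<open>k = 2\<^sup>m\<close> there were vectors \<open>x \<theta>\<close>, indexed by the cube, all of whose signed sums are almost as
  long as in \<open>\<ell>\<^sub>1\<close>. Then the sums in \<open>K_convex_cylinder_bound\<close> would have norm at least about the mean of
  \<open>\<bar>\<Sum>j. \<theta> j\<bar>\<close>, for every point \<open>B\<close>, by symmetry of the cube. These means are unbounded in \<open>m\<close>.
\<close>

lemma K_convex_imp_B_convex:
  assumes "K_convex TYPE('x::complex_banach)"
  obtains k \<delta> where "0 < k" "0 < \<delta>" "\<delta> < 1"
    "\<And>x :: nat \<Rightarrow> 'x. (\<And>j. j < k \<Longrightarrow> norm (x j) \<le> 1) \<Longrightarrow> \<exists>B\<subseteq>{..<k}. norm (\<Sum>j<k. signed B j (x j)) \<le> (1 - \<delta>) * real k"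
proof (rule K_convex_cylinder_bound[OF assms])
  fix C assume C: "0 \<le> C"
    "\<And>m (x :: nat set \<Rightarrow> 'x) c. (\<And>\<theta>. \<theta> \<subseteq> {..<m} \<Longrightarrow> norm (x \<theta>) \<le> 1) \<Longrightarrow> 0 \<le> c \<Longrightarrow>
      (\<And>B. B \<subseteq> {..<m} \<Longrightarrow> c \<le> norm (\<Sum>\<theta>\<in>Pow {..<m}. ((\<Sum>j<m. sign_point \<theta> j * sign_point B j) / 2 ^ m) *\<^sub>R x \<theta>)) \<Longrightarrow> c \<le> C"
  obtain m where m: "0 < m" "2 ^ m * (C + 2) \<le> (\<Sum>B\<in>Pow {..<m}. \<bar>\<Sum>j<m. sign_point B j\<bar>)"
    by (rule sign_sum_unbounded)
  define k :: nat where "k = 2 ^ m"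
  define \<delta> where "\<delta> = 1 / (real m + 1)"
  have card: "card (Pow {..<m}) = k" by (simp add: k_def card_Pow)
  obtain e where e: "bij_betw e {..<k} (Pow {..<m})"
    using ex_bij_betw_nat_finite[of "Pow {..<m}"] card by (auto simp: atLeast0LessThan)
  show ?thesis
  proof (rule that[of k \<delta>])
    show "0 < k" "0 < \<delta>" "\<delta> < 1" using m by (auto simp: k_def \<delta>_def)
    fix x :: "nat \<Rightarrow> 'x" assume x: "\<And>j. j < k \<Longrightarrow> norm (x j) \<le> 1"
    show "\<exists>B\<subseteq>{..<k}. norm (\<Sum>j<k. signed B j (x j)) \<le> (1 - \<delta>) * real k"
    proof (rule ccontr)
      assume contra: "\<not> ?thesis"
      define e' where "e' = the_inv_into {..<k} e"
      have e': "e' \<theta> < k" "e (e' \<theta>) = \<theta>" if "\<theta> \<subseteq> {..<m}" for \<theta>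
        using e that the_inv_into_into[of e "{..<k}" \<theta> "{..<k}"] f_the_inv_into_f[of e "{..<k}" \<theta>]
        by (auto simp: e'_def bij_betw_def)
      have e'e: "e' (e j) = j" if "j < k" for j
        using e that by (auto simp: e'_def bij_betw_def the_inv_into_f_f)
      define y where "y \<theta> = x (e' \<theta>)" for \<theta>
      have y: "norm (y \<theta>) \<le> 1" if "\<theta> \<subseteq> {..<m}" for \<theta>
        unfolding y_def using x e'(1)[OF that] by auto
      have big: "(1 - \<delta>) * real k < norm (\<Sum>\<theta>\<in>Pow {..<m}. s \<theta> *\<^sub>R y \<theta>)" if s: "\<And>\<theta>. s \<theta> = 1 \<or> s \<theta> = - 1" for s :: "nat set \<Rightarrow> real"
      proof -
        define B where "B = {j. j < k \<and> s (e j) = 1}"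
        have "(\<Sum>\<theta>\<in>Pow {..<m}. s \<theta> *\<^sub>R y \<theta>) = (\<Sum>j<k. s (e j) *\<^sub>R y (e j))"
          using sum.reindex_bij_betw[OF e, of "\<lambda>\<theta>. s \<theta> *\<^sub>R y \<theta>"] by simp
        also have "\<dots> = (\<Sum>j<k. signed B j (x j))"
        proof (intro sum.cong refl)
          fix j assume "j \<in> {..<k}"
          then show "s (e j) *\<^sub>R y (e j) = signed B j (x j)"
            using s[of "e j"] e'e[of j] by (auto simp: signed_def B_def y_def)
        qed
        finally have eq: "(\<Sum>\<theta>\<in>Pow {..<m}. s \<theta> *\<^sub>R y \<theta>) = (\<Sum>j<k. signed B j (x j))" .
        have "B \<subseteq> {..<k}" by (auto simp: B_def)
        then show ?thesis using contra unfolding eq by (auto simp: not_le)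
      qed
      have "C + 1 \<le> C"
      proof (rule C(2)[of m y])
        fix B assume B: "B \<subseteq> {..<m}"
        define a where "a \<theta> = (\<Sum>j<m. sign_point \<theta> j * sign_point B j)" for \<theta>
        define s where "s \<theta> = (if 0 \<le> a \<theta> then 1 else - 1 :: real)" for \<theta>
        have a_le: "\<bar>a \<theta>\<bar> \<le> real m" for \<theta>
        proof -
          have "\<bar>a \<theta>\<bar> \<le> (\<Sum>j<m. \<bar>sign_point \<theta> j * sign_point B j\<bar>)" unfolding a_def by (rule sum_abs)
          also have "\<dots> = (\<Sum>j<m. 1)" by (intro sum.cong refl) (simp add: sign_point_def)
          also have "\<dots> = real m" by simp
          finally show ?thesis .
        qed
        have "(\<Sum>\<theta>\<in>Pow {..<m}. \<bar>a \<theta>\<bar>) = (\<Sum>\<theta>\<in>Pow {..<m}. \<bar>\<Sum>j<m. sign_point \<theta> j\<bar>)"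
        proof -
          have "sign_point (flip B' \<theta>) j * sign_point B j = - sign_point \<theta> j" if "B' = B" for B' \<theta> j
            using that by (auto simp: sign_point_def flip_def)
          then have "a (flip B \<theta>) = - (\<Sum>j<m. sign_point \<theta> j)" for \<theta> by (simp add: a_def sum_negf)
          then have "(\<Sum>\<theta>\<in>Pow {..<m}. \<bar>a (flip B \<theta>)\<bar>) = (\<Sum>\<theta>\<in>Pow {..<m}. \<bar>\<Sum>j<m. sign_point \<theta> j\<bar>)" by simp
          then show ?thesis using sum_flip[OF B, of "\<lambda>\<theta>. \<bar>a \<theta>\<bar>"] by simp
        qed
        then have a_sum: "2 ^ m * (C + 2) \<le> (\<Sum>\<theta>\<in>Pow {..<m}. \<bar>a \<theta>\<bar>)" using m(2) by simp
        have split: "(\<Sum>\<theta>\<in>Pow {..<m}. a \<theta> *\<^sub>R y \<theta>)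
            = real m *\<^sub>R (\<Sum>\<theta>\<in>Pow {..<m}. s \<theta> *\<^sub>R y \<theta>) - (\<Sum>\<theta>\<in>Pow {..<m}. ((real m - \<bar>a \<theta>\<bar>) * s \<theta>) *\<^sub>R y \<theta>)"
        proof -
          have "a \<theta> = real m * s \<theta> - (real m - \<bar>a \<theta>\<bar>) * s \<theta>" for \<theta> by (auto simp: s_def algebra_simps)
          then have "a \<theta> *\<^sub>R y \<theta> = real m *\<^sub>R (s \<theta> *\<^sub>R y \<theta>) - ((real m - \<bar>a \<theta>\<bar>) * s \<theta>) *\<^sub>R y \<theta>" for \<theta>
            by (metis scaleR_left_diff_distrib scaleR_scaleR)
          then show ?thesis by (simp only: sum_subtractf scaleR_sum_right)
        qed
        have "norm (\<Sum>\<theta>\<in>Pow {..<m}. ((real m - \<bar>a \<theta>\<bar>) * s \<theta>) *\<^sub>R y \<theta>) \<le> (\<Sum>\<theta>\<in>Pow {..<m}. real m - \<bar>a \<theta>\<bar>)"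
        proof (rule sum_norm_le)
          fix \<theta> assume "\<theta> \<in> Pow {..<m}"
          then have "norm (((real m - \<bar>a \<theta>\<bar>) * s \<theta>) *\<^sub>R y \<theta>) \<le> (real m - \<bar>a \<theta>\<bar>) * 1"
            using y[of \<theta>] a_le[of \<theta>] by (auto simp: s_def abs_mult intro!: mult_left_le)
          then show "norm (((real m - \<bar>a \<theta>\<bar>) * s \<theta>) *\<^sub>R y \<theta>) \<le> real m - \<bar>a \<theta>\<bar>" by simp
        qed
        also have "\<dots> \<le> real m * 2 ^ m - 2 ^ m * (C + 2)"
          using a_sum by (simp add: sum_subtractf card_Pow)
        finally have 1: "norm (\<Sum>\<theta>\<in>Pow {..<m}. ((real m - \<bar>a \<theta>\<bar>) * s \<theta>) *\<^sub>R y \<theta>) \<le> real m * 2 ^ m - 2 ^ m * (C + 2)" .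
        have "real m * ((1 - \<delta>) * real k) \<le> real m * norm (\<Sum>\<theta>\<in>Pow {..<m}. s \<theta> *\<^sub>R y \<theta>)"
        proof (intro mult_left_mono less_imp_le[OF big])
          show "s \<theta> = 1 \<or> s \<theta> = - 1" for \<theta> by (simp add: s_def)
        qed simp
        moreover have "real m * 2 ^ m - 2 ^ m \<le> real m * ((1 - \<delta>) * real k)"
        proof -
          have "real m * \<delta> \<le> 1" by (simp add: \<delta>_def)
          then have "2 ^ m * (real m * \<delta>) \<le> 2 ^ m * (1::real)" by (intro mult_left_mono) auto
          then show ?thesis by (simp add: k_def algebra_simps)
        qed
        ultimately have "2 ^ m * (C + 1) \<le> norm (\<Sum>\<theta>\<in>Pow {..<m}. a \<theta> *\<^sub>R y \<theta>)"
          unfolding split using 1 norm_triangle_ineq2[of "real m *\<^sub>R (\<Sum>\<theta>\<in>Pow {..<m}. s \<theta> *\<^sub>R y \<theta>)" "\<Sum>\<theta>\<in>Pow {..<m}. ((real m - \<bar>a \<theta>\<bar>) * s \<theta>) *\<^sub>R y \<theta>"]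
          by (simp add: algebra_simps)
        also have "(\<Sum>\<theta>\<in>Pow {..<m}. a \<theta> *\<^sub>R y \<theta>) = 2 ^ m *\<^sub>R (\<Sum>\<theta>\<in>Pow {..<m}. (a \<theta> / 2 ^ m) *\<^sub>R y \<theta>)"
          by (simp add: scaleR_sum_right)
        finally show "C + 1 \<le> norm (\<Sum>\<theta>\<in>Pow {..<m}. ((\<Sum>j<m. sign_point \<theta> j * sign_point B j) / 2 ^ m) *\<^sub>R y \<theta>)"
          unfolding a_def by simp
      qed (use y C(1) in auto)
      then show False by simp
    qed
  qed
qed

section \<open>The type inequality\<close>

text \<open>
  The midpoint convexity gap of \<open>t\<^sup>p\<close> on \<open>[b, 1]\<close> shrinks as \<open>b\<close> approaches 1 and stays positive before.
\<close>

lemma powr_midpoint_gap_antimono: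
  fixes p :: real
  defines "\<phi> \<equiv> \<lambda>b. 1 + b powr p - 2 * ((1 + b) / 2) powr p"
  assumes p: "1 < p"
  shows "\<lbrakk>0 \<le> b; b \<le> c; c \<le> 1\<rbrakk> \<Longrightarrow> \<phi> c \<le> \<phi> b" and "\<lbrakk>0 \<le> b; b < 1\<rbrakk> \<Longrightarrow> 0 < \<phi> b"
proof -
  have cont: "continuous_on {u..v} \<phi>" if "0 \<le> u" for u v
    unfolding \<phi>_def using p that by (intro continuous_intros continuous_on_powr') auto
  have der: "\<exists>y. (\<phi> has_real_derivative y) (at x) \<and> y < 0" if "0 < x" "x < 1" for x
  proof (intro exI conjI)
    show "(\<phi> has_real_derivative p * x powr (p - 1) - p * ((1 + x) / 2) powr (p - 1)) (at x)"
      unfolding \<phi>_def using that by (auto intro!: derivative_eq_intros)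
    have "x powr (p - 1) < ((1 + x) / 2) powr (p - 1)"
      using that p by (intro powr_less_mono2) auto
    then have "p * x powr (p - 1) < p * ((1 + x) / 2) powr (p - 1)"
      using p by (intro mult_strict_left_mono) auto
    then show "p * x powr (p - 1) - p * ((1 + x) / 2) powr (p - 1) < 0" by simp
  qed
  show "\<phi> c \<le> \<phi> b" if "0 \<le> b" "b \<le> c" "c \<le> 1"
  proof (rule DERIV_nonpos_imp_decreasing_open[OF that(2) _ cont[OF that(1)]])
    fix x assume "b < x" "x < c"
    then have "0 < x" "x < 1" using that by auto
    from der[OF this] show "\<exists>y. (\<phi> has_real_derivative y) (at x) \<and> y \<le> 0" by (auto intro: less_imp_le)
  qed
  show "0 < \<phi> b" if "0 \<le> b" "b < 1"
  proof -
    have "\<phi> 1 < \<phi> b"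
    proof (rule DERIV_neg_imp_decreasing_open[OF that(2) _ cont[OF that(1)]])
      fix x assume "b < x" "x < 1"
      then have "0 < x" "x < 1" using that by auto
      from der[OF this] show "\<exists>y. (\<phi> has_real_derivative y) (at x) \<and> y < 0" .
    qed
    then show ?thesis by (simp add: \<phi>_def)
  qed
qed

lemma sum_powr_le:
  fixes a :: "nat \<Rightarrow> real"
  assumes "\<And>j. j < k \<Longrightarrow> 0 \<le> a j" "1 \<le> p"
  shows "(\<Sum>j<k. a j) powr p \<le> real k powr (p - 1) * (\<Sum>j<k. a j powr p)"
proof (cases "k = 0")
  case False
  have "(\<Sum>j<k. 1 / real k * a j) powr p \<le> (\<Sum>j<k. 1 / real k * a j powr p)"
    using False assms by (intro jensen_powr_sum) auto
  then have "(1 / real k) powr p * (\<Sum>j<k. a j) powr p \<le> 1 / real k * (\<Sum>j<k. a j powr p)"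
    using assms by (simp add: sum_distrib_left[symmetric] powr_mult sum_nonneg flip: sum_divide_distrib)
      (simp add: powr_divide)
  then have "real k powr p * ((1 / real k) powr p * (\<Sum>j<k. a j) powr p) \<le> real k powr p * (1 / real k * (\<Sum>j<k. a j powr p))"
    by (intro mult_left_mono) auto
  moreover have "real k powr p * (1 / real k) powr p = 1" using False by (simp flip: powr_mult)
  moreover have "real k powr p * (1 / real k) = real k powr (p - 1)" using False by (simp add: powr_diff)
  ultimately show ?thesis by (simp only: mult.assoc[symmetric] mult_1)
qed simp

text \<open>
  Jensen's inequality for \<open>k\<close> numbers is strict by a definite amount if two of them differ. Averaging these
  two first costs the convexity gap of \<open>t\<^sup>p\<close> between them.
\<close>

lemma sum_powr_gap:
  fixes a :: "nat \<Rightarrow> real" and p g :: real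
  assumes p: "1 < p" and g: "0 < g" "g \<le> 1"
    and a: "\<And>j. j < k \<Longrightarrow> 0 \<le> a j" "i < k" "a i = 1" "l < k" "a l \<le> 1 - g"
  shows "(\<Sum>j<k. a j) powr p \<le> real k powr (p - 1) * ((\<Sum>j<k. a j powr p) - (1 + (1 - g) powr p - 2 * ((1 + (1 - g)) / 2) powr p))"
proof -
  have il: "i \<noteq> l" using a g by auto
  define a' where "a' j = (if j = i \<or> j = l then (1 + a l) / 2 else a j)" for j
  have split: "(\<Sum>j<k. f j) = f i + f l + (\<Sum>j\<in>{..<k} - {i} - {l}. f j)" for f :: "nat \<Rightarrow> real"
    using a il by (simp add: sum.remove[of "{..<k}" i] sum.remove[of "{..<k} - {i}" l])
  have rest: "(\<Sum>j\<in>{..<k} - {i} - {l}. h (a' j)) = (\<Sum>j\<in>{..<k} - {i} - {l}. h (a j))" for h :: "real \<Rightarrow> real"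
    by (intro sum.cong) (auto simp: a'_def)
  have "(\<Sum>j<k. a j) = (\<Sum>j<k. a' j)"
    using split[of a] split[of a'] rest[of "\<lambda>x. x"] a by (simp add: a'_def)
  also have "(\<Sum>j<k. a' j) powr p \<le> real k powr (p - 1) * (\<Sum>j<k. a' j powr p)"
    using a p by (intro sum_powr_le) (auto simp: a'_def)
  also have "(\<Sum>j<k. a' j powr p) = (\<Sum>j<k. a j powr p) - (1 + a l powr p - 2 * ((1 + a l) / 2) powr p)"
    using split[of "\<lambda>j. a j powr p"] split[of "\<lambda>j. a' j powr p"] rest[of "\<lambda>x. x powr p"] a
    by (simp add: a'_def)
  also have "\<dots> \<le> (\<Sum>j<k. a j powr p) - (1 + (1 - g) powr p - 2 * ((1 + (1 - g)) / 2) powr p)"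
    using powr_midpoint_gap_antimono(1)[OF p, of "a l" "1 - g"] a g by simp
  finally show ?thesis by (simp add: mult_left_mono)
qed

text \<open>
  Normalize the largest norm to 1. If all norms exceed \<open>\<surd>(1 - \<delta>)\<close>, one choice of signs gains a factor over the triangle
  inequality, and this choice is a fraction \<open>2\<^sup>-\<^sup>k\<close> of all choices. Otherwise two of the norms
  differ, and every choice gains from the strict convexity of \<open>t\<^sup>p\<close>, which needs \<open>1 < p\<close>.
\<close>

lemma B_convex_imp_signed_type:
  fixes k :: nat
  assumes k: "0 < k" and d: "0 < \<delta>" "\<delta> < 1" and p: "1 < p"
    and B: "\<And>x :: nat \<Rightarrow> 'x::real_normed_vector. (\<And>j. j < k \<Longrightarrow> norm (x j) \<le> 1) \<Longrightarrow>
      \<exists>B\<subseteq>{..<k}. norm (\<Sum>j<k. signed B j (x j)) \<le> (1 - \<delta>) * real k"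
  obtains \<epsilon> where "0 < \<epsilon>" "\<epsilon> < 1" "signed_type k (1 - \<epsilon>) p (norm :: 'x \<Rightarrow> real)"
proof -
  define s where "s = sqrt (1 - \<delta>)"
  have s: "0 < s" "s < 1" "s * s = 1 - \<delta>" using d by (auto simp: s_def)
  define \<kappa> where "\<kappa> = 1 + s powr p - 2 * ((1 + s) / 2) powr p"
  have kap: "0 < \<kappa>" unfolding \<kappa>_def using s by (intro powr_midpoint_gap_antimono(2) p) auto
  define r where "r = s powr p"
  have r: "0 < r" "r < 1"
  proof -
    show "0 < r" using s by (simp add: r_def)
    have "s powr p < 1 powr p" using s p by (intro powr_less_mono2) auto
    then show "r < 1" by (simp add: r_def)
  qed
  \<comment> \<open>The two bounds are the gains in the cases of unequal and of almost equal norms.\<close>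
  define \<epsilon> where "\<epsilon> = min (\<kappa> / real k) ((1 - r) / 2 ^ k)"
  have e: "0 < \<epsilon>" using kap r k by (simp add: \<epsilon>_def)
  have "(1 - r) / 2 ^ k < 1 / 1" using r by (intro frac_less) auto
  then have e1: "\<epsilon> < 1" unfolding \<epsilon>_def by (intro le_less_trans[OF min.cobounded2]) simp
  have norm_le: "norm (\<Sum>j<k. signed B j (x j)) powr p \<le> (\<Sum>j<k. norm (x j)) powr p" for B and x :: "nat \<Rightarrow> 'x"
    using p by (intro powr_mono2 order_trans[OF norm_sum]) auto
  have main: "(\<Sum>B\<in>Pow {..<k}. norm (\<Sum>j<k. signed B j (z j)) powr p) \<le> 2 ^ k * (1 - \<epsilon>) * real k powr (p - 1) * (\<Sum>j<k. norm (z j) powr p)"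
    if z: "\<And>j. j < k \<Longrightarrow> norm (z j) \<le> 1" and i: "i < k" "norm (z i) = 1" for z :: "nat \<Rightarrow> 'x" and i
  proof -
    define H where "H = (\<Sum>j<k. norm (z j) powr p)"
    have H0: "0 \<le> H" by (simp add: H_def sum_nonneg)
    have "H \<le> (\<Sum>j<k. 1)" unfolding H_def using z p by (intro sum_mono) (simp add: powr_le1)
    then have Hk: "H \<le> real k" by simp
    have kH: "0 \<le> real k powr (p - 1) * H" using H0 by simp
    show ?thesis
    proof (cases "\<exists>l<k. norm (z l) \<le> s")
      case True
      then obtain l where l: "l < k" "norm (z l) \<le> s" by auto
      have "(\<Sum>j<k. norm (z j)) powr p \<le> real k powr (p - 1) * (H - \<kappa>)"
        using sum_powr_gap[of p "1 - s" k "\<lambda>j. norm (z j)" i l] p s i l by (simp add: H_def \<kappa>_def)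
      also have "\<dots> \<le> real k powr (p - 1) * ((1 - \<epsilon>) * H)"
      proof (intro mult_left_mono)
        have "\<epsilon> * H \<le> \<kappa> / real k * H" using H0 by (intro mult_right_mono) (auto simp: \<epsilon>_def)
        also have "\<dots> \<le> \<kappa> / real k * real k" using Hk kap k by (intro mult_left_mono) auto
        also have "\<dots> = \<kappa>" using k by simp
        finally show "H - \<kappa> \<le> (1 - \<epsilon>) * H" by (simp add: algebra_simps)
      qed simp
      finally have each: "norm (\<Sum>j<k. signed B j (z j)) powr p \<le> real k powr (p - 1) * ((1 - \<epsilon>) * H)" for B
        using norm_le[of B z] by (rule order_trans[rotated])
      have "(\<Sum>B\<in>Pow {..<k}. norm (\<Sum>j<k. signed B j (z j)) powr p) \<le> (\<Sum>B\<in>Pow {..<k}. real k powr (p - 1) * ((1 - \<epsilon>) * H))"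
        by (intro sum_mono each)
      also have "\<dots> = 2 ^ k * (real k powr (p - 1) * ((1 - \<epsilon>) * H))" by (simp add: card_Pow)
      finally show ?thesis by (simp add: H_def mult_ac)
    next
      case False
      then have low: "s \<le> norm (z j)" if "j < k" for j using that by force
      have "real k * r = (\<Sum>j<k. s powr p)" by (simp add: r_def)
      also have "\<dots> \<le> H" unfolding H_def using low s p by (intro sum_mono powr_mono2) auto
      finally have Hr: "real k * r \<le> H" .
      obtain B0 where B0: "B0 \<subseteq> {..<k}" "norm (\<Sum>j<k. signed B0 j (z j)) \<le> (1 - \<delta>) * real k"
        using B[of z] z by blast
      have "norm (\<Sum>j<k. signed B0 j (z j)) powr p \<le> (s * s * real k) powr p"
        using B0 p s by (intro powr_mono2) auto
      also have "\<dots> = real k powr (p - 1) * r * (real k * r)"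
        using s(1,2) k by (simp add: powr_mult r_def powr_diff)
      also have "\<dots> \<le> real k powr (p - 1) * r * H" using Hr r by (intro mult_left_mono) auto
      finally have one: "norm (\<Sum>j<k. signed B0 j (z j)) powr p \<le> real k powr (p - 1) * r * H" .
      have each: "norm (\<Sum>j<k. signed B j (z j)) powr p \<le> real k powr (p - 1) * H" for B
        using norm_le[of B z] sum_powr_le[of k "\<lambda>j. norm (z j)" p] p unfolding H_def by (auto intro: order_trans)
      have "(\<Sum>B\<in>Pow {..<k}. norm (\<Sum>j<k. signed B j (z j)) powr p)
          = norm (\<Sum>j<k. signed B0 j (z j)) powr p + (\<Sum>B\<in>Pow {..<k} - {B0}. norm (\<Sum>j<k. signed B j (z j)) powr p)"
        using B0 by (intro sum.remove) auto
      also have "\<dots> \<le> real k powr (p - 1) * r * H + (\<Sum>B\<in>Pow {..<k} - {B0}. real k powr (p - 1) * H)"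
        by (intro add_mono one sum_mono each)
      also have "(\<Sum>B\<in>Pow {..<k} - {B0}. real k powr (p - 1) * H) = (2 ^ k - 1) * (real k powr (p - 1) * H)"
        using B0 by (simp add: card_Pow card_Diff_singleton of_nat_diff)
      also have "real k powr (p - 1) * r * H + (2 ^ k - 1) * (real k powr (p - 1) * H) = (2 ^ k - (1 - r)) * (real k powr (p - 1) * H)"
        by (simp add: algebra_simps)
      also have "\<dots> \<le> (2 ^ k * (1 - \<epsilon>)) * (real k powr (p - 1) * H)"
      proof (rule mult_right_mono[OF _ kH])
        have "2 ^ k * \<epsilon> \<le> 2 ^ k * ((1 - r) / 2 ^ k)" by (intro mult_left_mono) (auto simp: \<epsilon>_def)
        also have "\<dots> = 1 - r" by simp
        finally show "2 ^ k - (1 - r) \<le> 2 ^ k * (1 - \<epsilon>)" by (simp add: algebra_simps)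
      qed
      finally show ?thesis by (simp add: H_def mult_ac)
    qed
  qed
  show ?thesis
  proof (rule that[OF e e1], unfold signed_type_def, rule allI)
    fix x :: "nat \<Rightarrow> 'x"
    define t where "t = Max ((\<lambda>j. norm (x j)) ` {..<k})"
    have ne: "(\<lambda>j. norm (x j)) ` {..<k} \<noteq> {}" using k by auto
    have "t \<in> (\<lambda>j. norm (x j)) ` {..<k}" unfolding t_def using ne by (intro Max_in) auto
    then obtain i where i: "i < k" "norm (x i) = t" by auto
    have le: "norm (x j) \<le> t" if "j < k" for j unfolding t_def using that by (intro Max_ge) auto
    have t0: "0 \<le> t" using i(2) norm_ge_zero by metis
    show "(\<Sum>B\<in>Pow {..<k}. norm (\<Sum>j<k. signed B j (x j)) powr p) \<le> 2 ^ k * (1 - \<epsilon>) * real k powr (p - 1) * (\<Sum>j<k. norm (x j) powr p)"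
    proof (cases "t = 0")
      case True
      then have "x j = 0" if "j < k" for j using le[OF that] by simp
      then have "signed B j (x j) = 0" if "j < k" for B j using that by (simp add: signed_def)
      then show ?thesis by (simp add: \<open>\<And>j. j < k \<Longrightarrow> x j = 0\<close>)
    next
      case False
      with t0 have t: "0 < t" by simp
      define z where "z j = (1 / t) *\<^sub>R x j" for j
      have xz: "x j = t *\<^sub>R z j" for j using t by (simp add: z_def)
      have scale: "norm (t *\<^sub>R y) powr p = t powr p * norm y powr p" for y :: 'x using t by (simp add: powr_mult)
      have "signed B j (x j) = t *\<^sub>R signed B j (z j)" for B j by (simp add: xz signed_def)
      then have "(\<Sum>j<k. signed B j (x j)) = t *\<^sub>R (\<Sum>j<k. signed B j (z j))" for B by (simp add: scaleR_sum_right)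
      then have "(\<Sum>B\<in>Pow {..<k}. norm (\<Sum>j<k. signed B j (x j)) powr p) = t powr p * (\<Sum>B\<in>Pow {..<k}. norm (\<Sum>j<k. signed B j (z j)) powr p)"
        by (simp only: scale sum_distrib_left)
      also have "\<dots> \<le> t powr p * (2 ^ k * (1 - \<epsilon>) * real k powr (p - 1) * (\<Sum>j<k. norm (z j) powr p))"
        using t le i by (intro mult_left_mono main[of z i]) (auto simp: z_def)
      also have "\<dots> = 2 ^ k * (1 - \<epsilon>) * real k powr (p - 1) * (\<Sum>j<k. norm (x j) powr p)"
        by (simp only: xz scale sum_distrib_left mult_ac)
      finally show ?thesis .
    qed
  qed
qed

lemma signed_flip: "signed (flip E B) j x = (if j \<in> E then - signed B j x else signed B j x)"
  by (simp add: signed_def mem_flip)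

lemma signed_typeD:
  "signed_type k \<alpha> p N \<Longrightarrow> (\<Sum>B\<in>Pow {..<k}. N (\<Sum>j<k. signed B j (x j)) powr p)
     \<le> 2 ^ k * \<alpha> * real k powr (p - 1) * (\<Sum>j<k. N (x j) powr p)"
  unfolding signed_type_def by blast

lemma block_index_less:
  fixes i r k l :: nat
  assumes "i < k" "r < l"
  shows "i * l + r < k * l"
proof -
  have "Suc i * l \<le> k * l" using assms by (intro mult_le_mono1) auto
  with assms show ?thesis by simp
qed

text \<open>
  Divide \<open>k * l\<close> vectors into \<open>k\<close> blocks of length \<open>l\<close>. Flipping the signs of whole blocks
  preserves the mean over all signs, so the inequality for \<open>k\<close> applies to the block sums and the one for \<open>l\<close> inside each block.
\<close>

lemma signed_type_mult:
  fixes N :: "'a::ab_group_add \<Rightarrow> real"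
  assumes k: "signed_type k \<alpha> p N" "0 \<le> \<alpha>" and l: "signed_type l \<beta> p N"
    and N: "\<And>x. N (- x) = N x"
  shows "signed_type (k * l) (\<alpha> * \<beta>) p N"
  unfolding signed_type_def
proof
  fix x :: "nat \<Rightarrow> 'a"
  let ?K = "{..<k * l}"
  have N_signed: "N (signed B j y) = N y" for B j y by (simp add: signed_def N)
  define y where "y B i = (\<Sum>r<l. signed B (i * l + r) (x (i * l + r)))" for B i
  have block: "(\<Sum>j<k * l. f j) = (\<Sum>i<k. \<Sum>r<l. f (i * l + r))" for f :: "nat \<Rightarrow> 'b::comm_monoid_add"
  proof -
    have "(\<Sum>j<k * l. f j) = (\<Sum>i<k. sum f {i * l..<i * l + l})" by (rule sum.nat_group[symmetric])
    also have "\<dots> = (\<Sum>i<k. \<Sum>r<l. f (i * l + r))"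
    proof (rule sum.cong[OF refl])
      fix i show "sum f {i * l..<i * l + l} = (\<Sum>r<l. f (i * l + r))"
        by (rule sum.reindex_bij_witness[of _ "\<lambda>r. i * l + r" "\<lambda>j. j - i * l"]) auto
    qed
    finally show ?thesis .
  qed
  have outer: "2 ^ k * (\<Sum>B\<in>Pow ?K. N (\<Sum>j<k * l. signed B j (x j)) powr p)
      \<le> (\<Sum>B\<in>Pow ?K. 2 ^ k * \<alpha> * real k powr (p - 1) * (\<Sum>i<k. N (y B i) powr p))"
  proof -
    define E where "E D = {j\<in>?K. j div l \<notin> D}" for D
    have sub: "E D \<subseteq> ?K" for D by (auto simp: E_def)
    have "(\<Sum>j<k * l. signed (flip (E D) B) j (x j)) = (\<Sum>i<k. signed D i (y B i))" for D B
    proof -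
      have "signed (flip (E D) B) (i * l + r) (x (i * l + r)) = signed D i (signed B (i * l + r) (x (i * l + r)))"
        if "i < k" "r < l" for i r
      proof -
        have "i * l + r < k * l"
          using that by (rule block_index_less)
        then show ?thesis using that unfolding signed_flip by (auto simp: E_def signed_def)
      qed
      then show ?thesis
        unfolding block y_def by (intro sum.cong refl) (auto simp: signed_def sum_negf)
    qed
    then have "2 ^ k * (\<Sum>B\<in>Pow ?K. N (\<Sum>j<k * l. signed B j (x j)) powr p)
        = (\<Sum>D\<in>Pow {..<k}. \<Sum>B\<in>Pow ?K. N (\<Sum>i<k. signed D i (y B i)) powr p)"
      using sum_flip[OF sub, of "\<lambda>B. N (\<Sum>j<k * l. signed B j (x j)) powr p"]
      by (simp add: card_Pow)
    also have "\<dots> = (\<Sum>B\<in>Pow ?K. \<Sum>D\<in>Pow {..<k}. N (\<Sum>i<k. signed D i (y B i)) powr p)" by (rule sum.swap)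
    also have "\<dots> \<le> (\<Sum>B\<in>Pow ?K. 2 ^ k * \<alpha> * real k powr (p - 1) * (\<Sum>i<k. N (y B i) powr p))"
      by (intro sum_mono signed_typeD[OF k(1)])
    finally show ?thesis .
  qed
  have inner: "2 ^ l * (\<Sum>B\<in>Pow ?K. N (y B i) powr p) \<le> 2 ^ (k * l) * (2 ^ l * \<beta> * real l powr (p - 1) * (\<Sum>r<l. N (x (i * l + r)) powr p))" if "i < k" for i
  proof -
    define E where "E D = {j\<in>?K. j mod l \<notin> D}" for D
    have sub: "E D \<subseteq> ?K" for D by (auto simp: E_def)
    have "y (flip (E D) B) i = (\<Sum>r<l. signed D r (signed B (i * l + r) (x (i * l + r))))" for D B
    proof -
      have "signed (flip (E D) B) (i * l + r) (x (i * l + r)) = signed D r (signed B (i * l + r) (x (i * l + r)))"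
        if "r < l" for r
      proof -
        have "i * l + r < k * l"
          using \<open>i < k\<close> that by (rule block_index_less)
        then show ?thesis using that unfolding signed_flip by (auto simp: E_def signed_def)
      qed
      then show ?thesis unfolding y_def by (intro sum.cong) auto
    qed
    then have "2 ^ l * (\<Sum>B\<in>Pow ?K. N (y B i) powr p)
        = (\<Sum>D\<in>Pow {..<l}. \<Sum>B\<in>Pow ?K. N (\<Sum>r<l. signed D r (signed B (i * l + r) (x (i * l + r)))) powr p)"
      using sum_flip[OF sub, of "\<lambda>B. N (y B i) powr p"]
      by (simp add: card_Pow)
    also have "\<dots> = (\<Sum>B\<in>Pow ?K. \<Sum>D\<in>Pow {..<l}. N (\<Sum>r<l. signed D r (signed B (i * l + r) (x (i * l + r)))) powr p)" by (rule sum.swap)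
    also have "\<dots> \<le> (\<Sum>B\<in>Pow ?K. 2 ^ l * \<beta> * real l powr (p - 1) * (\<Sum>r<l. N (signed B (i * l + r) (x (i * l + r))) powr p))"
      by (intro sum_mono signed_typeD[OF l])
    finally show ?thesis by (simp add: N_signed card_Pow)
  qed
  have "2 ^ k * 2 ^ l * (\<Sum>B\<in>Pow ?K. N (\<Sum>j<k * l. signed B j (x j)) powr p)
      \<le> 2 ^ l * (\<Sum>B\<in>Pow ?K. 2 ^ k * \<alpha> * real k powr (p - 1) * (\<Sum>i<k. N (y B i) powr p))"
    using mult_left_mono[OF outer, of "2 ^ l"] by (simp add: mult_ac)
  also have "\<dots> = 2 ^ k * \<alpha> * real k powr (p - 1) * (\<Sum>i<k. 2 ^ l * (\<Sum>B\<in>Pow ?K. N (y B i) powr p))"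
  proof -
    have "(\<Sum>B\<in>Pow ?K. \<Sum>i<k. N (y B i) powr p) = (\<Sum>i<k. \<Sum>B\<in>Pow ?K. N (y B i) powr p)" by (rule sum.swap)
    then show ?thesis by (simp only: sum_distrib_left[symmetric] mult_ac)
  qed
  also have "\<dots> \<le> 2 ^ k * \<alpha> * real k powr (p - 1) * (\<Sum>i<k. 2 ^ (k * l) * (2 ^ l * \<beta> * real l powr (p - 1) * (\<Sum>r<l. N (x (i * l + r)) powr p)))"
    using k(2) inner by (intro mult_left_mono sum_mono) auto
  also have "\<dots> = 2 ^ k * 2 ^ l * (2 ^ (k * l) * (\<alpha> * \<beta>) * (real k powr (p - 1) * real l powr (p - 1)) * (\<Sum>i<k. \<Sum>r<l. N (x (i * l + r)) powr p))"
    by (simp only: sum_distrib_left mult_ac)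
  also have "real k powr (p - 1) * real l powr (p - 1) = real (k * l) powr (p - 1)" by (simp add: powr_mult)
  finally show "(\<Sum>B\<in>Pow ?K. N (\<Sum>j<k * l. signed B j (x j)) powr p) \<le> 2 ^ (k * l) * (\<alpha> * \<beta>) * real (k * l) powr (p - 1) * (\<Sum>j<k * l. N (x j) powr p)"
    unfolding block[of "\<lambda>j. N (x j) powr p"] by simp
qed

lemma K_convex_imp_signed_type:
  assumes "K_convex TYPE('x::complex_banach)" "1 < p" "0 < c"
  obtains k where "0 < k" "signed_type k c p (norm :: 'x \<Rightarrow> real)"
proof (rule K_convex_imp_B_convex[OF assms(1)])
  fix k \<delta> assume k: "0 < k" "0 < \<delta>" "\<delta> < 1"
    "\<And>x :: nat \<Rightarrow> 'x. (\<And>j. j < k \<Longrightarrow> norm (x j) \<le> 1) \<Longrightarrow> \<exists>B\<subseteq>{..<k}. norm (\<Sum>j<k. signed B j (x j)) \<le> (1 - \<delta>) * real k"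
  show thesis
  proof (rule B_convex_imp_signed_type[OF k(1-3) assms(2) k(4)])
    fix \<epsilon> assume e: "0 < \<epsilon>" "\<epsilon> < 1" "signed_type k (1 - \<epsilon>) p (norm :: 'x \<Rightarrow> real)"
    have pow: "signed_type (k ^ Suc q) ((1 - \<epsilon>) ^ Suc q) p (norm :: 'x \<Rightarrow> real)" for q
    proof (induction q)
      case (Suc q)
      from signed_type_mult[OF e(3) _ Suc] e show ?case by simp
    qed (use e in simp)
    obtain q where q: "(1 - \<epsilon>) ^ q < c" using real_arch_pow_inv[OF assms(3), of "1 - \<epsilon>"] e by auto
    have "(1 - \<epsilon>) ^ Suc q \<le> (1 - \<epsilon>) ^ q" using e by (intro power_decreasing) auto
    with q have le: "(1 - \<epsilon>) ^ Suc q \<le> c" by simp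
    show thesis
    proof (rule that[of "k ^ Suc q"])
      show "signed_type (k ^ Suc q) c p (norm :: 'x \<Rightarrow> real)"
        unfolding signed_type_def
      proof
        fix x :: "nat \<Rightarrow> 'x"
        have "(\<Sum>B\<in>Pow {..<k ^ Suc q}. norm (\<Sum>j<k ^ Suc q. signed B j (x j)) powr p)
          \<le> 2 ^ (k ^ Suc q) * (1 - \<epsilon>) ^ Suc q * real (k ^ Suc q) powr (p - 1) * (\<Sum>j<k ^ Suc q. norm (x j) powr p)"
          using pow[of q] unfolding signed_type_def by blast
        also have "\<dots> \<le> 2 ^ (k ^ Suc q) * c * real (k ^ Suc q) powr (p - 1) * (\<Sum>j<k ^ Suc q. norm (x j) powr p)"
          using le by (intro mult_right_mono mult_left_mono) (auto intro: sum_nonneg)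
        finally show "(\<Sum>B\<in>Pow {..<k ^ Suc q}. norm (\<Sum>j<k ^ Suc q. signed B j (x j)) powr p)
          \<le> 2 ^ (k ^ Suc q) * c * real (k ^ Suc q) powr (p - 1) * (\<Sum>j<k ^ Suc q. norm (x j) powr p)" .
      qed
    qed (use k in simp)
  qed
qed

section \<open>Slices of a regular measure\<close>

text \<open>
  A tube lemma: \<open>t\<close> ranges over a compact set and \<open>(s, t) \<mapsto> s - t\<close> is jointly continuous.
\<close>

lemma open_translates_into:
  fixes K U :: "'g::{topological_ab_group_add, t2_space} set"
  assumes K: "compact K" and U: "open U"
  shows "open {s. \<forall>t\<in>K. s - t \<in> U}"
proof (subst open_subopen, safe)
  fix s assume s: "\<forall>t\<in>K. s - t \<in> U"
  have cont: "continuous_on UNIV (\<lambda>(x::'g, y). x - y)"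
    by (simp add: case_prod_unfold continuous_on_diff continuous_on_fst continuous_on_snd continuous_on_id)
  have op: "open ((\<lambda>(x::'g, y). x - y) -` U)"
    using open_vimage[OF U cont] .
  then have "\<exists>A B. open A \<and> open B \<and> s \<in> A \<and> t \<in> B \<and> (\<forall>x\<in>A. \<forall>y\<in>B. x - y \<in> U)" if "t \<in> K" for t
  proof -
    have "(s, t) \<in> (\<lambda>(x::'g, y). x - y) -` U" using s that by simp
    from open_prod_elim[OF op this] obtain A B where "open A" "open B" "(s, t) \<in> A \<times> B" "A \<times> B \<subseteq> (\<lambda>(x::'g, y). x - y) -` U"
      by blast
    then show ?thesis by (intro exI[of _ A] exI[of _ B]) auto
  qed
  then have "\<forall>t\<in>K. \<exists>P. open (fst P) \<and> open (snd P) \<and> s \<in> fst P \<and> t \<in> snd P \<and> (\<forall>x\<in>fst P. \<forall>y\<in>snd P. x - y \<in> U)"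
    by fastforce
  from bchoice[OF this] obtain P where P: "\<forall>t\<in>K. open (fst (P t)) \<and> open (snd (P t)) \<and> s \<in> fst (P t) \<and> t \<in> snd (P t) \<and> (\<forall>x\<in>fst (P t). \<forall>y\<in>snd (P t). x - y \<in> U)" ..
  define A B where "A t = fst (P t)" and "B t = snd (P t)" for t
  have AB: "t \<in> K \<Longrightarrow> open (A t) \<and> open (B t) \<and> s \<in> A t \<and> t \<in> B t \<and> (\<forall>x\<in>A t. \<forall>y\<in>B t. x - y \<in> U)" for t
    using P unfolding A_def B_def by blast
  have "K \<subseteq> (\<Union>t\<in>K. B t)" using AB by blast
  then obtain F where F: "F \<subseteq> K" "finite F" "K \<subseteq> (\<Union>t\<in>F. B t)"
    using compactE_image[OF K, of K B] AB by blast
  show "\<exists>T. open T \<and> s \<in> T \<and> T \<subseteq> {s. \<forall>t\<in>K. s - t \<in> U}"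
  proof (intro exI[of _ "\<Inter>t\<in>F. A t"] conjI)
    show "open (\<Inter>t\<in>F. A t)" using F AB by (intro open_INT) auto
    show "s \<in> (\<Inter>t\<in>F. A t)" using F AB by auto
    show "(\<Inter>t\<in>F. A t) \<subseteq> {s. \<forall>t\<in>K. s - t \<in> U}" using F AB by blast
  qed
qed

lemma measurable_reflect_translate [measurable]:
  fixes s :: "'g::{topological_ab_group_add, t2_space}"
  shows "(\<lambda>t. s - t) \<in> borel_measurable borel" "(\<lambda>t. t - s) \<in> borel_measurable borel"
    "(\<lambda>t. s + t) \<in> borel_measurable borel" "(\<lambda>t. t + s) \<in> borel_measurable borel" "(\<lambda>t::'g. - t) \<in> borel_measurable borel"
  by (intro borel_measurable_continuous_onI continuous_intros)+

lemma slice_sets: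
  fixes V :: "'g::{topological_ab_group_add, t2_space} set"
  assumes "V \<in> sets borel"
  shows "{t. s - t \<in> V} \<in> sets borel" "{t. t - s \<in> V} \<in> sets borel" "{t. s + t \<in> V} \<in> sets borel"
    "{t. t + s \<in> V} \<in> sets borel" "{t. - t \<in> V} \<in> sets borel"
  using measurable_sets[OF measurable_reflect_translate(1)[of s] assms] measurable_sets[OF measurable_reflect_translate(2)[of s] assms]
    measurable_sets[OF measurable_reflect_translate(3)[of s] assms] measurable_sets[OF measurable_reflect_translate(4)[of s] assms]
    measurable_sets[OF measurable_reflect_translate(5) assms]
  by (simp_all add: vimage_def)

locale regular_prob =
  fixes \<nu> :: "'g::{topological_ab_group_add, t2_space} measure"
  assumes regular: "regular_prob_measure \<nu>"
begin

lemma prob: "prob_space \<nu>" and sets_eq [measurable_cong, simp]: "sets \<nu> = sets borel"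
  using regular by (auto simp: regular_prob_measure_def)

lemma space_eq [simp]: "space \<nu> = UNIV"
  using sets_eq_imp_space_eq[OF sets_eq] by simp

sublocale prob_space \<nu> by (rule prob)

lemma total [simp]: "emeasure \<nu> UNIV = 1"
  using emeasure_space_1 by simp

lemma inner_regular_less:
  assumes "V \<in> sets borel" "a < emeasure \<nu> V"
  obtains K where "compact K" "K \<subseteq> V" "a < emeasure \<nu> K"
proof -
  have "emeasure \<nu> V = (SUP K\<in>{K. compact K \<and> K \<subseteq> V}. emeasure \<nu> K)"
    using regular assms(1) by (auto simp: regular_prob_measure_def)
  with assms(2) show ?thesis using that by (auto simp: less_SUP_iff)
qed

definition slice :: "'g set \<Rightarrow> 'g \<Rightarrow> ennreal"
  where "slice V s = emeasure \<nu> {t. s - t \<in> V}"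

lemma slice_le_1: "slice V s \<le> 1"
  unfolding slice_def by (rule emeasure_le_1)

lemma slice_mono: "V \<subseteq> W \<Longrightarrow> W \<in> sets borel \<Longrightarrow> slice V s \<le> slice W s"
  unfolding slice_def by (intro emeasure_mono) (auto simp: slice_sets)

lemma open_slice_greater:
  assumes U: "open U" shows "open {s. a < slice U s}"
proof (subst open_subopen, safe)
  fix s assume s: "a < slice U s"
  have "{t. s - t \<in> U} \<in> sets borel" using U by (simp add: slice_sets)
  moreover have "a < emeasure \<nu> {t. s - t \<in> U}" using s by (simp add: slice_def)
  ultimately obtain K where K: "compact K" "K \<subseteq> {t. s - t \<in> U}" "a < emeasure \<nu> K"
    by (rule inner_regular_less)
  have "a < slice U s'" if "\<forall>t\<in>K. s' - t \<in> U" for s'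
  proof -
    have "emeasure \<nu> K \<le> slice U s'"
      unfolding slice_def using that U by (intro emeasure_mono) (auto simp: slice_sets)
    with K(3) show ?thesis by simp
  qed
  then show "\<exists>T. open T \<and> s \<in> T \<and> T \<subseteq> {s. a < slice U s}"
    using K open_translates_into[OF K(1) U] by (intro exI[of _ "{s. \<forall>t\<in>K. s - t \<in> U}"]) auto
qed

text \<open>
  For open \<open>V\<close> inner regularity makes the function lower semicontinuous; the general case follows by
  Dynkin's theorem. Measurability of a two-variable function is avoided.
\<close>

lemma slice_measurable [measurable]:
  assumes "V \<in> sets borel" shows "slice V \<in> borel_measurable borel"
proof -
  have sig: "V \<in> sigma_sets UNIV {S. open S}" using assms by (simp add: borel_def)
  have stab: "Int_stable {S::'g set. open S}" by (auto simp: Int_stable_def)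
  have sub: "{S::'g set. open S} \<subseteq> Pow UNIV" by simp
  from stab sub sig show ?thesis
  proof (induction rule: sigma_sets_induct_disjoint)
    case (basic U)
    then show ?case by (intro borel_measurableI_greater) (auto intro!: borel_open open_slice_greater)
  next
    case empty
    then show ?case by (simp add: slice_def[abs_def])
  next
    case (compl A)
    then have A: "A \<in> sets borel" by (simp add: borel_def)
    have "slice (UNIV - A) s = 1 - slice A s" for s
    proof -
      have "slice (UNIV - A) s = emeasure \<nu> (space \<nu> - {t. s - t \<in> A})"
        unfolding slice_def by (intro arg_cong[where f="emeasure \<nu>"]) auto
      also have "\<dots> = 1 - slice A s"
        unfolding slice_def using A by (subst emeasure_compl) (auto simp: slice_sets emeasure_finite)
      finally show ?thesis .
    qed
    then have "slice (UNIV - A) = (\<lambda>s. 1 - slice A s)" by auto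
    then show ?case using compl by simp
  next
    case (union A)
    then have A: "A i \<in> sets borel" for i by (auto simp: borel_def)
    have "slice (\<Union>i. A i) s = (suminf (\<lambda>i. slice (A i) s))" for s
    proof -
      have "(suminf (\<lambda>i. emeasure \<nu> {t. s - t \<in> A i})) = emeasure \<nu> (\<Union>i. {t. s - t \<in> A i})"
        using A union(1) by (intro suminf_emeasure) (auto simp: slice_sets disjoint_family_on_def)
      moreover have "(\<Union>i. {t. s - t \<in> A i}) = {t. s - t \<in> (\<Union>i. A i)}" by auto
      ultimately show ?thesis by (simp add: slice_def)
    qed
    then have "slice (\<Union>i. A i) = (\<lambda>s. (suminf (\<lambda>i. slice (A i) s)))" by auto
    then show ?case using union by simp
  qed
qed

end

section \<open>Haar measure\<close>

locale haar =
  fixes \<mu> :: "'g::{topological_ab_group_add, t2_space} measure"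
  assumes haar: "haar_measure \<mu>"
begin

lemma sets_eq [measurable_cong, simp]: "sets \<mu> = sets borel"
  using haar by (auto simp: haar_measure_def)

lemma space_eq [simp]: "space \<mu> = UNIV"
  using sets_eq_imp_space_eq[OF sets_eq] by simp

lemma translate:
  assumes "V \<in> sets borel" shows "emeasure \<mu> {s. s - t \<in> V} = emeasure \<mu> V"
proof -
  have "{s. s - t \<in> V} = (\<lambda>s. t + s) ` V"
  proof safe
    fix s assume "s - t \<in> V"
    then show "s \<in> (\<lambda>s. t + s) ` V" by (intro image_eqI[of _ _ "s - t"]) auto
  qed auto
  then show ?thesis using haar assms by (auto simp: haar_measure_def)
qed

lemma distr_translate: "distr \<mu> borel (\<lambda>s. s - t) = \<mu>"
proof (rule measure_eqI)
  fix A assume "A \<in> sets (distr \<mu> borel (\<lambda>s. s - t))"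
  then have A: "A \<in> sets borel" by simp
  have "(\<lambda>s. s - t) \<in> measurable \<mu> borel" by measurable
  then have "emeasure (distr \<mu> borel (\<lambda>s. s - t)) A = emeasure \<mu> ((\<lambda>s. s - t) -` A \<inter> space \<mu>)"
    using A by (rule emeasure_distr)
  also have "(\<lambda>s. s - t) -` A \<inter> space \<mu> = {s. s - t \<in> A}" by auto
  finally show "emeasure (distr \<mu> borel (\<lambda>s. s - t)) A = emeasure \<mu> A" using translate[OF A] by simp
qed simp

lemma compact_finite: "compact K \<Longrightarrow> emeasure \<mu> K < \<infinity>"
  using haar by (auto simp: haar_measure_def)

lemma compact_sets: "compact K \<Longrightarrow> K \<in> sets borel" for K :: "'g set"
  by (intro borel_closed compact_imp_closed)

lemma inner_regular_open:
  assumes "open U" "a < emeasure \<mu> U"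
  obtains K where "compact K" "K \<subseteq> U" "a < emeasure \<mu> K"
proof -
  have "emeasure \<mu> U = (SUP K\<in>{K. compact K \<and> K \<subseteq> U}. emeasure \<mu> K)"
    using haar assms(1) by (auto simp: haar_measure_def)
  with assms(2) show ?thesis using that by (auto simp: less_SUP_iff)
qed

lemma outer_regular:
  assumes "V \<in> sets borel" "emeasure \<mu> V < a"
  obtains U where "open U" "V \<subseteq> U" "emeasure \<mu> U < a"
proof -
  have "emeasure \<mu> V = (INF U\<in>{U. open U \<and> V \<subseteq> U}. emeasure \<mu> U)"
    using haar assms(1) by (auto simp: haar_measure_def)
  with assms(2) show ?thesis using that by (auto simp: INF_less_iff)
qed

lemma regular_approx:
  assumes V: "V \<in> sets borel" "emeasure \<mu> V < \<infinity>" and e: "0 < e"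
  obtains K U where "compact K" "open U" "K \<subseteq> V" "V \<subseteq> U" "emeasure \<mu> (U - K) < ennreal e" "emeasure \<mu> U < \<infinity>"
proof -
  have fin_less: "emeasure \<mu> A < emeasure \<mu> A + ennreal (e / 4)" if "emeasure \<mu> A < \<infinity>" for A
    using that e by (simp add: ennreal_add_left_cancel_less[where c=0, simplified] less_top[symmetric])
  obtain U where U: "open U" "V \<subseteq> U" "emeasure \<mu> U < emeasure \<mu> V + ennreal (e / 4)"
    using outer_regular[OF V(1) fin_less[OF V(2)]] .
  have Ufin: "emeasure \<mu> U < \<infinity>" by (rule less_le_trans[OF U(3)]) simp
  have Usets: "U \<in> sets borel" using U by simp
  have UV: "emeasure \<mu> (U - V) < ennreal (e / 4)"
  proof -
    have "emeasure \<mu> V + emeasure \<mu> (U - V) = emeasure \<mu> U"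
      using U Usets V by (subst plus_emeasure) (auto simp: Un_absorb1)
    with U(3) show ?thesis using V(2) by (metis ennreal_add_left_cancel_less)
  qed
  have UVsets: "U - V \<in> sets borel" using Usets V by auto
  obtain Q where Q: "open Q" "U - V \<subseteq> Q" "emeasure \<mu> Q < ennreal (e / 4)"
    using outer_regular[OF UVsets UV] .
  obtain K' where K': "compact K'" "K' \<subseteq> U" "emeasure \<mu> U \<le> emeasure \<mu> K' + ennreal (e / 4)"
  proof -
    obtain u where u: "emeasure \<mu> U = ennreal u" "0 \<le> u" using Ufin by (cases "emeasure \<mu> U") auto
    show ?thesis
    proof (cases "u \<le> e / 4")
      case True
      then show ?thesis by (intro that[of "{}"]) (auto simp: u ennreal_leI)
    next
      case False
      then have "ennreal (u - e / 4) < emeasure \<mu> U" using e by (simp add: u(1) ennreal_lessI)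
      then obtain K where K: "compact K" "K \<subseteq> U" "ennreal (u - e / 4) < emeasure \<mu> K"
        using inner_regular_open[OF U(1)] by blast
      have "emeasure \<mu> U = ennreal (u - e / 4) + ennreal (e / 4)"
        using False e by (simp add: u(1) flip: ennreal_plus)
      also have "\<dots> \<le> emeasure \<mu> K + ennreal (e / 4)" using K(3) by (intro add_right_mono) auto
      finally show ?thesis using that K by blast
    qed
  qed
  have K'sets: "K' \<in> sets borel" using K' compact_sets by auto
  have UK': "emeasure \<mu> (U - K') \<le> ennreal (e / 4)"
  proof -
    have "emeasure \<mu> K' + emeasure \<mu> (U - K') = emeasure \<mu> U"
      using K' K'sets Usets by (subst plus_emeasure) (auto simp: Un_absorb1)
    with K'(3) have "emeasure \<mu> K' + emeasure \<mu> (U - K') \<le> emeasure \<mu> K' + ennreal (e / 4)" by simp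
    then show ?thesis using compact_finite[OF K'(1)] by (auto simp: ennreal_add_left_cancel_le)
  qed
  have "compact (K' - Q)" using K'(1) Q(1) by (simp add: compact_diff)
  moreover have "K' - Q \<subseteq> V" using K'(2) Q(2) by auto
  moreover have "emeasure \<mu> (U - (K' - Q)) < ennreal e"
  proof -
    have "emeasure \<mu> (U - (K' - Q)) \<le> emeasure \<mu> ((U - K') \<union> Q)"
      using Usets K'sets Q(1) by (intro emeasure_mono) auto
    also have "\<dots> \<le> emeasure \<mu> (U - K') + emeasure \<mu> Q"
      using Usets K'sets Q(1) by (intro emeasure_subadditive) auto
    also have "\<dots> \<le> ennreal (e / 4) + ennreal (e / 4)" using UK' Q(3) by (intro add_mono) auto
    also have "\<dots> = ennreal (e / 2)" using e by (simp flip: ennreal_plus)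
    also have "\<dots> < ennreal e" using e by (intro ennreal_lessI) auto
    finally show ?thesis .
  qed
  ultimately show ?thesis using that U Ufin by blast
qed

end

locale haar_prob = haar \<mu> + nu: regular_prob \<nu> for \<mu> \<nu> :: "'g::{topological_ab_group_add, t2_space} measure"
begin

text \<open>
  Inner regularity provides, near each point of a compact set, a compact set \<open>C\<close> of large measure that works for
  all nearby \<open>s\<close>. The finitely many rectangles obtained are measurable for the product \<open>\<sigma>\<close>-algebra, so
  Fubini's theorem applies to their union \<open>W\<close>, which lies inside \<open>{(t, s). s - t \<in> U}\<close>. The restriction
  of \<open>\<mu>\<close> to a compact set supplies \<open>\<sigma>\<close>-finiteness.
\<close>

lemma compact_family_slice_le:
  fixes a :: "'i \<Rightarrow> real"
  assumes U: "open U" and I: "finite I" and K: "\<And>i. i \<in> I \<Longrightarrow> compact (K i)" "disjoint_family_on K I"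
    and a: "\<And>i s. i \<in> I \<Longrightarrow> s \<in> K i \<Longrightarrow> ennreal (a i) < nu.slice U s"
  shows "(\<Sum>i\<in>I. ennreal (a i) * emeasure \<mu> (K i)) \<le> emeasure \<mu> U"
proof -
  define Op where "Op C = {s. \<forall>t\<in>C. s - t \<in> U}" for C
  have "\<exists>R. finite R \<and> (\<forall>C\<in>R. compact C \<and> ennreal (a i) < emeasure \<nu> C) \<and> K i \<subseteq> (\<Union>C\<in>R. Op C)" if i: "i \<in> I" for i
  proof -
    let ?R = "{C. compact C \<and> ennreal (a i) < emeasure \<nu> C}"
    have "\<exists>C\<in>?R. s \<in> Op C" if "s \<in> K i" for s
    proof -
      have "ennreal (a i) < emeasure \<nu> {t. s - t \<in> U}" using a[OF i that] by (simp add: nu.slice_def)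
      moreover have "{t. s - t \<in> U} \<in> sets borel" using U by (simp add: slice_sets)
      ultimately obtain C where "compact C" "C \<subseteq> {t. s - t \<in> U}" "ennreal (a i) < emeasure \<nu> C"
        by (metis nu.inner_regular_less)
      then show ?thesis by (intro bexI[of _ C]) (auto simp: Op_def)
    qed
    then have cover: "K i \<subseteq> (\<Union>C\<in>?R. Op C)" by blast
    have "open (Op C)" if "C \<in> ?R" for C unfolding Op_def using that U by (intro open_translates_into) auto
    then obtain R where "R \<subseteq> ?R" "finite R" "K i \<subseteq> (\<Union>C\<in>R. Op C)"
      using compactE_image[OF K(1)[OF i] _ cover] by metis
    then show ?thesis by (intro exI[of _ R]) auto
  qed
  then obtain R where R: "\<And>i. i \<in> I \<Longrightarrow> finite (R i)" "\<And>i C. i \<in> I \<Longrightarrow> C \<in> R i \<Longrightarrow> compact C \<and> ennreal (a i) < emeasure \<nu> C"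
    "\<And>i. i \<in> I \<Longrightarrow> K i \<subseteq> (\<Union>C\<in>R i. Op C)" by metis
  define W where "W = (\<Union>i\<in>I. \<Union>C\<in>R i. C \<times> (Op C \<inter> K i))"
  define K' where "K' = (\<Union>i\<in>I. K i)"
  have K'c: "compact K'" unfolding K'_def using I K by (intro compact_UN) auto
  have K'sets: "K' \<in> sets borel" using K'c by (rule compact_sets)
  define \<mu>K where "\<mu>K = density \<mu> (indicator K')"
  have sets_\<mu>K: "sets \<mu>K = sets borel" by (simp add: \<mu>K_def)
  have em: "emeasure \<mu>K A = emeasure \<mu> (K' \<inter> A)" if "A \<in> sets borel" for A
    unfolding \<mu>K_def using that K'sets by (subst emeasure_density) (auto simp: indicator_inter_arith[symmetric])
  have sp: "space \<mu>K = UNIV" by (simp add: \<mu>K_def)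
  interpret mK: finite_measure \<mu>K
    by (rule finite_measureI) (use em[of UNIV] compact_finite[OF K'c] in \<open>simp add: sp\<close>)
  interpret P: pair_sigma_finite \<nu> \<mu>K
    by (intro pair_sigma_finite.intro nu.sigma_finite_measure mK.sigma_finite_measure)
  have W: "W \<in> sets (\<nu> \<Otimes>\<^sub>M \<mu>K)"
  proof -
    have "C \<times> (Op C \<inter> K i) \<in> sets (\<nu> \<Otimes>\<^sub>M \<mu>K)" if "i \<in> I" "C \<in> R i" for i C
    proof -
      have "compact C" using R that by auto
      then have "open (Op C)" unfolding Op_def by (rule open_translates_into[OF _ U])
      then show ?thesis
        using \<open>compact C\<close> K(1)[OF that(1)] compact_sets by (intro pair_measureI) (auto simp: sets_\<mu>K)
    qed
    then show ?thesis unfolding W_def using I R(1) by (intro sets.finite_UN) auto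
  qed
  have "(\<Sum>i\<in>I. ennreal (a i) * emeasure \<mu> (K i)) = (\<Sum>i\<in>I. ennreal (a i) * emeasure \<mu>K (K i))"
  proof (intro sum.cong refl)
    fix i assume i: "i \<in> I"
    then have "K' \<inter> K i = K i" by (auto simp: K'_def)
    then show "ennreal (a i) * emeasure \<mu> (K i) = ennreal (a i) * emeasure \<mu>K (K i)"
      using em[of "K i"] compact_sets[OF K(1)[OF i]] by simp
  qed
  also have "\<dots> = (\<integral>\<^sup>+s. (\<Sum>i\<in>I. ennreal (a i) * indicator (K i) s) \<partial>\<mu>K)"
    using compact_sets[OF K(1)] sets_\<mu>K
    by (subst nn_integral_sum) (auto intro!: sum.cong nn_integral_cmult_indicator[symmetric])
  also have "\<dots> \<le> (\<integral>\<^sup>+s. (\<integral>\<^sup>+t. indicator W (t, s) \<partial>\<nu>) \<partial>\<mu>K)"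
  proof (rule nn_integral_mono)
    fix s
    show "(\<Sum>i\<in>I. ennreal (a i) * indicator (K i) s) \<le> (\<integral>\<^sup>+t. indicator W (t, s) \<partial>\<nu>)"
    proof (cases "\<exists>i\<in>I. s \<in> K i")
      case True
      then obtain i where i: "i \<in> I" "s \<in> K i" by auto
      then obtain C where C: "C \<in> R i" "s \<in> Op C" using R(3) by blast
      have "(\<Sum>j\<in>I. ennreal (a j) * indicator (K j) s) = (\<Sum>j\<in>I. if j = i then ennreal (a i) else 0)"
        using i K(2) by (intro sum.cong refl) (auto simp: disjoint_family_on_def indicator_def)
      also have "\<dots> = ennreal (a i)" using i I by simp
      also have "\<dots> \<le> emeasure \<nu> C" using R(2)[OF i(1) C(1)] by auto
      also have "\<dots> = (\<integral>\<^sup>+t. indicator C t \<partial>\<nu>)"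
        using R(2)[OF i(1) C(1)] compact_sets by (simp add: nn_integral_indicator)
      also have "\<dots> \<le> (\<integral>\<^sup>+t. indicator W (t, s) \<partial>\<nu>)"
        using C i by (intro nn_integral_mono) (auto simp: indicator_def W_def)
      finally show ?thesis .
    next
      case False
      then have "(\<Sum>i\<in>I. ennreal (a i) * indicator (K i) s) = 0" by (auto simp: indicator_def)
      then show ?thesis by simp
    qed
  qed
  also have "\<dots> = (\<integral>\<^sup>+t. (\<integral>\<^sup>+s. indicator W (t, s) \<partial>\<mu>K) \<partial>\<nu>)"
    using W by (intro P.Fubini) simp
  also have "\<dots> \<le> (\<integral>\<^sup>+t. emeasure \<mu> U \<partial>\<nu>)"
  proof (rule nn_integral_mono)
    fix t
    have A: "{s. s - t \<in> U} \<in> sets borel" using U by (simp add: slice_sets)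
    have "(\<integral>\<^sup>+s. indicator W (t, s) \<partial>\<mu>K) \<le> (\<integral>\<^sup>+s. indicator {s. s - t \<in> U} s \<partial>\<mu>K)"
      by (intro nn_integral_mono) (auto simp: indicator_def W_def Op_def)
    also have "\<dots> = emeasure \<mu> (K' \<inter> {s. s - t \<in> U})" using A em[OF A] sets_\<mu>K by (simp add: nn_integral_indicator)
    also have "\<dots> \<le> emeasure \<mu> {s. s - t \<in> U}" using A by (intro emeasure_mono) auto
    also have "\<dots> = emeasure \<mu> U" using U by (intro translate) auto
    finally show "(\<integral>\<^sup>+s. indicator W (t, s) \<partial>\<mu>K) \<le> emeasure \<mu> U" .
  qed
  also have "\<dots> = emeasure \<mu> U" by simp
  finally show ?thesis .
qed

text \<open>
  The integral is the supremum over the step functions below the slice function, and their level sets are approximated from inside by disjoint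
  compact sets, to which \<open>compact_family_slice_le\<close> applies.
\<close>

lemma slice_open_le:
  assumes U: "open U"
  shows "(\<integral>\<^sup>+s. nu.slice U s \<partial>\<mu>) \<le> emeasure \<mu> U"
proof (cases "emeasure \<mu> U = \<infinity>")
  case False
  then obtain u where u: "emeasure \<mu> U = ennreal u" "0 \<le> u" by (cases "emeasure \<mu> U") auto
  show ?thesis unfolding nn_integral_def_finite
  proof (rule SUP_least)
    fix g assume "g \<in> {g. simple_function \<mu> g \<and> g \<le> nu.slice U \<and> (\<forall>x. g x < top)}"
    then have g: "simple_function \<mu> g" "\<And>s. g s \<le> nu.slice U s" by (auto simp: le_fun_def)
    define Y where "Y = range g - {0}"
    have Yfin: "finite Y" using simple_functionD(1)[OF g(1)] by (simp add: Y_def)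
    define A where "A y = g -` {y}" for y
    have A: "A y \<in> sets borel" for y using simple_functionD(2)[OF g(1), of "{y}"] by (simp add: A_def)
    define r where "r y = enn2real y" for y
    have r: "y = ennreal (r y)" "0 < r y" if yY: "y \<in> Y" for y
    proof -
      obtain s where s: "y = g s" "y \<noteq> 0" using yY unfolding Y_def by blast
      have "y \<le> 1" using g(2)[of s] nu.slice_le_1[of U s] s by (auto intro: order_trans)
      then have "y < top" by (rule le_less_trans) simp
      then show "y = ennreal (r y)" by (simp add: r_def)
      with s(2) show "0 < r y" by (metis enn2real_nonneg ennreal_0 less_eq_real_def r_def)
    qed
    have fin: "emeasure \<mu> (A y) < \<infinity>" if y: "y \<in> Y" for y
    proof (rule ccontr)
      assume "\<not> emeasure \<mu> (A y) < \<infinity>"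
      then have inf: "emeasure \<mu> (A y) = \<infinity>" by (simp add: less_top[symmetric])
      define O' where "O' = {s. ennreal (r y / 2) < nu.slice U s}"
      have O': "open O'" unfolding O'_def by (rule nu.open_slice_greater[OF U])
      have "A y \<subseteq> O'"
      proof
        fix s assume "s \<in> A y"
        then have "y \<le> nu.slice U s" using g(2)[of s] by (simp add: A_def)
        moreover have "ennreal (r y / 2) < y" using r[OF y] by (metis ennreal_lessI half_gt_zero_iff field_sum_of_halves less_add_same_cancel1)
        ultimately show "s \<in> O'" by (simp add: O'_def)
      qed
      then have "emeasure \<mu> O' = \<infinity>" using inf emeasure_mono[of "A y" O' \<mu>] O' by (simp add: top_unique)
      then have "ennreal (2 * (u + 1) / r y) < emeasure \<mu> O'" by simp
      then obtain L where L: "compact L" "L \<subseteq> O'" "ennreal (2 * (u + 1) / r y) < emeasure \<mu> L"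
        by (rule inner_regular_open[OF O'])
      have "ennreal (r y / 2) * emeasure \<mu> L \<le> emeasure \<mu> U"
        using compact_family_slice_le[OF U, of "{()}" "\<lambda>_. L" "\<lambda>_. r y / 2"] L by (auto simp: O'_def disjoint_family_on_def)
      moreover have "ennreal (r y / 2) * ennreal (2 * (u + 1) / r y) \<le> ennreal (r y / 2) * emeasure \<mu> L"
        using L(3) by (intro mult_left_mono) auto
      moreover have "ennreal (r y / 2) * ennreal (2 * (u + 1) / r y) = ennreal (u + 1)"
      proof -
        have "ennreal (r y / 2) * ennreal (2 * (u + 1) / r y) = ennreal (r y / 2 * (2 * (u + 1) / r y))"
          using r(2)[OF y] u(2) by (intro ennreal_mult[symmetric]) auto
        also have "r y / 2 * (2 * (u + 1) / r y) = u + 1" using r(2)[OF y] by simp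
        finally show ?thesis .
      qed
      ultimately have "ennreal (u + 1) \<le> ennreal u" using u(1) by simp
      then show False using u(2) by simp
    qed
    define m where "m y = measure \<mu> (A y)" for y
    have m: "emeasure \<mu> (A y) = ennreal (m y)" if "y \<in> Y" for y
      unfolding m_def using fin[OF that] by (intro emeasure_eq_ennreal_measure) simp
    have m0: "0 \<le> m y" for y by (simp add: m_def)
    have theta: "\<theta> * \<theta> * (\<Sum>y\<in>Y. r y * m y) \<le> u" if th: "0 < \<theta>" "\<theta> < 1" for \<theta>
    proof -
      have "\<exists>K. compact K \<and> K \<subseteq> A y \<and> ennreal (\<theta> * m y) \<le> emeasure \<mu> K" if y: "y \<in> Y" for y
      proof (cases "m y = 0")
        case False
        with m0[of y] have "0 < m y" by simp
        define e where "e = (1 - \<theta>) * m y"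
        have e: "0 < e" using th \<open>0 < m y\<close> by (simp add: e_def)
        obtain K V where KV: "compact K" "open V" "K \<subseteq> A y" "A y \<subseteq> V" "emeasure \<mu> (V - K) < ennreal e" "emeasure \<mu> V < \<infinity>"
          using regular_approx[OF A fin[OF y] e] .
        have "ennreal (m y) = emeasure \<mu> K + emeasure \<mu> (A y - K)"
          using m[OF y] KV compact_sets[OF KV(1)] A by (subst plus_emeasure) (auto simp: Un_absorb1)
        also have "\<dots> \<le> emeasure \<mu> K + ennreal e"
        proof -
          have "emeasure \<mu> (A y - K) \<le> emeasure \<mu> (V - K)"
            using KV compact_sets[OF KV(1)] by (intro emeasure_mono) auto
          then show ?thesis using KV(5) by (intro add_left_mono) auto
        qed
        finally have "ennreal (m y) - ennreal e \<le> emeasure \<mu> K" by (simp add: ennreal_minus_le_iff add.commute)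
        moreover have "ennreal (m y) - ennreal e = ennreal (\<theta> * m y)"
          using e by (simp add: ennreal_minus e_def algebra_simps)
        ultimately show ?thesis using KV by auto
      qed (auto intro: exI[of _ "{}"])
      then obtain K where K: "\<And>y. y \<in> Y \<Longrightarrow> compact (K y) \<and> K y \<subseteq> A y \<and> ennreal (\<theta> * m y) \<le> emeasure \<mu> (K y)"
        by metis
      have "(\<Sum>y\<in>Y. ennreal (\<theta> * r y) * emeasure \<mu> (K y)) \<le> emeasure \<mu> U"
      proof (rule compact_family_slice_le[OF U Yfin])
        show "disjoint_family_on K Y" using K unfolding disjoint_family_on_def A_def by blast
        fix y s assume y: "y \<in> Y" "s \<in> K y"
        then have "y \<le> nu.slice U s" using K g(2)[of s] by (auto simp: A_def)
        moreover have "ennreal (\<theta> * r y) < ennreal (r y)" using r(2)[OF y(1)] th by (intro ennreal_lessI) auto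
        ultimately show "ennreal (\<theta> * r y) < nu.slice U s" using r(1)[OF y(1)] by simp
      qed (use K in auto)
      moreover have "(\<Sum>y\<in>Y. ennreal (\<theta> * r y) * ennreal (\<theta> * m y)) \<le> (\<Sum>y\<in>Y. ennreal (\<theta> * r y) * emeasure \<mu> (K y))"
        using K by (intro sum_mono mult_left_mono) auto
      moreover have "(\<Sum>y\<in>Y. ennreal (\<theta> * r y) * ennreal (\<theta> * m y)) = ennreal (\<theta> * \<theta> * (\<Sum>y\<in>Y. r y * m y))"
      proof -
        have "(\<Sum>y\<in>Y. ennreal (\<theta> * r y) * ennreal (\<theta> * m y)) = (\<Sum>y\<in>Y. ennreal (\<theta> * \<theta> * (r y * m y)))"
          using r th m0 by (intro sum.cong refl) (simp add: ennreal_mult[symmetric] less_imp_le mult_ac)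
        also have "\<dots> = ennreal (\<Sum>y\<in>Y. \<theta> * \<theta> * (r y * m y))"
          using r th m0 by (intro sum_ennreal) (simp add: less_imp_le)
        finally show ?thesis by (simp add: sum_distrib_left)
      qed
      ultimately show ?thesis using u by (metis (no_types, lifting) ennreal_le_iff order_trans)
    qed
    have "(\<Sum>y\<in>Y. r y * m y) \<le> u"
    proof (rule field_le_mult_one_interval)
      fix z :: real assume "0 < z" "z < 1"
      then show "z * (\<Sum>y\<in>Y. r y * m y) \<le> u" using theta[of "sqrt z"] by simp
    qed
    have "integral\<^sup>S \<mu> g = (\<Sum>y\<in>range g. y * emeasure \<mu> (A y))"
      by (simp add: simple_integral_def A_def)
    also have "\<dots> = (\<Sum>y\<in>Y. y * emeasure \<mu> (A y))"
      using simple_functionD(1)[OF g(1)] unfolding Y_def by (intro sum.mono_neutral_right) auto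
    also have "\<dots> = (\<Sum>y\<in>Y. ennreal (r y * m y))"
      using r m m0 by (intro sum.cong refl) (metis ennreal_mult less_imp_le)
    also have "\<dots> = ennreal (\<Sum>y\<in>Y. r y * m y)"
      using r m0 by (intro sum_ennreal) (simp add: less_imp_le)
    also have "\<dots> \<le> emeasure \<mu> U" using \<open>(\<Sum>y\<in>Y. r y * m y) \<le> u\<close> u by (simp add: ennreal_leI)
    finally show "integral\<^sup>S \<mu> g \<le> emeasure \<mu> U" .
  qed
qed simp

text \<open>
  Outer regularity of \<open>\<mu>\<close> reduces the claim to open sets. This is one half of the identity that Fubini's theorem and
  translation invariance give for second countable groups.
\<close>

lemma slice_le:
  assumes V: "V \<in> sets borel"
  shows "(\<integral>\<^sup>+s. nu.slice V s \<partial>\<mu>) \<le> emeasure \<mu> V"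
proof (rule ccontr)
  assume "\<not> ?thesis"
  then have "emeasure \<mu> V < (\<integral>\<^sup>+s. nu.slice V s \<partial>\<mu>)" by simp
  then obtain U where U: "open U" "V \<subseteq> U" "emeasure \<mu> U < (\<integral>\<^sup>+s. nu.slice V s \<partial>\<mu>)"
    by (rule outer_regular[OF V])
  have "(\<integral>\<^sup>+s. nu.slice V s \<partial>\<mu>) \<le> (\<integral>\<^sup>+s. nu.slice U s \<partial>\<mu>)"
    using U by (intro nn_integral_mono nu.slice_mono) auto
  also have "\<dots> \<le> emeasure \<mu> U" by (rule slice_open_le[OF U(1)])
  finally show False using U(3) by simp
qed

lemma nn_integral_slice_le:
  assumes "\<phi> \<in> borel_measurable borel"
  shows "(\<lambda>s. \<integral>\<^sup>+t. \<phi> (s - t) \<partial>\<nu>) \<in> borel_measurable borel \<and>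
    (\<integral>\<^sup>+s. (\<integral>\<^sup>+t. \<phi> (s - t) \<partial>\<nu>) \<partial>\<mu>) \<le> (\<integral>\<^sup>+s. \<phi> s \<partial>\<mu>)"
  using assms
proof (induction rule: borel_measurable_induct)
  case (cong f g)
  then have "f = g" by auto
  with cong show ?case by simp
next
  case (set A)
  have "(\<integral>\<^sup>+t. indicator A (s - t) \<partial>\<nu>) = nu.slice A s" for s
  proof -
    have "(\<integral>\<^sup>+t. indicator A (s - t) \<partial>\<nu>) = (\<integral>\<^sup>+t. indicator {t. s - t \<in> A} t \<partial>\<nu>)"
      by (intro nn_integral_cong) (auto simp: indicator_def)
    then show ?thesis using set by (simp add: nn_integral_indicator slice_sets nu.slice_def)
  qed
  then show ?case using nu.slice_measurable[OF set] slice_le[OF set] set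
    by (simp add: nn_integral_indicator)
next
  case (mult u c)
  have [measurable]: "u \<in> borel_measurable borel" by fact
  have [measurable]: "(\<lambda>s. \<integral>\<^sup>+t. u (s - t) \<partial>\<nu>) \<in> borel_measurable borel" using mult by auto
  have eq: "(\<integral>\<^sup>+t. c * u (s - t) \<partial>\<nu>) = c * (\<integral>\<^sup>+t. u (s - t) \<partial>\<nu>)" for s
    by (rule nn_integral_cmult) measurable
  have "(\<integral>\<^sup>+s. c * (\<integral>\<^sup>+t. u (s - t) \<partial>\<nu>) \<partial>\<mu>) = c * (\<integral>\<^sup>+s. (\<integral>\<^sup>+t. u (s - t) \<partial>\<nu>) \<partial>\<mu>)"
    by (rule nn_integral_cmult) measurable
  moreover have "(\<integral>\<^sup>+s. c * u s \<partial>\<mu>) = c * (\<integral>\<^sup>+s. u s \<partial>\<mu>)" by (rule nn_integral_cmult) measurable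
  ultimately show ?case using mult unfolding eq by (auto intro!: mult_left_mono)
next
  case (add u v)
  have [measurable]: "u \<in> borel_measurable borel" "v \<in> borel_measurable borel" by fact+
  have [measurable]: "(\<lambda>s. \<integral>\<^sup>+t. u (s - t) \<partial>\<nu>) \<in> borel_measurable borel" "(\<lambda>s. \<integral>\<^sup>+t. v (s - t) \<partial>\<nu>) \<in> borel_measurable borel"
    using add by auto
  have eq: "(\<integral>\<^sup>+t. v (s - t) + u (s - t) \<partial>\<nu>) = (\<integral>\<^sup>+t. v (s - t) \<partial>\<nu>) + (\<integral>\<^sup>+t. u (s - t) \<partial>\<nu>)" for s
    by (rule nn_integral_add) measurable
  have "(\<integral>\<^sup>+s. (\<integral>\<^sup>+t. v (s - t) \<partial>\<nu>) + (\<integral>\<^sup>+t. u (s - t) \<partial>\<nu>) \<partial>\<mu>)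
     = (\<integral>\<^sup>+s. (\<integral>\<^sup>+t. v (s - t) \<partial>\<nu>) \<partial>\<mu>) + (\<integral>\<^sup>+s. (\<integral>\<^sup>+t. u (s - t) \<partial>\<nu>) \<partial>\<mu>)"
    by (rule nn_integral_add) measurable
  moreover have "(\<integral>\<^sup>+s. v s + u s \<partial>\<mu>) = (\<integral>\<^sup>+s. v s \<partial>\<mu>) + (\<integral>\<^sup>+s. u s \<partial>\<mu>)" by (rule nn_integral_add) measurable
  ultimately show ?case using add unfolding eq by (auto intro!: add_mono)
next
  case (seq U)
  have [measurable]: "U i \<in> borel_measurable borel" for i by fact
  have m [measurable]: "(\<lambda>s. \<integral>\<^sup>+t. U i (s - t) \<partial>\<nu>) \<in> borel_measurable borel" for i
    using seq by auto
  have inc: "incseq (\<lambda>i. U i x)" for x using \<open>incseq U\<close> by (auto simp: incseq_def le_fun_def)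
  have eq: "(\<integral>\<^sup>+t. (SUP i. U i) (s - t) \<partial>\<nu>) = (SUP i. \<integral>\<^sup>+t. U i (s - t) \<partial>\<nu>)" for s
    unfolding SUP_apply using \<open>incseq U\<close>
    by (intro nn_integral_monotone_convergence_SUP) (auto simp: incseq_def le_fun_def)
  have "(\<integral>\<^sup>+s. (SUP i. \<integral>\<^sup>+t. U i (s - t) \<partial>\<nu>) \<partial>\<mu>) = (SUP i. \<integral>\<^sup>+s. (\<integral>\<^sup>+t. U i (s - t) \<partial>\<nu>) \<partial>\<mu>)"
    using \<open>incseq U\<close>
    by (intro nn_integral_monotone_convergence_SUP) (auto simp: incseq_def le_fun_def intro!: nn_integral_mono)
  also have "\<dots> \<le> (SUP i. \<integral>\<^sup>+s. U i s \<partial>\<mu>)" using seq by (intro SUP_mono) auto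
  also have "\<dots> = (\<integral>\<^sup>+s. (SUP i. U i s) \<partial>\<mu>)"
    using \<open>incseq U\<close> by (intro nn_integral_monotone_convergence_SUP[symmetric]) (auto simp: incseq_def le_fun_def)
  finally show ?case unfolding eq by (simp add: image_comp comp_def)
qed

end

section \<open>Convolution on Lp\<close>

lemma nn_integral_jensen_powr:
  fixes h :: "'a \<Rightarrow> real"
  assumes M: "prob_space M" and h: "h \<in> borel_measurable M" "\<And>x. 0 \<le> h x" and p: "1 \<le> p"
    and fin: "(\<integral>\<^sup>+x. ennreal (h x powr p) \<partial>M) < \<infinity>"
  shows "(\<integral>\<^sup>+x. ennreal (h x) \<partial>M) < \<infinity>"
    and "0 \<le> r \<Longrightarrow> ennreal r \<le> (\<integral>\<^sup>+x. ennreal (h x) \<partial>M) \<Longrightarrow> ennreal (r powr p) \<le> (\<integral>\<^sup>+x. ennreal (h x powr p) \<partial>M)"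
proof -
  have [measurable]: "h \<in> borel_measurable M" by fact
  have one: "emeasure M (space M) = 1" using M by (rule prob_space.emeasure_space_1)
  have "(\<integral>\<^sup>+x. ennreal (h x) \<partial>M) \<le> (\<integral>\<^sup>+x. 1 + ennreal (h x powr p) \<partial>M)"
  proof (rule nn_integral_mono)
    fix x
    have "h x \<le> 1 + h x powr p"
    proof (cases "h x \<le> 1")
      case False
      then have "h x powr 1 \<le> h x powr p" using p by (intro powr_mono) auto
      with False show ?thesis by simp
    qed (simp add: add_increasing2)
    then have "ennreal (h x) \<le> ennreal (1 + h x powr p)" by (rule ennreal_leI)
    then show "ennreal (h x) \<le> 1 + ennreal (h x powr p)" by simp
  qed
  also have "\<dots> = 1 + (\<integral>\<^sup>+x. ennreal (h x powr p) \<partial>M)"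
    using one by (subst nn_integral_add) auto
  also have "\<dots> < \<infinity>" using fin by simp
  finally show hfin: "(\<integral>\<^sup>+x. ennreal (h x) \<partial>M) < \<infinity>" .
  obtain m where m: "(\<integral>\<^sup>+x. ennreal (h x) \<partial>M) = ennreal m" "0 \<le> m"
    using hfin by (cases "\<integral>\<^sup>+x. ennreal (h x) \<partial>M") auto
  obtain H where H: "(\<integral>\<^sup>+x. ennreal (h x powr p) \<partial>M) = ennreal H" "0 \<le> H"
    using fin by (cases "\<integral>\<^sup>+x. ennreal (h x powr p) \<partial>M") auto
  have mp: "m powr p \<le> H"
  proof (cases "m = 0")
    case False
    with m have m0: "0 < m" by simp
    define c where "c = p * m powr (p - 1)"
    have c: "0 \<le> c" using p by (simp add: c_def)
    have mc: "c * m = p * m powr p" using m0 by (simp add: c_def powr_mult_base mult_ac)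
    have "ennreal (m powr p) + ennreal c * (\<integral>\<^sup>+x. ennreal (h x) \<partial>M) = (\<integral>\<^sup>+x. ennreal (m powr p) + ennreal c * ennreal (h x) \<partial>M)"
      using one by (subst nn_integral_add) (auto simp: nn_integral_cmult)
    also have "\<dots> \<le> (\<integral>\<^sup>+x. ennreal (h x powr p) + ennreal (c * m) \<partial>M)"
    proof (rule nn_integral_mono)
      fix x
      have "m powr p + c * h x \<le> h x powr p + c * m"
        using powr_above_tangent[OF h(2) m0 p, of x] by (simp add: c_def algebra_simps)
      then have "ennreal (m powr p + c * h x) \<le> ennreal (h x powr p + c * m)" by (rule ennreal_leI)
      then show "ennreal (m powr p) + ennreal c * ennreal (h x) \<le> ennreal (h x powr p) + ennreal (c * m)"
        using c h(2)[of x] m0 by (simp add: ennreal_plus ennreal_mult[symmetric])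
    qed
    also have "\<dots> = ennreal H + ennreal (c * m)"
      using one H by (subst nn_integral_add) auto
    finally have "ennreal (m powr p + c * m) \<le> ennreal (H + c * m)"
      using c m H by (simp add: ennreal_plus ennreal_mult[symmetric])
    then have "m powr p + c * m \<le> H + c * m"
      using c m H by (subst (asm) ennreal_le_iff) auto
    then show ?thesis by simp
  qed (use H p in simp)
  assume r: "0 \<le> r" "ennreal r \<le> (\<integral>\<^sup>+x. ennreal (h x) \<partial>M)"
  then have "r \<le> m" using m by simp
  then have "r powr p \<le> m powr p" using r p by (intro powr_mono2) auto
  with mp show "ennreal (r powr p) \<le> (\<integral>\<^sup>+x. ennreal (h x powr p) \<partial>M)" unfolding H(1) by (intro ennreal_leI) simp
qed

context haar begin

lemma Lp_int_translate:
  fixes f :: "'g \<Rightarrow> 'x::real_normed_vector"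
  assumes "ae_strongly_measurable \<mu> f"
  shows "ae_strongly_measurable \<mu> (\<lambda>s. f (s - t))" "Lp_int \<mu> p (\<lambda>s. f (s - t)) = Lp_int \<mu> p f"
proof -
  obtain g where g: "strongly_measurable \<mu> g" "AE x in \<mu>. f x = g x"
    using assms by (rule ae_strongly_measurableE)
  have meas: "(\<lambda>s. s - t) \<in> measurable \<mu> \<mu>" by measurable
  have meas': "(\<lambda>s. s - t) \<in> measurable \<mu> borel" by measurable
  have [measurable]: "g \<in> borel_measurable \<mu>" using g(1) by (rule strongly_measurable_borel)
  have gb: "g \<in> borel_measurable borel" by measurable
  have ae: "AE x in \<mu>. f (x - t) = g (x - t)"
  proof -
    have "AE x in distr \<mu> borel (\<lambda>s. s - t). f x = g x" unfolding distr_translate by (rule g(2))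
    then show ?thesis by (rule AE_distrD[OF meas'])
  qed
  have "strongly_measurable \<mu> (\<lambda>s. g (s - t))" by (rule strongly_measurable_compose[OF g(1) meas])
  with ae show "ae_strongly_measurable \<mu> (\<lambda>s. f (s - t))" unfolding ae_strongly_measurable_iff by blast
  have "Lp_int \<mu> p (\<lambda>s. f (s - t)) = Lp_int \<mu> p (\<lambda>s. g (s - t))" by (rule Lp_int_cong_AE[OF ae])
  also have "\<dots> = Lp_int (distr \<mu> borel (\<lambda>s. s - t)) p g"
    using gb by (subst nn_integral_distr[OF meas']) measurable
  also have "\<dots> = Lp_int \<mu> p g" by (simp add: distr_translate)
  also have "\<dots> = Lp_int \<mu> p f" by (rule Lp_int_cong_AE[symmetric, OF g(2)])
  finally show "Lp_int \<mu> p (\<lambda>s. f (s - t)) = Lp_int \<mu> p f" .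
qed

lemma Lp_fun_translate:
  fixes f :: "'g \<Rightarrow> 'x::real_normed_vector"
  assumes "f \<in> Lp_fun \<mu> p"
  shows "(\<lambda>s. f (s - t)) \<in> Lp_fun \<mu> p" "Lp_norm \<mu> p (\<lambda>s. f (s - t)) = Lp_norm \<mu> p f"
  using assms Lp_int_translate[of f] by (auto simp: Lp_fun_def Lp_norm_def)

end

context haar_prob begin

text \<open>
  By Jensen's inequality this dominates the \<open>p\<close>-th power of the norm of \<open>conv_fun \<nu> f\<close> pointwise, and its integral is controlled by
  translation invariance.
\<close>

definition conv_maj :: "real \<Rightarrow> ('g \<Rightarrow> 'x::real_normed_vector) \<Rightarrow> 'g \<Rightarrow> ennreal"
  where "conv_maj p f s = (\<integral>\<^sup>+t. ennreal (norm (f (s - t)) powr p) \<partial>\<nu>)"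

text \<open>
  A null set of \<open>\<mu>\<close> is met by almost every reflected translate in a null set of \<open>\<nu>\<close>; so convolution is well
  defined on classes.
\<close>

lemma AE_slice:
  assumes "AE s in \<mu>. P s"
  shows "AE s in \<mu>. AE t in \<nu>. P (s - t)"
proof -
  obtain N where N: "{x \<in> space \<mu>. \<not> P x} \<subseteq> N" "emeasure \<mu> N = 0" "N \<in> sets \<mu>"
    using AE_E[OF assms] .
  have Ns: "N \<in> sets borel" using N by simp
  have "(\<integral>\<^sup>+s. nu.slice N s \<partial>\<mu>) = 0" using slice_le[OF Ns] N by simp
  moreover have "nu.slice N \<in> borel_measurable \<mu>" using nu.slice_measurable[OF Ns] by (simp cong: measurable_cong_sets)
  ultimately have "AE s in \<mu>. nu.slice N s = 0" by (subst (asm) nn_integral_0_iff_AE) auto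
  then show ?thesis
  proof eventually_elim
    case (elim s)
    have "{t. s - t \<in> N} \<in> null_sets \<nu>" using elim Ns by (auto simp: nu.slice_def null_sets_def slice_sets)
    note null = this
    show ?case by (rule AE_I'[OF null]) (use N(1) in auto)
  qed
qed

lemma conv_maj_bound:
  fixes f :: "'g \<Rightarrow> 'x::real_normed_vector"
  assumes f: "ae_strongly_measurable \<mu> f"
  obtains \<Psi> where "\<Psi> \<in> borel_measurable \<mu>" "AE s in \<mu>. conv_maj p f s = \<Psi> s" "(\<integral>\<^sup>+s. \<Psi> s \<partial>\<mu>) \<le> Lp_int \<mu> p f"
    "AE s in \<mu>. ae_strongly_measurable \<nu> (\<lambda>t. f (s - t))"
proof -
  obtain g where g: "strongly_measurable \<mu> g" "AE x in \<mu>. f x = g x"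
    using f by (rule ae_strongly_measurableE)
  have gb: "g \<in> borel_measurable borel" using strongly_measurable_borel[OF g(1)] by (simp cong: measurable_cong_sets)
  have phi: "(\<lambda>s. ennreal (norm (g s) powr p)) \<in> borel_measurable borel" using gb by measurable
  have ae: "AE s in \<mu>. AE t in \<nu>. f (s - t) = g (s - t)" by (rule AE_slice[OF g(2)])
  show ?thesis
  proof (rule that[of "conv_maj p g"])
    show "conv_maj p g \<in> borel_measurable \<mu>"
      using nn_integral_slice_le[OF phi] unfolding conv_maj_def[abs_def] by (simp cong: measurable_cong_sets)
    show "AE s in \<mu>. conv_maj p f s = conv_maj p g s"
      using ae
    proof eventually_elim
      case (elim s)
      show ?case unfolding conv_maj_def by (rule nn_integral_cong_AE) (use elim in eventually_elim, simp)
    qed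
    have "(\<integral>\<^sup>+s. conv_maj p g s \<partial>\<mu>) \<le> Lp_int \<mu> p g"
      using nn_integral_slice_le[OF phi] unfolding conv_maj_def by simp
    also have "\<dots> = Lp_int \<mu> p f" by (rule Lp_int_cong_AE[symmetric, OF g(2)])
    finally show "(\<integral>\<^sup>+s. conv_maj p g s \<partial>\<mu>) \<le> Lp_int \<mu> p f" .
    show "AE s in \<mu>. ae_strongly_measurable \<nu> (\<lambda>t. f (s - t))"
      using ae
    proof eventually_elim
      case (elim s)
      have "(\<lambda>t. s - t) \<in> measurable \<nu> \<mu>" by measurable
      then have "strongly_measurable \<nu> (\<lambda>t. g (s - t))" by (rule strongly_measurable_compose[OF g(1)])
      with elim show ?case unfolding ae_strongly_measurable_iff by blast
    qed
  qed
qed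

lemma conv_fun_pointwise:
  fixes f :: "'g \<Rightarrow> 'x::complex_banach"
  assumes f: "f \<in> Lp_fun \<mu> p" and p: "1 \<le> p"
  shows "AE s in \<mu>. strongly_integrable \<nu> (\<lambda>t. f (s - t)) \<and> ennreal (norm (conv_fun \<nu> f s) powr p) \<le> conv_maj p f s"
proof -
  have fm: "ae_strongly_measurable \<mu> f" using f by (simp add: Lp_fun_def)
  obtain \<Psi> where Psi: "\<Psi> \<in> borel_measurable \<mu>" "AE s in \<mu>. conv_maj p f s = \<Psi> s" "(\<integral>\<^sup>+s. \<Psi> s \<partial>\<mu>) \<le> Lp_int \<mu> p f"
    "AE s in \<mu>. ae_strongly_measurable \<nu> (\<lambda>t. f (s - t))"
    using conv_maj_bound[OF fm, of p] .
  have "(\<integral>\<^sup>+s. \<Psi> s \<partial>\<mu>) \<noteq> \<infinity>" using Psi(3) f by (auto simp: Lp_fun_def)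
  from nn_integral_PInf_AE[OF Psi(1) this]
  have "AE s in \<mu>. conv_maj p f s < \<infinity>" using Psi(2) by eventually_elim (simp add: less_top)
  with Psi(4) show ?thesis
  proof eventually_elim
    case (elim s)
    obtain h where h: "strongly_measurable \<nu> h" "AE t in \<nu>. f (s - t) = h t"
      using elim(1) by (rule ae_strongly_measurableE)
    have hb: "(\<lambda>t. norm (h t)) \<in> borel_measurable \<nu>" using strongly_measurable_borel[OF h(1)] by measurable
    have eqp: "conv_maj p f s = (\<integral>\<^sup>+t. ennreal (norm (h t) powr p) \<partial>\<nu>)"
      unfolding conv_maj_def by (rule nn_integral_cong_AE) (use h(2) in eventually_elim, simp)
    have eq1: "(\<integral>\<^sup>+t. ennreal (norm (f (s - t))) \<partial>\<nu>) = (\<integral>\<^sup>+t. ennreal (norm (h t)) \<partial>\<nu>)"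
      by (rule nn_integral_cong_AE) (use h(2) in eventually_elim, simp)
    have fin: "(\<integral>\<^sup>+t. ennreal (norm (h t) powr p) \<partial>\<nu>) < \<infinity>" using elim(2) eqp by simp
    note J = nn_integral_jensen_powr[OF nu.prob hb norm_ge_zero p fin]
    have "strongly_integrable \<nu> (\<lambda>t. f (s - t))"
      using elim(1) J(1) eq1 by (simp add: strongly_integrable_def)
    moreover have "ennreal (norm (conv_fun \<nu> f s)) \<le> (\<integral>\<^sup>+t. ennreal (norm (h t)) \<partial>\<nu>)"
      unfolding conv_fun_def eq1[symmetric] by (rule norm_strong_integral_le)
    then have "ennreal (norm (conv_fun \<nu> f s) powr p) \<le> conv_maj p f s"
      unfolding eqp by (intro J(2)) auto
    ultimately show ?case by blast
  qed
qed

lemma conv_fun_cong: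
  assumes "AE s in \<mu>. f s = g s" shows "AE s in \<mu>. conv_fun \<nu> f s = conv_fun \<nu> g s"
  using AE_slice[OF assms]
proof eventually_elim
  case (elim s)
  then show ?case unfolding conv_fun_def by (rule strong_integral_cong_AE)
qed

lemma conv_fun_add:
  fixes f g :: "'g \<Rightarrow> 'x::complex_banach"
  assumes "f \<in> Lp_fun \<mu> p" "g \<in> Lp_fun \<mu> p" "1 \<le> p"
  shows "AE s in \<mu>. conv_fun \<nu> (\<lambda>s. f s + g s) s = conv_fun \<nu> f s + conv_fun \<nu> g s"
  using conv_fun_pointwise[OF assms(1,3)] conv_fun_pointwise[OF assms(2,3)]
  by eventually_elim (simp add: conv_fun_def strong_integral_add)

lemma conv_fun_diff:
  fixes f g :: "'g \<Rightarrow> 'x::complex_banach"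
  assumes "f \<in> Lp_fun \<mu> p" "g \<in> Lp_fun \<mu> p" "1 \<le> p"
  shows "AE s in \<mu>. conv_fun \<nu> (\<lambda>s. f s - g s) s = conv_fun \<nu> f s - conv_fun \<nu> g s"
  using conv_fun_pointwise[OF assms(1,3)] conv_fun_pointwise[OF assms(2,3)]
  by eventually_elim (simp add: conv_fun_def strong_integral_diff)

lemma conv_fun_scaleC:
  fixes f :: "'g \<Rightarrow> 'x::complex_banach"
  assumes "f \<in> Lp_fun \<mu> p" "1 \<le> p"
  shows "AE s in \<mu>. conv_fun \<nu> (\<lambda>s. scaleC c (f s)) s = scaleC c (conv_fun \<nu> f s)"
  using conv_fun_pointwise[OF assms]
  by eventually_elim (simp add: conv_fun_def strong_integral_linear[OF _ bounded_linear_scaleC])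

lemma conv_fun_simple:
  fixes u :: "'g \<Rightarrow> 'x::complex_banach"
  assumes u: "simple_function \<mu> u"
  shows "conv_fun \<nu> u s = (\<Sum>y\<in>range u - {0}. enn2real (nu.slice (u -` {y}) s) *\<^sub>R y)"
proof -
  have A: "u -` {y} \<in> sets borel" for y using simple_functionD(2)[OF u, of "{y}"] by simp
  have "(\<lambda>t. u (s - t)) = (\<lambda>t. \<Sum>y\<in>range u - {0}. indicator {t. s - t \<in> u -` {y}} t *\<^sub>R y)"
  proof
    fix t
    have "u (s - t) = (\<Sum>y\<in>range u - {0}. indicator (u -` {y}) (s - t) *\<^sub>R y)"
      using simple_function_eq_sum[OF _ u, of "s - t"] unfolding space_eq Int_UNIV_right by (simp only: UNIV_I)
    also have "\<dots> = (\<Sum>y\<in>range u - {0}. indicator {t. s - t \<in> u -` {y}} t *\<^sub>R y)"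
      by (intro sum.cong refl) (simp only: indicator_def mem_Collect_eq)
    finally show "u (s - t) = (\<Sum>y\<in>range u - {0}. indicator {t. s - t \<in> u -` {y}} t *\<^sub>R y)" .
  qed
  note eq = this
  have ind: "strongly_integrable \<nu> (\<lambda>t. indicator {t. s - t \<in> u -` {y}} t *\<^sub>R y)"
    "strong_integral \<nu> (\<lambda>t. indicator {t. s - t \<in> u -` {y}} t *\<^sub>R y) = measure \<nu> {t. s - t \<in> u -` {y}} *\<^sub>R y" for y
  proof -
    have m: "{t. s - t \<in> u -` {y}} \<in> sets \<nu>" "emeasure \<nu> {t. s - t \<in> u -` {y}} < \<infinity>"
      unfolding nu.sets_eq infinity_ennreal_def less_top[symmetric] by (rule slice_sets(1)[OF A], rule nu.emeasure_finite)
    show "strongly_integrable \<nu> (\<lambda>t. indicator {t. s - t \<in> u -` {y}} t *\<^sub>R y)"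
      "strong_integral \<nu> (\<lambda>t. indicator {t. s - t \<in> u -` {y}} t *\<^sub>R y) = measure \<nu> {t. s - t \<in> u -` {y}} *\<^sub>R y"
      by (rule strong_integral_indicator[OF m])+
  qed
  show ?thesis
    unfolding conv_fun_def eq strong_integral_sum[OF ind(1)] ind(2) measure_def nu.slice_def ..
qed

lemma conv_fun_simple_measurable:
  fixes u :: "'g \<Rightarrow> 'x::complex_banach"
  assumes u: "simple_function \<mu> u"
  shows "ae_strongly_measurable \<mu> (conv_fun \<nu> u)"
proof -
  have A: "u -` {y} \<in> sets borel" for y using simple_functionD(2)[OF u, of "{y}"] by simp
  have "ae_strongly_measurable \<mu> (\<lambda>s. enn2real (nu.slice (u -` {y}) s) *\<^sub>R y)" for y
  proof -
    have "(\<lambda>s. enn2real (nu.slice (u -` {y}) s)) \<in> borel_measurable \<mu>"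
      using nu.slice_measurable[OF A[of y]] by (simp cong: measurable_cong_sets)
    then have "strongly_measurable \<mu> (\<lambda>s. enn2real (nu.slice (u -` {y}) s))"
      by (rule strongly_measurable_borel_second_countable)
    from strongly_measurable_linear[OF this bounded_linear_scaleR_left[of y]]
    show ?thesis by (rule strongly_measurable_imp_ae)
  qed
  then have "ae_strongly_measurable \<mu> (\<lambda>s. \<Sum>y\<in>range u - {0}. enn2real (nu.slice (u -` {y}) s) *\<^sub>R y)"
    by (rule ae_strongly_measurable_sum)
  moreover have "conv_fun \<nu> u = (\<lambda>s. \<Sum>y\<in>range u - {0}. enn2real (nu.slice (u -` {y}) s) *\<^sub>R y)"
    by (rule ext) (rule conv_fun_simple[OF u])
  ultimately show ?thesis by simp
qed

text \<open>
  The norm bound is Young's inequality for a probability measure. Strong measurability comes from simple functions that converge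
  fast enough in \<open>L\<^sup>p\<close> for the convolutions to converge almost everywhere.
\<close>

lemma conv_fun_Lp:
  fixes f :: "'g \<Rightarrow> 'x::complex_banach"
  assumes f: "f \<in> Lp_fun \<mu> p" and p: "1 \<le> p"
  shows "conv_fun \<nu> f \<in> Lp_fun \<mu> p" "Lp_norm \<mu> p (conv_fun \<nu> f) \<le> Lp_norm \<mu> p f"
proof -
  have fm: "ae_strongly_measurable \<mu> f" using f by (simp add: Lp_fun_def)
  have p0: "0 < p" using p by simp
  obtain s where s: "\<And>i::nat. simple_function \<mu> (s i)" "\<And>i. Lp_int \<mu> p (s i) < \<infinity>"
    "(\<lambda>i. Lp_int \<mu> p (\<lambda>x. f x - s i x)) \<longlonglongrightarrow> 0"
    by (rule Lp_fun_approx_simple[OF f p0]) (rule that)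
  have "\<exists>i. Lp_int \<mu> p (\<lambda>x. f x - s i x) < ennreal ((1/2) ^ n)" for n
  proof -
    have "\<forall>\<^sub>F i in sequentially. Lp_int \<mu> p (\<lambda>x. f x - s i x) < ennreal ((1/2) ^ n)"
      using s(3) by (rule order_tendstoD) simp
    then show ?thesis by (rule eventually_happens'[OF sequentially_bot])
  qed
  then obtain k where k: "\<And>n. Lp_int \<mu> p (\<lambda>x. f x - s (k n) x) < ennreal ((1/2) ^ n)" by metis
  have sLp: "s i \<in> Lp_fun \<mu> p" for i
    using s by (auto simp: Lp_fun_def intro: strongly_measurable_imp_ae strongly_measurable_simple)
  have dLp: "(\<lambda>x. f x - s (k n) x) \<in> Lp_fun \<mu> p" for n by (intro Lp_fun_diff f sLp p)
  have "\<exists>\<Psi>. \<Psi> \<in> borel_measurable \<mu> \<and> (AE x in \<mu>. conv_maj p (\<lambda>x. f x - s (k n) x) x = \<Psi> x) \<and> (\<integral>\<^sup>+x. \<Psi> x \<partial>\<mu>) \<le> ennreal ((1/2) ^ n)" for n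
  proof -
    have m: "ae_strongly_measurable \<mu> (\<lambda>x. f x - s (k n) x)" using dLp by (simp add: Lp_fun_def)
    obtain \<Psi> where "\<Psi> \<in> borel_measurable \<mu>" "AE x in \<mu>. conv_maj p (\<lambda>x. f x - s (k n) x) x = \<Psi> x"
      "(\<integral>\<^sup>+x. \<Psi> x \<partial>\<mu>) \<le> Lp_int \<mu> p (\<lambda>x. f x - s (k n) x)" "AE x in \<mu>. ae_strongly_measurable \<nu> (\<lambda>t. f (x - t) - s (k n) (x - t))"
      using conv_maj_bound[OF m, of p] .
    then show ?thesis using k[of n] by (intro exI[of _ \<Psi>]) auto
  qed
  then obtain \<Psi> where Psi: "\<And>n. \<Psi> n \<in> borel_measurable \<mu>" "\<And>n. AE x in \<mu>. conv_maj p (\<lambda>x. f x - s (k n) x) x = \<Psi> n x"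
    "\<And>n. (\<integral>\<^sup>+x. \<Psi> n x \<partial>\<mu>) \<le> ennreal ((1/2) ^ n)" by metis
  have "(\<integral>\<^sup>+x. (suminf (\<lambda>n. \<Psi> n x)) \<partial>\<mu>) = (suminf (\<lambda>n. \<integral>\<^sup>+x. \<Psi> n x \<partial>\<mu>))" using Psi(1) by (rule nn_integral_suminf)
  also have "\<dots> \<le> (suminf (\<lambda>n. ennreal ((1/2) ^ n)))" by (intro suminf_le Psi(3)) auto
  also have "\<dots> = ennreal (suminf (\<lambda>n. (1/2) ^ n))" by (rule suminf_ennreal2) (auto intro: summable_geometric)
  finally have "(\<integral>\<^sup>+x. (suminf (\<lambda>n. \<Psi> n x)) \<partial>\<mu>) \<noteq> \<infinity>" by (auto simp: top_unique)
  then have fin: "AE x in \<mu>. (suminf (\<lambda>n. \<Psi> n x)) \<noteq> \<infinity>"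
    using Psi(1) by (intro nn_integral_PInf_AE) auto
  have "AE x in \<mu>. \<forall>n. conv_maj p (\<lambda>x. f x - s (k n) x) x = \<Psi> n x" using Psi(2) by (simp add: AE_all_countable)
  moreover have "AE x in \<mu>. \<forall>n. ennreal (norm (conv_fun \<nu> (\<lambda>x. f x - s (k n) x) x) powr p) \<le> conv_maj p (\<lambda>x. f x - s (k n) x) x"
    unfolding AE_all_countable
  proof
    fix n show "AE x in \<mu>. ennreal (norm (conv_fun \<nu> (\<lambda>x. f x - s (k n) x) x) powr p) \<le> conv_maj p (\<lambda>x. f x - s (k n) x) x"
      using conv_fun_pointwise[OF dLp[of n] p] by eventually_elim simp
  qed
  moreover have "AE x in \<mu>. \<forall>n. conv_fun \<nu> (\<lambda>x. f x - s (k n) x) x = conv_fun \<nu> f x - conv_fun \<nu> (s (k n)) x"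
    unfolding AE_all_countable by (intro allI conv_fun_diff[where p=p] f sLp p)
  ultimately have "AE x in \<mu>. (\<lambda>n. conv_fun \<nu> (s (k n)) x) \<longlonglongrightarrow> conv_fun \<nu> f x"
    using fin
  proof eventually_elim
    case (elim x)
    define d where "d n = norm (conv_fun \<nu> f x - conv_fun \<nu> (s (k n)) x)" for n
    have d: "ennreal (d n powr p) \<le> \<Psi> n x" for n using elim(1-3) by (metis d_def)
    have "(suminf (\<lambda>n. ennreal (d n powr p))) \<le> (suminf (\<lambda>n. \<Psi> n x))" by (intro suminf_le d) auto
    then have ne: "(suminf (\<lambda>n. ennreal (d n powr p))) \<noteq> \<infinity>" using elim(4) by (auto simp: top_unique)
    have "summable (\<lambda>n. d n powr p)" using ne by (intro summable_suminf_not_top) auto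
    then have "(\<lambda>n. d n powr p) \<longlonglongrightarrow> 0" by (rule summable_LIMSEQ_zero)
    then have "(\<lambda>n. (d n powr p) powr (1 / p)) \<longlonglongrightarrow> 0 powr (1 / p)"
      using p by (intro tendsto_powr') (auto intro: tendsto_const)
    moreover have "(d n powr p) powr (1 / p) = d n" for n using p by (simp add: powr_powr d_def)
    ultimately have "d \<longlonglongrightarrow> 0" using p by simp
    moreover have "d = (\<lambda>n. norm (conv_fun \<nu> (s (k n)) x - conv_fun \<nu> f x))"
      by (auto simp: d_def norm_minus_commute)
    ultimately have "(\<lambda>n. norm (conv_fun \<nu> (s (k n)) x - conv_fun \<nu> f x)) \<longlonglongrightarrow> 0" by simp
    then show ?case by (rule LIM_zero_cancel[OF tendsto_norm_zero_cancel])
  qed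
  then have meas: "ae_strongly_measurable \<mu> (conv_fun \<nu> f)"
    by (rule ae_strongly_measurable_LIMSEQ[OF conv_fun_simple_measurable[OF s(1)]])
  obtain \<Phi> where Phi: "\<Phi> \<in> borel_measurable \<mu>" "AE x in \<mu>. conv_maj p f x = \<Phi> x" "(\<integral>\<^sup>+x. \<Phi> x \<partial>\<mu>) \<le> Lp_int \<mu> p f"
      "AE x in \<mu>. ae_strongly_measurable \<nu> (\<lambda>t. f (x - t))"
    using conv_maj_bound[OF fm, of p] .
  have "Lp_int \<mu> p (conv_fun \<nu> f) \<le> (\<integral>\<^sup>+x. \<Phi> x \<partial>\<mu>)"
  proof (rule nn_integral_mono_AE)
    show "AE x in \<mu>. ennreal (norm (conv_fun \<nu> f x) powr p) \<le> \<Phi> x"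
      using conv_fun_pointwise[OF f p] Phi(2) by eventually_elim simp
  qed
  also note Phi(3)
  finally have le: "Lp_int \<mu> p (conv_fun \<nu> f) \<le> Lp_int \<mu> p f" .
  then show Lp: "conv_fun \<nu> f \<in> Lp_fun \<mu> p"
    using meas f by (auto simp: Lp_fun_def intro: le_less_trans)
  show "Lp_norm \<mu> p (conv_fun \<nu> f) \<le> Lp_norm \<mu> p f"
    using le Lp_norm_powr[OF f p0] Lp Lp_norm_nonneg by (subst Lp_norm_le_iff[OF Lp p0]) auto
qed

end

section \<open>Discretization\<close>

context regular_prob begin

lemma compact_of_measure_close_to_1:
  assumes "0 < \<delta>"
  obtains K where "compact K" "K \<in> sets borel" "measure \<nu> (UNIV - K) \<le> \<delta>"
proof -
  have "ennreal (1 - \<delta>) < ennreal 1" using assms by (intro ennreal_lessI) auto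
  then have "ennreal (1 - \<delta>) < emeasure \<nu> UNIV" by simp
  moreover have "UNIV \<in> sets (borel :: 'g measure)" by simp
  ultimately obtain K where K: "compact K" "K \<subseteq> UNIV" "ennreal (1 - \<delta>) < emeasure \<nu> K"
    using inner_regular_less by blast
  have Kb: "K \<in> sets borel" using K(1) by (intro borel_closed compact_imp_closed)
  have "1 - \<delta> \<le> measure \<nu> K"
  proof (rule ccontr)
    assume "\<not> ?thesis"
    then have "ennreal (measure \<nu> K) \<le> ennreal (1 - \<delta>)" by (intro ennreal_leI) auto
    with K(3) show False by (simp add: emeasure_eq_measure)
  qed
  moreover have "measure \<nu> (space \<nu> - K) = 1 - measure \<nu> K" using Kb by (intro prob_compl) simp
  ultimately have "measure \<nu> (UNIV - K) \<le> \<delta>" by simp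
  with K(1) Kb show ?thesis by (rule that)
qed

text \<open>
  A compact set of almost full measure is covered by finitely many of the open sets. The exceptional
  piece \<open>E 0\<close> is the complement of the compact set, with an arbitrary sample point.
\<close>

lemma finite_borel_partition:
  fixes Ob :: "'g \<Rightarrow> 'g set"
  assumes Ob: "\<And>t. open (Ob t)" "\<And>t. t \<in> Ob t" and d: "0 < \<delta>"
  obtains n :: nat and E :: "nat \<Rightarrow> 'g set" and t :: "nat \<Rightarrow> 'g" where
    "\<And>j. E j \<in> sets borel" "disjoint_family_on E {..n}" "(\<Union>j\<le>n. E j) = UNIV" "measure \<nu> (E 0) \<le> \<delta>"
    "\<And>j. 1 \<le> j \<Longrightarrow> j \<le> n \<Longrightarrow> E j \<subseteq> Ob (t j)"
proof -
  obtain K where K: "compact K" and Kb: "K \<in> sets borel" and K_large: "measure \<nu> (UNIV - K) \<le> \<delta>"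
    by (rule compact_of_measure_close_to_1[OF d])
  have "K \<subseteq> (\<Union>t\<in>K. Ob t)" using Ob(2) by blast
  then obtain F where F: "F \<subseteq> K" "finite F" "K \<subseteq> (\<Union>t\<in>F. Ob t)"
    using compactE_image[OF K, of K Ob] Ob(1) by blast
  obtain ts where ts: "set ts = F" using finite_list[OF F(2)] by blast
  define n where "n = length ts"
  define t where "t j = ts ! (j - 1)" for j
  have cover: "K \<subseteq> (\<Union>j\<in>{1..n}. Ob (t j))"
  proof
    fix x assume "x \<in> K"
    then obtain y where "y \<in> set ts" "x \<in> Ob y" using F ts by auto
    then obtain i where "i < n" "ts ! i = y" unfolding n_def in_set_conv_nth by auto
    then show "x \<in> (\<Union>j\<in>{1..n}. Ob (t j))" using \<open>x \<in> Ob y\<close> by (intro UN_I[of "Suc i"]) (auto simp: t_def)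
  qed
  define E where "E j = (if j = 0 then UNIV - K else (K \<inter> Ob (t j)) - (\<Union>i\<in>{1..<j}. Ob (t i)))" for j
  show ?thesis
  proof (rule that[of E n t])
    show "E j \<in> sets borel" for j using Kb Ob(1) by (auto simp: E_def)
    have disj: "E i \<inter> E j = {}" if "i < j" for i j
      using that by (cases "i = 0") (auto simp: E_def)
    show "disjoint_family_on E {..n}"
      unfolding disjoint_family_on_def
    proof (intro ballI impI)
      fix i j :: nat assume "i \<noteq> j"
      then show "E i \<inter> E j = {}" using disj[of i j] disj[of j i] by (cases "i < j") (auto simp: Int_commute)
    qed
    show "(\<Union>j\<le>n. E j) = UNIV"
    proof (intro equalityI subsetI UNIV_I)
      fix x
      show "x \<in> (\<Union>j\<le>n. E j)"
      proof (cases "x \<in> K")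
        case True
        define j where "j = (LEAST j. 1 \<le> j \<and> j \<le> n \<and> x \<in> Ob (t j))"
        have "x \<in> (\<Union>j\<in>{1..n}. Ob (t j))" using cover True by blast
        then have ex: "\<exists>j. 1 \<le> j \<and> j \<le> n \<and> x \<in> Ob (t j)" by auto
        have j: "1 \<le> j" "j \<le> n" "x \<in> Ob (t j)" using LeastI_ex[OF ex] unfolding j_def by auto
        have "x \<notin> Ob (t i)" if "1 \<le> i" "i < j" for i
          using not_less_Least[of i "\<lambda>j. 1 \<le> j \<and> j \<le> n \<and> x \<in> Ob (t j)"] that j(2) unfolding j_def[symmetric] by auto
        then have "x \<in> E j" using True j by (auto simp: E_def)
        with j show ?thesis by auto
      next
        case False
        then have "x \<in> E 0" by (simp add: E_def)
        then show ?thesis by auto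
      qed
    qed
    show "measure \<nu> (E 0) \<le> \<delta>" using K_large by (simp add: E_def)
    show "E j \<subseteq> Ob (t j)" if "1 \<le> j" "j \<le> n" for j using that by (auto simp: E_def)
  qed
qed

lemma partition_measure:
  assumes "\<And>j. E j \<in> sets borel" "disjoint_family_on E {..n::nat}" "(\<Union>j\<le>n. E j) = UNIV" "A \<in> sets borel"
  shows "measure \<nu> A = (\<Sum>j\<le>n. measure \<nu> (E j \<inter> A))"
proof -
  have "(\<Sum>j\<le>n. measure \<nu> (E j \<inter> A)) = measure \<nu> (\<Union>j\<le>n. E j \<inter> A)"
    using assms by (intro finite_measure_finite_Union[symmetric]) (auto simp: disjoint_family_on_def)
  also have "(\<Union>j\<le>n. E j \<inter> A) = A" using assms(3) by blast
  finally show ?thesis by simp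
qed

lemma partition_weights:
  assumes "\<And>j. E j \<in> sets borel" "disjoint_family_on E {..n::nat}" "(\<Union>j\<le>n. E j) = UNIV"
  shows "(\<Sum>j\<le>n. measure \<nu> (E j)) = 1"
  using partition_measure[OF assms, of UNIV] by (simp add: measure_def)

lemma slice_eq_measure: "enn2real (slice V s) = measure \<nu> {t. s - t \<in> V}"
  by (simp add: slice_def measure_def)

lemma strong_integral_bounded_scaleR:
  fixes y :: "'x::complex_banach"
  assumes g: "\<gamma> \<in> borel_measurable borel" "\<And>t. \<gamma> t \<le> 1"
  shows "strongly_integrable \<nu> (\<lambda>t. enn2real (\<gamma> t) *\<^sub>R y)"
    "strong_integral \<nu> (\<lambda>t. enn2real (\<gamma> t) *\<^sub>R y) = enn2real (\<integral>\<^sup>+t. \<gamma> t \<partial>\<nu>) *\<^sub>R y"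
proof -
  have [measurable]: "(\<lambda>t. enn2real (\<gamma> t)) \<in> borel_measurable \<nu>" using g(1) by measurable
  have top: "\<gamma> t < top" for t using g(2)[of t] by (rule le_less_trans) simp
  have le1: "enn2real (\<gamma> t) \<le> 1" for t using g(2)[of t] by (intro enn2real_leI) auto
  have int: "integrable \<nu> (\<lambda>t. enn2real (\<gamma> t))"
    by (rule integrable_const_bound[of _ 1]) (use le1 in auto)
  have hs: "has_strong_integral \<nu> (\<lambda>t. enn2real (\<gamma> t)) (integral\<^sup>L \<nu> (\<lambda>t. enn2real (\<gamma> t)))"
    using has_bochner_integral_integrable[OF int] by (subst has_strong_integral_iff_has_bochner_integral) auto
  have eq: "integral\<^sup>L \<nu> (\<lambda>t. enn2real (\<gamma> t)) = enn2real (\<integral>\<^sup>+t. \<gamma> t \<partial>\<nu>)"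
    using top by (subst integral_eq_nn_integral) auto
  have si: "strongly_integrable \<nu> (\<lambda>t. enn2real (\<gamma> t))"
    unfolding strongly_integrable_def
  proof
    show "ae_strongly_measurable \<nu> (\<lambda>t. enn2real (\<gamma> t))"
      by (intro strongly_measurable_imp_ae strongly_measurable_borel_second_countable) measurable
    have "(\<integral>\<^sup>+t. ennreal (norm (enn2real (\<gamma> t))) \<partial>\<nu>) \<le> (\<integral>\<^sup>+t. 1 \<partial>\<nu>)"
      using le1 by (intro nn_integral_mono) auto
    then show "(\<integral>\<^sup>+t. ennreal (norm (enn2real (\<gamma> t))) \<partial>\<nu>) < \<infinity>" by (simp add: le_less_trans)
  qed
  show "strongly_integrable \<nu> (\<lambda>t. enn2real (\<gamma> t) *\<^sub>R y)"
    by (rule strongly_integrable_bounded_linear[OF si bounded_linear_scaleR_left])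
  show "strong_integral \<nu> (\<lambda>t. enn2real (\<gamma> t) *\<^sub>R y) = enn2real (\<integral>\<^sup>+t. \<gamma> t \<partial>\<nu>) *\<^sub>R y"
    using strong_integral_eq[OF has_strong_integral_linear[OF hs bounded_linear_scaleR_left[of y]]] eq by simp
qed

end

locale symmetric_prob = regular_prob \<nu> for \<nu> :: "'g::{topological_ab_group_add, t2_space} measure" +
  assumes symmetric: "symmetric_measure \<nu>"
begin

lemma reflect:
  assumes "V \<in> sets borel" shows "emeasure \<nu> {t. - t \<in> V} = emeasure \<nu> V"
proof -
  have "{t. - t \<in> V} = uminus ` V"
  proof safe
    fix t assume "- t \<in> V"
    then show "t \<in> uminus ` V" by (intro image_eqI[of _ _ "- t"]) auto
  qed auto
  then show ?thesis using symmetric assms by (auto simp: symmetric_measure_def)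
qed

lemma slice_plus:
  assumes "V \<in> sets borel" shows "emeasure \<nu> {t. s + t \<in> V} = slice V s"
  using reflect[OF slice_sets(3)[OF assms, of s]] by (simp add: slice_def)

end

context haar_prob begin

text \<open>
  For a point \<open>x\<close> of \<open>E j\<close>, membership of \<open>s - x\<close> and of \<open>s - t j\<close> in \<open>V\<close> can differ only if one of the two lies in \<open>U - K\<close>, since the
  points of \<open>E j\<close> differ from \<open>t j\<close> by elements of \<open>W\<close>. The resulting error has small integral, and
  it is bounded by 1, so its \<open>p\<close>-th power is small as well. The piece \<open>E 0\<close> contributes at most \<open>\<delta>\<close>
  pointwise; its \<open>p\<close>-th power is at most \<open>\<delta>\<^sup>p\<^sup>-\<^sup>1\<close> times an integrable function, because \<open>1 < p\<close>.
\<close>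

lemma slice_discretization:
  assumes V: "V \<in> sets borel" and K: "K \<in> sets borel" "K \<subseteq> V" and U: "U \<in> sets borel" "V \<subseteq> U"
    and W: "\<And>k w. k \<in> K \<Longrightarrow> w \<in> W \<Longrightarrow> k + w \<in> U \<and> k - w \<in> U"
    and E: "\<And>j. E j \<in> sets borel" "disjoint_family_on E {..n::nat}" "(\<Union>j\<le>n. E j) = UNIV"
    and t: "\<And>j x. 1 \<le> j \<Longrightarrow> j \<le> n \<Longrightarrow> x \<in> E j \<Longrightarrow> x - t j \<in> W"
    and d: "measure \<nu> (E 0) \<le> \<delta>" and p: "1 < p"
  shows "(\<integral>\<^sup>+s. ennreal (\<bar>enn2real (nu.slice V s) - (\<Sum>j\<le>n. measure \<nu> (E j) * indicator V (s - t j))\<bar> powr p) \<partial>\<mu>)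
    \<le> ennreal (4 powr p * 2) * (emeasure \<mu> (U - K) + ennreal (\<delta> powr (p - 1)) * emeasure \<mu> V)"
proof -
  define w where "w j = measure \<nu> (E j)" for j
  have w0: "0 \<le> w j" for j by (simp add: w_def)
  have w1: "w j \<le> 1" for j unfolding w_def by (rule nu.prob_le_1)
  define B where "B = U - K"
  have Bs: "B \<in> sets borel" using U K by (auto simp: B_def)
  define a where "a s = enn2real (nu.slice B s)" for s
  define b where "b s = (\<Sum>j\<in>{1..n}. w j * indicator B (s - t j))" for s
  define h where "h s = measure \<nu> (E 0 \<inter> {t. s - t \<in> V})" for s
  define h' where "h' s = w 0 * indicator V (s - t 0)" for s
  have wsum: "w 0 + (\<Sum>j\<in>{1..n}. w j) = 1"
  proof -
    have "{..n} = insert 0 {1..n}" by auto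
    then show ?thesis using nu.partition_weights[OF E] by (simp add: w_def)
  qed
  have pt: "\<bar>enn2real (nu.slice V s) - (\<Sum>j\<le>n. w j * indicator V (s - t j))\<bar> \<le> a s + b s + h s + h' s" for s
  proof -
    let ?S = "\<lambda>A. {t. s - t \<in> A}"
    have S: "?S A \<in> sets borel" if "A \<in> sets borel" for A using slice_sets(1)[OF that] .
    have each: "\<bar>measure \<nu> (E j \<inter> ?S V) - w j * indicator V (s - t j)\<bar> \<le> measure \<nu> (E j \<inter> ?S B) + w j * indicator B (s - t j)"
      if j: "1 \<le> j" "j \<le> n" for j
    proof -
      have mono: "measure \<nu> X \<le> measure \<nu> Y" if "X \<subseteq> Y" "Y \<in> sets borel" for X Y
        using that by (intro nu.finite_measure_mono) auto
      have le_w: "measure \<nu> (E j \<inter> X) \<le> w j" for X unfolding w_def by (intro mono E) auto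
      have KU: "s - x \<in> U" if "x \<in> E j" "s - t j \<in> K" for x
        using W[OF that(2) t[OF j that(1)]] by (simp add: algebra_simps)
      have UK: "s - t j \<in> U" if "x \<in> E j" "s - x \<in> K" for x
        using W[OF that(2) t[OF j that(1)]] by (simp add: algebra_simps)
      show ?thesis
      proof (cases "s - t j \<in> B")
        case True
        then have iB: "indicator B (s - t j) = (1::real)" by simp
        have iV: "w j * indicator V (s - t j) = 0 \<or> w j * indicator V (s - t j) = w j" by (simp add: indicator_def)
        have "0 \<le> measure \<nu> (E j \<inter> ?S V)" "0 \<le> measure \<nu> (E j \<inter> ?S B)" by (rule measure_nonneg)+
        with le_w[of "?S V"] iV show ?thesis unfolding iB mult_1_right by linarith
      next
        case False
        show ?thesis
        proof (cases "s - t j \<in> V")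
          case True
          then have sK: "s - t j \<in> K" using False U by (auto simp: B_def)
          have "w j = measure \<nu> (E j \<inter> ?S V) + measure \<nu> (E j - ?S V)"
            using E S[OF V] nu.finite_measure_Union[of "E j \<inter> ?S V" "E j - ?S V"]
            by (simp add: w_def Un_Diff_Int Int_Un_distrib inf_sup_aci Diff_disjoint Un_commute)
          moreover have "measure \<nu> (E j - ?S V) \<le> measure \<nu> (E j \<inter> ?S B)"
            using KU[OF _ sK] K S[OF Bs] E by (intro mono) (auto simp: B_def)
          moreover have "measure \<nu> (E j \<inter> ?S V) \<le> w j" by (rule le_w)
          ultimately show ?thesis using True by (simp add: indicator_def)
        next
          case nV: False
          have "s - x \<notin> K" if "x \<in> E j" for x using UK[OF that] False nV K by (auto simp: B_def)
          then have "measure \<nu> (E j \<inter> ?S V) \<le> measure \<nu> (E j \<inter> ?S B)"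
            using U S[OF Bs] E by (intro mono) (auto simp: B_def)
          then show ?thesis using nV False by (simp add: indicator_def)
        qed
      qed
    qed
    have split: "(\<Sum>j\<le>n. f j) = f 0 + (\<Sum>j\<in>{1..n}. f j)" for f :: "nat \<Rightarrow> real"
    proof -
      have "{..n} = insert 0 {1..n}" by auto
      then show ?thesis by simp
    qed
    have sV: "enn2real (nu.slice V s) = h s + (\<Sum>j\<in>{1..n}. measure \<nu> (E j \<inter> ?S V))"
      unfolding nu.slice_eq_measure h_def using nu.partition_measure[OF E S[OF V]] split[of "\<lambda>j. measure \<nu> (E j \<inter> ?S V)"] by simp
    have sB: "(\<Sum>j\<in>{1..n}. measure \<nu> (E j \<inter> ?S B)) \<le> a s"
      unfolding a_def nu.slice_eq_measure using nu.partition_measure[OF E S[OF Bs]] split[of "\<lambda>j. measure \<nu> (E j \<inter> ?S B)"] by simp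
    have "\<bar>(\<Sum>j\<in>{1..n}. measure \<nu> (E j \<inter> ?S V) - w j * indicator V (s - t j))\<bar>
        \<le> (\<Sum>j\<in>{1..n}. measure \<nu> (E j \<inter> ?S B) + w j * indicator B (s - t j))"
      by (rule order_trans[OF sum_abs]) (intro sum_mono each, auto)
    also have "\<dots> \<le> a s + b s" using sB by (simp add: sum.distrib b_def)
    finally have "\<bar>(\<Sum>j\<in>{1..n}. measure \<nu> (E j \<inter> ?S V)) - (\<Sum>j\<in>{1..n}. w j * indicator V (s - t j))\<bar> \<le> a s + b s"
      by (simp add: sum_subtractf)
    moreover have "0 \<le> h s" "0 \<le> h' s" using w0 by (auto simp: h_def h'_def)
    ultimately show ?thesis
      unfolding sV split[of "\<lambda>j. w j * indicator V (s - t j)"] h'_def[symmetric] by linarith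
  qed
  have ab: "0 \<le> a s" "a s \<le> 1" "0 \<le> b s" "b s \<le> 1" for s
  proof -
    show "0 \<le> a s" "0 \<le> b s" using w0 by (auto simp: a_def b_def intro!: sum_nonneg)
    show "a s \<le> 1" unfolding a_def nu.slice_eq_measure by (rule nu.prob_le_1)
    have "b s \<le> (\<Sum>j\<in>{1..n}. w j)" unfolding b_def using w0 by (intro sum_mono) (auto simp: indicator_def)
    then show "b s \<le> 1" using wsum w0[of 0] by simp
  qed
  have powr_le: "x powr p \<le> c powr (p - 1) * x" if "0 \<le> x" "x \<le> c" for x c :: real
  proof (cases "x = 0")
    case False
    with that have "x powr p = x powr (p - 1) * x" by (simp add: powr_mult_base mult.commute)
    also have "\<dots> \<le> c powr (p - 1) * x" using that p by (intro mult_right_mono powr_mono2) auto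
    finally show ?thesis .
  qed simp
  have powr4: "(x1 + x2 + x3 + x4) powr p \<le> 4 powr p * (x1 powr p + x2 powr p + x3 powr p + x4 powr p)"
    if "0 \<le> x1" "0 \<le> x2" "0 \<le> x3" "0 \<le> x4" for x1 x2 x3 x4 :: real
  proof -
    define m where "m = max (max x1 x2) (max x3 x4)"
    have "x1 + x2 + x3 + x4 \<le> 4 * m" by (simp add: m_def)
    then have "(x1 + x2 + x3 + x4) powr p \<le> (4 * m) powr p" using that p by (intro powr_mono2) auto
    also have "\<dots> = 4 powr p * m powr p" using that by (simp add: powr_mult m_def)
    also have "m powr p \<le> x1 powr p + x2 powr p + x3 powr p + x4 powr p"
      unfolding m_def by (auto simp: max_def)
    finally show ?thesis by simp
  qed
  define c where "c = \<delta> powr (p - 1)"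
  have c0: "0 \<le> c" by (simp add: c_def)
  have integrand: "\<bar>enn2real (nu.slice V s) - (\<Sum>j\<le>n. w j * indicator V (s - t j))\<bar> powr p
      \<le> 4 powr p * (a s + b s + c * enn2real (nu.slice V s) + c * indicator V (s - t 0))" for s
  proof -
    have hd: "0 \<le> h s" "h s \<le> \<delta>" "h s \<le> enn2real (nu.slice V s)"
    proof -
      show "0 \<le> h s" by (simp add: h_def)
      have "h s \<le> measure \<nu> (E 0)" unfolding h_def using E by (intro nu.finite_measure_mono) auto
      then show "h s \<le> \<delta>" using d by simp
      show "h s \<le> enn2real (nu.slice V s)"
        unfolding h_def nu.slice_eq_measure using slice_sets(1)[OF V] by (intro nu.finite_measure_mono) auto
    qed
    have h'd: "0 \<le> h' s" "h' s \<le> \<delta>" "h' s \<le> indicator V (s - t 0)"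
    proof -
      show "0 \<le> h' s" using w0[of 0] by (simp add: h'_def)
      have "h' s \<le> w 0" using w0[of 0] by (simp add: h'_def indicator_def)
      also have "w 0 \<le> \<delta>" using d by (simp add: w_def)
      finally show "h' s \<le> \<delta>" .
      show "h' s \<le> indicator V (s - t 0)" using w1[of 0] by (simp add: h'_def indicator_def)
    qed
    have "\<bar>enn2real (nu.slice V s) - (\<Sum>j\<le>n. w j * indicator V (s - t j))\<bar> powr p \<le> (a s + b s + h s + h' s) powr p"
      using pt p by (intro powr_mono2) auto
    also have "\<dots> \<le> 4 powr p * (a s powr p + b s powr p + h s powr p + h' s powr p)"
      using ab hd h'd by (intro powr4) auto
    also have "\<dots> \<le> 4 powr p * (a s + b s + c * enn2real (nu.slice V s) + c * indicator V (s - t 0))"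
    proof (intro mult_left_mono add_mono)
      show "a s powr p \<le> a s" "b s powr p \<le> b s" using powr_le[of "a s" 1] powr_le[of "b s" 1] ab by auto
      have "h s powr p \<le> c * h s" unfolding c_def using hd by (intro powr_le)
      also have "\<dots> \<le> c * enn2real (nu.slice V s)" using hd c0 by (intro mult_left_mono)
      finally show "h s powr p \<le> c * enn2real (nu.slice V s)" .
      have "h' s powr p \<le> c * h' s" unfolding c_def using h'd by (intro powr_le)
      also have "\<dots> \<le> c * indicator V (s - t 0)" using h'd c0 by (intro mult_left_mono)
      finally show "h' s powr p \<le> c * indicator V (s - t 0)" .
    qed simp
    finally show ?thesis .
  qed
  have sl: "ennreal (enn2real (nu.slice A s)) = nu.slice A s" for A s
  proof (rule ennreal_enn2real)
    show "nu.slice A s < top" using nu.slice_le_1[of A s] by (rule le_less_trans) simp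
  qed
  have ms [measurable]: "nu.slice B \<in> borel_measurable \<mu>" "nu.slice V \<in> borel_measurable \<mu>"
    using nu.slice_measurable[OF Bs] nu.slice_measurable[OF V] by (simp_all cong: measurable_cong_sets)
  have ind: "(\<integral>\<^sup>+s. indicator A (s - x) \<partial>\<mu>) = emeasure \<mu> A" "(\<lambda>s. indicator A (s - x) :: ennreal) \<in> borel_measurable \<mu>"
    if A: "A \<in> sets borel" for A x
  proof -
    have eq: "(\<lambda>s. indicator A (s - x) :: ennreal) = indicator {s. s - x \<in> A}" by (auto simp: indicator_def fun_eq_iff)
    have s: "{s. s - x \<in> A} \<in> sets \<mu>" using slice_sets(2)[OF A] by simp
    show "(\<lambda>s. indicator A (s - x) :: ennreal) \<in> borel_measurable \<mu>"
      unfolding eq using s by (rule borel_measurable_indicator)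
    show "(\<integral>\<^sup>+s. indicator A (s - x) \<partial>\<mu>) = emeasure \<mu> A"
      unfolding eq using s translate[OF A] by (simp add: nn_integral_indicator)
  qed
  note [measurable] = ind(2)[OF V] ind(2)[OF Bs]
  have "(\<integral>\<^sup>+s. ennreal (\<bar>enn2real (nu.slice V s) - (\<Sum>j\<le>n. w j * indicator V (s - t j))\<bar> powr p) \<partial>\<mu>)
     \<le> (\<integral>\<^sup>+s. ennreal (4 powr p) * (nu.slice B s + (\<Sum>j\<in>{1..n}. ennreal (w j) * indicator B (s - t j)) + ennreal c * nu.slice V s + ennreal c * indicator V (s - t 0)) \<partial>\<mu>)"
  proof (rule nn_integral_mono)
    fix s
    have "ennreal (\<bar>enn2real (nu.slice V s) - (\<Sum>j\<le>n. w j * indicator V (s - t j))\<bar> powr p)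
        \<le> ennreal (4 powr p * (a s + b s + c * enn2real (nu.slice V s) + c * indicator V (s - t 0)))"
      by (intro ennreal_leI integrand)
    also have "\<dots> = ennreal (4 powr p) * (ennreal (a s) + ennreal (b s) + ennreal c * ennreal (enn2real (nu.slice V s)) + ennreal c * ennreal (indicator V (s - t 0)))"
      using ab c0 by (simp add: ennreal_mult ennreal_plus)
    also have "ennreal (a s) = nu.slice B s" unfolding a_def by (rule sl)
    also have "ennreal (b s) = (\<Sum>j\<in>{1..n}. ennreal (w j) * indicator B (s - t j))"
      unfolding b_def using w0 by (subst sum_ennreal[symmetric]) (auto simp: ennreal_mult ennreal_indicator)
    also have "ennreal (indicator V (s - t 0)) = indicator V (s - t 0)" by (rule ennreal_indicator)
    finally show "ennreal (\<bar>enn2real (nu.slice V s) - (\<Sum>j\<le>n. w j * indicator V (s - t j))\<bar> powr p)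
      \<le> ennreal (4 powr p) * (nu.slice B s + (\<Sum>j\<in>{1..n}. ennreal (w j) * indicator B (s - t j)) + ennreal c * nu.slice V s + ennreal c * indicator V (s - t 0))"
      unfolding sl .
  qed
  also have "\<dots> = ennreal (4 powr p) * ((\<integral>\<^sup>+s. nu.slice B s \<partial>\<mu>) + (\<Sum>j\<in>{1..n}. ennreal (w j) * emeasure \<mu> B) + ennreal c * (\<integral>\<^sup>+s. nu.slice V s \<partial>\<mu>) + ennreal c * emeasure \<mu> V)"
    by (simp add: nn_integral_cmult nn_integral_add nn_integral_sum ind V Bs del: Bochner_Integration.sum_mult_indicator)
  also have "\<dots> \<le> ennreal (4 powr p) * (emeasure \<mu> B + emeasure \<mu> B + ennreal c * emeasure \<mu> V + ennreal c * emeasure \<mu> V)"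
  proof (intro mult_left_mono add_mono order.refl slice_le[OF Bs] slice_le[OF V])
    have "(\<Sum>j\<in>{1..n}. ennreal (w j) * emeasure \<mu> B) = ennreal (\<Sum>j\<in>{1..n}. w j) * emeasure \<mu> B"
      using w0 by (simp add: sum_distrib_right[symmetric] sum_ennreal)
    also have "\<dots> \<le> 1 * emeasure \<mu> B"
      using wsum w0[of 0] by (intro mult_right_mono) (auto simp: ennreal_le_1)
    finally show "(\<Sum>j\<in>{1..n}. ennreal (w j) * emeasure \<mu> B) \<le> emeasure \<mu> B" by simp
  qed auto
  also have "\<dots> = ennreal (4 powr p) * (2 * (emeasure \<mu> B + ennreal c * emeasure \<mu> V))"
    by (simp only: mult_2 add_ac)
  also have "\<dots> = ennreal (4 powr p * 2) * (emeasure \<mu> B + ennreal c * emeasure \<mu> V)"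
    by (simp add: ennreal_mult mult.assoc)
  finally show ?thesis by (simp add: w_def B_def c_def)
qed

end

section \<open>Convolution squares\<close>

context symmetric_prob begin

text \<open>
  The set function in the definition is countably additive on Borel sets, so the generated measure has these values.
\<close>

lemma emeasure_conv_measure:
  assumes V: "V \<in> sets borel"
  shows "emeasure (conv_measure \<nu> \<nu>) V = (\<integral>\<^sup>+t. slice V t \<partial>\<nu>)"
proof -
  let ?m = "\<lambda>V. \<integral>\<^sup>+t. emeasure \<nu> {s. s + t \<in> V} \<partial>\<nu>"
  have m: "?m A = (\<integral>\<^sup>+t. slice A t \<partial>\<nu>)" if "A \<in> sets borel" for A
    using slice_plus[OF that] by (simp add: add.commute)
  have "emeasure (conv_measure \<nu> \<nu>) V = ?m V"
    unfolding conv_measure_def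
  proof (rule emeasure_measure_of_sigma)
    show "sigma_algebra UNIV (sets (borel :: 'g measure))"
      using sets.sigma_algebra_axioms[of "borel :: 'g measure"] by simp
    show "positive (sets borel) ?m" by (simp add: positive_def)
    show "countably_additive (sets borel) ?m"
      unfolding countably_additive_def
    proof (intro allI impI)
      fix A :: "nat \<Rightarrow> 'g set"
      assume A: "range A \<subseteq> sets borel" "disjoint_family A" and U: "\<Union> (range A) \<in> sets borel"
      have As: "A i \<in> sets borel" for i using A(1) by auto
      have "(suminf (\<lambda>i. ?m (A i))) = (suminf (\<lambda>i. \<integral>\<^sup>+t. slice (A i) t \<partial>\<nu>))" by (simp only: m[OF As])
      also have "\<dots> = (\<integral>\<^sup>+t. (suminf (\<lambda>i. slice (A i) t)) \<partial>\<nu>)"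
        using slice_measurable[OF As] by (intro nn_integral_suminf[symmetric]) (simp cong: measurable_cong_sets)
      also have "\<dots> = (\<integral>\<^sup>+t. slice (\<Union> (range A)) t \<partial>\<nu>)"
      proof (rule nn_integral_cong)
        fix s
        have "(suminf (\<lambda>i. emeasure \<nu> {t. s - t \<in> A i})) = emeasure \<nu> (\<Union>i. {t. s - t \<in> A i})"
          using A slice_sets(1)[OF As] by (intro suminf_emeasure) (auto simp: disjoint_family_on_def)
        also have "(\<Union>i. {t. s - t \<in> A i}) = {t. s - t \<in> \<Union> (range A)}" by auto
        finally show "(suminf (\<lambda>i. slice (A i) s)) = slice (\<Union> (range A)) s" by (simp add: slice_def)
      qed
      also have "\<dots> = ?m (\<Union> (range A))" by (rule m[OF U, symmetric])
      finally show "(suminf (\<lambda>i. ?m (A i))) = ?m (\<Union> (range A))" .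
    qed
  qed (rule V)
  then show ?thesis using m[OF V] by simp
qed

end

lemma Lp_fun_simple_dense:
  fixes f :: "'a \<Rightarrow> 'x::complex_banach"
  assumes f: "f \<in> Lp_fun M p" and p: "1 \<le> p" and e: "0 < e"
  obtains u where "simple_function M u" "u \<in> Lp_fun M p" "Lp_norm M p (\<lambda>x. f x - u x) \<le> e"
proof -
  have p0: "0 < p" using p by simp
  obtain s where s: "\<And>i::nat. simple_function M (s i)" "\<And>i. Lp_int M p (s i) < \<infinity>"
    "(\<lambda>i. Lp_int M p (\<lambda>x. f x - s i x)) \<longlonglongrightarrow> 0"
    by (rule Lp_fun_approx_simple[OF f p0]) (rule that)
  have sLp: "s i \<in> Lp_fun M p" for i
    using s(2)[of i] strongly_measurable_imp_ae[OF strongly_measurable_simple[OF s(1)[of i]]] by (simp add: Lp_fun_def)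
  have "\<forall>\<^sub>F i in sequentially. Lp_int M p (\<lambda>x. f x - s i x) < ennreal (e powr p)"
    using e by (intro order_tendstoD(2)[OF s(3)]) simp
  then obtain i where i: "Lp_int M p (\<lambda>x. f x - s i x) < ennreal (e powr p)"
    by (auto simp: eventually_sequentially)
  have "Lp_norm M p (\<lambda>x. f x - s i x) \<le> e"
    using i e by (subst Lp_norm_le_iff[OF Lp_fun_diff[OF f sLp p] p0]) auto
  with s(1) sLp show ?thesis by (rule that)
qed

lemma Lp_norm_minus_commute:
  fixes f g :: "'a \<Rightarrow> 'x::real_normed_vector"
  shows "Lp_norm M p (\<lambda>x. f x - g x) = Lp_norm M p (\<lambda>x. g x - f x)"
  by (simp add: Lp_norm_def norm_minus_commute)

lemma Lp_norm_diff_le: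
  fixes f g h :: "'a \<Rightarrow> 'x::complex_banach"
  assumes "f \<in> Lp_fun M p" "g \<in> Lp_fun M p" "h \<in> Lp_fun M p" "1 \<le> p"
  shows "Lp_norm M p (\<lambda>x. f x - h x) \<le> Lp_norm M p (\<lambda>x. f x - g x) + Lp_norm M p (\<lambda>x. g x - h x)"
  using Lp_norm_triangle[OF Lp_fun_diff[OF assms(1,2,4)] Lp_fun_diff[OF assms(2,3,4)] assms(4)] by simp

context haar_prob begin

lemma conv_fun_dist_le:
  fixes f g :: "'g \<Rightarrow> 'x::complex_banach"
  assumes "f \<in> Lp_fun \<mu> p" "g \<in> Lp_fun \<mu> p" "1 \<le> p"
  shows "Lp_norm \<mu> p (\<lambda>s. conv_fun \<nu> f s - conv_fun \<nu> g s) \<le> Lp_norm \<mu> p (\<lambda>s. f s - g s)"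
proof -
  have "Lp_norm \<mu> p (\<lambda>s. conv_fun \<nu> f s - conv_fun \<nu> g s) = Lp_norm \<mu> p (conv_fun \<nu> (\<lambda>s. f s - g s))"
    using conv_fun_diff[OF assms] by (intro Lp_norm_cong_AE) auto
  also have "\<dots> \<le> Lp_norm \<mu> p (\<lambda>s. f s - g s)" by (intro conv_fun_Lp Lp_fun_diff assms)
  finally show ?thesis .
qed

end

locale haar_square = haar \<mu> + eta: symmetric_prob \<eta> + nu: symmetric_prob \<nu>
  for \<mu> \<eta> \<nu> :: "'g::{topological_ab_group_add, t2_space} measure" +
  assumes square: "\<nu> = conv_measure \<eta> \<eta>"
begin

sublocale conv_eta: haar_prob \<mu> \<eta> ..

sublocale conv_nu: haar_prob \<mu> \<nu> ..

text \<open>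
  Associativity of convolution on the level of sets; symmetry of \<open>\<eta>\<close> turns sums into differences.
\<close>

lemma slice_square:
  assumes A: "A \<in> sets borel"
  shows "nu.slice A s = (\<integral>\<^sup>+t. eta.slice A (s - t) \<partial>\<eta>)"
proof -
  have "nu.slice A s = (\<integral>\<^sup>+t. eta.slice {u. s - u \<in> A} t \<partial>\<eta>)"
    using eta.emeasure_conv_measure[OF slice_sets(1)[OF A]] by (simp add: nu.slice_def square[symmetric])
  also have "\<dots> = (\<integral>\<^sup>+t. eta.slice A (s - t) \<partial>\<eta>)"
  proof (rule nn_integral_cong)
    fix t
    have "s - (t - r) = (s - t) + r" for r by (simp add: algebra_simps)
    then show "eta.slice {u. s - u \<in> A} t = eta.slice A (s - t)"
      unfolding eta.slice_plus[OF A, symmetric] by (simp only: eta.slice_def mem_Collect_eq)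
  qed
  finally show ?thesis .
qed

lemma conv_fun_square_simple:
  fixes u :: "'g \<Rightarrow> 'x::complex_banach"
  assumes u: "simple_function \<mu> u"
  shows "conv_fun \<nu> u = conv_fun \<eta> (conv_fun \<eta> u)"
proof
  fix s
  have A: "u -` {y} \<in> sets borel" for y using simple_functionD(2)[OF u, of "{y}"] by simp
  have m: "(\<lambda>t. eta.slice (u -` {y}) (s - t)) \<in> borel_measurable borel" for y
    using measurable_reflect_translate(1) eta.slice_measurable[OF A] by (rule measurable_compose)
  note int = eta.strong_integral_bounded_scaleR[OF m eta.slice_le_1]
  have "conv_fun \<eta> (conv_fun \<eta> u) s
      = strong_integral \<eta> (\<lambda>t. \<Sum>y\<in>range u - {0}. enn2real (eta.slice (u -` {y}) (s - t)) *\<^sub>R y)"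
    by (simp add: conv_fun_def[of \<eta> "conv_fun \<eta> u"] conv_eta.conv_fun_simple[OF u])
  also have "\<dots> = (\<Sum>y\<in>range u - {0}. enn2real (\<integral>\<^sup>+t. eta.slice (u -` {y}) (s - t) \<partial>\<eta>) *\<^sub>R y)"
    by (subst strong_integral_sum[OF int(1)]) (simp only: int(2))
  also have "\<dots> = conv_fun \<nu> u s"
    by (simp only: conv_nu.conv_fun_simple[OF u] slice_square[OF A])
  finally show "conv_fun \<nu> u s = conv_fun \<eta> (conv_fun \<eta> u) s" by simp
qed

text \<open>
  Both sides are contractions of \<open>f\<close> in \<open>L\<^sup>p\<close> and they agree for simple functions.
\<close>

lemma conv_fun_square:
  fixes f :: "'g \<Rightarrow> 'x::complex_banach"
  assumes f: "f \<in> Lp_fun \<mu> p" and p: "1 \<le> p"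
  shows "Lp_norm \<mu> p (\<lambda>s. conv_fun \<nu> f s - conv_fun \<eta> (conv_fun \<eta> f) s) = 0"
proof (rule antisym[OF field_le_epsilon Lp_norm_nonneg])
  fix e :: real assume "0 < e"
  then obtain u where u: "simple_function \<mu> u" "u \<in> Lp_fun \<mu> p" "Lp_norm \<mu> p (\<lambda>x. f x - u x) \<le> e / 2"
    using Lp_fun_simple_dense[OF f p, of "e / 2"] by auto
  note Lp = conv_nu.conv_fun_Lp(1)[OF f p] conv_nu.conv_fun_Lp(1)[OF u(2) p]
    conv_eta.conv_fun_Lp(1)[OF f p] conv_eta.conv_fun_Lp(1)[OF u(2) p]
  note Lp2 = conv_eta.conv_fun_Lp(1)[OF Lp(3) p]
  have "Lp_norm \<mu> p (\<lambda>s. conv_fun \<nu> f s - conv_fun \<eta> (conv_fun \<eta> f) s)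
      \<le> Lp_norm \<mu> p (\<lambda>s. conv_fun \<nu> f s - conv_fun \<nu> u s) + Lp_norm \<mu> p (\<lambda>s. conv_fun \<nu> u s - conv_fun \<eta> (conv_fun \<eta> f) s)"
    by (rule Lp_norm_diff_le[OF Lp(1,2) Lp2 p])
  also have "Lp_norm \<mu> p (\<lambda>s. conv_fun \<nu> f s - conv_fun \<nu> u s) \<le> e / 2"
    by (rule order_trans[OF conv_nu.conv_fun_dist_le[OF f u(2) p] u(3)])
  also have "Lp_norm \<mu> p (\<lambda>s. conv_fun \<nu> u s - conv_fun \<eta> (conv_fun \<eta> f) s)
      = Lp_norm \<mu> p (\<lambda>s. conv_fun \<eta> (conv_fun \<eta> f) s - conv_fun \<eta> (conv_fun \<eta> u) s)"
    unfolding conv_fun_square_simple[OF u(1)] by (rule Lp_norm_minus_commute)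
  also have "\<dots> \<le> e / 2"
    by (rule order_trans[OF conv_eta.conv_fun_dist_le[OF Lp(3,4) p]])
       (rule order_trans[OF conv_eta.conv_fun_dist_le[OF f u(2) p] u(3)])
  finally show "Lp_norm \<mu> p (\<lambda>s. conv_fun \<nu> f s - conv_fun \<eta> (conv_fun \<eta> f) s) \<le> 0 + e" by simp
qed

end

section \<open>Approximation of a convolution by averages of translates\<close>

definition translation_mean :: "nat \<Rightarrow> (nat \<Rightarrow> real) \<Rightarrow> (nat \<Rightarrow> 'g::ab_group_add) \<Rightarrow> ('g \<Rightarrow> 'x::complex_banach) \<Rightarrow> 'g \<Rightarrow> 'x"
  where "translation_mean n w t f s = (\<Sum>j\<le>n. scaleC (of_real (w j)) (f (s - t j)))"

context haar begin

lemma translation_mean_Lp: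
  fixes f :: "'g \<Rightarrow> 'x::complex_banach"
  assumes f: "f \<in> Lp_fun \<mu> p" and p: "1 \<le> p"
  shows "translation_mean n w t f \<in> Lp_fun \<mu> p"
    and "(\<And>j. j \<le> n \<Longrightarrow> 0 \<le> w j) \<Longrightarrow> (\<Sum>j\<le>n. w j) = 1 \<Longrightarrow> Lp_norm \<mu> p (translation_mean n w t f) \<le> Lp_norm \<mu> p f"
proof -
  have p0: "0 < p" using p by simp
  note tr = Lp_fun_translate[OF f]
  have eq: "translation_mean n w t f = (\<lambda>s. \<Sum>j\<le>n. scaleC (of_real (w j)) (f (s - t j)))"
    by (simp add: translation_mean_def fun_eq_iff)
  show "translation_mean n w t f \<in> Lp_fun \<mu> p"
    unfolding eq by (intro Lp_fun_sum Lp_fun_scaleC tr p p0)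
  assume w: "\<And>j. j \<le> n \<Longrightarrow> 0 \<le> w j" "(\<Sum>j\<le>n. w j) = 1"
  have "Lp_norm \<mu> p (translation_mean n w t f) \<le> (\<Sum>j\<le>n. Lp_norm \<mu> p (\<lambda>s. scaleC (of_real (w j)) (f (s - t j))))"
    unfolding eq by (intro Lp_norm_sum_le Lp_fun_scaleC tr p p0)
  also have "\<dots> = (\<Sum>j\<le>n. w j * Lp_norm \<mu> p f)"
    using w(1) by (intro sum.cong refl) (simp add: Lp_norm_scaleC[OF tr(1) p0] tr(2))
  also have "\<dots> = Lp_norm \<mu> p f" using w(2) by (simp add: sum_distrib_right[symmetric])
  finally show "Lp_norm \<mu> p (translation_mean n w t f) \<le> Lp_norm \<mu> p f" .
qed

lemma translation_mean_diff:
  fixes f g :: "'g \<Rightarrow> 'x::complex_banach"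
  shows "translation_mean n w t f s - translation_mean n w t g s = translation_mean n w t (\<lambda>s. f s - g s) s"
proof -
  have "scaleC c x - scaleC c y = scaleC c (x - y)" for c and x y :: 'x
    using linear_diff[OF bounded_linear.linear[OF bounded_linear_scaleC], of c x y] by simp
  then show ?thesis by (simp add: translation_mean_def sum_subtractf[symmetric])
qed

end

context haar_prob begin

lemma conv_fun_mean_close:
  fixes f u :: "'g \<Rightarrow> 'x::complex_banach"
  assumes f: "f \<in> Lp_fun \<mu> p" and u: "u \<in> Lp_fun \<mu> p" and p: "1 \<le> p"
    and w: "\<And>j. j \<le> n \<Longrightarrow> 0 \<le> w j" "(\<Sum>j\<le>n. w j) = 1"
    and fu: "Lp_norm \<mu> p (\<lambda>s. f s - u s) \<le> e / 3"
    and close: "Lp_norm \<mu> p (\<lambda>s. conv_fun \<nu> u s - translation_mean n w t u s) \<le> e / 3"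
  shows "Lp_norm \<mu> p (\<lambda>s. conv_fun \<nu> f s - translation_mean n w t f s) \<le> e"
proof -
  note Lp = conv_fun_Lp(1)[OF f p] conv_fun_Lp(1)[OF u p] translation_mean_Lp(1)[OF f p, of n w t] translation_mean_Lp(1)[OF u p, of n w t]
  have "Lp_norm \<mu> p (\<lambda>s. conv_fun \<nu> f s - translation_mean n w t f s)
      \<le> Lp_norm \<mu> p (\<lambda>s. conv_fun \<nu> f s - conv_fun \<nu> u s) + Lp_norm \<mu> p (\<lambda>s. conv_fun \<nu> u s - translation_mean n w t f s)"
    by (rule Lp_norm_diff_le[OF Lp(1,2,3) p])
  moreover have "Lp_norm \<mu> p (\<lambda>s. conv_fun \<nu> f s - conv_fun \<nu> u s) \<le> e / 3"
    by (rule order_trans[OF conv_fun_dist_le[OF f u p] fu])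
  moreover have "Lp_norm \<mu> p (\<lambda>s. conv_fun \<nu> u s - translation_mean n w t f s)
      \<le> Lp_norm \<mu> p (\<lambda>s. conv_fun \<nu> u s - translation_mean n w t u s) + Lp_norm \<mu> p (\<lambda>s. translation_mean n w t u s - translation_mean n w t f s)"
    by (rule Lp_norm_diff_le[OF Lp(2,4,3) p])
  moreover have "Lp_norm \<mu> p (\<lambda>s. translation_mean n w t u s - translation_mean n w t f s) \<le> e / 3"
  proof -
    have "Lp_norm \<mu> p (translation_mean n w t (\<lambda>s. u s - f s)) \<le> Lp_norm \<mu> p (\<lambda>s. u s - f s)"
      by (rule translation_mean_Lp(2)[OF Lp_fun_diff[OF u f p] p w])
    also have "\<dots> \<le> e / 3" using fu by (simp only: Lp_norm_minus_commute[of \<mu> p u f])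
    finally show ?thesis by (simp only: translation_mean_diff)
  qed
  ultimately show ?thesis using close by linarith
qed

lemma conv_fun_simple_mean_le:
  fixes u :: "'g \<Rightarrow> 'x::complex_banach"
  assumes u: "simple_function \<mu> u" "u \<in> Lp_fun \<mu> p" and p: "1 \<le> p" and c: "0 \<le> c"
    and le: "\<And>y. y \<in> range u - {0} \<Longrightarrow>
      (\<integral>\<^sup>+s. ennreal (\<bar>enn2real (nu.slice (u -` {y}) s) - (\<Sum>j\<le>n. w j * indicator (u -` {y}) (s - t j))\<bar> powr p) \<partial>\<mu>) \<le> ennreal (c powr p)"
  shows "Lp_norm \<mu> p (\<lambda>s. conv_fun \<nu> u s - translation_mean n w t u s) \<le> c * (\<Sum>y\<in>range u - {0}. norm y)"
proof -
  have p0: "0 < p" using p by simp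
  have A: "u -` {y} \<in> sets borel" for y using simple_functionD(2)[OF u(1), of "{y}"] by simp
  define d where "d y s = enn2real (nu.slice (u -` {y}) s) - (\<Sum>j\<le>n. w j * indicator (u -` {y}) (s - t j))" for y s
  have u_eq: "u x = (\<Sum>y\<in>range u - {0}. indicator (u -` {y}) x *\<^sub>R y)" for x
    by (rule simple_function_eq_sum[OF _ u(1), of x, unfolded space_eq Int_UNIV_right]) simp
  have eq: "conv_fun \<nu> u s - translation_mean n w t u s = (\<Sum>y\<in>range u - {0}. d y s *\<^sub>R y)" for s
  proof -
    have "translation_mean n w t u s = (\<Sum>j\<le>n. \<Sum>y\<in>range u - {0}. (w j * indicator (u -` {y}) (s - t j)) *\<^sub>R y)"
      unfolding translation_mean_def
    proof (rule sum.cong[OF refl])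
      fix j
      have "scaleC (of_real (w j)) (u (s - t j)) = w j *\<^sub>R (\<Sum>y\<in>range u - {0}. indicator (u -` {y}) (s - t j) *\<^sub>R y)"
        by (subst u_eq) (rule scaleC_of_real)
      then show "scaleC (of_real (w j)) (u (s - t j)) = (\<Sum>y\<in>range u - {0}. (w j * indicator (u -` {y}) (s - t j)) *\<^sub>R y)"
        by (simp only: scaleR_sum_right scaleR_scaleR)
    qed
    also have "\<dots> = (\<Sum>y\<in>range u - {0}. (\<Sum>j\<le>n. w j * indicator (u -` {y}) (s - t j)) *\<^sub>R y)"
      by (subst sum.swap) (simp only: scaleR_sum_left)
    finally show ?thesis by (simp only: conv_fun_simple[OF u(1)] d_def scaleR_diff_left sum_subtractf)
  qed
  have dm: "d y \<in> borel_measurable \<mu>" for y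
  proof -
    have [measurable]: "nu.slice (u -` {y}) \<in> borel_measurable \<mu>"
      using nu.slice_measurable[OF A] by (simp cong: measurable_cong_sets)
    have [measurable]: "(\<lambda>s. indicator (u -` {y}) (s - x) :: real) \<in> borel_measurable \<mu>" for x
    proof -
      have "(\<lambda>s. indicator (u -` {y}) (s - x) :: real) = indicator {s. s - x \<in> u -` {y}}" by (auto simp: indicator_def fun_eq_iff)
      then show ?thesis using slice_sets(2)[OF A, of x y] by simp
    qed
    show ?thesis unfolding d_def by measurable
  qed
  have each: "(\<lambda>s. d y s *\<^sub>R y) \<in> Lp_fun \<mu> p \<and> Lp_norm \<mu> p (\<lambda>s. d y s *\<^sub>R y) \<le> c * norm y" if y: "y \<in> range u - {0}" for y
  proof -
    have "ae_strongly_measurable \<mu> (\<lambda>s. d y s *\<^sub>R y)"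
      by (intro strongly_measurable_imp_ae strongly_measurable_linear[OF strongly_measurable_borel_second_countable[OF dm] bounded_linear_scaleR_left])
    moreover have int: "Lp_int \<mu> p (\<lambda>s. d y s *\<^sub>R y) \<le> ennreal ((c * norm y) powr p)"
    proof -
      have "Lp_int \<mu> p (\<lambda>s. d y s *\<^sub>R y) = (\<integral>\<^sup>+s. ennreal (norm y powr p) * ennreal (\<bar>d y s\<bar> powr p) \<partial>\<mu>)"
        by (intro nn_integral_cong) (simp add: powr_mult ennreal_mult mult.commute)
      also have "\<dots> = ennreal (norm y powr p) * (\<integral>\<^sup>+s. ennreal (\<bar>d y s\<bar> powr p) \<partial>\<mu>)"
        using measurable_norm_powr[OF dm[of y], of p] by (intro nn_integral_cmult) simp
      also have "\<dots> \<le> ennreal (norm y powr p) * ennreal (c powr p)"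
        using le[OF y] by (intro mult_left_mono) (auto simp: d_def)
      also have "\<dots> = ennreal ((c * norm y) powr p)" using c by (simp add: powr_mult ennreal_mult mult.commute)
      finally show ?thesis .
    qed
    ultimately have Lp: "(\<lambda>s. d y s *\<^sub>R y) \<in> Lp_fun \<mu> p" by (simp add: Lp_fun_def le_less_trans)
    then show ?thesis using int c by (simp add: Lp_norm_le_iff[OF Lp p0])
  qed
  have "Lp_norm \<mu> p (\<lambda>s. \<Sum>y\<in>range u - {0}. d y s *\<^sub>R y) \<le> (\<Sum>y\<in>range u - {0}. Lp_norm \<mu> p (\<lambda>s. d y s *\<^sub>R y))"
    using each by (intro Lp_norm_sum_le p) blast
  also have "\<dots> \<le> (\<Sum>y\<in>range u - {0}. c * norm y)" using each by (intro sum_mono) blast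
  finally show ?thesis by (simp add: eq sum_distrib_left)
qed

text \<open>
  One partition serves all sets of the family, and also the reflected points \<open>- t j\<close>: the neighbourhood
  \<open>W\<close> is symmetric, and the reflected pieces have the same measures because \<open>\<nu>\<close> is symmetric.
\<close>

lemma simultaneous_slice_discretization:
  fixes \<V> :: "'g set set"
  assumes sym: "symmetric_measure \<nu>" and V: "finite \<V>" "\<And>V. V \<in> \<V> \<Longrightarrow> V \<in> sets borel" "\<And>V. V \<in> \<V> \<Longrightarrow> emeasure \<mu> V < \<infinity>"
    and \<kappa>: "0 < \<kappa>" and p: "1 < p"
  obtains n :: nat and w :: "nat \<Rightarrow> real" and t :: "nat \<Rightarrow> 'g"
  where "\<And>j. 0 \<le> w j" "(\<Sum>j\<le>n. w j) = 1"
    "\<And>V. V \<in> \<V> \<Longrightarrow> (\<integral>\<^sup>+s. ennreal (\<bar>enn2real (nu.slice V s) - (\<Sum>j\<le>n. w j * indicator V (s - t j))\<bar> powr p) \<partial>\<mu>) \<le> ennreal \<kappa>"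
    "\<And>V. V \<in> \<V> \<Longrightarrow> (\<integral>\<^sup>+s. ennreal (\<bar>enn2real (nu.slice V s) - (\<Sum>j\<le>n. w j * indicator V (s - (- t j)))\<bar> powr p) \<partial>\<mu>) \<le> ennreal \<kappa>"
proof -
  interpret sym: symmetric_prob \<nu> by unfold_locales (rule sym)
  define C where "C = 4 powr p * (2::real)"
  have C: "0 < C" by (simp add: C_def)
  define m where "m = 1 + (\<Sum>V\<in>\<V>. enn2real (emeasure \<mu> V))"
  have m: "0 < m" by (simp add: m_def add_pos_nonneg sum_nonneg)
  have m_le: "emeasure \<mu> V \<le> ennreal m" if "V \<in> \<V>" for V
  proof -
    have "emeasure \<mu> V = ennreal (enn2real (emeasure \<mu> V))" using V(3)[OF that] by simp
    also have "enn2real (emeasure \<mu> V) \<le> (\<Sum>V\<in>\<V>. enn2real (emeasure \<mu> V))" by (rule member_le_sum[OF that]) (use V in auto)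
    finally show ?thesis by (simp add: m_def ennreal_leI add_increasing order_trans[OF _ ennreal_leI])
  qed
  define \<delta> where "\<delta> = (\<kappa> / (2 * C * m)) powr (1 / (p - 1))"
  have d: "0 < \<delta>" using \<kappa> C m by (simp add: \<delta>_def)
  have dp: "\<delta> powr (p - 1) = \<kappa> / (2 * C * m)" using p \<kappa> C m by (simp add: \<delta>_def powr_powr)
  have "\<forall>V\<in>\<V>. \<exists>K U. compact K \<and> open U \<and> K \<subseteq> V \<and> V \<subseteq> U \<and> emeasure \<mu> (U - K) < ennreal (\<kappa> / (2 * C))"
  proof
    fix V assume "V \<in> \<V>"
    have "0 < \<kappa> / (2 * C)" using \<kappa> C by simp
    from regular_approx[OF V(2,3)[OF \<open>V \<in> \<V>\<close>] this] show "\<exists>K U. compact K \<and> open U \<and> K \<subseteq> V \<and> V \<subseteq> U \<and> emeasure \<mu> (U - K) < ennreal (\<kappa> / (2 * C))"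
      by metis
  qed
  then obtain K U where KU: "\<And>V. V \<in> \<V> \<Longrightarrow> compact (K V)" "\<And>V. V \<in> \<V> \<Longrightarrow> open (U V)" "\<And>V. V \<in> \<V> \<Longrightarrow> K V \<subseteq> V"
    "\<And>V. V \<in> \<V> \<Longrightarrow> V \<subseteq> U V" "\<And>V. V \<in> \<V> \<Longrightarrow> emeasure \<mu> (U V - K V) < ennreal (\<kappa> / (2 * C))"
    by metis
  define W where "W = (\<Inter>V\<in>\<V>. {w. \<forall>x\<in>uminus ` K V. w - x \<in> U V} \<inter> {w. \<forall>x\<in>K V. w - x \<in> uminus -` U V})"
  have W_iff: "w \<in> W \<longleftrightarrow> (\<forall>V\<in>\<V>. \<forall>k\<in>K V. k + w \<in> U V \<and> k - w \<in> U V)" for w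
    by (auto simp: W_def add.commute)
  have W_open: "open W"
    unfolding W_def
  proof (intro open_INT V(1) ballI open_Int open_translates_into)
    fix V assume "V \<in> \<V>"
    show "compact (uminus ` K V)" by (rule compact_continuous_image[OF _ KU(1)[OF \<open>V \<in> \<V>\<close>]]) (intro continuous_intros)
    show "open (U V)" "compact (K V)" using KU \<open>V \<in> \<V>\<close> by auto
    show "open (uminus -` U V)" by (rule open_vimage[OF KU(2)[OF \<open>V \<in> \<V>\<close>]]) (intro continuous_intros)
  qed
  have W0: "0 \<in> W" using KU(3,4) by (fastforce simp: W_iff)
  have W_sym: "- w \<in> W" if "w \<in> W" for w using that by (simp add: W_iff)
  define Ob where "Ob t = (\<lambda>x. x - t) -` W" for t
  have Ob: "open (Ob t)" "t \<in> Ob t" for t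
    using W0 by (auto simp: Ob_def intro!: open_vimage[OF W_open] continuous_intros)
  obtain n :: nat and E :: "nat \<Rightarrow> 'g set" and t :: "nat \<Rightarrow> 'g" where
    E: "\<And>j. E j \<in> sets borel" "disjoint_family_on E {..n}" "(\<Union>j\<le>n. E j) = UNIV" and E0: "measure \<nu> (E 0) \<le> \<delta>"
    and EO: "\<And>j. 1 \<le> j \<Longrightarrow> j \<le> n \<Longrightarrow> E j \<subseteq> Ob (t j)"
    by (rule nu.finite_borel_partition[OF Ob d]) (rule that)
  have xW: "x - t j \<in> W" if "1 \<le> j" "j \<le> n" "x \<in> E j" for j x
    using EO[OF that(1,2)] that(3) by (auto simp: Ob_def)
  define E' where "E' j = {x. - x \<in> E j}" for j
  have E': "E' j \<in> sets borel" for j unfolding E'_def by (rule slice_sets(5)[OF E(1)])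
  have E'2: "disjoint_family_on E' {..n}" using E(2) by (fastforce simp: disjoint_family_on_def E'_def)
  have E'3: "(\<Union>j\<le>n. E' j) = UNIV" using E(3) by (auto simp: E'_def set_eq_iff)
  have meas': "measure \<nu> (E' j) = measure \<nu> (E j)" for j
    using sym.reflect[OF E(1), of j] by (simp add: measure_def E'_def)
  have xW': "x - (- t j) \<in> W" if "1 \<le> j" "j \<le> n" "x \<in> E' j" for j x
    using W_sym[OF xW[OF that(1,2), of "- x"]] that(3) by (simp add: E'_def add.commute)
  have small: "ennreal (4 powr p * 2) * (emeasure \<mu> (U V - K V) + ennreal (\<delta> powr (p - 1)) * emeasure \<mu> V) \<le> ennreal \<kappa>"
    if v: "V \<in> \<V>" for V
  proof -
    have "ennreal (4 powr p * 2) * (emeasure \<mu> (U V - K V) + ennreal (\<delta> powr (p - 1)) * emeasure \<mu> V)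
        \<le> ennreal C * (ennreal (\<kappa> / (2 * C)) + ennreal (\<kappa> / (2 * C * m)) * ennreal m)"
      unfolding dp C_def[symmetric] using KU(5)[OF v] m_le[OF v] by (intro mult_left_mono add_mono) auto
    also have "ennreal (\<kappa> / (2 * C * m)) * ennreal m = ennreal (\<kappa> / (2 * C))"
      using C \<kappa> m by (subst ennreal_mult[symmetric]) auto
    also have "ennreal C * (ennreal (\<kappa> / (2 * C)) + ennreal (\<kappa> / (2 * C))) = ennreal (C * (\<kappa> / (2 * C) + \<kappa> / (2 * C)))"
      using C \<kappa> by (simp only: ennreal_plus[symmetric] ennreal_mult[symmetric] less_imp_le divide_nonneg_pos add_nonneg_nonneg mult_pos_pos zero_less_numeral)
    also have "C * (\<kappa> / (2 * C) + \<kappa> / (2 * C)) = \<kappa>" using C by (simp add: field_simps)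
    finally show ?thesis .
  qed
  show thesis
  proof (rule that[of "\<lambda>j. measure \<nu> (E j)" n t])
    show "(\<Sum>j\<le>n. measure \<nu> (E j)) = 1" by (rule nu.partition_weights[OF E])
    fix V assume v: "V \<in> \<V>"
    have KUs: "K V \<in> sets borel" "U V \<in> sets borel" using KU(2)[OF v] compact_sets[OF KU(1)[OF v]] by auto
    have KW: "k + w \<in> U V \<and> k - w \<in> U V" if "k \<in> K V" "w \<in> W" for k w using that v by (auto simp: W_iff)
    show "(\<integral>\<^sup>+s. ennreal (\<bar>enn2real (nu.slice V s) - (\<Sum>j\<le>n. measure \<nu> (E j) * indicator V (s - t j))\<bar> powr p) \<partial>\<mu>) \<le> ennreal \<kappa>"
      by (rule order_trans[OF slice_discretization[OF V(2)[OF v] KUs(1) KU(3)[OF v] KUs(2) KU(4)[OF v] KW E xW E0 p] small[OF v]])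
    have E0': "measure \<nu> (E' 0) \<le> \<delta>" using E0 by (simp add: meas')
    show "(\<integral>\<^sup>+s. ennreal (\<bar>enn2real (nu.slice V s) - (\<Sum>j\<le>n. measure \<nu> (E j) * indicator V (s - (- t j)))\<bar> powr p) \<partial>\<mu>) \<le> ennreal \<kappa>"
      using order_trans[OF slice_discretization[OF V(2)[OF v] KUs(1) KU(3)[OF v] KUs(2) KU(4)[OF v] KW E' E'2 E'3 xW' E0' p] small[OF v]]
      unfolding meas' .
  qed simp
qed

text \<open>
  The means with \<open>t j\<close> and with \<open>- t j\<close> approximate the same operator. Their product then approximates the square, and it is a product of
  a mean of group elements with the mean of their inverses.
\<close>

lemma conv_fun_discretization:
  fixes F :: "('g \<Rightarrow> 'x::complex_banach) set"
  assumes sym: "symmetric_measure \<nu>" and F: "finite F" "F \<subseteq> Lp_fun \<mu> p" and e: "0 < e" and p: "1 < p"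
  shows "\<exists>(n::nat) w t. (\<forall>j\<le>n. 0 \<le> w j) \<and> (\<Sum>j\<le>n. w j) = 1 \<and>
    (\<forall>f\<in>F. Lp_norm \<mu> p (\<lambda>s. conv_fun \<nu> f s - translation_mean n w t f s) \<le> e \<and>
      Lp_norm \<mu> p (\<lambda>s. conv_fun \<nu> f s - translation_mean n w (\<lambda>j. - t j) f s) \<le> e)"
proof -
  have p1: "1 \<le> p" and p0: "0 < p" using p by auto
  have "\<forall>f\<in>F. \<exists>u. simple_function \<mu> u \<and> u \<in> Lp_fun \<mu> p \<and> Lp_norm \<mu> p (\<lambda>x. f x - u x) \<le> e / 3"
  proof
    fix f assume "f \<in> F"
    then have f: "f \<in> Lp_fun \<mu> p" using F by auto
    show "\<exists>u. simple_function \<mu> u \<and> u \<in> Lp_fun \<mu> p \<and> Lp_norm \<mu> p (\<lambda>x. f x - u x) \<le> e / 3"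
      by (rule Lp_fun_simple_dense[OF f p1, of "e / 3"]) (use e in auto)
  qed
  then obtain u where u: "\<And>f. f \<in> F \<Longrightarrow> simple_function \<mu> (u f)" "\<And>f. f \<in> F \<Longrightarrow> u f \<in> Lp_fun \<mu> p"
    "\<And>f. f \<in> F \<Longrightarrow> Lp_norm \<mu> p (\<lambda>x. f x - u f x) \<le> e / 3"
    by metis
  define L where "L f = (\<Sum>y\<in>range (u f) - {0}. norm y)" for f
  have L0: "0 \<le> L f" for f by (simp add: L_def sum_nonneg)
  define m where "m = 1 + (\<Sum>f\<in>F. L f)"
  have m: "0 < m" using L0 by (simp add: m_def add_pos_nonneg sum_nonneg)
  have Lm: "L f \<le> m" if "f \<in> F" for f using member_le_sum[OF that, of L] L0 F(1) by (simp add: m_def)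
  define c where "c = e / (3 * m)"
  have c: "0 < c" using e m by (simp add: c_def)
  define \<V> where "\<V> = (\<Union>f\<in>F. (\<lambda>y. u f -` {y}) ` (range (u f) - {0}))"
  have fin_range: "finite (range (u f))" if "f \<in> F" for f using simple_functionD(1)[OF u(1)[OF that]] by simp
  have V1: "finite \<V>" unfolding \<V>_def using F(1) fin_range by auto
  have V2: "V \<in> sets borel" "emeasure \<mu> V < \<infinity>" if v: "V \<in> \<V>" for V
  proof -
    obtain f y where fy: "f \<in> F" "y \<noteq> 0" "V = u f -` {y}" using v by (auto simp: \<V>_def)
    show s: "V \<in> sets borel" using simple_functionD(2)[OF u(1)[OF fy(1)], of "{y}"] fy by simp
    have "ennreal (norm y powr p) * emeasure \<mu> V = (\<integral>\<^sup>+x. ennreal (norm y powr p) * indicator V x \<partial>\<mu>)"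
      using s by (simp add: nn_integral_cmult_indicator)
    also have "\<dots> \<le> Lp_int \<mu> p (u f)" using fy by (intro nn_integral_mono) (auto simp: indicator_def)
    also have "\<dots> < \<infinity>" using u(2)[OF fy(1)] by (simp add: Lp_fun_def)
    finally show "emeasure \<mu> V < \<infinity>" using fy(2) by (auto simp: ennreal_mult_less_top less_top[symmetric] ennreal_mult_eq_top_iff)
  qed
  have "0 < c powr p" using c by simp
  obtain n :: nat and w :: "nat \<Rightarrow> real" and t :: "nat \<Rightarrow> 'g" where w: "\<And>j. 0 \<le> w j" "(\<Sum>j\<le>n. w j) = 1"
    and V: "\<And>V. V \<in> \<V> \<Longrightarrow> (\<integral>\<^sup>+s. ennreal (\<bar>enn2real (nu.slice V s) - (\<Sum>j\<le>n. w j * indicator V (s - t j))\<bar> powr p) \<partial>\<mu>) \<le> ennreal (c powr p)"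
    "\<And>V. V \<in> \<V> \<Longrightarrow> (\<integral>\<^sup>+s. ennreal (\<bar>enn2real (nu.slice V s) - (\<Sum>j\<le>n. w j * indicator V (s - (- t j)))\<bar> powr p) \<partial>\<mu>) \<le> ennreal (c powr p)"
    by (rule simultaneous_slice_discretization[OF sym V1 V2 \<open>0 < c powr p\<close> p]) (assumption, assumption, rule that)
  have close: "Lp_norm \<mu> p (\<lambda>s. conv_fun \<nu> f s - translation_mean n w t' f s) \<le> e"
    if f: "f \<in> F" and V: "\<And>V. V \<in> \<V> \<Longrightarrow> (\<integral>\<^sup>+s. ennreal (\<bar>enn2real (nu.slice V s) - (\<Sum>j\<le>n. w j * indicator V (s - t' j))\<bar> powr p) \<partial>\<mu>) \<le> ennreal (c powr p)"
    for f t'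
  proof (rule conv_fun_mean_close[OF _ u(2)[OF f] p1 w u(3)[OF f]])
    show "f \<in> Lp_fun \<mu> p" using F f by auto
    have "Lp_norm \<mu> p (\<lambda>s. conv_fun \<nu> (u f) s - translation_mean n w t' (u f) s) \<le> c * L f"
      unfolding L_def
    proof (rule conv_fun_simple_mean_le[OF u(1)[OF f] u(2)[OF f] p1 less_imp_le[OF c]])
      fix y assume "y \<in> range (u f) - {0}"
      then have "u f -` {y} \<in> \<V>" using f by (auto simp: \<V>_def)
      then show "(\<integral>\<^sup>+s. ennreal (\<bar>enn2real (nu.slice (u f -` {y}) s) - (\<Sum>j\<le>n. w j * indicator (u f -` {y}) (s - t' j))\<bar> powr p) \<partial>\<mu>) \<le> ennreal (c powr p)"
        by (rule V)
    qed
    also have "\<dots> \<le> c * m" using c Lm[OF f] by (intro mult_left_mono) auto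
    also have "\<dots> = e / 3" using m by (simp add: c_def)
    finally show "Lp_norm \<mu> p (\<lambda>s. conv_fun \<nu> (u f) s - translation_mean n w t' (u f) s) \<le> e / 3" .
  qed
  show ?thesis
    by (intro exI[of _ n] exI[of _ w] exI[of _ t] conjI ballI close V allI impI w)
qed

end

section \<open>Integrals of representations\<close>

lemma Pettis_compact_image:
  fixes h :: "'g::t2_space \<Rightarrow> 'x::real_normed_vector"
  assumes h: "continuous_on UNIV h" and K: "compact K"
  obtains D where "countable D" "h ` K \<subseteq> closure D"
proof -
  have C: "compact (h ` K)" by (rule compact_continuous_image[OF continuous_on_subset[OF h subset_UNIV] K])
  have tb: "\<exists>k. finite k \<and> h ` K \<subseteq> (\<Union>x\<in>k. ball x e)" if e: "0 < e" for e
  proof -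
    have "h ` K \<subseteq> (\<Union>x\<in>h ` K. ball x e)" using e by auto
    then obtain k where "k \<subseteq> h ` K" "finite k" "h ` K \<subseteq> (\<Union>x\<in>k. ball x e)"
      using compactE_image[OF C, of "h ` K" "\<lambda>x. ball x e"] open_ball by metis
    then show ?thesis by blast
  qed
  have "\<forall>n::nat. \<exists>k. finite k \<and> h ` K \<subseteq> (\<Union>x\<in>k. ball x (inverse (real (Suc n))))"
  proof
    fix n
    show "\<exists>k. finite k \<and> h ` K \<subseteq> (\<Union>x\<in>k. ball x (inverse (real (Suc n))))"
      using tb[of "inverse (real (Suc n))"] by auto
  qed
  then obtain k where k: "\<And>n. finite (k n)" "\<And>n. h ` K \<subseteq> (\<Union>x\<in>k n. ball x (inverse (real (Suc n))))" by metis
  show ?thesis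
  proof (rule that[of "\<Union>n. k n"])
    show "countable (\<Union>n. k n)" using k(1) by (auto intro: countable_finite)
    show "h ` K \<subseteq> closure (\<Union>n. k n)"
    proof
      fix y assume y: "y \<in> h ` K"
      show "y \<in> closure (\<Union>n. k n)"
        unfolding closure_approachable
      proof (intro allI impI)
        fix e :: real assume "0 < e"
        then obtain n where n: "inverse (real (Suc n)) < e" using reals_Archimedean by blast
        from k(2)[of n] y obtain z where "z \<in> k n" "dist z y < inverse (real (Suc n))" by auto
        with n show "\<exists>z\<in>\<Union>n. k n. dist z y < e" by (intro bexI[of _ z]) auto
      qed
    qed
  qed
qed

lemma sum_indicator_partition:
  fixes y :: "nat \<Rightarrow> 'x::real_vector"
  assumes "disjoint_family_on E {..n}" "j \<le> n" "s \<in> E j"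
  shows "(\<Sum>i\<le>n. indicator (E i) s *\<^sub>R y i) = y j"
proof -
  have "(\<Sum>i\<le>n. indicator (E i) s *\<^sub>R y i) = (\<Sum>i\<le>n. if i = j then y i else 0)"
  proof (rule sum.cong[OF refl])
    fix i assume "i \<in> {..n}"
    then have "i \<noteq> j \<Longrightarrow> s \<notin> E i" using assms by (auto simp: disjoint_family_on_def)
    then show "indicator (E i) s *\<^sub>R y i = (if i = j then y i else 0)" using assms(3) by (auto simp: indicator_def)
  qed
  then show ?thesis using assms(2) by simp
qed

context regular_prob begin

text \<open>
  A regular measure is carried by countably many compact sets, and continuous images of compact sets are separable.
\<close>

lemma ae_strongly_measurable_continuous:
  fixes h :: "'g \<Rightarrow> 'x::real_normed_vector"
  assumes h: "continuous_on UNIV h"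
  shows "ae_strongly_measurable \<nu> h"
proof -
  have "\<exists>K. compact K \<and> measure \<nu> (UNIV - K) \<le> inverse (real (Suc n))" for n
  proof -
    have "0 < inverse (real (Suc n))" by simp
    then obtain K where "compact K" "K \<in> sets borel" "measure \<nu> (UNIV - K) \<le> inverse (real (Suc n))"
      by (rule compact_of_measure_close_to_1)
    then show ?thesis by blast
  qed
  then obtain K where K: "\<And>n. compact (K n)" "\<And>n. measure \<nu> (UNIV - K n) \<le> inverse (real (Suc n))" by metis
  have Kb: "K n \<in> sets borel" for n using K(1) by (simp add: compact_imp_closed)
  define Z where "Z = (\<Union>n. K n)"
  have Zb: "Z \<in> sets \<nu>" using Kb by (auto simp: Z_def)
  have "measure \<nu> (UNIV - Z) \<le> inverse (real (Suc n))" for n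
    using K(2)[of n] Kb by (intro order_trans[OF finite_measure_mono K(2)[of n]]) (auto simp: Z_def)
  then have "measure \<nu> (UNIV - Z) \<le> 0"
    by (intro LIMSEQ_le_const[OF LIMSEQ_inverse_real_of_nat]) auto
  then have "measure \<nu> (UNIV - Z) = 0" by (simp add: measure_le_0_iff)
  then have AEZ: "AE x in \<nu>. x \<in> Z"
    using Zb by (intro AE_I[where N="UNIV - Z"]) (auto simp: emeasure_eq_measure)
  have "\<exists>D. countable D \<and> h ` K n \<subseteq> closure D" for n
    by (rule Pettis_compact_image[OF h K(1)[of n]]) auto
  then obtain D where D: "\<And>n. countable (D n)" "\<And>n. h ` K n \<subseteq> closure (D n)" by metis
  define g where "g x = (if x \<in> Z then h x else 0)" for x
  have hb: "h \<in> borel_measurable \<nu>" using borel_measurable_continuous_onI[OF h] by (simp cong: measurable_cong_sets)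
  have "strongly_measurable \<nu> g"
  proof (rule strongly_measurable_Pettis)
    show "g \<in> borel_measurable \<nu>" unfolding g_def using hb Zb by (intro measurable_If_set) auto
    show "countable (insert 0 (\<Union>n. D n))" using D(1) by auto
    show "g ` space \<nu> \<subseteq> closure (insert 0 (\<Union>n. D n))"
    proof -
      have sub: "closure (D n) \<subseteq> closure (insert 0 (\<Union>n. D n))" for n by (intro closure_mono) auto
      have zero: "0 \<in> closure (insert 0 (\<Union>n. D n))" by (rule subsetD[OF closure_subset]) simp
      have "g x \<in> closure (insert 0 (\<Union>n. D n))" for x
      proof (cases "x \<in> Z")
        case True
        then obtain n where "x \<in> K n" by (auto simp: Z_def)
        then have "h x \<in> closure (D n)" using D(2)[of n] by blast
        with True sub[of n] show ?thesis by (auto simp: g_def)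
      qed (simp add: g_def zero)
      then show ?thesis by blast
    qed
  qed
  then show ?thesis
    unfolding ae_strongly_measurable_iff using AEZ by (intro exI[of _ g]) (auto simp: g_def elim: AE_mp)
qed

lemma strongly_integrable_bounded:
  fixes h :: "'g \<Rightarrow> 'x::real_normed_vector"
  assumes h: "ae_strongly_measurable \<nu> h" and B: "\<And>t. norm (h t) \<le> B"
  shows "strongly_integrable \<nu> h"
proof -
  have "(\<integral>\<^sup>+t. ennreal (norm (h t)) \<partial>\<nu>) \<le> (\<integral>\<^sup>+t. ennreal B \<partial>\<nu>)" using B by (intro nn_integral_mono ennreal_leI)
  also have "\<dots> < \<infinity>" by simp
  finally show ?thesis using h by (simp add: strongly_integrable_def)
qed

lemma norm_strong_integral_le_bound:
  fixes h :: "'g \<Rightarrow> 'x::banach"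
  assumes B: "\<And>t. norm (h t) \<le> B"
  shows "norm (strong_integral \<nu> h) \<le> B"
proof -
  have B0: "0 \<le> B" using order_trans[OF norm_ge_zero B] by blast
  have "ennreal (norm (strong_integral \<nu> h)) \<le> (\<integral>\<^sup>+t. ennreal (norm (h t)) \<partial>\<nu>)" by (rule norm_strong_integral_le)
  also have "\<dots> \<le> (\<integral>\<^sup>+t. ennreal B \<partial>\<nu>)" using B by (intro nn_integral_mono ennreal_leI)
  finally show ?thesis using B0 by simp
qed

lemma integral_discretization:
  fixes h :: "'g \<Rightarrow> 'x::complex_banach"
  assumes h: "ae_strongly_measurable \<nu> h" and B: "\<And>t. norm (h t) \<le> B"
    and E: "\<And>j. E j \<in> sets borel" "disjoint_family_on E {..n::nat}" "(\<Union>j\<le>n. E j) = UNIV"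
    and E0: "measure \<nu> (E 0) \<le> \<delta>" and t: "\<And>j s. 1 \<le> j \<Longrightarrow> j \<le> n \<Longrightarrow> s \<in> E j \<Longrightarrow> norm (h s - h (t j)) \<le> e" and e: "0 \<le> e"
  shows "norm (strong_integral \<nu> h - (\<Sum>j\<le>n. scaleC (of_real (measure \<nu> (E j))) (h (t j)))) \<le> e + 2 * B * \<delta>"
proof -
  have B0: "0 \<le> B" using order_trans[OF norm_ge_zero B] by blast
  define v where "v s = (\<Sum>j\<le>n. indicator (E j) s *\<^sub>R h (t j))" for s
  have ind: "strongly_integrable \<nu> (\<lambda>s. indicator (E j) s *\<^sub>R y)" "strong_integral \<nu> (\<lambda>s. indicator (E j) s *\<^sub>R y) = measure \<nu> (E j) *\<^sub>R y"
    for j and y :: 'x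
    using strong_integral_indicator[of "E j" \<nu> y] E(1) by (auto simp: emeasure_eq_measure)
  have vi: "strongly_integrable \<nu> v" unfolding v_def by (intro strongly_integrable_sum ind)
  have v_int: "strong_integral \<nu> v = (\<Sum>j\<le>n. scaleC (of_real (measure \<nu> (E j))) (h (t j)))"
    unfolding v_def by (subst strong_integral_sum[OF ind(1)]) (simp only: ind(2) scaleC_of_real)
  have v_val: "v s = h (t j)" if "j \<le> n" "s \<in> E j" for s j
    unfolding v_def by (rule sum_indicator_partition[OF E(2) that])
  have "ennreal (norm (strong_integral \<nu> (\<lambda>s. h s - v s))) \<le> (\<integral>\<^sup>+s. ennreal (norm (h s - v s)) \<partial>\<nu>)"
    by (rule norm_strong_integral_le)
  also have "\<dots> \<le> (\<integral>\<^sup>+s. ennreal e + ennreal (2 * B) * indicator (E 0) s \<partial>\<nu>)"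
  proof (rule nn_integral_mono)
    fix s
    obtain j where j: "j \<le> n" "s \<in> E j" using E(3) by blast
    have "norm (h s - v s) \<le> e + 2 * B * indicator (E 0) s"
    proof (cases "j = 0")
      case True
      have "norm (h s - v s) \<le> 2 * B" unfolding v_val[OF j] using norm_triangle_le_diff[of "h s" "h (t j)" "2 * B"] B[of s] B[of "t j"] by linarith
      then show ?thesis using True j e by simp
    next
      case False
      have "norm (h s - v s) \<le> e" unfolding v_val[OF j] using False j by (intro t) auto
      then show ?thesis using B0 by (simp add: indicator_def)
    qed
    then have "ennreal (norm (h s - v s)) \<le> ennreal (e + 2 * B * indicator (E 0) s)" by (rule ennreal_leI)
    also have "\<dots> = ennreal e + ennreal (2 * B) * indicator (E 0) s" using e B0 by (auto simp: indicator_def)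
    finally show "ennreal (norm (h s - v s)) \<le> ennreal e + ennreal (2 * B) * indicator (E 0) s" .
  qed
  also have "\<dots> = ennreal e + ennreal (2 * B) * emeasure \<nu> (E 0)"
    using E(1) by (simp add: nn_integral_add nn_integral_cmult_indicator)
  also have "\<dots> = ennreal (e + 2 * B * measure \<nu> (E 0))"
    using e B0 by (simp add: emeasure_eq_measure ennreal_mult ennreal_plus)
  finally have "norm (strong_integral \<nu> (\<lambda>s. h s - v s)) \<le> e + 2 * B * measure \<nu> (E 0)"
    using e B0 by (subst (asm) ennreal_le_iff) (auto intro!: add_nonneg_nonneg mult_nonneg_nonneg)
  also have "\<dots> \<le> e + 2 * B * \<delta>" using E0 B0 by (intro add_left_mono mult_left_mono) auto
  finally show ?thesis
    using strong_integral_diff[OF strongly_integrable_bounded[OF h B] vi] v_int by simp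
qed

lemma simultaneous_integral_discretization:
  fixes H :: "('g \<Rightarrow> 'x::complex_banach) set"
  assumes sym: "symmetric_measure \<nu>" and H: "finite H" "\<And>h. h \<in> H \<Longrightarrow> continuous_on UNIV h" "\<And>h t. h \<in> H \<Longrightarrow> norm (h t) \<le> B" and e: "0 < e"
  obtains n :: nat and w :: "nat \<Rightarrow> real" and t :: "nat \<Rightarrow> 'g"
  where "\<And>j. 0 \<le> w j" "(\<Sum>j\<le>n. w j) = 1"
    "\<And>h. h \<in> H \<Longrightarrow> norm (strong_integral \<nu> h - (\<Sum>j\<le>n. scaleC (of_real (w j)) (h (t j)))) \<le> e"
    "\<And>h. h \<in> H \<Longrightarrow> norm (strong_integral \<nu> h - (\<Sum>j\<le>n. scaleC (of_real (w j)) (h (- t j)))) \<le> e"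
proof -
  interpret sym: symmetric_prob \<nu> by unfold_locales (rule sym)
  define b where "b = \<bar>B\<bar> + 1"
  have b_pos: "0 < b" by (simp add: b_def)
  have b: "norm (h t) \<le> b" if "h \<in> H" for h t using H(3)[OF that, of t] by (simp add: b_def)
  define \<delta> where "\<delta> = e / (4 * b)"
  have d: "0 < \<delta>" using e b_pos by (simp add: \<delta>_def)
  define Ob where "Ob t = (\<Inter>h\<in>H. {s. norm (h s - h t) < e / 2} \<inter> {s. norm (h (- s) - h (- t)) < e / 2})" for t
  have Ob: "open (Ob t)" "t \<in> Ob t" for t
  proof -
    show "open (Ob t)"
      unfolding Ob_def
    proof (intro open_INT H(1) ballI open_Int)
      fix h assume h: "h \<in> H"
      have cm: "continuous_on UNIV (\<lambda>s. h (- s))"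
        by (rule continuous_on_compose2[OF H(2)[OF h]]) (auto intro: continuous_intros)
      show "open {s. norm (h s - h t) < e / 2}"
        by (intro open_Collect_less continuous_intros H(2)[OF h])
      show "open {s. norm (h (- s) - h (- t)) < e / 2}"
        by (intro open_Collect_less continuous_on_norm continuous_on_diff cm continuous_on_const)
    qed
    show "t \<in> Ob t" using e by (simp add: Ob_def)
  qed
  obtain n :: nat and E :: "nat \<Rightarrow> 'g set" and t :: "nat \<Rightarrow> 'g" where
    E: "\<And>j. E j \<in> sets borel" "disjoint_family_on E {..n}" "(\<Union>j\<le>n. E j) = UNIV" and E0: "measure \<nu> (E 0) \<le> \<delta>"
    and EO: "\<And>j. 1 \<le> j \<Longrightarrow> j \<le> n \<Longrightarrow> E j \<subseteq> Ob (t j)"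
    by (rule finite_borel_partition[OF Ob d]) (rule that)
  have near: "norm (h s - h (t j)) \<le> e / 2" "norm (h (- s) - h (- t j)) \<le> e / 2"
    if "1 \<le> j" "j \<le> n" "s \<in> E j" "h \<in> H" for j s h
    using EO[OF that(1,2)] that(3,4) by (auto simp: Ob_def less_imp_le)
  define E' where "E' j = {x. - x \<in> E j}" for j
  have E': "E' j \<in> sets borel" for j unfolding E'_def by (rule slice_sets(5)[OF E(1)])
  have E'2: "disjoint_family_on E' {..n}" using E(2) by (fastforce simp: disjoint_family_on_def E'_def)
  have E'3: "(\<Union>j\<le>n. E' j) = UNIV" using E(3) by (auto simp: E'_def set_eq_iff)
  have meas': "measure \<nu> (E' j) = measure \<nu> (E j)" for j
    using sym.reflect[OF E(1), of j] by (simp add: measure_def E'_def)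
  have tot: "e / 2 + 2 * b * \<delta> = e" using b_pos by (simp add: \<delta>_def)
  show thesis
  proof (rule that[of "\<lambda>j. measure \<nu> (E j)" n t])
    show "(\<Sum>j\<le>n. measure \<nu> (E j)) = 1" by (rule partition_weights[OF E])
    fix h assume h: "h \<in> H"
    note hm = ae_strongly_measurable_continuous[OF H(2)[OF h]]
    have e2: "0 \<le> e / 2" using e by simp
    show "norm (strong_integral \<nu> h - (\<Sum>j\<le>n. scaleC (of_real (measure \<nu> (E j))) (h (t j)))) \<le> e"
      using integral_discretization[where t=t, OF hm b[OF h] E E0 near(1)[OF _ _ _ h] e2] unfolding tot .
    have "norm (strong_integral \<nu> h - (\<Sum>j\<le>n. scaleC (of_real (measure \<nu> (E' j))) (h (- t j)))) \<le> e / 2 + 2 * b * \<delta>"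
    proof (rule integral_discretization[OF hm b[OF h] E' E'2 E'3 _ _ e2])
      show "measure \<nu> (E' 0) \<le> \<delta>" using E0 by (simp add: meas')
      show "norm (h s - h (- t j)) \<le> e / 2" if "1 \<le> j" "j \<le> n" "s \<in> E' j" for j s
        using near(2)[OF that(1,2) _ h, of "- s"] that(3) by (simp add: E'_def)
    qed
    then show "norm (strong_integral \<nu> h - (\<Sum>j\<le>n. scaleC (of_real (measure \<nu> (E j))) (h (- t j)))) \<le> e"
      unfolding tot meas' .
  qed simp
qed

end

section \<open>Representations of the group algebra\<close>

lemma poly_mapping_eq_sum_single:
  "a = (\<Sum>t\<in>Poly_Mapping.keys a. Poly_Mapping.single t (Poly_Mapping.lookup a t))"
proof (rule poly_mapping_eqI)
  fix k
  have "(\<Sum>t\<in>Poly_Mapping.keys a. Poly_Mapping.lookup (Poly_Mapping.single t (Poly_Mapping.lookup a t)) k)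
      = (\<Sum>t\<in>Poly_Mapping.keys a. if t = k then Poly_Mapping.lookup a k else 0)"
    by (intro sum.cong refl) (auto simp: lookup_single when_def)
  also have "\<dots> = Poly_Mapping.lookup a k"
    by (simp add: in_keys_iff)
  finally show "Poly_Mapping.lookup a k = Poly_Mapping.lookup (\<Sum>t\<in>Poly_Mapping.keys a. Poly_Mapping.single t (Poly_Mapping.lookup a t)) k"
    by (simp add: lookup_sum)
qed

definition signed_type_on :: "'a::ab_group_add set \<Rightarrow> nat \<Rightarrow> real \<Rightarrow> real \<Rightarrow> ('a \<Rightarrow> real) \<Rightarrow> bool"
  where "signed_type_on V k \<alpha> p N \<longleftrightarrow> (\<forall>x. (\<forall>j<k. x j \<in> V) \<longrightarrow> (\<Sum>B\<in>Pow {..<k}. N (\<Sum>j<k. signed B j (x j)) powr p)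
     \<le> 2 ^ k * \<alpha> * real k powr (p - 1) * (\<Sum>j<k. N (x j) powr p))"

text \<open>
  A bounded action of \<open>G\<close> on a subspace \<open>V\<close> with a seminorm. The carrier, the scalar multiplication and the seminorm are parameters
  because one instance is the space of \<open>p\<close>-integrable functions, with \<open>p\<close> a value and functions not identified almost
  everywhere.
\<close>

locale isometric_action =
  fixes V :: "'v::ab_group_add set" and sc :: "complex \<Rightarrow> 'v \<Rightarrow> 'v" and N :: "'v \<Rightarrow> real"
    and \<pi> :: "'g::ab_group_add \<Rightarrow> 'v \<Rightarrow> 'v" and M :: real
  assumes V_0: "0 \<in> V" and V_add: "\<lbrakk>x \<in> V; y \<in> V\<rbrakk> \<Longrightarrow> x + y \<in> V" and V_sc: "x \<in> V \<Longrightarrow> sc c x \<in> V"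
    and V_\<pi>: "x \<in> V \<Longrightarrow> \<pi> t x \<in> V"
    and sc_right: "sc c (x + y) = sc c x + sc c y" and sc_left: "sc (c + d) x = sc c x + sc d x"
    and sc_sc: "sc c (sc d x) = sc (c * d) x" and sc_one: "sc 1 x = x"
    and \<pi>_add: "\<lbrakk>x \<in> V; y \<in> V\<rbrakk> \<Longrightarrow> \<pi> t (x + y) = \<pi> t x + \<pi> t y"
    and \<pi>_sc: "x \<in> V \<Longrightarrow> \<pi> t (sc c x) = sc c (\<pi> t x)"
    and \<pi>_plus: "x \<in> V \<Longrightarrow> \<pi> (s + t) x = \<pi> s (\<pi> t x)" and \<pi>_0: "x \<in> V \<Longrightarrow> \<pi> 0 x = x"
    and N_add: "\<lbrakk>x \<in> V; y \<in> V\<rbrakk> \<Longrightarrow> N (x + y) \<le> N x + N y" and N_scale: "x \<in> V \<Longrightarrow> N (sc c x) = cmod c * N x"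
    and N_\<pi>: "x \<in> V \<Longrightarrow> N (\<pi> t x) \<le> M * N x" and M_ge: "1 \<le> M"
begin

lemma sc_zero_left: "sc 0 x = 0"
  using sc_left[of 0 0 x] by simp

lemma sc_zero_right: "sc c 0 = 0"
  using sc_right[of c 0 0] by simp

lemma sc_neg: "sc (- 1) x = - x"
  using sc_left[of 1 "- 1" x] by (simp add: sc_zero_left sc_one eq_neg_iff_add_eq_0 add.commute)

lemma sc_sum_right: "sc c (\<Sum>i\<in>I. f i) = (\<Sum>i\<in>I. sc c (f i))"
  by (induction I rule: infinite_finite_induct) (auto simp: sc_zero_right sc_right)

lemma V_uminus: "x \<in> V \<Longrightarrow> - x \<in> V"
  using V_sc[of x "- 1"] by (simp add: sc_neg)

lemma V_diff: "\<lbrakk>x \<in> V; y \<in> V\<rbrakk> \<Longrightarrow> x - y \<in> V"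
  using V_add[OF _ V_uminus, of x y] by simp

lemma V_sum: "(\<And>i. i \<in> I \<Longrightarrow> f i \<in> V) \<Longrightarrow> (\<Sum>i\<in>I. f i) \<in> V"
  by (induction I rule: infinite_finite_induct) (auto intro: V_0 V_add)

lemma \<pi>_sum: "(\<And>i. i \<in> I \<Longrightarrow> f i \<in> V) \<Longrightarrow> \<pi> t (\<Sum>i\<in>I. f i) = (\<Sum>i\<in>I. \<pi> t (f i))"
proof (induction I rule: infinite_finite_induct)
  case empty
  then show ?case using \<pi>_sc[OF V_0, of t 0] by (simp add: sc_zero_left)
next
  case (infinite A)
  then show ?case using \<pi>_sc[OF V_0, of t 0] by (simp add: sc_zero_left)
qed (auto simp: \<pi>_add V_sum)

lemma Nz: "N 0 = 0" using N_scale[OF V_0, of 0] by (simp add: sc_zero_left)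

lemma N_neg: "x \<in> V \<Longrightarrow> N (- x) = N x"
  using N_scale[of x "- 1"] by (simp add: sc_neg)

lemma N_minus: "\<lbrakk>x \<in> V; y \<in> V\<rbrakk> \<Longrightarrow> N (x - y) \<le> N x + N y"
  using N_add[of x "- y"] by (simp add: N_neg V_uminus)

text \<open>
  Finitely supported functions with convolution form the group algebra; on \<open>'g \<Rightarrow>\<^sub>0 complex\<close> this is the
  multiplication of the ring. Commutativity of \<open>G\<close> makes it a commutative ring.
\<close>

definition act :: "('g \<Rightarrow>\<^sub>0 complex) \<Rightarrow> 'v \<Rightarrow> 'v"
  where "act a x = (\<Sum>t\<in>Poly_Mapping.keys a. sc (Poly_Mapping.lookup a t) (\<pi> t x))"

lemma act_superset:
  assumes "finite S" "Poly_Mapping.keys a \<subseteq> S"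
  shows "act a x = (\<Sum>t\<in>S. sc (Poly_Mapping.lookup a t) (\<pi> t x))"
  unfolding act_def using assms
  by (intro sum.mono_neutral_left) (auto simp: in_keys_iff sc_zero_left)

lemma act_add: "act (a + b) x = act a x + act b x"
proof -
  let ?S = "Poly_Mapping.keys a \<union> Poly_Mapping.keys b"
  have "Poly_Mapping.keys (a + b) \<subseteq> ?S" by (rule Poly_Mapping.keys_add)
  then have "act (a + b) x = (\<Sum>t\<in>?S. sc (Poly_Mapping.lookup (a + b) t) (\<pi> t x))"
    by (intro act_superset) auto
  also have "\<dots> = (\<Sum>t\<in>?S. sc (Poly_Mapping.lookup a t) (\<pi> t x)) + (\<Sum>t\<in>?S. sc (Poly_Mapping.lookup b t) (\<pi> t x))"
    by (simp add: lookup_add sc_left sum.distrib)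
  also have "\<dots> = act a x + act b x" by (simp add: act_superset[of ?S])
  finally show ?thesis .
qed

lemma act_zero: "act 0 x = 0" by (simp add: act_def)

lemma act_uminus: "act (- a) x = - act a x"
  using act_add[of a "- a" x] by (simp add: act_zero eq_neg_iff_add_eq_0 add.commute)

lemma act_diff: "act (a - b) x = act a x - act b x"
  using act_add[of a "- b" x] by (simp add: act_uminus)

lemma act_sum: "act (\<Sum>i\<in>I. f i) x = (\<Sum>i\<in>I. act (f i) x)"
  by (induction I rule: infinite_finite_induct) (auto simp: act_zero act_add)

lemma act_single: "act (Poly_Mapping.single t c) x = sc c (\<pi> t x)"
  using act_superset[of "{t}" "Poly_Mapping.single t c" x] by simp

lemma act_V: "x \<in> V \<Longrightarrow> act a x \<in> V"
  unfolding act_def by (intro V_sum V_sc V_\<pi>)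

lemma act_single_mult:
  assumes x: "x \<in> V" shows "act (Poly_Mapping.single t c * b) x = sc c (\<pi> t (act b x))"
proof -
  have "Poly_Mapping.single t c * b = (\<Sum>u\<in>Poly_Mapping.keys b. Poly_Mapping.single (t + u) (c * Poly_Mapping.lookup b u))"
    by (subst poly_mapping_eq_sum_single[of b]) (simp add: sum_distrib_left mult_single)
  then have "act (Poly_Mapping.single t c * b) x = (\<Sum>u\<in>Poly_Mapping.keys b. sc (c * Poly_Mapping.lookup b u) (\<pi> (t + u) x))"
    by (simp add: act_sum act_single)
  also have "\<dots> = sc c (\<Sum>u\<in>Poly_Mapping.keys b. \<pi> t (sc (Poly_Mapping.lookup b u) (\<pi> u x)))"
    unfolding sc_sum_right using x by (intro sum.cong refl) (simp add: sc_sc \<pi>_plus \<pi>_sc V_\<pi>)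
  also have "(\<Sum>u\<in>Poly_Mapping.keys b. \<pi> t (sc (Poly_Mapping.lookup b u) (\<pi> u x))) = \<pi> t (act b x)"
    unfolding act_def using x by (intro \<pi>_sum[symmetric] V_sc V_\<pi>)
  finally show ?thesis .
qed

lemma act_mult:
  assumes x: "x \<in> V" shows "act (a * b) x = act a (act b x)"
proof -
  have "a * b = (\<Sum>t\<in>Poly_Mapping.keys a. Poly_Mapping.single t (Poly_Mapping.lookup a t) * b)"
    by (subst poly_mapping_eq_sum_single[of a]) (rule sum_distrib_right)
  then have "act (a * b) x = (\<Sum>t\<in>Poly_Mapping.keys a. sc (Poly_Mapping.lookup a t) (\<pi> t (act b x)))"
    by (simp add: act_sum act_single_mult[OF x])
  then show ?thesis by (simp add: act_def)
qed

lemma act_one: "x \<in> V \<Longrightarrow> act 1 x = x"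
  using act_single[of 0 1 x] by (simp add: \<pi>_0 sc_one)

lemma scalar_ring_act:
  assumes x: "x \<in> V" shows "scalar_ring (Poly_Mapping.single 0) (\<lambda>a. N (act a x))"
proof
  fix c :: complex and a :: "'g \<Rightarrow>\<^sub>0 complex"
  show "N (act (Poly_Mapping.single 0 c * a) x) = cmod c * N (act a x)"
    using x by (simp add: act_single_mult \<pi>_0 act_V N_scale)
qed (use x in \<open>auto simp: single_add mult_single act_add intro!: N_add act_V\<close>)

lemma averaging_act:
  assumes x: "x \<in> V"
  shows "averaging (Poly_Mapping.single 0) (\<lambda>a. N (act a x)) (range (\<lambda>t. Poly_Mapping.single t 1)) M"
proof -
  interpret scalar_ring "Poly_Mapping.single 0" "\<lambda>a. N (act a x)" by (rule scalar_ring_act[OF x])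
  show ?thesis
  proof
    show "1 \<in> range (\<lambda>t::'g. Poly_Mapping.single t (1::complex))" by (intro image_eqI[of _ _ 0]) auto
    show "g * h \<in> range (\<lambda>t::'g. Poly_Mapping.single t (1::complex))"
      if "g \<in> range (\<lambda>t. Poly_Mapping.single t 1)" "h \<in> range (\<lambda>t. Poly_Mapping.single t 1)" for g h
      using that by (auto simp: mult_single)
    show "N (act (g * a) x) \<le> M * N (act a x)" if "g \<in> range (\<lambda>t. Poly_Mapping.single t 1)" for g a
      using that x by (auto simp: act_single_mult sc_one act_V N_\<pi>)
  qed (rule M_ge)
qed

lemma signed_type_act:
  assumes "signed_type_on V k \<alpha> p N" "x \<in> V"
  shows "signed_type k \<alpha> p (\<lambda>a. N (act a x))"
  unfolding signed_type_def
proof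
  fix a :: "nat \<Rightarrow> 'g \<Rightarrow>\<^sub>0 complex"
  have "act (\<Sum>j<k. signed B j (a j)) x = (\<Sum>j<k. signed B j (act (a j) x))" for B
    by (simp add: act_sum) (intro sum.cong refl, simp add: signed_def act_uminus)
  then show "(\<Sum>B\<in>Pow {..<k}. N (act (\<Sum>j<k. signed B j (a j)) x) powr p)
      \<le> 2 ^ k * \<alpha> * real k powr (p - 1) * (\<Sum>j<k. N (act (a j) x) powr p)"
    using assms act_V unfolding signed_type_on_def by simp
qed

definition mean :: "nat \<Rightarrow> (nat \<Rightarrow> real) \<Rightarrow> (nat \<Rightarrow> 'g) \<Rightarrow> 'g \<Rightarrow>\<^sub>0 complex"
  where "mean n w t = (\<Sum>j\<le>n. Poly_Mapping.single 0 (of_real (w j)) * Poly_Mapping.single (t j) 1)"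

lemma act_mean: "act (mean n w t) x = (\<Sum>j\<le>n. sc (of_real (w j)) (\<pi> (t j) x))"
  unfolding mean_def by (simp add: act_sum mult_single act_single)

text \<open>
  A power of the mean is again a convex combination of group elements, indexed by words. So \<open>\<tau> ^ q\<close> has the form
  required by \<open>product_square_difference\<close> for each \<open>q\<close>, with the same \<open>k\<close>.
\<close>

lemma mean_square_estimates:
  fixes n m k :: nat and w :: "nat \<Rightarrow> real" and t :: "nat \<Rightarrow> 'g" and x :: 'v and p :: real
  assumes x: "x \<in> V" and w: "\<And>j. j \<le> n \<Longrightarrow> 0 \<le> w j" "(\<Sum>j\<le>n. w j) = 1"
    and type: "signed_type_on V k ((1 / (4 * M\<^sup>2)) powr p) p N" and k: "0 < k" and p: "1 \<le> p"
  defines "\<tau> \<equiv> mean n w t * mean n w (\<lambda>j. - t j)"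
  shows "N (act (mean n w t) x) \<le> M * N x" "N (act (\<tau> ^ m) x) \<le> M * N x"
    "real (Suc m) * N (act (\<tau> ^ m * (1 - \<tau>)) x) \<le> ritt_constant M k * N x"
proof -
  interpret averaging "Poly_Mapping.single 0" "\<lambda>a. N (act a x)" "range (\<lambda>t. Poly_Mapping.single t 1)" M
    by (rule averaging_act[OF x])
  have one: "act 1 x = x" by (rule act_one[OF x])
  have in\<Gamma>: "Poly_Mapping.single s 1 \<in> contractive" for s using \<Gamma>_subset_contractive by auto
  have mean_in: "mean n w s \<in> contractive" for s
    unfolding mean_def using w by (intro contractive_average in\<Gamma>) auto
  show "N (act (mean n w t) x) \<le> M * N x" using contractive_bound[OF mean_in, of t 1] one by simp
  have tau_in: "\<tau> ^ q \<in> contractive" for q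
    unfolding \<tau>_def by (intro contractive_power contractive_mult mean_in)
  show "N (act (\<tau> ^ m) x) \<le> M * N x" using contractive_bound[OF tau_in, of m 1] one by simp
  have small: "N (act ((\<tau> ^ q) ^ k * (1 - \<tau> ^ q) * a) x) \<le> N (act a x) / 2" for q a
  proof -
    let ?I = "PiE {..<q} (\<lambda>_. {..n})"
    let ?w = "\<lambda>\<omega>. \<Prod>i<q. w (\<omega> i)"
    have fin: "finite ?I" by (intro finite_PiE) auto
    have pow: "mean n w s ^ q = (\<Sum>\<omega>\<in>?I. Poly_Mapping.single 0 (of_real (?w \<omega>)) * (\<Prod>i<q. Poly_Mapping.single (s (\<omega> i)) 1))" for s
    proof -
      have "mean n w s ^ q = (\<Prod>i<q. mean n w s)" by simp
      also have "\<dots> = (\<Sum>\<omega>\<in>?I. \<Prod>i<q. Poly_Mapping.single 0 (of_real (w (\<omega> i))) * Poly_Mapping.single (s (\<omega> i)) 1)"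
        unfolding mean_def by (rule prod_sum_PiE) auto
      finally show ?thesis by (simp add: prod.distrib of_real_prod sc_prod)
    qed
    have prod_in: "(\<Prod>i\<in>A. Poly_Mapping.single (s i) 1) \<in> range (\<lambda>t. Poly_Mapping.single t (1::complex))"
      for A :: "nat set" and s :: "nat \<Rightarrow> 'g"
      by (induction A rule: infinite_finite_induct) (auto intro!: mult_in one_in)
    have "N (act ((\<tau> ^ q) ^ k * (1 - \<tau> ^ q) * a) x) \<le> 2 * (1 / (4 * M\<^sup>2)) * M\<^sup>2 * N (act a x)"
      unfolding \<tau>_def power_mult_distrib[of "mean n w t"] pow[of t] pow[of "\<lambda>j. - t j"]
    proof (rule product_square_difference[OF fin])
      show "0 \<le> ?w \<omega>" if "\<omega> \<in> ?I" for \<omega> using that w by (intro prod_nonneg) (auto simp: PiE_iff)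
      have "(\<Sum>\<omega>\<in>?I. ?w \<omega>) = (\<Prod>i<q. \<Sum>j\<le>n. w j)" by (rule prod_sum_PiE[symmetric]) auto
      then show "(\<Sum>\<omega>\<in>?I. ?w \<omega>) = 1" using w by simp
      show "(\<Prod>i<q. Poly_Mapping.single (t (\<omega> i)) 1) * (\<Prod>i<q. Poly_Mapping.single (- t (\<omega> i)) 1) = (1 :: 'g \<Rightarrow>\<^sub>0 complex)" for \<omega>
        by (simp add: prod.distrib[symmetric] mult_single)
      show "signed_type k ((1 / (4 * M\<^sup>2)) powr p) p (\<lambda>a. N (act a x))" by (rule signed_type_act[OF type x])
    qed (use prod_in k p in auto)
    then show ?thesis using M_ge by simp
  qed
  have "real (Suc m) * N (act (\<tau> ^ m * (1 - \<tau>) * 1) x) \<le> ritt_constant M k * N (act 1 x)"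
  proof (rule ritt_estimate_of_small_differences[OF _ M_ge])
    show "N (act (\<tau> ^ q * a) x) \<le> M * N (act a x)" for q a by (rule contractive_bound[OF tau_in])
  qed (rule small)
  then show "real (Suc m) * N (act (\<tau> ^ m * (1 - \<tau>)) x) \<le> ritt_constant M k * N x" using one by simp
qed

text \<open>
  For fixed \<open>n\<close> and \<open>x\<close> only finitely many vectors occur in \<open>T\<^sup>n x\<close> and \<open>T\<^sup>n\<^sup>+\<^sup>1 x\<close>, and \<open>T\<close> is replaced by
  \<open>\<tau>\<close> one factor at a time with error \<open>e\<close> each. The constants do not depend on the approximation.
\<close>

lemma ritt_estimates_of_approximation:
  assumes A: "\<And>x. x \<in> V \<Longrightarrow> A x \<in> V" and T: "\<And>x. x \<in> V \<Longrightarrow> T x \<in> V"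
    and sq: "\<And>x. x \<in> V \<Longrightarrow> N (T x - A (A x)) = 0"
    and approx: "\<And>F e. finite F \<Longrightarrow> F \<subseteq> V \<Longrightarrow> 0 < e \<Longrightarrow> \<exists>(n::nat) w t. (\<forall>j\<le>n. 0 \<le> w j) \<and> (\<Sum>j\<le>n. w j) = 1 \<and>
      (\<forall>y\<in>F. N (A y - (\<Sum>j\<le>n. sc (of_real (w j)) (\<pi> (t j) y))) \<le> e \<and>
        N (A y - (\<Sum>j\<le>n. sc (of_real (w j)) (\<pi> (- t j) y))) \<le> e)"
    and type: "signed_type_on V k ((1 / (4 * M\<^sup>2)) powr p) p N" and k: "0 < k" and p: "1 \<le> p"
    and x: "x \<in> V"
  shows "N ((T ^^ n) x) \<le> M * N x"
    "real (Suc n) * N ((T ^^ n) x - (T ^^ Suc n) x) \<le> ritt_constant M k * N x"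
proof -
  have TV: "(T ^^ m) x \<in> V" for m using x T by (induction m) auto
  have key: "N ((T ^^ n) x) \<le> M * N x + \<epsilon> \<and> real (Suc n) * N ((T ^^ n) x - (T ^^ Suc n) x) \<le> ritt_constant M k * N x + \<epsilon>"
    if eps: "0 < \<epsilon>" for \<epsilon>
  proof -
    define e where "e = \<epsilon> / (real (Suc n) * (real (2 * n + 1) * (M * (1 + M))))"
    have e: "0 < e" using eps M_ge by (simp add: e_def)
    define F where "F = (\<lambda>m. (T ^^ m) x) ` {..n} \<union> (\<lambda>m. A ((T ^^ m) x)) ` {..n}"
    have "finite F" "F \<subseteq> V" using TV A by (auto simp: F_def)
    obtain l :: nat and w t where lwt: "(\<forall>j\<le>l. 0 \<le> w j) \<and> (\<Sum>j\<le>l. w j) = 1 \<and>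
      (\<forall>y\<in>F. N (A y - (\<Sum>j\<le>l. sc (of_real (w j)) (\<pi> (t j) y))) \<le> e \<and>
        N (A y - (\<Sum>j\<le>l. sc (of_real (w j)) (\<pi> (- t j) y))) \<le> e)"
      using approx[OF \<open>finite F\<close> \<open>F \<subseteq> V\<close> e] by (elim exE) (rule that)
    note w = conjunct1[OF lwt] conjunct1[OF conjunct2[OF lwt]] and F' = conjunct2[OF conjunct2[OF lwt]]
    have F: "N (A y - act (mean l w t) y) \<le> e" "N (A y - act (mean l w (\<lambda>j. - t j)) y) \<le> e" if "y \<in> F" for y
      using F' that by (simp_all add: act_mean)
    define \<tau> where "\<tau> = mean l w t * mean l w (\<lambda>j. - t j)"
    have bound: "N (act (mean l w t) y) \<le> M * N y" "N (act (\<tau> ^ m) y) \<le> M * N y"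
      "real (Suc m) * N (act (\<tau> ^ m * (1 - \<tau>)) y) \<le> ritt_constant M k * N y" if "y \<in> V" for y m
      using mean_square_estimates[OF that _ w(2) type k p, where t=t] w(1) by (simp_all add: \<tau>_def)
    have act_minus: "act a (y - z) = act a y - act a z" if "y \<in> V" "z \<in> V" for a y z
    proof -
      have "act a (y - z) + act a z = act a y"
      proof -
        have "\<pi> s (y - z) + \<pi> s z = \<pi> s y" for s using \<pi>_add[OF V_diff[OF that] that(2), of s] by simp
        then show ?thesis unfolding act_def by (simp add: sum.distrib[symmetric] sc_right[symmetric])
      qed
      then show ?thesis by (simp add: eq_diff_eq)
    qed
    define err where "err = M * ((1 + M) * e)"
    have err0: "0 \<le> err" using M_ge e by (simp add: err_def)
    have step: "N (T y - act \<tau> y) \<le> (1 + M) * e" if y: "y = (T ^^ m) x" "m \<le> n" for y m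
    proof -
      have yV: "y \<in> V" using TV y by simp
      note AyV = A[OF yV] and AAyV = A[OF A[OF yV]]
      let ?b = "mean l w t" and ?b' = "mean l w (\<lambda>j. - t j)"
      have in_F: "y \<in> F" "A y \<in> F" using y by (auto simp: F_def)
      have eq: "T y - act \<tau> y = (T y - A (A y)) + ((A (A y) - act ?b (A y)) + act ?b (A y - act ?b' y))"
        by (simp add: \<tau>_def act_mult[OF yV] act_minus[OF AyV act_V[OF yV]])
      have "N (T y - act \<tau> y) \<le> N (T y - A (A y)) + (N (A (A y) - act ?b (A y)) + N (act ?b (A y - act ?b' y)))"
        unfolding eq
      proof (rule order_trans[OF N_add add_left_mono[OF N_add]])
      qed (intro V_add V_diff act_V A T yV)+
      also have "N (act ?b (A y - act ?b' y)) \<le> M * e"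
        using M_ge by (intro order_trans[OF bound(1)[OF V_diff[OF AyV act_V[OF yV]]]] mult_left_mono F(2)[OF in_F(1)]) simp
      finally show ?thesis using sq[OF yV] F(1)[OF in_F(2)] by (simp add: algebra_simps)
    qed
    have tele: "N (act (\<tau> ^ q) ((T ^^ m) x) - act (\<tau> ^ (q + m)) x) \<le> real m * err" if "m \<le> Suc n" for m q
      using that
    proof (induction m arbitrary: q)
      case 0
      then show ?case by (simp add: Nz)
    next
      case (Suc m)
      let ?y = "(T ^^ m) x"
      have yV: "?y \<in> V" by (rule TV)
      have eq: "act (\<tau> ^ q) (T ?y) - act (\<tau> ^ (q + Suc m)) x
          = act (\<tau> ^ q) (T ?y - act \<tau> ?y) + (act (\<tau> ^ Suc q) ?y - act (\<tau> ^ (Suc q + m)) x)"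
      proof -
        have "act (\<tau> ^ Suc q) ?y = act (\<tau> ^ q) (act \<tau> ?y)"
          using act_mult[OF yV, of "\<tau> ^ q" \<tau>] by (simp add: mult.commute)
        then show ?thesis using act_minus[OF T[OF yV] act_V[OF yV]] by simp
      qed
      have "N (act (\<tau> ^ q) (T ?y) - act (\<tau> ^ (q + Suc m)) x)
          \<le> N (act (\<tau> ^ q) (T ?y - act \<tau> ?y)) + N (act (\<tau> ^ Suc q) ?y - act (\<tau> ^ (Suc q + m)) x)"
        unfolding eq by (rule N_add) (intro V_diff act_V T yV x)+
      also have "\<dots> \<le> err + real m * err"
      proof (rule add_mono)
        have dV: "T ?y - act \<tau> ?y \<in> V" by (intro V_diff act_V T yV)
        have "N (act (\<tau> ^ q) (T ?y - act \<tau> ?y)) \<le> M * N (T ?y - act \<tau> ?y)" by (rule bound(2)[OF dV])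
        also have "\<dots> \<le> M * ((1 + M) * e)" using step[OF refl, of m] Suc.prems M_ge by (intro mult_left_mono) auto
        finally show "N (act (\<tau> ^ q) (T ?y - act \<tau> ?y)) \<le> err" by (simp add: err_def)
        show "N (act (\<tau> ^ Suc q) ?y - act (\<tau> ^ (Suc q + m)) x) \<le> real m * err"
          by (rule Suc.IH) (use Suc.prems in simp)
      qed
      finally show ?case by (simp add: distrib_right)
    qed
    have close: "N ((T ^^ m) x - act (\<tau> ^ m) x) \<le> real m * err" if "m \<le> Suc n" for m
      using tele[OF that, of 0] by (simp add: act_one TV)
    have eps_eq: "real (Suc n) * (real (2 * n + 1) * err) = \<epsilon>"
    proof -
      define c where "c = real (Suc n) * (real (2 * n + 1) * (M * (1 + M)))"
      have "c \<noteq> 0" using M_ge by (simp add: c_def)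
      moreover have "e = \<epsilon> / c" by (simp only: e_def c_def)
      ultimately have "c * e = \<epsilon>" by simp
      then show ?thesis by (simp only: c_def err_def mult.assoc)
    qed
    have "N ((T ^^ n) x) = N (act (\<tau> ^ n) x + ((T ^^ n) x - act (\<tau> ^ n) x))" by simp
    also have "\<dots> \<le> M * N x + real n * err"
      using bound(2)[OF x, of n] close[of n] by (intro order_trans[OF N_add[OF act_V[OF x] V_diff[OF TV act_V[OF x]]]] add_mono) auto
    also have "real n * err \<le> \<epsilon>"
    proof -
      have "real n * err \<le> 1 * (real (2 * n + 1) * err)" using err0 by (simp add: mult_right_mono)
      also have "\<dots> \<le> real (Suc n) * (real (2 * n + 1) * err)" using err0 by (intro mult_right_mono) auto
      finally show ?thesis using eps_eq by simp
    qed
    finally have 1: "N ((T ^^ n) x) \<le> M * N x + \<epsilon>" by simp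
    have "act (\<tau> ^ n * (1 - \<tau>)) x = act (\<tau> ^ n) x - act (\<tau> ^ Suc n) x"
    proof -
      have "\<tau> ^ n * (1 - \<tau>) = \<tau> ^ n - \<tau> ^ Suc n" by (simp add: algebra_simps)
      then show ?thesis by (simp only: act_diff)
    qed
    then have "(T ^^ n) x - (T ^^ Suc n) x = act (\<tau> ^ n * (1 - \<tau>)) x + (((T ^^ n) x - act (\<tau> ^ n) x) - ((T ^^ Suc n) x - act (\<tau> ^ Suc n) x))"
      by simp
    then have "N ((T ^^ n) x - (T ^^ Suc n) x) \<le> N (act (\<tau> ^ n * (1 - \<tau>)) x) + (N ((T ^^ n) x - act (\<tau> ^ n) x) + N ((T ^^ Suc n) x - act (\<tau> ^ Suc n) x))"
    proof (elim ssubst)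
      show "N (act (\<tau> ^ n * (1 - \<tau>)) x + (((T ^^ n) x - act (\<tau> ^ n) x) - ((T ^^ Suc n) x - act (\<tau> ^ Suc n) x)))
          \<le> N (act (\<tau> ^ n * (1 - \<tau>)) x) + (N ((T ^^ n) x - act (\<tau> ^ n) x) + N ((T ^^ Suc n) x - act (\<tau> ^ Suc n) x))"
        by (rule order_trans[OF N_add add_left_mono[OF N_minus]]) (intro V_diff act_V TV x)+
    qed
    also have "\<dots> \<le> N (act (\<tau> ^ n * (1 - \<tau>)) x) + real (2 * n + 1) * err"
      using close[of n] close[of "Suc n"] by (simp add: algebra_simps)
    finally have "real (Suc n) * N ((T ^^ n) x - (T ^^ Suc n) x) \<le> real (Suc n) * (N (act (\<tau> ^ n * (1 - \<tau>)) x) + real (2 * n + 1) * err)"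
      by (intro mult_left_mono) auto
    also have "\<dots> \<le> ritt_constant M k * N x + \<epsilon>"
      using bound(3)[OF x, of n] eps_eq by (simp only: distrib_left add_mono)
    finally show ?thesis using 1 by blast
  qed
  show "N ((T ^^ n) x) \<le> M * N x"
    by (rule field_le_epsilon) (rule conjunct1[OF key])
  show "real (Suc n) * N ((T ^^ n) x - (T ^^ Suc n) x) \<le> ritt_constant M k * N x"
    by (rule field_le_epsilon) (rule conjunct2[OF key])
qed

end

lemma ritt_operatorI:
  assumes T: "bounded_operator E T" and nonneg: "\<And>x. x \<in> ncarrier E \<Longrightarrow> 0 \<le> nnorm E x"
    and C: "0 \<le> C" "\<And>n x. x \<in> ncarrier E \<Longrightarrow> nnorm E ((T ^^ n) x) \<le> C * nnorm E x"
    and D: "0 \<le> D" "\<And>n x. x \<in> ncarrier E \<Longrightarrow> real (Suc n) * nnorm E (ndiff E ((T ^^ Suc n) x) ((T ^^ n) x)) \<le> D * nnorm E x"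
  shows "ritt_operator E T"
proof -
  have op_norm_le: "op_norm E S \<le> K" if "0 \<le> K" "\<And>x. x \<in> ncarrier E \<Longrightarrow> nnorm E (S x) \<le> K * nnorm E x" for S K
    unfolding op_norm_def using that by (intro cInf_lower bdd_belowI[of _ 0]) auto
  have "real n * op_norm E (\<lambda>x. ndiff E ((T ^^ n) x) ((T ^^ (n - 1)) x)) \<le> D" if n: "n \<in> {1..}" for n
  proof -
    obtain m where m: "n = Suc m" using n by (cases n) auto
    have "op_norm E (\<lambda>x. ndiff E ((T ^^ n) x) ((T ^^ (n - 1)) x)) \<le> D / real (Suc m)"
    proof (rule op_norm_le)
      fix x assume "x \<in> ncarrier E"
      from D(2)[OF this, of m] show "nnorm E (ndiff E ((T ^^ n) x) ((T ^^ (n - 1)) x)) \<le> D / real (Suc m) * nnorm E x"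
        by (simp add: m field_simps)
    qed (use D in auto)
    then show ?thesis by (simp add: m field_simps)
  qed
  moreover have "op_norm E (T ^^ n) \<le> C" for n using C by (intro op_norm_le) auto
  ultimately show ?thesis unfolding ritt_operator_def using T by (intro conjI bdd_aboveI) auto
qed

section \<open>Orbit integrals against a convolution square\<close>

lemma (in regular_prob) norm_conv_fun_diff_le:
  fixes f g :: "'g \<Rightarrow> 'x::complex_banach"
  assumes f: "strongly_integrable \<nu> (\<lambda>t. f (s - t))" and g: "strongly_integrable \<nu> (\<lambda>t. g (s - t))"
    and E: "E \<in> sets borel" and le: "\<And>x. norm (f x - g x) \<le> \<epsilon> + b * indicator E x" and nn: "0 \<le> \<epsilon>" "0 \<le> b"
  shows "ennreal (norm (conv_fun \<nu> f s - conv_fun \<nu> g s)) \<le> ennreal \<epsilon> + ennreal b * slice E s"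
proof -
  have "conv_fun \<nu> f s - conv_fun \<nu> g s = strong_integral \<nu> (\<lambda>t. f (s - t) - g (s - t))"
    unfolding conv_fun_def by (rule strong_integral_diff[OF f g, symmetric])
  then have "ennreal (norm (conv_fun \<nu> f s - conv_fun \<nu> g s)) \<le> (\<integral>\<^sup>+t. ennreal (norm (f (s - t) - g (s - t))) \<partial>\<nu>)"
    using norm_strong_integral_le[of \<nu> "\<lambda>t. f (s - t) - g (s - t)"] by simp
  also have "\<dots> \<le> (\<integral>\<^sup>+t. ennreal \<epsilon> + ennreal b * indicator {t. s - t \<in> E} t \<partial>\<nu>)"
  proof (rule nn_integral_mono)
    fix t
    have "ennreal (norm (f (s - t) - g (s - t))) \<le> ennreal (\<epsilon> + b * indicator E (s - t))" by (intro ennreal_leI le)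
    also have "\<dots> = ennreal \<epsilon> + ennreal b * indicator {t. s - t \<in> E} t" using nn by (auto simp: indicator_def)
    finally show "ennreal (norm (f (s - t) - g (s - t))) \<le> ennreal \<epsilon> + ennreal b * indicator {t. s - t \<in> E} t" .
  qed
  also have "\<dots> = ennreal \<epsilon> + ennreal b * slice E s"
    using slice_sets(1)[OF E, of s] by (simp add: nn_integral_add nn_integral_cmult_indicator slice_def)
  finally show ?thesis .
qed

context haar_square begin

text \<open>
  Simple functions that are uniformly close to \<open>h\<close> outside a set of small measure satisfy the
  identity. The exceptional set contributes the same quantity on both sides, by \<open>slice_square\<close>.
\<close>

lemma conv_fun_square_continuous:
  fixes h :: "'g \<Rightarrow> 'x::complex_banach"
  assumes h: "continuous_on UNIV h" and B: "\<And>t. norm (h t) \<le> B"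
    and g: "continuous_on UNIV (conv_fun \<eta> h)"
  shows "conv_fun \<nu> h 0 = conv_fun \<eta> (conv_fun \<eta> h) 0"
proof -
  have B0: "0 \<le> B" using order_trans[OF norm_ge_zero B] by blast
  have shift: "continuous_on UNIV (\<lambda>t. f (s - t))" if "continuous_on UNIV f" for f :: "'g \<Rightarrow> 'x" and s
    by (rule continuous_on_compose2[OF that]) (auto intro: continuous_intros)
  have "norm (conv_fun \<nu> h 0 - conv_fun \<eta> (conv_fun \<eta> h) 0) \<le> 0 + e" if e: "0 < e" for e
  proof -
    define \<epsilon> where "\<epsilon> = e / 4"
    define \<delta> where "\<delta> = e / (8 * (B + 1))"
    have pos: "0 < \<epsilon>" "0 < \<delta>" using e B0 by (auto simp: \<epsilon>_def \<delta>_def)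
    define Ob where "Ob t = {s. norm (h s - h t) < \<epsilon>}" for t
    have Ob: "open (Ob t)" "t \<in> Ob t" for t
      using pos unfolding Ob_def by (auto intro!: open_Collect_less continuous_intros h)
    obtain n :: nat and E :: "nat \<Rightarrow> 'g set" and t :: "nat \<Rightarrow> 'g" where
      E: "\<And>j. E j \<in> sets borel" "disjoint_family_on E {..n}" "(\<Union>j\<le>n. E j) = UNIV" and E0: "measure \<nu> (E 0) \<le> \<delta>"
      and EO: "\<And>j. 1 \<le> j \<Longrightarrow> j \<le> n \<Longrightarrow> E j \<subseteq> Ob (t j)"
      by (rule nu.finite_borel_partition[OF Ob pos(2)]) (rule that)
    define u where "u s = (\<Sum>j\<le>n. indicator (E j) s *\<^sub>R h (t j))" for s
    have u_val: "u s = h (t j)" if "j \<le> n" "s \<in> E j" for s j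
      unfolding u_def by (rule sum_indicator_partition[OF E(2) that])
    have cover: "\<exists>j\<le>n. s \<in> E j" for s using E(3) by blast
    have u_le: "norm (u s) \<le> B" for s using cover[of s] u_val B by metis
    have u_simple: "simple_function \<mu> u"
      unfolding u_def
    proof (intro simple_function_sum)
      fix j
      have "simple_function \<mu> (\<lambda>s. indicator (E j) s :: real)" using E(1) by (intro simple_function_indicator) simp
      then show "simple_function \<mu> (\<lambda>s. indicator (E j) s *\<^sub>R h (t j))"
        by (rule simple_function_compose1)
    qed
    have close: "norm (h s - u s) \<le> \<epsilon> + 2 * B * indicator (E 0) s" for s
    proof -
      obtain j where j: "j \<le> n" "s \<in> E j" using cover by blast
      show ?thesis
      proof (cases "j = 0")
        case True
        have "norm (h s - u s) \<le> 2 * B" using norm_triangle_ineq4[of "h s" "u s"] B[of s] u_le[of s] by linarith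
        then show ?thesis using True j pos by simp
      next
        case False
        then have "s \<in> Ob (t j)" using EO[of j] j by auto
        then have "norm (h s - u s) \<le> \<epsilon>" unfolding u_val[OF j] by (simp add: Ob_def)
        then show ?thesis using B0 by (simp add: indicator_def)
      qed
    qed
    have u_int: "strongly_integrable \<rho> (\<lambda>t. u (s - t))" if "regular_prob \<rho>" for \<rho> s
    proof -
      interpret rho: regular_prob \<rho> by (rule that)
      have "(\<lambda>t. s - t) \<in> measurable \<rho> \<mu>"
        using measurable_reflect_translate(1)[of s] by (simp cong: measurable_cong_sets)
      then have "strongly_measurable \<rho> (\<lambda>t. u (s - t))"
        by (rule strongly_measurable_compose[OF strongly_measurable_simple[OF u_simple]])
      then show ?thesis by (intro rho.strongly_integrable_bounded[OF _ u_le] strongly_measurable_imp_ae)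
    qed
    have h_int: "strongly_integrable \<rho> (\<lambda>t. h (s - t))" if "regular_prob \<rho>" for \<rho> s
    proof -
      interpret rho: regular_prob \<rho> by (rule that)
      show ?thesis by (intro rho.strongly_integrable_bounded[OF _ B] rho.ae_strongly_measurable_continuous shift h)
    qed
    note reg = nu.regular_prob_axioms eta.regular_prob_axioms
    have B2: "0 \<le> 2 * B" using B0 by simp
    have r0: "nu.slice (E 0) 0 \<le> ennreal \<delta>"
      using nu.reflect[OF E(1), of 0] E0 by (simp add: nu.slice_def nu.emeasure_eq_measure ennreal_leI)
    have total: "ennreal \<epsilon> + ennreal (2 * B) * nu.slice (E 0) 0 \<le> ennreal (e / 2)"
    proof -
      have "ennreal \<epsilon> + ennreal (2 * B) * nu.slice (E 0) 0 \<le> ennreal \<epsilon> + ennreal (2 * B) * ennreal \<delta>"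
        using r0 by (intro add_left_mono mult_left_mono) auto
      also have "\<dots> = ennreal (\<epsilon> + 2 * B * \<delta>)" using pos B2 by (simp add: ennreal_mult ennreal_plus)
      also have "\<dots> \<le> ennreal (e / 2)"
      proof (rule ennreal_leI)
        have "2 * B * \<delta> \<le> 2 * (B + 1) * \<delta>" using pos by (intro mult_right_mono) auto
        also have "\<dots> = e / 4" using B0 by (simp add: \<delta>_def field_simps)
        finally show "\<epsilon> + 2 * B * \<delta> \<le> e / 2" by (simp add: \<epsilon>_def)
      qed
      finally show ?thesis .
    qed
    have 1: "norm (conv_fun \<nu> h 0 - conv_fun \<nu> u 0) \<le> e / 2"
      using order_trans[OF nu.norm_conv_fun_diff_le[OF h_int[OF reg(1)] u_int[OF reg(1)] E(1) close less_imp_le[OF pos(1)] B2] total] e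
      by simp
    have A: "u -` {y} \<in> sets borel" for y using simple_functionD(2)[OF u_simple, of "{y}"] by simp
    have "strongly_integrable \<eta> (\<lambda>t. \<Sum>y\<in>range u - {0}. enn2real (eta.slice (u -` {y}) (0 - t)) *\<^sub>R y)"
    proof (intro strongly_integrable_sum eta.strong_integral_bounded_scaleR(1) eta.slice_le_1)
      fix y show "(\<lambda>t. eta.slice (u -` {y}) (0 - t)) \<in> borel_measurable borel"
        using measurable_reflect_translate(1) eta.slice_measurable[OF A] by (rule measurable_compose)
    qed
    then have cu: "strongly_integrable \<eta> (\<lambda>t. conv_fun \<eta> u (0 - t))"
      by (simp only: conv_eta.conv_fun_simple[OF u_simple])
    have ch_le: "norm (conv_fun \<eta> h s) \<le> B" for s
      unfolding conv_fun_def by (rule eta.norm_strong_integral_le_bound[OF B])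
    have ch: "strongly_integrable \<eta> (\<lambda>t. conv_fun \<eta> h (0 - t))"
      by (intro eta.strongly_integrable_bounded[OF _ ch_le] eta.ae_strongly_measurable_continuous shift g)
    have "conv_fun \<eta> (conv_fun \<eta> h) 0 - conv_fun \<eta> (conv_fun \<eta> u) 0
        = strong_integral \<eta> (\<lambda>t. conv_fun \<eta> h (0 - t) - conv_fun \<eta> u (0 - t))"
      unfolding conv_fun_def[of \<eta> "conv_fun \<eta> h"] conv_fun_def[of \<eta> "conv_fun \<eta> u"]
      by (rule strong_integral_diff[OF ch cu, symmetric])
    then have "ennreal (norm (conv_fun \<eta> (conv_fun \<eta> h) 0 - conv_fun \<eta> (conv_fun \<eta> u) 0))
        \<le> (\<integral>\<^sup>+t. ennreal (norm (conv_fun \<eta> h (0 - t) - conv_fun \<eta> u (0 - t))) \<partial>\<eta>)"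
      by (simp only: norm_strong_integral_le)
    also have "\<dots> \<le> (\<integral>\<^sup>+t. ennreal \<epsilon> + ennreal (2 * B) * eta.slice (E 0) (0 - t) \<partial>\<eta>)"
      by (intro nn_integral_mono eta.norm_conv_fun_diff_le[OF h_int[OF reg(2)] u_int[OF reg(2)] E(1) close less_imp_le[OF pos(1)] B2])
    also have "\<dots> = ennreal \<epsilon> + ennreal (2 * B) * (\<integral>\<^sup>+t. eta.slice (E 0) (0 - t) \<partial>\<eta>)"
    proof -
      have "(\<lambda>t. eta.slice (E 0) (0 - t)) \<in> borel_measurable \<eta>"
        unfolding measurable_cong_sets[OF eta.sets_eq refl]
        by (rule measurable_compose[OF measurable_reflect_translate(1) eta.slice_measurable[OF E(1)]])
      then show ?thesis by (subst nn_integral_add) (auto simp: nn_integral_cmult)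
    qed
    also have "\<dots> \<le> ennreal (e / 2)" using total by (simp only: slice_square[OF E(1)])
    finally have 2: "norm (conv_fun \<eta> (conv_fun \<eta> h) 0 - conv_fun \<eta> (conv_fun \<eta> u) 0) \<le> e / 2" using e by simp
    have "conv_fun \<nu> u 0 = conv_fun \<eta> (conv_fun \<eta> u) 0" by (simp only: conv_fun_square_simple[OF u_simple])
    then have "norm (conv_fun \<nu> h 0 - conv_fun \<eta> (conv_fun \<eta> h) 0)
        \<le> norm (conv_fun \<nu> h 0 - conv_fun \<nu> u 0) + norm (conv_fun \<eta> (conv_fun \<eta> h) 0 - conv_fun \<eta> (conv_fun \<eta> u) 0)"
      using norm_triangle_ineq4[of "conv_fun \<nu> h 0 - conv_fun \<nu> u 0" "conv_fun \<eta> (conv_fun \<eta> h) 0 - conv_fun \<eta> (conv_fun \<eta> u) 0"] by simp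
    with 1 2 show ?thesis by simp
  qed
  then have "norm (conv_fun \<nu> h 0 - conv_fun \<eta> (conv_fun \<eta> h) 0) \<le> 0" by (rule field_le_epsilon)
  then show ?thesis by simp
qed

end

section \<open>Bounded representations\<close>

lemma nnorm_le_op_norm:
  assumes T: "bounded_operator E T" and nn: "\<And>x. x \<in> ncarrier E \<Longrightarrow> 0 \<le> nnorm E x" and x: "x \<in> ncarrier E"
  shows "nnorm E (T x) \<le> op_norm E T * nnorm E x"
proof -
  obtain C where C: "0 \<le> C" "\<And>x. x \<in> ncarrier E \<Longrightarrow> 0 \<le> nnorm E x \<Longrightarrow> nnorm E (T x) \<le> C * nnorm E x"
    by (rule bounded_operator_bound[OF T]) (rule that)
  show ?thesis
  proof (cases "nnorm E x = 0")
    case True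
    then show ?thesis using C(2)[OF x] by simp
  next
    case False
    then have pos: "0 < nnorm E x" using nn[OF x] by simp
    have "nnorm E (T x) / nnorm E x \<le> op_norm E T"
      unfolding op_norm_def
    proof (rule cInf_greatest)
      show "{C. 0 \<le> C \<and> (\<forall>x\<in>ncarrier E. nnorm E (T x) \<le> C * nnorm E x)} \<noteq> {}" using C nn by blast
      fix D assume "D \<in> {C. 0 \<le> C \<and> (\<forall>x\<in>ncarrier E. nnorm E (T x) \<le> C * nnorm E x)}"
      then show "nnorm E (T x) / nnorm E x \<le> D" using x pos by (auto simp: pos_divide_le_eq)
    qed
    then show ?thesis using pos by (simp add: pos_divide_le_eq)
  qed
qed

locale strongly_continuous_representation =
  fixes \<pi> :: "'g::{topological_ab_group_add, t2_space} \<Rightarrow> 'x::complex_banach \<Rightarrow> 'x" and M :: real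
  assumes rep: "group_representation \<pi>" and cont: "strongly_continuous \<pi>"
    and norm_le: "\<And>t x. norm (\<pi> t x) \<le> M * norm x" and M_ge_1: "1 \<le> M"
begin

lemma \<pi>_add: "\<pi> t (x + y) = \<pi> t x + \<pi> t y" and \<pi>_scaleC: "\<pi> t (scaleC c x) = scaleC c (\<pi> t x)"
  and \<pi>_plus: "\<pi> (s + t) x = \<pi> s (\<pi> t x)" and \<pi>_zero: "\<pi> 0 x = x"
  using rep by (auto simp: group_representation_def bounded_operator_def type_space_def)

lemma bounded_linear_\<pi>: "bounded_linear (\<pi> t)"
proof (rule bounded_linear_intro[where K=M])
  show "\<pi> t (x + y) = \<pi> t x + \<pi> t y" for x y by (rule \<pi>_add)
  show "\<pi> t (r *\<^sub>R x) = r *\<^sub>R \<pi> t x" for r x using \<pi>_scaleC[of t "of_real r" x] by (simp add: scaleC_of_real)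
  show "norm (\<pi> t x) \<le> norm x * M" for x using norm_le[of t x] by (simp add: mult.commute)
qed

lemma continuous_orbit: "continuous_on UNIV (\<lambda>t. \<pi> t x)"
  using cont by (simp add: strongly_continuous_def)

lemma strongly_integrable_orbit: "regular_prob \<rho> \<Longrightarrow> strongly_integrable \<rho> (\<lambda>t. \<pi> t x)"
  by (intro regular_prob.strongly_integrable_bounded[OF _ regular_prob.ae_strongly_measurable_continuous[OF _ continuous_orbit] norm_le])

lemma bounded_operator_S:
  assumes "regular_prob \<rho>" shows "bounded_operator type_space (S_operator \<pi> \<rho>)"
proof -
  interpret regular_prob \<rho> by fact
  note int = strongly_integrable_orbit[OF assms]
  have "S_operator \<pi> \<rho> (x + y) = S_operator \<pi> \<rho> x + S_operator \<pi> \<rho> y" for x y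
    unfolding S_operator_def \<pi>_add by (rule strong_integral_add[OF int int])
  moreover have "S_operator \<pi> \<rho> (scaleC c x) = scaleC c (S_operator \<pi> \<rho> x)" for c x
    unfolding S_operator_def \<pi>_scaleC by (rule strong_integral_linear[OF int bounded_linear_scaleC])
  moreover have "norm (S_operator \<pi> \<rho> x) \<le> M * norm x" for x
    unfolding S_operator_def by (rule norm_strong_integral_le_bound[OF norm_le])
  ultimately show ?thesis unfolding bounded_operator_def type_space_def by auto
qed

text \<open>
  For \<open>h t = \<pi> (- t) x\<close> the convolution \<open>conv_fun \<eta> h\<close> is the orbit of \<open>S_operator \<pi> \<eta> x\<close>, again reflected. So
  the identity is the value at 0 of the associativity of convolution for bounded continuous functions.
\<close>

lemma S_operator_square:
  assumes sq: "haar_square \<mu> \<eta> \<nu>"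
  shows "S_operator \<pi> \<nu> x = S_operator \<pi> \<eta> (S_operator \<pi> \<eta> x)"
proof -
  interpret haar_square \<mu> \<eta> \<nu> by (rule sq)
  define h where "h t = \<pi> (- t) x" for t
  have reflected: "continuous_on UNIV (\<lambda>t. \<pi> (- t) y)" for y
    by (rule continuous_on_compose2[OF continuous_orbit]) (auto intro: continuous_intros)
  have conv: "conv_fun \<eta> h s = \<pi> (- s) (S_operator \<pi> \<eta> x)" for s
  proof -
    have "h (s - t) = \<pi> (- s) (\<pi> t x)" for t
      using \<pi>_plus[of "- s" t x] by (simp add: h_def add.commute)
    then show ?thesis
      unfolding conv_fun_def S_operator_def
      by (simp add: strong_integral_linear[OF strongly_integrable_orbit[OF eta.regular_prob_axioms] bounded_linear_\<pi>])
  qed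
  have "conv_fun \<nu> h 0 = conv_fun \<eta> (conv_fun \<eta> h) 0"
  proof (rule conv_fun_square_continuous)
    show "continuous_on UNIV h" unfolding h_def by (rule reflected)
    show "norm (h t) \<le> M * norm x" for t unfolding h_def by (rule norm_le)
    show "continuous_on UNIV (conv_fun \<eta> h)" unfolding conv by (rule reflected)
  qed
  moreover have "conv_fun \<nu> h 0 = S_operator \<pi> \<nu> x" by (simp add: conv_fun_def S_operator_def h_def)
  moreover have "conv_fun \<eta> (conv_fun \<eta> h) 0 = S_operator \<pi> \<eta> (S_operator \<pi> \<eta> x)"
    by (simp add: conv_fun_def[of \<eta> "conv_fun \<eta> h"] conv S_operator_def[of \<pi> \<eta> "S_operator \<pi> \<eta> x"])
  ultimately show ?thesis by simp
qed

theorem ritt_S_operator: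
  assumes sq: "haar_square \<mu> \<eta> \<nu>" and K: "K_convex TYPE('x)"
  shows "ritt_operator type_space (S_operator \<pi> \<nu>)"
proof -
  interpret haar_square \<mu> \<eta> \<nu> by (rule sq)
  interpret act: isometric_action UNIV scaleC norm \<pi> M
  proof
    show "scaleC 1 x = x" for x :: 'x by (rule scaleC_one)
  qed (auto simp: \<pi>_add \<pi>_scaleC \<pi>_plus \<pi>_zero scaleC_add_right scaleC_add_left scaleC_scaleC norm_scaleC norm_le M_ge_1 norm_triangle_ineq)
  have two: "1 < (2::real)" and c: "0 < (1 / (4 * M\<^sup>2)) powr 2" using M_ge_1 by simp_all
  obtain k where k: "0 < k" "signed_type k ((1 / (4 * M\<^sup>2)) powr 2) 2 (norm :: 'x \<Rightarrow> real)"
    by (rule K_convex_imp_signed_type[OF K two c]) (rule that)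
  then have type: "signed_type_on UNIV k ((1 / (4 * M\<^sup>2)) powr 2) 2 (norm :: 'x \<Rightarrow> real)"
    by (simp add: signed_type_on_def signed_type_def)
  have approx: "\<exists>(n::nat) w t. (\<forall>j\<le>n. 0 \<le> w j) \<and> (\<Sum>j\<le>n. w j) = 1 \<and>
      (\<forall>y\<in>F. norm (S_operator \<pi> \<eta> y - (\<Sum>j\<le>n. scaleC (of_real (w j)) (\<pi> (t j) y))) \<le> e \<and>
        norm (S_operator \<pi> \<eta> y - (\<Sum>j\<le>n. scaleC (of_real (w j)) (\<pi> (- t j) y))) \<le> e)"
    if F: "finite F" and e: "0 < e" for F and e :: real
  proof -
    define H where "H = (\<lambda>y t. \<pi> t y) ` F"
    have H: "finite H" "\<And>h. h \<in> H \<Longrightarrow> continuous_on UNIV h" using F continuous_orbit by (auto simp: H_def)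
    have HB: "norm (h t) \<le> M * (\<Sum>y\<in>F. norm y)" if "h \<in> H" for h t
    proof -
      obtain y where y: "y \<in> F" "h = (\<lambda>t. \<pi> t y)" using \<open>h \<in> H\<close> by (auto simp: H_def)
      have "norm y \<le> (\<Sum>y\<in>F. norm y)" using y(1) F by (intro member_le_sum) auto
      then show ?thesis using norm_le[of t y] M_ge_1 unfolding y(2) by (meson mult_left_mono order_trans zero_le_one)
    qed
    obtain n :: nat and w :: "nat \<Rightarrow> real" and t :: "nat \<Rightarrow> 'g" where w: "\<And>j. 0 \<le> w j" "(\<Sum>j\<le>n. w j) = 1"
      and close: "\<And>h. h \<in> H \<Longrightarrow> norm (strong_integral \<eta> h - (\<Sum>j\<le>n. scaleC (of_real (w j)) (h (t j)))) \<le> e"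
        "\<And>h. h \<in> H \<Longrightarrow> norm (strong_integral \<eta> h - (\<Sum>j\<le>n. scaleC (of_real (w j)) (h (- t j)))) \<le> e"
      by (rule eta.simultaneous_integral_discretization[where H=H and B="M * (\<Sum>y\<in>F. norm y)", OF eta.symmetric H(1) _ _ e]) (erule H(2), erule HB, rule that)
    have inH: "(\<lambda>t. \<pi> t y) \<in> H" if "y \<in> F" for y using that by (simp add: H_def)
    show ?thesis
      unfolding S_operator_def using w close[OF inH]
      by (intro exI[of _ n] exI[of _ w] exI[of _ t] conjI ballI allI impI) auto
  qed
  have sq0: "norm (S_operator \<pi> \<nu> x - S_operator \<pi> \<eta> (S_operator \<pi> \<eta> x)) = 0" for x
    using S_operator_square[OF sq, of x] by simp
  note est = act.ritt_estimates_of_approximation[where A="S_operator \<pi> \<eta>" and T="S_operator \<pi> \<nu>", OF _ _ sq0 approx type k(1)]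
  have rc: "0 \<le> ritt_constant M k" using M_ge_1 by (simp add: ritt_constant_def Let_def)
  show ?thesis
  proof (rule ritt_operatorI[where C=M and D="ritt_constant M k"])
    show "bounded_operator type_space (S_operator \<pi> \<nu>)" by (rule bounded_operator_S[OF nu.regular_prob_axioms])
    show "nnorm type_space ((S_operator \<pi> \<nu> ^^ n) x) \<le> M * nnorm type_space x" for n x
      using est(1)[of x n] by (simp add: type_space_def)
    show "real (Suc n) * nnorm type_space (ndiff type_space ((S_operator \<pi> \<nu> ^^ Suc n) x) ((S_operator \<pi> \<nu> ^^ n) x))
        \<le> ritt_constant M k * nnorm type_space x" for n x
      using est(2)[of x n] by (simp add: type_space_def ndiff_def scaleC_minus1 norm_minus_commute)
  qed (use M_ge_1 rc in \<open>auto simp: type_space_def\<close>)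
qed

end

section \<open>Convolution operators\<close>

lemma sum_fun_apply: "(\<Sum>i\<in>I. f i) s = (\<Sum>i\<in>I. f i s)"
  by (induction I rule: infinite_finite_induct) (auto simp: zero_fun_def plus_fun_def)

text \<open>
  The inequality involves only \<open>p\<close>-th powers of norms, so it may be integrated pointwise.
\<close>

lemma signed_type_on_Lp_fun:
  assumes type: "signed_type k \<alpha> p (norm :: 'x::complex_banach \<Rightarrow> real)" and p: "1 \<le> p" and a: "0 \<le> \<alpha>"
  shows "signed_type_on (Lp_fun M p) k \<alpha> p (Lp_norm M p :: ('a \<Rightarrow> 'x) \<Rightarrow> real)"
  unfolding signed_type_on_def
proof (intro allI impI)
  fix f :: "nat \<Rightarrow> 'a \<Rightarrow> 'x" assume f: "\<forall>j<k. f j \<in> Lp_fun M p"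
  have p0: "0 < p" using p by simp
  let ?C = "2 ^ k * \<alpha> * real k powr (p - 1)"
  have C: "0 \<le> ?C" using a by simp
  have "\<forall>j. \<exists>g. j < k \<longrightarrow> strongly_measurable M g \<and> (AE x in M. f j x = g x)"
    using f by (auto simp: Lp_fun_def ae_strongly_measurable_iff)
  then obtain g where g: "\<And>j. j < k \<Longrightarrow> strongly_measurable M (g j)" "\<And>j. j < k \<Longrightarrow> AE x in M. f j x = g j x"
    by metis
  have gLp: "g j \<in> Lp_fun M p" if "j < k" for j using f that by (intro Lp_fun_cong_AE[OF g(2)]) auto
  have gm: "(\<lambda>x. ennreal (norm (g j x) powr p)) \<in> borel_measurable M" if "j \<in> {..<k}" for j
    using that by (intro measurable_norm_powr strongly_measurable_borel g(1)) simp
  have AE: "AE x in M. \<forall>j<k. f j x = g j x" using g(2) by (simp add: AE_all_countable AE_impI)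
  define S where "S B x = (\<Sum>j<k. signed B j (g j x))" for B x
  have sLp: "(\<lambda>x. signed B j (g j x)) \<in> Lp_fun M p" if "j < k" for B j
    using gLp[OF that] Lp_fun_uminus[OF gLp[OF that]] by (cases "j \<in> B") (simp_all add: signed_def)
  have SLp: "S B \<in> Lp_fun M p" for B unfolding S_def by (intro Lp_fun_sum sLp p) auto
  have sm: "strongly_measurable M (\<lambda>x. signed B j (g j x))" if "j < k" for B j
    using g(1)[OF that] strongly_measurable_linear[OF g(1)[OF that] bounded_linear_minus[OF bounded_linear_ident]] by (cases "j \<in> B") (simp_all add: signed_def)
  have Sm: "S B \<in> borel_measurable M" for B
  proof -
    have "strongly_measurable M (\<lambda>x. \<Sum>j\<in>J. signed B j (g j x))" if "J \<subseteq> {..<k}" for J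
      using that
    proof (induction J rule: infinite_finite_induct)
      case (insert j J)
      then show ?case using strongly_measurable_add[OF sm[of j B]] by simp
    qed (auto intro: strongly_measurable_simple simple_function_const)
    then show ?thesis unfolding S_def by (intro strongly_measurable_borel) auto
  qed
  have norm_S: "Lp_norm M p (\<Sum>j<k. signed B j (f j)) = Lp_norm M p (S B)" for B
  proof (rule Lp_norm_cong_AE)
    show "AE x in M. (\<Sum>j<k. signed B j (f j)) x = S B x"
      using AE
    proof eventually_elim
      case (elim x)
      have "(\<Sum>j<k. signed B j (f j)) x = (\<Sum>j<k. signed B j (f j x))"
        unfolding sum_fun_apply by (intro sum.cong refl) (simp add: signed_def)
      also have "\<dots> = S B x" unfolding S_def using elim by (intro sum.cong) auto
      finally show ?case .
    qed
  qed
  have norm_f: "Lp_norm M p (f j) = Lp_norm M p (g j)" if "j < k" for j by (rule Lp_norm_cong_AE[OF g(2)[OF that]])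
  have "ennreal (\<Sum>B\<in>Pow {..<k}. Lp_norm M p (S B) powr p) = (\<Sum>B\<in>Pow {..<k}. Lp_int M p (S B))"
    by (subst sum_ennreal[symmetric]) (auto simp: Lp_norm_powr[OF SLp p0])
  also have "\<dots> = (\<integral>\<^sup>+x. (\<Sum>B\<in>Pow {..<k}. ennreal (norm (S B x) powr p)) \<partial>M)"
    using Sm by (intro nn_integral_sum[symmetric] measurable_norm_powr)
  also have "\<dots> \<le> (\<integral>\<^sup>+x. ennreal ?C * (\<Sum>j<k. ennreal (norm (g j x) powr p)) \<partial>M)"
  proof (rule nn_integral_mono)
    fix x
    have "(\<Sum>B\<in>Pow {..<k}. norm (S B x) powr p) \<le> ?C * (\<Sum>j<k. norm (g j x) powr p)"
      unfolding S_def using type[unfolded signed_type_def, rule_format, of "\<lambda>j. g j x"] .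
    then have "ennreal (\<Sum>B\<in>Pow {..<k}. norm (S B x) powr p) \<le> ennreal (?C * (\<Sum>j<k. norm (g j x) powr p))"
      by (rule ennreal_leI)
    then show "(\<Sum>B\<in>Pow {..<k}. ennreal (norm (S B x) powr p)) \<le> ennreal ?C * (\<Sum>j<k. ennreal (norm (g j x) powr p))"
      using C by (simp add: sum_ennreal ennreal_mult sum_nonneg)
  qed
  also have "\<dots> = ennreal ?C * (\<Sum>j<k. Lp_int M p (g j))"
    by (simp only: nn_integral_cmult[OF borel_measurable_sum[OF gm]] nn_integral_sum[OF gm])
  also have "(\<Sum>j<k. Lp_int M p (g j)) = ennreal (\<Sum>j<k. Lp_norm M p (g j) powr p)"
    by (subst sum_ennreal[symmetric]) (auto simp: Lp_norm_powr[OF gLp p0])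
  also have "ennreal ?C * \<dots> = ennreal (?C * (\<Sum>j<k. Lp_norm M p (g j) powr p))"
    using C by (intro ennreal_mult[symmetric] sum_nonneg) auto
  finally have "(\<Sum>B\<in>Pow {..<k}. Lp_norm M p (S B) powr p) \<le> ?C * (\<Sum>j<k. Lp_norm M p (g j) powr p)"
    using C by (subst (asm) ennreal_le_iff) (auto intro!: mult_nonneg_nonneg sum_nonneg)
  then show "(\<Sum>B\<in>Pow {..<k}. Lp_norm M p (\<Sum>j<k. signed B j (f j)) powr p) \<le> ?C * (\<Sum>j<k. Lp_norm M p (f j) powr p)"
    by (simp add: norm_S norm_f)
qed

context haar_prob begin

lemma conv_operator_Lp_class:
  fixes f :: "'g \<Rightarrow> 'x::complex_banach"
  assumes "f \<in> Lp_fun \<mu> p"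
  shows "conv_operator \<mu> p \<nu> (Lp_class \<mu> p f) = Lp_class \<mu> p (conv_fun \<nu> f)"
  unfolding conv_operator_def using repr_Lp_class(2)[OF assms] by (intro Lp_class_cong conv_fun_cong)

lemma conv_operator_power_Lp_class:
  fixes f :: "'g \<Rightarrow> 'x::complex_banach"
  assumes f: "f \<in> Lp_fun \<mu> p" and p: "1 \<le> p"
  shows "(conv_fun \<nu> ^^ n) f \<in> Lp_fun \<mu> p \<and>
    (conv_operator \<mu> p \<nu> ^^ n) (Lp_class \<mu> p f) = Lp_class \<mu> p ((conv_fun \<nu> ^^ n) f)"
  by (induction n) (auto simp: f conv_operator_Lp_class intro: conv_fun_Lp(1)[OF _ p])

lemma bounded_operator_conv:
  assumes p: "1 \<le> p"
  shows "bounded_operator (Lp_space \<mu> p :: ('g \<Rightarrow> 'x::complex_banach) set cnormed) (conv_operator \<mu> p \<nu>)"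
proof -
  have p0: "0 < p" using p by simp
  note conv = conv_fun_Lp(1)[OF _ p]
  let ?E = "Lp_space \<mu> p :: ('g \<Rightarrow> 'x) set cnormed"
  have "conv_operator \<mu> p \<nu> (nadd ?E (Lp_class \<mu> p f) (Lp_class \<mu> p g))
      = nadd ?E (conv_operator \<mu> p \<nu> (Lp_class \<mu> p f)) (conv_operator \<mu> p \<nu> (Lp_class \<mu> p g))"
    if "f \<in> Lp_fun \<mu> p" "g \<in> Lp_fun \<mu> p" for f g
    using that by (simp add: nadd_Lp_space conv_operator_Lp_class Lp_fun_add p conv Lp_class_cong[OF conv_fun_add[OF that p]])
  moreover have "conv_operator \<mu> p \<nu> (nscale ?E c (Lp_class \<mu> p f)) = nscale ?E c (conv_operator \<mu> p \<nu> (Lp_class \<mu> p f))"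
    if "f \<in> Lp_fun \<mu> p" for c f
    using that by (simp add: nscale_Lp_space conv_operator_Lp_class Lp_fun_scaleC p0 conv Lp_class_cong[OF conv_fun_scaleC[OF that p]])
  moreover have "nnorm ?E (conv_operator \<mu> p \<nu> (Lp_class \<mu> p f)) \<le> 1 * nnorm ?E (Lp_class \<mu> p f)" if "f \<in> Lp_fun \<mu> p" for f
    using conv_fun_Lp(2)[OF that p] that by (simp add: nnorm_Lp_space conv_operator_Lp_class conv)
  ultimately show ?thesis
    unfolding bounded_operator_def ncarrier_Lp_space
  proof (intro conjI)
    show "conv_operator \<mu> p \<nu> \<in> Lp_class \<mu> p ` (Lp_fun \<mu> p :: ('g \<Rightarrow> 'x) set) \<rightarrow> Lp_class \<mu> p ` Lp_fun \<mu> p"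
      by (auto simp: conv_operator_Lp_class intro!: imageI conv)
  qed blast+
qed

end

theorem (in haar_square) ritt_conv_operator:
  assumes K: "K_convex TYPE('x::complex_banach)" and p: "1 < p"
  shows "ritt_operator (Lp_space \<mu> p :: ('g \<Rightarrow> 'x) set cnormed) (conv_operator \<mu> p \<nu>)"
proof -
  have p1: "1 \<le> p" and p0: "0 < p" using p by auto
  let ?V = "Lp_fun \<mu> p :: ('g \<Rightarrow> 'x) set"
  let ?sc = "\<lambda>c (f :: 'g \<Rightarrow> 'x) s. scaleC c (f s)"
  let ?tr = "\<lambda>t (f :: 'g \<Rightarrow> 'x) s. f (s - t)"
  interpret act: isometric_action ?V ?sc "Lp_norm \<mu> p" ?tr 1
  proof
    show "0 \<in> ?V" using Lp_fun_zero[OF p0] by (simp add: zero_fun_def)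
    show "x + y \<in> ?V" if "x \<in> ?V" "y \<in> ?V" for x y using Lp_fun_add[OF that p1] by (simp add: plus_fun_def)
    show "Lp_norm \<mu> p (x + y) \<le> Lp_norm \<mu> p x + Lp_norm \<mu> p y" if "x \<in> ?V" "y \<in> ?V" for x y
      using Lp_norm_triangle[OF that p1] by (simp add: plus_fun_def)
    show "?tr (s + t) f = ?tr s (?tr t f)" for s t f by (simp add: fun_eq_iff algebra_simps)
  qed (auto simp: fun_eq_iff scaleC_add_right scaleC_add_left scaleC_scaleC scaleC_one Lp_norm_scaleC p0 Lp_fun_translate
      intro: Lp_fun_scaleC Lp_fun_translate(1) p0)
  have c: "0 < (1 / (4 * (1::real)\<^sup>2)) powr p" by simp
  obtain k where k: "0 < k" "signed_type k ((1 / (4 * 1\<^sup>2)) powr p) p (norm :: 'x \<Rightarrow> real)"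
    by (rule K_convex_imp_signed_type[OF K p c]) (rule that)
  note type = signed_type_on_Lp_fun[OF k(2) p1 powr_ge_zero, of \<mu>]
  have mean: "(\<Sum>j\<le>n. ?sc (of_real (w j)) (?tr (t j) f)) = translation_mean n w t f" for n w t f
    by (simp add: fun_eq_iff sum_fun_apply translation_mean_def)
  have mean': "(\<Sum>j\<le>n. ?sc (of_real (w j)) (?tr (- t j) f)) = translation_mean n w (\<lambda>j. - t j) f" for n w t f
    by (simp add: fun_eq_iff sum_fun_apply translation_mean_def)
  have approx: "\<exists>(n::nat) w t. (\<forall>j\<le>n. 0 \<le> w j) \<and> (\<Sum>j\<le>n. w j) = 1 \<and>
      (\<forall>f\<in>F. Lp_norm \<mu> p (conv_fun \<eta> f - (\<Sum>j\<le>n. ?sc (of_real (w j)) (?tr (t j) f))) \<le> e \<and>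
        Lp_norm \<mu> p (conv_fun \<eta> f - (\<Sum>j\<le>n. ?sc (of_real (w j)) (?tr (- t j) f))) \<le> e)"
    if "finite F" "F \<subseteq> ?V" "0 < e" for F and e :: real
    using conv_eta.conv_fun_discretization[OF eta.symmetric that p] unfolding mean mean' fun_diff_def .
  have sq0: "Lp_norm \<mu> p (conv_fun \<nu> f - conv_fun \<eta> (conv_fun \<eta> f)) = 0" if "f \<in> ?V" for f
    using conv_fun_square[OF that p1] by (simp add: fun_diff_def)
  note in_V = conv_eta.conv_fun_Lp(1)[OF _ p1] conv_nu.conv_fun_Lp(1)[OF _ p1]
  have est: "Lp_norm \<mu> p ((conv_fun \<nu> ^^ n) f) \<le> 1 * Lp_norm \<mu> p f"
    "real (Suc n) * Lp_norm \<mu> p ((conv_fun \<nu> ^^ n) f - (conv_fun \<nu> ^^ Suc n) f) \<le> ritt_constant 1 k * Lp_norm \<mu> p f"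
    if "f \<in> ?V" for f n
    by (rule act.ritt_estimates_of_approximation[where A="conv_fun \<eta>" and T="conv_fun \<nu>", OF _ _ _ _ type k(1) p1 that];
        (rule in_V sq0 approx; assumption))+
  have rc: "0 \<le> ritt_constant 1 k" by (simp add: ritt_constant_def Let_def)
  show ?thesis
  proof (rule ritt_operatorI[where C=1 and D="ritt_constant 1 k"])
    show "bounded_operator (Lp_space \<mu> p :: ('g \<Rightarrow> 'x) set cnormed) (conv_operator \<mu> p \<nu>)" by (rule conv_nu.bounded_operator_conv[OF p1])
    fix F :: "('g \<Rightarrow> 'x) set" assume "F \<in> ncarrier (Lp_space \<mu> p)"
    then obtain f where f: "f \<in> ?V" "F = Lp_class \<mu> p f" by auto
    note pow = conv_nu.conv_operator_power_Lp_class[OF f(1) p1]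
    show "0 \<le> nnorm (Lp_space \<mu> p) F" by (simp add: f nnorm_Lp_space Lp_norm_nonneg)
    show "nnorm (Lp_space \<mu> p) ((conv_operator \<mu> p \<nu> ^^ n) F) \<le> 1 * nnorm (Lp_space \<mu> p) F" for n
      using est(1)[OF f(1), of n] pow[of n] by (simp add: f nnorm_Lp_space)
    show "real (Suc n) * nnorm (Lp_space \<mu> p) (ndiff (Lp_space \<mu> p) ((conv_operator \<mu> p \<nu> ^^ Suc n) F) ((conv_operator \<mu> p \<nu> ^^ n) F))
        \<le> ritt_constant 1 k * nnorm (Lp_space \<mu> p) F" for n
    proof -
      let ?d = "\<lambda>x. (conv_fun \<nu> ^^ Suc n) f x - (conv_fun \<nu> ^^ n) f x"
      have "nnorm (Lp_space \<mu> p) (ndiff (Lp_space \<mu> p) ((conv_operator \<mu> p \<nu> ^^ Suc n) F) ((conv_operator \<mu> p \<nu> ^^ n) F)) = Lp_norm \<mu> p ?d"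
        unfolding f(2) conjunct2[OF pow[of "Suc n"]] conjunct2[OF pow[of n]]
        by (simp only: ndiff_Lp_space[OF conjunct1[OF pow[of "Suc n"]] conjunct1[OF pow[of n]] p0]
            nnorm_Lp_space[OF Lp_fun_diff[OF conjunct1[OF pow[of "Suc n"]] conjunct1[OF pow[of n]] p1]])
      also have "\<dots> = Lp_norm \<mu> p ((conv_fun \<nu> ^^ n) f - (conv_fun \<nu> ^^ Suc n) f)"
        unfolding fun_diff_def by (rule Lp_norm_minus_commute)
      finally show ?thesis using est(2)[OF f(1), of n] by (simp only: f(2) nnorm_Lp_space[OF f(1)])
    qed
  qed (use rc in auto)
qed

section \<open>Ritt operators from convolution squares\<close>

theorem theorem11:
  fixes \<mu> \<nu> :: "('g::{topological_ab_group_add, t2_space}) measure"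
  assumes "locally_compact_space (euclidean :: 'g topology)"
    and "haar_measure \<mu>"
    and "regular_prob_measure \<nu>" and "symmetric_measure \<nu>"
    and "\<exists>\<eta>. regular_prob_measure \<eta> \<and> symmetric_measure \<eta> \<and> \<nu> = conv_measure \<eta> \<eta>"
    and "K_convex TYPE('x::complex_banach)"
  shows "(\<forall>p. 1 < p \<longrightarrow>
           ritt_operator (Lp_space \<mu> p :: ('g \<Rightarrow> 'x) set cnormed) (conv_operator \<mu> p \<nu>)) \<and>
         (\<forall>\<pi> :: 'g \<Rightarrow> 'x \<Rightarrow> 'x.
           group_representation \<pi> \<and> bounded_representation \<pi> \<and> strongly_continuous \<pi> \<longrightarrow>
           ritt_operator type_space (S_operator \<pi> \<nu>))"
proof -
  obtain \<eta> where eta: "regular_prob_measure \<eta>" "symmetric_measure \<eta>" "\<nu> = conv_measure \<eta> \<eta>"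
    using assms(5) by blast
  have square: "haar_square \<mu> \<eta> \<nu>"
    using assms(2-4) eta by unfold_locales auto
  have "ritt_operator type_space (S_operator \<pi> \<nu>)"
    if rep: "group_representation \<pi>" "bounded_representation \<pi>" "strongly_continuous \<pi>" for \<pi> :: "'g \<Rightarrow> 'x \<Rightarrow> 'x"
  proof -
    obtain C where C: "\<And>t. op_norm type_space (\<pi> t) \<le> C"
      using rep(2) by (auto simp: bounded_representation_def bdd_above_def)
    have "norm (\<pi> t x) \<le> max 1 C * norm x" for t x
    proof -
      have "bounded_operator type_space (\<pi> t)" using rep(1) by (simp add: group_representation_def)
      then have "norm (\<pi> t x) \<le> op_norm type_space (\<pi> t) * norm x"
        using nnorm_le_op_norm[of type_space "\<pi> t" x] by (simp add: type_space_def)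
      also have "\<dots> \<le> max 1 C * norm x" using C[of t] by (intro mult_right_mono) auto
      finally show ?thesis .
    qed
    then interpret strongly_continuous_representation \<pi> "max 1 C"
      using rep by unfold_locales auto
    show ?thesis by (rule ritt_S_operator[OF square assms(6)])
  qed
  moreover have "ritt_operator (Lp_space \<mu> p :: ('g \<Rightarrow> 'x) set cnormed) (conv_operator \<mu> p \<nu>)" if "1 < p" for p
    by (rule haar_square.ritt_conv_operator[OF square assms(6) that])
  ultimately show ?thesis by blast
qed

end
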